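(* (1) If $T$ is a finitary context-free type theory, then its translation $T^{\mathrm{tt}}$ is a finitary type theory (with contexts). (2) Suppose $T$ is a finitary context-free theory whose translation $T^{\mathrm{tt}}$ is also finitary, and let $\Theta;\Gamma$ be a tt-context such that $\vdash_{T^{\mathrm{tt}}}\Theta\ \mathsf{mctx}$ and $\Theta\vdash_{T^{\mathrm{tt}}}\Gamma\ \mathsf{vctx}$. If $\vdash_T\mathcal J$ and $\Theta;\Gamma$ is suitable for $\mathcal J$, then $\Theta;\Gamma\vdash_{T^{\mathrm{tt}}}|\mathcal J|$. (3) With $T$ and $\Theta;\Gamma$ as in (2), if $\vdash_T\mathcal B$ and $\Theta;\Gamma$ is suitable for $\mathcal B$, then $\Theta;\Gamma\vdash_{T^{\mathrm{tt}}}|\mathcal B|$.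
   Context: Translation. Erasure $|e|$ maps context-free (cf) syntax to tt-syntax: it removes conversion terms ($|\mathrm{cv}(t,\alpha)|=|t|$), replaces assumption sets by the dummy $\star$, and keeps annotated variables $a^A$ and metavariables $M^{\mathcal B}$, which in tt-syntax are regarded as atomic names (annotations being part of the name). A tt-metavariable context $\Theta$ is suitable for a cf-expression/judgement/boundary $X$ if every $M^{\mathcal B}\in\mathrm{mv}(X)$ lies in $|\Theta|$ with $\Theta(M^{\mathcal B})=|\mathcal B|$; a tt-variable context $\Gamma$ is suitable for $X$ if every $a^A\in\mathrm{fv}(X)$ lies in $|\Gamma|$ with $\Gamma(a^A)=|A|$; $\Theta;\Gamma$ is suitable if both are. A cf-rule $M_1^{\mathcal B_1},\dots,M_n^{\mathcal B_n}\Longrightarrow\mathcal J$ translates to the tt raw rule $[M_1^{\mathcal B_1}{:}|\mathcal B_1|,\dots,M_n^{\mathcal B_n}{:}|\mathcal B_n|]\Longrightarrow|\mathcal J|$, and a cf-theory $T=(R_i)_{i\in I}$ translates rulewise to $T^{\mathrm{tt}}=(R_i^{\mathrm{tt}})_{i\in I}$ over the same signature. Finitary: a tt raw rule $\Xi\Longrightarrow\beta[e]$ is finitary over a tt raw theory $T'$ if $\vdash_{T'}\Xi\ \mathsf{mctx}$ and $\Xi;[]\vdash_{T'}\beta$; a cf raw rule $M_1^{\mathcal B_1},\dots,M_n^{\mathcal B_n}\Longrightarrow\beta[e]$ is finitary over a cf raw theory $T'$ if $\vdash_{T'}\mathcal B_i$ for all $i$ and $\vdash_{T'}\beta$; a (tt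 or cf) raw theory $(R_i)_{i\in I}$ is finitary if there is a well-founded order $\prec$ on $I$ with each $R_i$ finitary over $(R_j)_{j\prec i}$. Well-formed tt-contexts: $\vdash[]\ \mathsf{mctx}$; $\vdash[\Theta,M{:}\mathcal B]\ \mathsf{mctx}$ if $\vdash\Theta\ \mathsf{mctx}$, $\Theta;[]\vdash\mathcal B$, $M\notin|\Theta|$; $\Theta\vdash[]\ \mathsf{vctx}$; $\Theta\vdash(\Gamma,a{:}A)\ \mathsf{vctx}$ if $\Theta\vdash\Gamma\ \mathsf{vctx}$, $\Theta;\Gamma\vdash A\ \mathsf{type}$, $a\notin|\Gamma|$. TT (with contexts) syntax and derivability. Signature: symbols with arities $(c,[(c_1,n_1),\dots])$, $c\in\{\mathrm{Ty},\mathrm{Tm}\}$, $c_i\in\{\mathrm{Ty},\mathrm{Tm},\mathrm{EqTy},\mathrm{EqTm}\}$. Types $S(\vec e)$, $M(\vec t)$; terms $a$, $x$, $S(\vec e)$, $M(\vec t)$; arguments also $\star$ and $\{x\}e$. Theses $A\ \mathsf{type}$, $t:A$, $A\equiv B$, $s\equiv t:A$; abstracted judgements $\{x{:}A\}\mathcal J$; boundaries $\Box\ \mathsf{type}$, $\Box:A$, $A\equiv B\ \mathsf{by}\ \Box$, $s\equiv t:A\ \mathsf{by}\ \Box$, $\{x{:}A\}\mathcal B$. Metavariable contexts $[M_1{:}\mathcal B_1,\dots]$ (closed boundaries, $\mathcal B_i$ over $M_{<i}$; $M$ gets arity $(c,m)$ when its boundary has $m$ abstractions and thesis of class $c$), variable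 contexts $[a_1{:}A_1,\dots]$. Filling: $(\Box\ \mathsf{type})[A]=A\ \mathsf{type}$, $(\Box:A)[t]=t:A$, equality boundaries filled with $\star$ give the equation, commuting with abstraction; filling with equations: $(\Box\ \mathsf{type})[A_1\equiv A_2]=A_1\equiv A_2$, $(\Box:A)[t_1\equiv t_2]=t_1\equiv t_2:A$. Instantiations $I=\langle M_i\mapsto e_i\rangle$ act by $I_*(M_i(\vec t))=e'_i[I_*\vec t/\vec x]$ ($e_i=\{\vec x\}e'_i$), $I_{(i)}$ restriction to $M_{<i}$. A raw rule is $\Xi\Longrightarrow\mathcal J$ ($\mathcal J$ closed non-abstracted over $\Xi$); a raw theory is a family of raw rules; $\Theta;\Gamma\vdash_T$ is the least set closed under: variable ($\Theta;\Gamma\vdash a:\Gamma(a)$); metavariable (if $\Theta(M)=\{\vec x{:}\vec A\}\beta$, from $t_j:A_j[\vec t_{<j}/\vec x_{<j}]$ and $\beta[\vec t/\vec x]$ infer $(\beta[\vec t/\vec x])[M(\vec t)]$); metavariable congruence (for object $\beta$, from $s_j:A_j[\vec s_{<j}/\vec x_{<j}]$, $t_j:A_j[\vec t_{<j}/\vec x_{<j}]$, $s_j\equiv t_j:A_j[\vec s_{<j}/\vec x_{<j}]$ and, if $\beta=\Box:C$, $C[\vec s/\vec x]\equiv C[\vec t/\vec x]$, infer $(\beta[\vec s/\vec x])[M(\vec s)\equiv M(\vec t)]$); abstraction (from $A\ \mathsf{type}$ and $\Theta;\Gamma,a{:}A\vdash\mathcal J[a/x]$, $a\notin|\Gamma|$,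 infer $\{x{:}A\}\mathcal J$); reflexivity/symmetry/transitivity of type and term equality; conversions ($t:A$, $A\equiv B\Rightarrow t:B$; $s\equiv t:A$, $A\equiv B\Rightarrow s\equiv t:B$); boundary rules ($\Box\ \mathsf{type}$; $\Box:A$ from $A\ \mathsf{type}$; $A\equiv B\ \mathsf{by}\ \Box$ from both types; $s\equiv t:A\ \mathsf{by}\ \Box$ from $A\ \mathsf{type},s:A,t:A$; $\{x{:}A\}\mathcal B$ from $A\ \mathsf{type}$ and $\Theta;\Gamma,a{:}A\vdash\mathcal B[a/x]$); specific rules $[M_i{:}\mathcal B_i]\Longrightarrow\beta[e]$ instantiated by $I$ (from $(I_{(i)*}\mathcal B_i)[e_i]$ for all $i$ and $I_*\beta$ infer $I_*(\beta[e])$); congruence rules for specific object rules (from $(I_{(i)*}\mathcal B_i)[f_i]$, $(J_{(i)*}\mathcal B_i)[g_i]$, $(I_{(i)*}\mathcal B_i)[f_i\equiv g_i]$ for object $\mathcal B_i$, and $I_*B\equiv J_*B$ if $\beta=\Box:B$, infer $(I_*\beta)[I_*e\equiv J_*e]$). CF (context-free) syntax and derivability. Free variables are annotated $a^A$ (equal iff names and annotations are equal), metavariables $M^{\mathcal B}$ ($\mathcal B$ closed); terms also include conversions $\mathrm{cv}(t,\alpha)$; assumption sets $\alpha$ are finite sets of annotated free variables, bound variables and annotated metavariables, used as equality arguments; theses $A\ \mathsf{type}$, $t:A$, $A\equiv B\ \mathsf{by}\ \alpha$, $s\equiv t:A\ \mathsf{by}\ \alpha$, abstracted and boundary forms as in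 tt. $\mathrm{fv},\mathrm{bv},\mathrm{mv}$ collect all annotated free variables (also inside annotations and assumption sets), free bound variables, and annotated metavariables (also inside annotations, boundaries and assumption sets); $\mathrm{asm}=\mathrm{fv}\cup\mathrm{bv}\cup\mathrm{mv}$. Filling equality boundaries with head $e$ yields assumption set $\mathrm{asm}(e)$. Substitution $e[s/x]$ replaces $x$ inside assumption sets by $\mathrm{asm}(s)$. Instantiations act also on annotations and assumption sets ($I_*\alpha=\bigcup\{\mathrm{asm}(e_i):M_i\in\alpha\}\cup\{x\in\alpha\}\cup\{a^{I_*A}:a^A\in\alpha\}$). A cf raw rule $M_1^{\mathcal B_1},\dots,M_n^{\mathcal B_n}\Longrightarrow\mathcal J$ has closed $\mathcal B_i,\mathcal J$, $\mathrm{mv}(\mathcal B_i)\subseteq\{M_{<i}\}$, $\mathrm{mv}(\mathcal J)=\{M_1^{\mathcal B_1},\dots,M_n^{\mathcal B_n}\}$. "$\alpha$ suitable" for a rule with premises $p_1..p_k$ and equality conclusion $\beta[\alpha]$ means $\mathrm{asm}(p_1,\dots,p_k)=\mathrm{asm}(\beta[\alpha])$. $\vdash_T$ is the least set closed under: $\vdash a^A:A$; abstraction (from $A\ \mathsf{type}$ and $\mathcal J[a^A/x]$ with $a^A\notin\mathrm{fv}(\mathcal J)$ infer $\{x{:}A\}\mathcal J$); metavariable rule as in tt with $M^{\mathcal B}$; metavariable congruence: from $s_j:A_j[\vec s_{<j}/\vec x_{<j}]$, $t_j:A_j[\vec t_{<j}/\vec x_{<j}]$, $s_j\equiv t'_j:A_j[\vec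 s_{<j}/\vec x_{<j}]\ \mathsf{by}\ \alpha_j$ with $|t'_j|=|t_j|$, infer $M^{\mathcal B}(\vec s)\equiv M^{\mathcal B}(\vec t)\ \mathsf{by}\ \gamma$ (type case) or, given $v:B[\vec s/\vec x]$ with $|v|=|M^{\mathcal B}(\vec t)|$, $M^{\mathcal B}(\vec s)\equiv v:B[\vec s/\vec x]\ \mathsf{by}\ \gamma$ ($\gamma$ suitable); reflexivity up to erasure with empty assumption set; symmetry; transitivity modulo erasure of the middle expression with suitable assumption set; conversion $t:A$, $A\equiv B\ \mathsf{by}\ \alpha\Rightarrow\mathrm{cv}(t,\beta):B$ when $\mathrm{asm}(t,A,B,\alpha)=\mathrm{asm}(t,B,\beta)$; equality conversion $s\equiv t:A\ \mathsf{by}\ \alpha$, $A\equiv B\ \mathsf{by}\ \beta\Rightarrow\mathrm{cv}(s,\gamma)\equiv\mathrm{cv}(t,\delta):B\ \mathsf{by}\ \alpha$ when $\mathrm{asm}(s,A,B,\beta)=\mathrm{asm}(s,B,\gamma)$, $\mathrm{asm}(t,A,B,\beta)=\mathrm{asm}(t,B,\delta)$; boundary rules as in tt (abstraction via $a^A\notin\mathrm{fv}(\mathcal B)$); specific rules instantiated as in tt; congruence rules: from $(I_{(i)*}\mathcal B_i)[f_i]$, $(J_{(i)*}\mathcal B_i)[g_i]$, and $(I_{(i)*}\mathcal B_i)[f_i\equiv g'_i\ \mathsf{by}\ \alpha_i]$ with $|g'_i|=|g_i|$ for object $\mathcal B_i$, infer $I_*A\equiv J_*A\ \mathsf{by}\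 \gamma$, or for a term rule with conclusion $t:A$, given $t':I_*A$ with $|t'|=|J_*t|$, infer $I_*t\equiv t':I_*A\ \mathsf{by}\ \gamma$ ($\gamma$ suitable).
   Formalization: Added hypothesis: in each rule of T every premise metavariable also occurs in the conclusion outside annotations and outside arguments of metavariables (assumption sets count). With only mv(J)={M_1,…,M_n} the claim fails, e.g. for M1:E, M2:{x:E}□ type ⟹ D(M2(M1)) type. *)

theory Defs
  imports Main "HOL-Library.FSet"
begin

section \<open>Signatures\<close>

text \<open>The four syntactic classes Ty, Tm, EqTy, EqTm are \<open>Obj Ty\<close>, \<open>Obj Tm\<close>, \<open>Eq Ty\<close>,
  \<open>Eq Tm\<close>. An arity \<open>(c, n)\<close> stands for class \<open>c\<close> with \<open>n\<close> bound variables.\<close>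

datatype obj_class = Ty | Tm
datatype cls = Obj obj_class | Eq obj_class

type_synonym arity = "cls \<times> nat"
type_synonym 's signature = "'s \<rightharpoonup> obj_class \<times> arity list"

section \<open>Type theories with contexts (tt)\<close>

subsection \<open>Raw syntax\<close>

text \<open>Locally nameless: free variables have names of type \<open>'v\<close>, bound variables are de Bruijn
  indices. Types, terms and arguments share one datatype; \<open>tt_wf\<close> below separates them.\<close>

datatype ('s, 'v, 'm) tt_exp =
    TFree 'v
  | TBound nat
  | TSym 's "('s, 'v, 'm) tt_exp list"
  | TMeta 'm "('s, 'v, 'm) tt_exp list"
  | TStar
  | TAbs "('s, 'v, 'm) tt_exp"

datatype ('s, 'v, 'm) tt_bdry =
    TBTy
  | TBTm "('s, 'v, 'm) tt_exp"
  | TBEqTy "('s, 'v, 'm) tt_exp" "('s, 'v, 'm) tt_exp"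
  | TBEqTm "('s, 'v, 'm) tt_exp" "('s, 'v, 'm) tt_exp" "('s, 'v, 'm) tt_exp"
  | TBAbs "('s, 'v, 'm) tt_exp" "('s, 'v, 'm) tt_bdry"

text \<open>\<open>TJTm t A\<close> is $t : A$ and \<open>TJEqTm s t A\<close> is $s \equiv t : A$; likewise \<open>TBEqTm s t A\<close>.\<close>

datatype ('s, 'v, 'm) tt_jdg =
    TJTy "('s, 'v, 'm) tt_exp"
  | TJTm "('s, 'v, 'm) tt_exp" "('s, 'v, 'm) tt_exp"
  | TJEqTy "('s, 'v, 'm) tt_exp" "('s, 'v, 'm) tt_exp"
  | TJEqTm "('s, 'v, 'm) tt_exp" "('s, 'v, 'm) tt_exp" "('s, 'v, 'm) tt_exp"
  | TJAbs "('s, 'v, 'm) tt_exp" "('s, 'v, 'm) tt_jdg"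

type_synonym ('s, 'v, 'm) tt_mctx = "('m \<times> ('s, 'v, 'm) tt_bdry) list"
type_synonym ('s, 'v, 'm) tt_vctx = "('v \<times> ('s, 'v, 'm) tt_exp) list"
type_synonym ('s, 'v, 'm) tt_rule = "('s, 'v, 'm) tt_mctx \<times> ('s, 'v, 'm) tt_jdg"

primrec tt_fv :: "('s, 'v, 'm) tt_exp \<Rightarrow> 'v set" where
  "tt_fv (TFree a) = {a}"
| "tt_fv (TBound i) = {}"
| "tt_fv (TSym S es) = \<Union> (set (map tt_fv es))"
| "tt_fv (TMeta M ts) = \<Union> (set (map tt_fv ts))"
| "tt_fv TStar = {}"
| "tt_fv (TAbs e) = tt_fv e"

primrec tt_fv_bdry :: "('s, 'v, 'm) tt_bdry \<Rightarrow> 'v set" where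
  "tt_fv_bdry TBTy = {}"
| "tt_fv_bdry (TBTm A) = tt_fv A"
| "tt_fv_bdry (TBEqTy A B) = tt_fv A \<union> tt_fv B"
| "tt_fv_bdry (TBEqTm s t A) = tt_fv s \<union> tt_fv t \<union> tt_fv A"
| "tt_fv_bdry (TBAbs A B) = tt_fv A \<union> tt_fv_bdry B"

primrec tt_fv_jdg :: "('s, 'v, 'm) tt_jdg \<Rightarrow> 'v set" where
  "tt_fv_jdg (TJTy A) = tt_fv A"
| "tt_fv_jdg (TJTm t A) = tt_fv t \<union> tt_fv A"
| "tt_fv_jdg (TJEqTy A B) = tt_fv A \<union> tt_fv B"
| "tt_fv_jdg (TJEqTm s t A) = tt_fv s \<union> tt_fv t \<union> tt_fv A"
| "tt_fv_jdg (TJAbs A J) = tt_fv A \<union> tt_fv_jdg J"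

primrec tt_arity :: "('s, 'v, 'm) tt_bdry \<Rightarrow> arity" where
  "tt_arity TBTy = (Obj Ty, 0)"
| "tt_arity (TBTm A) = (Obj Tm, 0)"
| "tt_arity (TBEqTy A B) = (Eq Ty, 0)"
| "tt_arity (TBEqTm s t A) = (Eq Tm, 0)"
| "tt_arity (TBAbs A B) = map_prod id Suc (tt_arity B)"

primrec tt_is_abs_bdry :: "('s, 'v, 'm) tt_bdry \<Rightarrow> bool" where
  "tt_is_abs_bdry TBTy = False"
| "tt_is_abs_bdry (TBTm A) = False"
| "tt_is_abs_bdry (TBEqTy A B) = False"
| "tt_is_abs_bdry (TBEqTm s t A) = False"
| "tt_is_abs_bdry (TBAbs A B) = True"

primrec tt_is_abs_jdg :: "('s, 'v, 'm) tt_jdg \<Rightarrow> bool" where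
  "tt_is_abs_jdg (TJTy A) = False"
| "tt_is_abs_jdg (TJTm t A) = False"
| "tt_is_abs_jdg (TJEqTy A B) = False"
| "tt_is_abs_jdg (TJEqTm s t A) = False"
| "tt_is_abs_jdg (TJAbs A J) = True"

definition is_obj :: "arity \<Rightarrow> bool" where
  "is_obj ar \<longleftrightarrow> (\<exists>c. fst ar = Obj c)"

text \<open>\<open>tt_wf \<Sigma> \<mu> V k (c, n) e\<close>: \<open>e\<close> has the form \<open>{x\<^sub>1}\<dots>{x\<^sub>n}e'\<close> with \<open>e'\<close> a raw expression of
  class \<open>c\<close>, where \<open>\<mu>\<close> gives the arities of metavariables, \<open>V\<close> is the set of available free
  variables and \<open>k\<close> bounds the dangling de Bruijn indices.\<close>

inductive tt_wf ::
  "'s signature \<Rightarrow> ('m \<rightharpoonup> arity) \<Rightarrow> 'v set \<Rightarrow> nat \<Rightarrow> arity \<Rightarrow> ('s, 'v, 'm) tt_exp \<Rightarrow> bool"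
  for \<Sigma> :: "'s signature" and \<mu> :: "'m \<rightharpoonup> arity" and V :: "'v set"
where
  tt_wf_free: "a \<in> V \<Longrightarrow> tt_wf \<Sigma> \<mu> V k (Obj Tm, 0) (TFree a)"
| tt_wf_bound: "i < k \<Longrightarrow> tt_wf \<Sigma> \<mu> V k (Obj Tm, 0) (TBound i)"
| tt_wf_sym: "\<Sigma> S = Some (c, as) \<Longrightarrow> list_all2 (tt_wf \<Sigma> \<mu> V k) as es
    \<Longrightarrow> tt_wf \<Sigma> \<mu> V k (Obj c, 0) (TSym S es)"
| tt_wf_meta: "\<mu> M = Some (Obj c, length ts) \<Longrightarrow> (\<forall>t\<in>set ts. tt_wf \<Sigma> \<mu> V k (Obj Tm, 0) t)
    \<Longrightarrow> tt_wf \<Sigma> \<mu> V k (Obj c, 0) (TMeta M ts)"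
| tt_wf_star: "tt_wf \<Sigma> \<mu> V k (Eq c, 0) TStar"
| tt_wf_abs: "tt_wf \<Sigma> \<mu> V (Suc k) (c, n) e \<Longrightarrow> tt_wf \<Sigma> \<mu> V k (c, Suc n) (TAbs e)"

primrec tt_wf_bdry ::
  "'s signature \<Rightarrow> ('m \<rightharpoonup> arity) \<Rightarrow> 'v set \<Rightarrow> nat \<Rightarrow> ('s, 'v, 'm) tt_bdry \<Rightarrow> bool"
where
  "tt_wf_bdry \<Sigma> \<mu> V k TBTy \<longleftrightarrow> True"
| "tt_wf_bdry \<Sigma> \<mu> V k (TBTm A) \<longleftrightarrow> tt_wf \<Sigma> \<mu> V k (Obj Ty, 0) A"
| "tt_wf_bdry \<Sigma> \<mu> V k (TBEqTy A B) \<longleftrightarrow>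
    tt_wf \<Sigma> \<mu> V k (Obj Ty, 0) A \<and> tt_wf \<Sigma> \<mu> V k (Obj Ty, 0) B"
| "tt_wf_bdry \<Sigma> \<mu> V k (TBEqTm s t A) \<longleftrightarrow> tt_wf \<Sigma> \<mu> V k (Obj Tm, 0) s
    \<and> tt_wf \<Sigma> \<mu> V k (Obj Tm, 0) t \<and> tt_wf \<Sigma> \<mu> V k (Obj Ty, 0) A"
| "tt_wf_bdry \<Sigma> \<mu> V k (TBAbs A B) \<longleftrightarrow>
    tt_wf \<Sigma> \<mu> V k (Obj Ty, 0) A \<and> tt_wf_bdry \<Sigma> \<mu> V (Suc k) B"

primrec tt_wf_jdg ::
  "'s signature \<Rightarrow> ('m \<rightharpoonup> arity) \<Rightarrow> 'v set \<Rightarrow> nat \<Rightarrow> ('s, 'v, 'm) tt_jdg \<Rightarrow> bool"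
where
  "tt_wf_jdg \<Sigma> \<mu> V k (TJTy A) \<longleftrightarrow> tt_wf \<Sigma> \<mu> V k (Obj Ty, 0) A"
| "tt_wf_jdg \<Sigma> \<mu> V k (TJTm t A) \<longleftrightarrow>
    tt_wf \<Sigma> \<mu> V k (Obj Tm, 0) t \<and> tt_wf \<Sigma> \<mu> V k (Obj Ty, 0) A"
| "tt_wf_jdg \<Sigma> \<mu> V k (TJEqTy A B) \<longleftrightarrow>
    tt_wf \<Sigma> \<mu> V k (Obj Ty, 0) A \<and> tt_wf \<Sigma> \<mu> V k (Obj Ty, 0) B"
| "tt_wf_jdg \<Sigma> \<mu> V k (TJEqTm s t A) \<longleftrightarrow> tt_wf \<Sigma> \<mu> V k (Obj Tm, 0) s
    \<and> tt_wf \<Sigma> \<mu> V k (Obj Tm, 0) t \<and> tt_wf \<Sigma> \<mu> V k (Obj Ty, 0) A"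
| "tt_wf_jdg \<Sigma> \<mu> V k (TJAbs A J) \<longleftrightarrow>
    tt_wf \<Sigma> \<mu> V k (Obj Ty, 0) A \<and> tt_wf_jdg \<Sigma> \<mu> V (Suc k) J"

subsection \<open>Substitution, instantiation and filling\<close>

primrec tt_lift :: "nat \<Rightarrow> ('s, 'v, 'm) tt_exp \<Rightarrow> ('s, 'v, 'm) tt_exp" where
  "tt_lift k (TFree a) = TFree a"
| "tt_lift k (TBound i) = TBound (if i < k then i else Suc i)"
| "tt_lift k (TSym S es) = TSym S (map (tt_lift k) es)"
| "tt_lift k (TMeta M ts) = TMeta M (map (tt_lift k) ts)"
| "tt_lift k TStar = TStar"
| "tt_lift k (TAbs e) = TAbs (tt_lift (Suc k) e)"

definition tt_up :: "(nat \<Rightarrow> ('s, 'v, 'm) tt_exp) \<Rightarrow> nat \<Rightarrow> ('s, 'v, 'm) tt_exp" where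
  "tt_up \<sigma> i = (case i of 0 \<Rightarrow> TBound 0 | Suc j \<Rightarrow> tt_lift 0 (\<sigma> j))"

primrec tt_subst ::
  "(nat \<Rightarrow> ('s, 'v, 'm) tt_exp) \<Rightarrow> ('s, 'v, 'm) tt_exp \<Rightarrow> ('s, 'v, 'm) tt_exp"
where
  "tt_subst \<sigma> (TFree a) = TFree a"
| "tt_subst \<sigma> (TBound i) = \<sigma> i"
| "tt_subst \<sigma> (TSym S es) = TSym S (map (tt_subst \<sigma>) es)"
| "tt_subst \<sigma> (TMeta M ts) = TMeta M (map (tt_subst \<sigma>) ts)"
| "tt_subst \<sigma> TStar = TStar"
| "tt_subst \<sigma> (TAbs e) = TAbs (tt_subst (tt_up \<sigma>) e)"

primrec tt_subst_bdry ::
  "(nat \<Rightarrow> ('s, 'v, 'm) tt_exp) \<Rightarrow> ('s, 'v, 'm) tt_bdry \<Rightarrow> ('s, 'v, 'm) tt_bdry"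
where
  "tt_subst_bdry \<sigma> TBTy = TBTy"
| "tt_subst_bdry \<sigma> (TBTm A) = TBTm (tt_subst \<sigma> A)"
| "tt_subst_bdry \<sigma> (TBEqTy A B) = TBEqTy (tt_subst \<sigma> A) (tt_subst \<sigma> B)"
| "tt_subst_bdry \<sigma> (TBEqTm s t A) = TBEqTm (tt_subst \<sigma> s) (tt_subst \<sigma> t) (tt_subst \<sigma> A)"
| "tt_subst_bdry \<sigma> (TBAbs A B) = TBAbs (tt_subst \<sigma> A) (tt_subst_bdry (tt_up \<sigma>) B)"

primrec tt_subst_jdg ::
  "(nat \<Rightarrow> ('s, 'v, 'm) tt_exp) \<Rightarrow> ('s, 'v, 'm) tt_jdg \<Rightarrow> ('s, 'v, 'm) tt_jdg"
where
  "tt_subst_jdg \<sigma> (TJTy A) = TJTy (tt_subst \<sigma> A)"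
| "tt_subst_jdg \<sigma> (TJTm t A) = TJTm (tt_subst \<sigma> t) (tt_subst \<sigma> A)"
| "tt_subst_jdg \<sigma> (TJEqTy A B) = TJEqTy (tt_subst \<sigma> A) (tt_subst \<sigma> B)"
| "tt_subst_jdg \<sigma> (TJEqTm s t A) = TJEqTm (tt_subst \<sigma> s) (tt_subst \<sigma> t) (tt_subst \<sigma> A)"
| "tt_subst_jdg \<sigma> (TJAbs A J) = TJAbs (tt_subst \<sigma> A) (tt_subst_jdg (tt_up \<sigma>) J)"

text \<open>\<open>tt_vec [t\<^sub>1, \<dots>, t\<^sub>m]\<close> is the simultaneous substitution $[\vec t/\vec x]$ for the body of
  $\{x_1\} \dots \{x_m\}$; the innermost variable $x_m$ has index 0.\<close>

definition tt_vec :: "('s, 'v, 'm) tt_exp list \<Rightarrow> nat \<Rightarrow> ('s, 'v, 'm) tt_exp" where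
  "tt_vec ts i = (if i < length ts then rev ts ! i else TBound (i - length ts))"

primrec tt_body :: "('s, 'v, 'm) tt_exp \<Rightarrow> ('s, 'v, 'm) tt_exp" where
  "tt_body (TFree a) = TFree a"
| "tt_body (TBound i) = TBound i"
| "tt_body (TSym S es) = TSym S es"
| "tt_body (TMeta M ts) = TMeta M ts"
| "tt_body TStar = TStar"
| "tt_body (TAbs e) = tt_body e"

text \<open>Instantiations have no dangling indices, so nothing is lifted under binders.\<close>

primrec tt_inst ::
  "('m \<rightharpoonup> ('s, 'v, 'm) tt_exp) \<Rightarrow> ('s, 'v, 'm) tt_exp \<Rightarrow> ('s, 'v, 'm) tt_exp"
where
  "tt_inst I (TFree a) = TFree a"
| "tt_inst I (TBound i) = TBound i"
| "tt_inst I (TSym S es) = TSym S (map (tt_inst I) es)"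
| "tt_inst I (TMeta M ts) = (case I M of
      None \<Rightarrow> TMeta M (map (tt_inst I) ts)
    | Some e \<Rightarrow> tt_subst (tt_vec (map (tt_inst I) ts)) (tt_body e))"
| "tt_inst I TStar = TStar"
| "tt_inst I (TAbs e) = TAbs (tt_inst I e)"

primrec tt_inst_bdry ::
  "('m \<rightharpoonup> ('s, 'v, 'm) tt_exp) \<Rightarrow> ('s, 'v, 'm) tt_bdry \<Rightarrow> ('s, 'v, 'm) tt_bdry"
where
  "tt_inst_bdry I TBTy = TBTy"
| "tt_inst_bdry I (TBTm A) = TBTm (tt_inst I A)"
| "tt_inst_bdry I (TBEqTy A B) = TBEqTy (tt_inst I A) (tt_inst I B)"
| "tt_inst_bdry I (TBEqTm s t A) = TBEqTm (tt_inst I s) (tt_inst I t) (tt_inst I A)"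
| "tt_inst_bdry I (TBAbs A B) = TBAbs (tt_inst I A) (tt_inst_bdry I B)"

primrec tt_inst_jdg ::
  "('m \<rightharpoonup> ('s, 'v, 'm) tt_exp) \<Rightarrow> ('s, 'v, 'm) tt_jdg \<Rightarrow> ('s, 'v, 'm) tt_jdg"
where
  "tt_inst_jdg I (TJTy A) = TJTy (tt_inst I A)"
| "tt_inst_jdg I (TJTm t A) = TJTm (tt_inst I t) (tt_inst I A)"
| "tt_inst_jdg I (TJEqTy A B) = TJEqTy (tt_inst I A) (tt_inst I B)"
| "tt_inst_jdg I (TJEqTm s t A) = TJEqTm (tt_inst I s) (tt_inst I t) (tt_inst I A)"
| "tt_inst_jdg I (TJAbs A J) = TJAbs (tt_inst I A) (tt_inst_jdg I J)"

text \<open>The head of an equality boundary is discarded, since tt equations carry no argument.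
  Filling is left unspecified when the abstractions of head and boundary do not match.\<close>

fun tt_fill :: "('s, 'v, 'm) tt_bdry \<Rightarrow> ('s, 'v, 'm) tt_exp \<Rightarrow> ('s, 'v, 'm) tt_jdg" where
  "tt_fill TBTy e = TJTy e"
| "tt_fill (TBTm A) e = TJTm e A"
| "tt_fill (TBEqTy A B) e = TJEqTy A B"
| "tt_fill (TBEqTm s t A) e = TJEqTm s t A"
| "tt_fill (TBAbs A B) (TAbs e) = TJAbs A (tt_fill B e)"

fun tt_fill_eq ::
  "('s, 'v, 'm) tt_bdry \<Rightarrow> ('s, 'v, 'm) tt_exp \<Rightarrow> ('s, 'v, 'm) tt_exp \<Rightarrow> ('s, 'v, 'm) tt_jdg"
where
  "tt_fill_eq TBTy e f = TJEqTy e f"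
| "tt_fill_eq (TBTm A) e f = TJEqTm e f A"
| "tt_fill_eq (TBAbs A B) (TAbs e) (TAbs f) = TJAbs A (tt_fill_eq B e f)"

primrec tt_bdry_of :: "('s, 'v, 'm) tt_jdg \<Rightarrow> ('s, 'v, 'm) tt_bdry" where
  "tt_bdry_of (TJTy A) = TBTy"
| "tt_bdry_of (TJTm t A) = TBTm A"
| "tt_bdry_of (TJEqTy A B) = TBEqTy A B"
| "tt_bdry_of (TJEqTm s t A) = TBEqTm s t A"
| "tt_bdry_of (TJAbs A J) = TBAbs A (tt_bdry_of J)"

subsection \<open>Raw rules and derivability\<close>

definition tt_marity :: "('s, 'v, 'm) tt_mctx \<Rightarrow> 'm \<rightharpoonup> arity" where
  "tt_marity \<Theta> M = map_option tt_arity (map_of \<Theta> M)"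

definition tt_raw_rule :: "'s signature \<Rightarrow> ('s, 'v, 'm) tt_rule \<Rightarrow> bool" where
  "tt_raw_rule \<Sigma> R \<longleftrightarrow> (case R of (\<Xi>, J) \<Rightarrow>
      distinct (map fst \<Xi>)
    \<and> (\<forall>i < length \<Xi>. tt_wf_bdry \<Sigma> (tt_marity (take i \<Xi>)) {} 0 (snd (\<Xi> ! i)))
    \<and> \<not> tt_is_abs_jdg J \<and> tt_wf_jdg \<Sigma> (tt_marity \<Xi>) {} 0 J)"

text \<open>\<open>tt_mk_inst \<Xi> es\<close> is the instantiation $\langle M_i \mapsto e_i \rangle$ and
  \<open>tt_prem_bdry \<Xi> es i\<close> is $I_{(i)*} \mathcal{B}_i$ (counting from 0).\<close>

definition tt_mk_inst ::
  "('s, 'v, 'm) tt_mctx \<Rightarrow> ('s, 'v, 'm) tt_exp list \<Rightarrow> 'm \<rightharpoonup> ('s, 'v, 'm) tt_exp"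
where
  "tt_mk_inst \<Xi> es = map_of (zip (map fst \<Xi>) es)"

definition tt_inst_wf ::
  "'s signature \<Rightarrow> ('s, 'v, 'm) tt_mctx \<Rightarrow> ('s, 'v, 'm) tt_vctx \<Rightarrow> ('s, 'v, 'm) tt_mctx
    \<Rightarrow> ('s, 'v, 'm) tt_exp list \<Rightarrow> bool"
where
  "tt_inst_wf \<Sigma> \<Theta> \<Gamma> \<Xi> es \<longleftrightarrow>
    list_all2 (\<lambda>p e. tt_wf \<Sigma> (tt_marity \<Theta>) (fst ` set \<Gamma>) 0 (tt_arity (snd p)) e) \<Xi> es"

definition tt_prem_bdry ::
  "('s, 'v, 'm) tt_mctx \<Rightarrow> ('s, 'v, 'm) tt_exp list \<Rightarrow> nat \<Rightarrow> ('s, 'v, 'm) tt_bdry"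
where
  "tt_prem_bdry \<Xi> es i = tt_inst_bdry (tt_mk_inst (take i \<Xi>) (take i es)) (snd (\<Xi> ! i))"

definition tt_arg_bdry ::
  "('s, 'v, 'm) tt_exp list \<Rightarrow> ('s, 'v, 'm) tt_exp list \<Rightarrow> nat \<Rightarrow> ('s, 'v, 'm) tt_exp"
where
  "tt_arg_bdry As ts j = tt_subst (tt_vec (take j ts)) (As ! j)"

text \<open>\<open>tt_der \<Sigma> T \<Theta> \<Gamma> J\<close> is $\Theta;\Gamma \vdash_T \mathcal{J}$ and \<open>tt_derb \<Sigma> T \<Theta> \<Gamma> B\<close> is
  $\Theta;\Gamma \vdash_T \mathcal{B}$. A raw judgement over $\Theta;\Gamma$ mentions only the variables
  of $\Gamma$, so in the abstraction rules \<open>a\<close> is fresh for \<open>J\<close> as well.\<close>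

inductive
  tt_der :: "'s signature \<Rightarrow> ('s, 'v, 'm) tt_rule set \<Rightarrow> ('s, 'v, 'm) tt_mctx
    \<Rightarrow> ('s, 'v, 'm) tt_vctx \<Rightarrow> ('s, 'v, 'm) tt_jdg \<Rightarrow> bool" and
  tt_derb :: "'s signature \<Rightarrow> ('s, 'v, 'm) tt_rule set \<Rightarrow> ('s, 'v, 'm) tt_mctx
    \<Rightarrow> ('s, 'v, 'm) tt_vctx \<Rightarrow> ('s, 'v, 'm) tt_bdry \<Rightarrow> bool"
  for \<Sigma> :: "'s signature" and T :: "('s, 'v, 'm) tt_rule set" and \<Theta> :: "('s, 'v, 'm) tt_mctx"
where
  tt_var:
    "map_of \<Gamma> a = Some A \<Longrightarrow> tt_der \<Sigma> T \<Theta> \<Gamma> (TJTm (TFree a) A)"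
| tt_meta:
    "map_of \<Theta> M = Some (foldr TBAbs As \<beta>) \<Longrightarrow> \<not> tt_is_abs_bdry \<beta>
    \<Longrightarrow> length ts = length As
    \<Longrightarrow> (\<forall>j < length As. tt_der \<Sigma> T \<Theta> \<Gamma> (TJTm (ts ! j) (tt_arg_bdry As ts j)))
    \<Longrightarrow> tt_derb \<Sigma> T \<Theta> \<Gamma> (tt_subst_bdry (tt_vec ts) \<beta>)
    \<Longrightarrow> tt_der \<Sigma> T \<Theta> \<Gamma> (tt_fill (tt_subst_bdry (tt_vec ts) \<beta>) (TMeta M ts))"
| tt_meta_congr:
    "map_of \<Theta> M = Some (foldr TBAbs As \<beta>) \<Longrightarrow> \<not> tt_is_abs_bdry \<beta> \<Longrightarrow> is_obj (tt_arity \<beta>)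
    \<Longrightarrow> length ss = length As \<Longrightarrow> length ts = length As
    \<Longrightarrow> (\<forall>j < length As. tt_der \<Sigma> T \<Theta> \<Gamma> (TJTm (ss ! j) (tt_arg_bdry As ss j)))
    \<Longrightarrow> (\<forall>j < length As. tt_der \<Sigma> T \<Theta> \<Gamma> (TJTm (ts ! j) (tt_arg_bdry As ts j)))
    \<Longrightarrow> (\<forall>j < length As. tt_der \<Sigma> T \<Theta> \<Gamma> (TJEqTm (ss ! j) (ts ! j) (tt_arg_bdry As ss j)))
    \<Longrightarrow> (\<forall>C. \<beta> = TBTm C \<longrightarrow>
          tt_der \<Sigma> T \<Theta> \<Gamma> (TJEqTy (tt_subst (tt_vec ss) C) (tt_subst (tt_vec ts) C)))
    \<Longrightarrow> tt_der \<Sigma> T \<Theta> \<Gamma> (tt_fill_eq (tt_subst_bdry (tt_vec ss) \<beta>) (TMeta M ss) (TMeta M ts))"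
| tt_abs:
    "tt_der \<Sigma> T \<Theta> \<Gamma> (TJTy A) \<Longrightarrow> a \<notin> fst ` set \<Gamma> \<Longrightarrow> a \<notin> tt_fv_jdg J
    \<Longrightarrow> tt_der \<Sigma> T \<Theta> (\<Gamma> @ [(a, A)]) (tt_subst_jdg (tt_vec [TFree a]) J)
    \<Longrightarrow> tt_der \<Sigma> T \<Theta> \<Gamma> (TJAbs A J)"
| tt_eqty_refl:
    "tt_der \<Sigma> T \<Theta> \<Gamma> (TJTy A) \<Longrightarrow> tt_der \<Sigma> T \<Theta> \<Gamma> (TJEqTy A A)"
| tt_eqty_sym:
    "tt_der \<Sigma> T \<Theta> \<Gamma> (TJEqTy A B) \<Longrightarrow> tt_der \<Sigma> T \<Theta> \<Gamma> (TJEqTy B A)"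
| tt_eqty_trans:
    "tt_der \<Sigma> T \<Theta> \<Gamma> (TJEqTy A B) \<Longrightarrow> tt_der \<Sigma> T \<Theta> \<Gamma> (TJEqTy B C)
    \<Longrightarrow> tt_der \<Sigma> T \<Theta> \<Gamma> (TJEqTy A C)"
| tt_eqtm_refl:
    "tt_der \<Sigma> T \<Theta> \<Gamma> (TJTm t A) \<Longrightarrow> tt_der \<Sigma> T \<Theta> \<Gamma> (TJEqTm t t A)"
| tt_eqtm_sym:
    "tt_der \<Sigma> T \<Theta> \<Gamma> (TJEqTm s t A) \<Longrightarrow> tt_der \<Sigma> T \<Theta> \<Gamma> (TJEqTm t s A)"
| tt_eqtm_trans:
    "tt_der \<Sigma> T \<Theta> \<Gamma> (TJEqTm s t A) \<Longrightarrow> tt_der \<Sigma> T \<Theta> \<Gamma> (TJEqTm t u A)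
    \<Longrightarrow> tt_der \<Sigma> T \<Theta> \<Gamma> (TJEqTm s u A)"
| tt_conv:
    "tt_der \<Sigma> T \<Theta> \<Gamma> (TJTm t A) \<Longrightarrow> tt_der \<Sigma> T \<Theta> \<Gamma> (TJEqTy A B)
    \<Longrightarrow> tt_der \<Sigma> T \<Theta> \<Gamma> (TJTm t B)"
| tt_conv_eq:
    "tt_der \<Sigma> T \<Theta> \<Gamma> (TJEqTm s t A) \<Longrightarrow> tt_der \<Sigma> T \<Theta> \<Gamma> (TJEqTy A B)
    \<Longrightarrow> tt_der \<Sigma> T \<Theta> \<Gamma> (TJEqTm s t B)"
| tt_specific:
    "(\<Xi>, J) \<in> T \<Longrightarrow> tt_inst_wf \<Sigma> \<Theta> \<Gamma> \<Xi> es
    \<Longrightarrow> (\<forall>i < length \<Xi>. tt_der \<Sigma> T \<Theta> \<Gamma> (tt_fill (tt_prem_bdry \<Xi> es i) (es ! i)))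
    \<Longrightarrow> tt_derb \<Sigma> T \<Theta> \<Gamma> (tt_inst_bdry (tt_mk_inst \<Xi> es) (tt_bdry_of J))
    \<Longrightarrow> tt_der \<Sigma> T \<Theta> \<Gamma> (tt_inst_jdg (tt_mk_inst \<Xi> es) J)"
| tt_congr_ty:
    "(\<Xi>, TJTy A) \<in> T \<Longrightarrow> tt_inst_wf \<Sigma> \<Theta> \<Gamma> \<Xi> fs \<Longrightarrow> tt_inst_wf \<Sigma> \<Theta> \<Gamma> \<Xi> gs
    \<Longrightarrow> (\<forall>i < length \<Xi>. tt_der \<Sigma> T \<Theta> \<Gamma> (tt_fill (tt_prem_bdry \<Xi> fs i) (fs ! i)))
    \<Longrightarrow> (\<forall>i < length \<Xi>. tt_der \<Sigma> T \<Theta> \<Gamma> (tt_fill (tt_prem_bdry \<Xi> gs i) (gs ! i)))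
    \<Longrightarrow> (\<forall>i < length \<Xi>. is_obj (tt_arity (snd (\<Xi> ! i))) \<longrightarrow>
          tt_der \<Sigma> T \<Theta> \<Gamma> (tt_fill_eq (tt_prem_bdry \<Xi> fs i) (fs ! i) (gs ! i)))
    \<Longrightarrow> tt_der \<Sigma> T \<Theta> \<Gamma> (TJEqTy (tt_inst (tt_mk_inst \<Xi> fs) A) (tt_inst (tt_mk_inst \<Xi> gs) A))"
| tt_congr_tm:
    "(\<Xi>, TJTm t B) \<in> T \<Longrightarrow> tt_inst_wf \<Sigma> \<Theta> \<Gamma> \<Xi> fs \<Longrightarrow> tt_inst_wf \<Sigma> \<Theta> \<Gamma> \<Xi> gs
    \<Longrightarrow> (\<forall>i < length \<Xi>. tt_der \<Sigma> T \<Theta> \<Gamma> (tt_fill (tt_prem_bdry \<Xi> fs i) (fs ! i)))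
    \<Longrightarrow> (\<forall>i < length \<Xi>. tt_der \<Sigma> T \<Theta> \<Gamma> (tt_fill (tt_prem_bdry \<Xi> gs i) (gs ! i)))
    \<Longrightarrow> (\<forall>i < length \<Xi>. is_obj (tt_arity (snd (\<Xi> ! i))) \<longrightarrow>
          tt_der \<Sigma> T \<Theta> \<Gamma> (tt_fill_eq (tt_prem_bdry \<Xi> fs i) (fs ! i) (gs ! i)))
    \<Longrightarrow> tt_der \<Sigma> T \<Theta> \<Gamma> (TJEqTy (tt_inst (tt_mk_inst \<Xi> fs) B) (tt_inst (tt_mk_inst \<Xi> gs) B))
    \<Longrightarrow> tt_der \<Sigma> T \<Theta> \<Gamma> (TJEqTm (tt_inst (tt_mk_inst \<Xi> fs) t) (tt_inst (tt_mk_inst \<Xi> gs) t)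
          (tt_inst (tt_mk_inst \<Xi> fs) B))"
| tt_bdry_ty:
    "tt_derb \<Sigma> T \<Theta> \<Gamma> TBTy"
| tt_bdry_tm:
    "tt_der \<Sigma> T \<Theta> \<Gamma> (TJTy A) \<Longrightarrow> tt_derb \<Sigma> T \<Theta> \<Gamma> (TBTm A)"
| tt_bdry_eqty:
    "tt_der \<Sigma> T \<Theta> \<Gamma> (TJTy A) \<Longrightarrow> tt_der \<Sigma> T \<Theta> \<Gamma> (TJTy B)
    \<Longrightarrow> tt_derb \<Sigma> T \<Theta> \<Gamma> (TBEqTy A B)"
| tt_bdry_eqtm:
    "tt_der \<Sigma> T \<Theta> \<Gamma> (TJTy A) \<Longrightarrow> tt_der \<Sigma> T \<Theta> \<Gamma> (TJTm s A) \<Longrightarrow> tt_der \<Sigma> T \<Theta> \<Gamma> (TJTm t A)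
    \<Longrightarrow> tt_derb \<Sigma> T \<Theta> \<Gamma> (TBEqTm s t A)"
| tt_bdry_abs:
    "tt_der \<Sigma> T \<Theta> \<Gamma> (TJTy A) \<Longrightarrow> a \<notin> fst ` set \<Gamma> \<Longrightarrow> a \<notin> tt_fv_bdry B
    \<Longrightarrow> tt_derb \<Sigma> T \<Theta> (\<Gamma> @ [(a, A)]) (tt_subst_bdry (tt_vec [TFree a]) B)
    \<Longrightarrow> tt_derb \<Sigma> T \<Theta> \<Gamma> (TBAbs A B)"

inductive tt_wf_mctx ::
  "'s signature \<Rightarrow> ('s, 'v, 'm) tt_rule set \<Rightarrow> ('s, 'v, 'm) tt_mctx \<Rightarrow> bool"
  for \<Sigma> :: "'s signature" and T :: "('s, 'v, 'm) tt_rule set"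
where
  tt_mctx_empty: "tt_wf_mctx \<Sigma> T []"
| tt_mctx_extend: "tt_wf_mctx \<Sigma> T \<Theta> \<Longrightarrow> tt_derb \<Sigma> T \<Theta> [] B \<Longrightarrow> M \<notin> fst ` set \<Theta>
    \<Longrightarrow> tt_wf_mctx \<Sigma> T (\<Theta> @ [(M, B)])"

inductive tt_wf_vctx :: "'s signature \<Rightarrow> ('s, 'v, 'm) tt_rule set \<Rightarrow> ('s, 'v, 'm) tt_mctx
    \<Rightarrow> ('s, 'v, 'm) tt_vctx \<Rightarrow> bool"
  for \<Sigma> :: "'s signature" and T :: "('s, 'v, 'm) tt_rule set" and \<Theta> :: "('s, 'v, 'm) tt_mctx"
where
  tt_vctx_empty: "tt_wf_vctx \<Sigma> T \<Theta> []"
| tt_vctx_extend: "tt_wf_vctx \<Sigma> T \<Theta> \<Gamma> \<Longrightarrow> tt_der \<Sigma> T \<Theta> \<Gamma> (TJTy A) \<Longrightarrow> a \<notin> fst ` set \<Gamma>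
    \<Longrightarrow> tt_wf_vctx \<Sigma> T \<Theta> (\<Gamma> @ [(a, A)])"

definition tt_finitary_rule ::
  "'s signature \<Rightarrow> ('s, 'v, 'm) tt_rule set \<Rightarrow> ('s, 'v, 'm) tt_rule \<Rightarrow> bool"
where
  "tt_finitary_rule \<Sigma> T R \<longleftrightarrow>
    tt_wf_mctx \<Sigma> T (fst R) \<and> tt_derb \<Sigma> T (fst R) [] (tt_bdry_of (snd R))"

definition tt_finitary ::
  "'s signature \<Rightarrow> 'i set \<Rightarrow> ('i \<Rightarrow> ('s, 'v, 'm) tt_rule) \<Rightarrow> bool"
where
  "tt_finitary \<Sigma> I R \<longleftrightarrow> (\<forall>i\<in>I. tt_raw_rule \<Sigma> (R i)) \<and>
    (\<exists>r. r \<subseteq> I \<times> I \<and> wf r \<and> trans r \<and>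
      (\<forall>i\<in>I. tt_finitary_rule \<Sigma> (R ` {j \<in> I. (j, i) \<in> r}) (R i)))"

section \<open>Context-free type theories (cf)\<close>

subsection \<open>Raw syntax\<close>

text \<open>\<open>FV a A\<close> is the annotated variable $a^A$ and \<open>MV m B\<close> the annotated metavariable
  $M^{\mathcal B}$. Annotations are locally closed, so lifting and substitution of bound variables
  do not enter them. Assumption sets are finite sets of \<open>cf_asm\<close> elements; \<open>CAsm\<close> is an assumption
  set used as an equality argument.\<close>

datatype ('s, 'a, 'm) cf_exp =
    CFree "('s, 'a, 'm) cf_fvar"
  | CBound nat
  | CSym 's "('s, 'a, 'm) cf_exp list"
  | CMeta "('s, 'a, 'm) cf_mvar" "('s, 'a, 'm) cf_exp list"
  | CConv "('s, 'a, 'm) cf_exp" "('s, 'a, 'm) cf_asm fset"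
  | CAsm "('s, 'a, 'm) cf_asm fset"
  | CAbs "('s, 'a, 'm) cf_exp"
and ('s, 'a, 'm) cf_fvar = FV 'a "('s, 'a, 'm) cf_exp"
and ('s, 'a, 'm) cf_mvar = MV 'm "('s, 'a, 'm) cf_bdry"
and ('s, 'a, 'm) cf_asm =
    AFree "('s, 'a, 'm) cf_fvar"
  | ABound nat
  | AMeta "('s, 'a, 'm) cf_mvar"
and ('s, 'a, 'm) cf_bdry =
    CBTy
  | CBTm "('s, 'a, 'm) cf_exp"
  | CBEqTy "('s, 'a, 'm) cf_exp" "('s, 'a, 'm) cf_exp"
  | CBEqTm "('s, 'a, 'm) cf_exp" "('s, 'a, 'm) cf_exp" "('s, 'a, 'm) cf_exp"
  | CBAbs "('s, 'a, 'm) cf_exp" "('s, 'a, 'm) cf_bdry"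

type_synonym ('s, 'a, 'm) cf_asms = "('s, 'a, 'm) cf_asm fset"

datatype ('s, 'a, 'm) cf_jdg =
    CJTy "('s, 'a, 'm) cf_exp"
  | CJTm "('s, 'a, 'm) cf_exp" "('s, 'a, 'm) cf_exp"
  | CJEqTy "('s, 'a, 'm) cf_exp" "('s, 'a, 'm) cf_exp" "('s, 'a, 'm) cf_asms"
  | CJEqTm "('s, 'a, 'm) cf_exp" "('s, 'a, 'm) cf_exp" "('s, 'a, 'm) cf_exp" "('s, 'a, 'm) cf_asms"
  | CJAbs "('s, 'a, 'm) cf_exp" "('s, 'a, 'm) cf_jdg"

type_synonym ('s, 'a, 'm) cf_rule = "('s, 'a, 'm) cf_mvar list \<times> ('s, 'a, 'm) cf_jdg"

primrec mvar_bdry :: "('s, 'a, 'm) cf_mvar \<Rightarrow> ('s, 'a, 'm) cf_bdry" where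
  "mvar_bdry (MV m B) = B"

definition asm_unbind :: "('s, 'a, 'm) cf_asms \<Rightarrow> ('s, 'a, 'm) cf_asms" where
  "asm_unbind X =
    (\<lambda>x. case x of ABound i \<Rightarrow> ABound (i - 1) | _ \<Rightarrow> x) |`| ffilter (\<lambda>x. x \<noteq> ABound 0) X"

text \<open>\<open>asm e\<close> is $\mathrm{asm}(e) = \mathrm{fv}(e) \cup \mathrm{bv}(e) \cup \mathrm{mv}(e)$; the parts
  $\mathrm{fv}$, $\mathrm{mv}$ are its projections below.\<close>

primrec
  asm :: "('s, 'a, 'm) cf_exp \<Rightarrow> ('s, 'a, 'm) cf_asms" and
  asm_fvar :: "('s, 'a, 'm) cf_fvar \<Rightarrow> ('s, 'a, 'm) cf_asms" and
  asm_mvar :: "('s, 'a, 'm) cf_mvar \<Rightarrow> ('s, 'a, 'm) cf_asms" and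
  asm_elem :: "('s, 'a, 'm) cf_asm \<Rightarrow> ('s, 'a, 'm) cf_asms" and
  asm_bdry :: "('s, 'a, 'm) cf_bdry \<Rightarrow> ('s, 'a, 'm) cf_asms"
where
  "asm (CFree v) = asm_fvar v"
| "asm (CBound i) = {|ABound i|}"
| "asm (CSym S es) = ffUnion (fset_of_list (map asm es))"
| "asm (CMeta M ts) = asm_mvar M |\<union>| ffUnion (fset_of_list (map asm ts))"
| "asm (CConv t \<alpha>) = asm t |\<union>| ffUnion (asm_elem |`| \<alpha>)"
| "asm (CAsm \<alpha>) = ffUnion (asm_elem |`| \<alpha>)"
| "asm (CAbs e) = asm_unbind (asm e)"
| "asm_fvar (FV a A) = finsert (AFree (FV a A)) (asm A)"
| "asm_mvar (MV m B) = finsert (AMeta (MV m B)) (asm_bdry B)"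
| "asm_elem (AFree v) = asm_fvar v"
| "asm_elem (ABound i) = {|ABound i|}"
| "asm_elem (AMeta M) = asm_mvar M"
| "asm_bdry CBTy = {||}"
| "asm_bdry (CBTm A) = asm A"
| "asm_bdry (CBEqTy A B) = asm A |\<union>| asm B"
| "asm_bdry (CBEqTm s t A) = asm s |\<union>| asm t |\<union>| asm A"
| "asm_bdry (CBAbs A B) = asm A |\<union>| asm_unbind (asm_bdry B)"

definition asm_set :: "('s, 'a, 'm) cf_asms \<Rightarrow> ('s, 'a, 'm) cf_asms" where
  "asm_set \<alpha> = ffUnion (asm_elem |`| \<alpha>)"

primrec asm_jdg :: "('s, 'a, 'm) cf_jdg \<Rightarrow> ('s, 'a, 'm) cf_asms" where
  "asm_jdg (CJTy A) = asm A"
| "asm_jdg (CJTm t A) = asm t |\<union>| asm A"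
| "asm_jdg (CJEqTy A B \<alpha>) = asm A |\<union>| asm B |\<union>| asm_set \<alpha>"
| "asm_jdg (CJEqTm s t A \<alpha>) = asm s |\<union>| asm t |\<union>| asm A |\<union>| asm_set \<alpha>"
| "asm_jdg (CJAbs A J) = asm A |\<union>| asm_unbind (asm_jdg J)"

definition fv_part :: "('s, 'a, 'm) cf_asms \<Rightarrow> ('s, 'a, 'm) cf_fvar set" where
  "fv_part X = {v. AFree v |\<in>| X}"

definition mv_part :: "('s, 'a, 'm) cf_asms \<Rightarrow> ('s, 'a, 'm) cf_mvar set" where
  "mv_part X = {M. AMeta M |\<in>| X}"

primrec cf_arity :: "('s, 'a, 'm) cf_bdry \<Rightarrow> arity" where
  "cf_arity CBTy = (Obj Ty, 0)"
| "cf_arity (CBTm A) = (Obj Tm, 0)"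
| "cf_arity (CBEqTy A B) = (Eq Ty, 0)"
| "cf_arity (CBEqTm s t A) = (Eq Tm, 0)"
| "cf_arity (CBAbs A B) = map_prod id Suc (cf_arity B)"

primrec cf_is_abs_bdry :: "('s, 'a, 'm) cf_bdry \<Rightarrow> bool" where
  "cf_is_abs_bdry CBTy = False"
| "cf_is_abs_bdry (CBTm A) = False"
| "cf_is_abs_bdry (CBEqTy A B) = False"
| "cf_is_abs_bdry (CBEqTm s t A) = False"
| "cf_is_abs_bdry (CBAbs A B) = True"

primrec cf_is_abs_jdg :: "('s, 'a, 'm) cf_jdg \<Rightarrow> bool" where
  "cf_is_abs_jdg (CJTy A) = False"
| "cf_is_abs_jdg (CJTm t A) = False"
| "cf_is_abs_jdg (CJEqTy A B \<alpha>) = False"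
| "cf_is_abs_jdg (CJEqTm s t A \<alpha>) = False"
| "cf_is_abs_jdg (CJAbs A J) = True"

text \<open>Well-formed raw syntax, with the arguments \<open>k\<close> and \<open>(c, n)\<close> as in \<open>tt_wf\<close>. The annotation of
  a free variable has no dangling index; that of a metavariable has no free variable either.\<close>

inductive
  cf_wf :: "'s signature \<Rightarrow> nat \<Rightarrow> arity \<Rightarrow> ('s, 'a, 'm) cf_exp \<Rightarrow> bool" and
  cf_wf_fvar :: "'s signature \<Rightarrow> ('s, 'a, 'm) cf_fvar \<Rightarrow> bool" and
  cf_wf_mvar :: "'s signature \<Rightarrow> ('s, 'a, 'm) cf_mvar \<Rightarrow> bool" and
  cf_wf_asm :: "'s signature \<Rightarrow> nat \<Rightarrow> ('s, 'a, 'm) cf_asm \<Rightarrow> bool" and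
  cf_wf_bdry :: "'s signature \<Rightarrow> nat \<Rightarrow> ('s, 'a, 'm) cf_bdry \<Rightarrow> bool"
  for \<Sigma> :: "'s signature"
where
  cf_wf_free: "cf_wf_fvar \<Sigma> v \<Longrightarrow> cf_wf \<Sigma> k (Obj Tm, 0) (CFree v)"
| cf_wf_bound: "i < k \<Longrightarrow> cf_wf \<Sigma> k (Obj Tm, 0) (CBound i)"
| cf_wf_sym: "\<Sigma> S = Some (c, as) \<Longrightarrow> list_all2 (cf_wf \<Sigma> k) as es
    \<Longrightarrow> cf_wf \<Sigma> k (Obj c, 0) (CSym S es)"
| cf_wf_meta: "cf_wf_mvar \<Sigma> M \<Longrightarrow> cf_arity (mvar_bdry M) = (Obj c, length ts)
    \<Longrightarrow> (\<forall>t\<in>set ts. cf_wf \<Sigma> k (Obj Tm, 0) t) \<Longrightarrow> cf_wf \<Sigma> k (Obj c, 0) (CMeta M ts)"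
| cf_wf_conv: "cf_wf \<Sigma> k (Obj Tm, 0) t \<Longrightarrow> (\<forall>x\<in>fset \<alpha>. cf_wf_asm \<Sigma> k x)
    \<Longrightarrow> cf_wf \<Sigma> k (Obj Tm, 0) (CConv t \<alpha>)"
| cf_wf_asms: "(\<forall>x\<in>fset \<alpha>. cf_wf_asm \<Sigma> k x) \<Longrightarrow> cf_wf \<Sigma> k (Eq c, 0) (CAsm \<alpha>)"
| cf_wf_abs: "cf_wf \<Sigma> (Suc k) (c, n) e \<Longrightarrow> cf_wf \<Sigma> k (c, Suc n) (CAbs e)"
| cf_wf_FV: "cf_wf \<Sigma> 0 (Obj Ty, 0) A \<Longrightarrow> cf_wf_fvar \<Sigma> (FV a A)"
| cf_wf_MV: "cf_wf_bdry \<Sigma> 0 B \<Longrightarrow> fv_part (asm_bdry B) = {} \<Longrightarrow> cf_wf_mvar \<Sigma> (MV m B)"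
| cf_wf_AFree: "cf_wf_fvar \<Sigma> v \<Longrightarrow> cf_wf_asm \<Sigma> k (AFree v)"
| cf_wf_ABound: "i < k \<Longrightarrow> cf_wf_asm \<Sigma> k (ABound i)"
| cf_wf_AMeta: "cf_wf_mvar \<Sigma> M \<Longrightarrow> cf_wf_asm \<Sigma> k (AMeta M)"
| cf_wf_CBTy: "cf_wf_bdry \<Sigma> k CBTy"
| cf_wf_CBTm: "cf_wf \<Sigma> k (Obj Ty, 0) A \<Longrightarrow> cf_wf_bdry \<Sigma> k (CBTm A)"
| cf_wf_CBEqTy: "cf_wf \<Sigma> k (Obj Ty, 0) A \<Longrightarrow> cf_wf \<Sigma> k (Obj Ty, 0) B
    \<Longrightarrow> cf_wf_bdry \<Sigma> k (CBEqTy A B)"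
| cf_wf_CBEqTm: "cf_wf \<Sigma> k (Obj Tm, 0) s \<Longrightarrow> cf_wf \<Sigma> k (Obj Tm, 0) t \<Longrightarrow> cf_wf \<Sigma> k (Obj Ty, 0) A
    \<Longrightarrow> cf_wf_bdry \<Sigma> k (CBEqTm s t A)"
| cf_wf_CBAbs: "cf_wf \<Sigma> k (Obj Ty, 0) A \<Longrightarrow> cf_wf_bdry \<Sigma> (Suc k) B
    \<Longrightarrow> cf_wf_bdry \<Sigma> k (CBAbs A B)"

definition cf_wf_asms :: "'s signature \<Rightarrow> nat \<Rightarrow> ('s, 'a, 'm) cf_asms \<Rightarrow> bool" where
  "cf_wf_asms \<Sigma> k \<alpha> \<longleftrightarrow> (\<forall>x\<in>fset \<alpha>. cf_wf_asm \<Sigma> k x)"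

primrec cf_wf_jdg :: "'s signature \<Rightarrow> nat \<Rightarrow> ('s, 'a, 'm) cf_jdg \<Rightarrow> bool" where
  "cf_wf_jdg \<Sigma> k (CJTy A) \<longleftrightarrow> cf_wf \<Sigma> k (Obj Ty, 0) A"
| "cf_wf_jdg \<Sigma> k (CJTm t A) \<longleftrightarrow> cf_wf \<Sigma> k (Obj Tm, 0) t \<and> cf_wf \<Sigma> k (Obj Ty, 0) A"
| "cf_wf_jdg \<Sigma> k (CJEqTy A B \<alpha>) \<longleftrightarrow>
    cf_wf \<Sigma> k (Obj Ty, 0) A \<and> cf_wf \<Sigma> k (Obj Ty, 0) B \<and> cf_wf_asms \<Sigma> k \<alpha>"
| "cf_wf_jdg \<Sigma> k (CJEqTm s t A \<alpha>) \<longleftrightarrow> cf_wf \<Sigma> k (Obj Tm, 0) s \<and> cf_wf \<Sigma> k (Obj Tm, 0) t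
    \<and> cf_wf \<Sigma> k (Obj Ty, 0) A \<and> cf_wf_asms \<Sigma> k \<alpha>"
| "cf_wf_jdg \<Sigma> k (CJAbs A J) \<longleftrightarrow> cf_wf \<Sigma> k (Obj Ty, 0) A \<and> cf_wf_jdg \<Sigma> (Suc k) J"

subsection \<open>Substitution, instantiation and filling\<close>

primrec lift_asm :: "nat \<Rightarrow> ('s, 'a, 'm) cf_asm \<Rightarrow> ('s, 'a, 'm) cf_asm" where
  "lift_asm k (AFree v) = AFree v"
| "lift_asm k (ABound i) = ABound (if i < k then i else Suc i)"
| "lift_asm k (AMeta M) = AMeta M"

primrec cf_lift :: "nat \<Rightarrow> ('s, 'a, 'm) cf_exp \<Rightarrow> ('s, 'a, 'm) cf_exp" where
  "cf_lift k (CFree v) = CFree v"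
| "cf_lift k (CBound i) = CBound (if i < k then i else Suc i)"
| "cf_lift k (CSym S es) = CSym S (map (cf_lift k) es)"
| "cf_lift k (CMeta M ts) = CMeta M (map (cf_lift k) ts)"
| "cf_lift k (CConv t \<alpha>) = CConv (cf_lift k t) (lift_asm k |`| \<alpha>)"
| "cf_lift k (CAsm \<alpha>) = CAsm (lift_asm k |`| \<alpha>)"
| "cf_lift k (CAbs e) = CAbs (cf_lift (Suc k) e)"

definition cf_up :: "(nat \<Rightarrow> ('s, 'a, 'm) cf_exp) \<Rightarrow> nat \<Rightarrow> ('s, 'a, 'm) cf_exp" where
  "cf_up \<sigma> i = (case i of 0 \<Rightarrow> CBound 0 | Suc j \<Rightarrow> cf_lift 0 (\<sigma> j))"

definition subst_asms ::
  "(nat \<Rightarrow> ('s, 'a, 'm) cf_exp) \<Rightarrow> ('s, 'a, 'm) cf_asms \<Rightarrow> ('s, 'a, 'm) cf_asms"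
where
  "subst_asms \<sigma> \<alpha> = ffUnion ((\<lambda>x. case x of ABound i \<Rightarrow> asm (\<sigma> i) | _ \<Rightarrow> {|x|}) |`| \<alpha>)"

primrec cf_subst ::
  "(nat \<Rightarrow> ('s, 'a, 'm) cf_exp) \<Rightarrow> ('s, 'a, 'm) cf_exp \<Rightarrow> ('s, 'a, 'm) cf_exp"
where
  "cf_subst \<sigma> (CFree v) = CFree v"
| "cf_subst \<sigma> (CBound i) = \<sigma> i"
| "cf_subst \<sigma> (CSym S es) = CSym S (map (cf_subst \<sigma>) es)"
| "cf_subst \<sigma> (CMeta M ts) = CMeta M (map (cf_subst \<sigma>) ts)"
| "cf_subst \<sigma> (CConv t \<alpha>) = CConv (cf_subst \<sigma> t) (subst_asms \<sigma> \<alpha>)"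
| "cf_subst \<sigma> (CAsm \<alpha>) = CAsm (subst_asms \<sigma> \<alpha>)"
| "cf_subst \<sigma> (CAbs e) = CAbs (cf_subst (cf_up \<sigma>) e)"

primrec cf_subst_bdry ::
  "(nat \<Rightarrow> ('s, 'a, 'm) cf_exp) \<Rightarrow> ('s, 'a, 'm) cf_bdry \<Rightarrow> ('s, 'a, 'm) cf_bdry"
where
  "cf_subst_bdry \<sigma> CBTy = CBTy"
| "cf_subst_bdry \<sigma> (CBTm A) = CBTm (cf_subst \<sigma> A)"
| "cf_subst_bdry \<sigma> (CBEqTy A B) = CBEqTy (cf_subst \<sigma> A) (cf_subst \<sigma> B)"
| "cf_subst_bdry \<sigma> (CBEqTm s t A) = CBEqTm (cf_subst \<sigma> s) (cf_subst \<sigma> t) (cf_subst \<sigma> A)"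
| "cf_subst_bdry \<sigma> (CBAbs A B) = CBAbs (cf_subst \<sigma> A) (cf_subst_bdry (cf_up \<sigma>) B)"

primrec cf_subst_jdg ::
  "(nat \<Rightarrow> ('s, 'a, 'm) cf_exp) \<Rightarrow> ('s, 'a, 'm) cf_jdg \<Rightarrow> ('s, 'a, 'm) cf_jdg"
where
  "cf_subst_jdg \<sigma> (CJTy A) = CJTy (cf_subst \<sigma> A)"
| "cf_subst_jdg \<sigma> (CJTm t A) = CJTm (cf_subst \<sigma> t) (cf_subst \<sigma> A)"
| "cf_subst_jdg \<sigma> (CJEqTy A B \<alpha>) = CJEqTy (cf_subst \<sigma> A) (cf_subst \<sigma> B) (subst_asms \<sigma> \<alpha>)"
| "cf_subst_jdg \<sigma> (CJEqTm s t A \<alpha>) =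
    CJEqTm (cf_subst \<sigma> s) (cf_subst \<sigma> t) (cf_subst \<sigma> A) (subst_asms \<sigma> \<alpha>)"
| "cf_subst_jdg \<sigma> (CJAbs A J) = CJAbs (cf_subst \<sigma> A) (cf_subst_jdg (cf_up \<sigma>) J)"

definition cf_vec :: "('s, 'a, 'm) cf_exp list \<Rightarrow> nat \<Rightarrow> ('s, 'a, 'm) cf_exp" where
  "cf_vec ts i = (if i < length ts then rev ts ! i else CBound (i - length ts))"

primrec cf_body :: "('s, 'a, 'm) cf_exp \<Rightarrow> ('s, 'a, 'm) cf_exp" where
  "cf_body (CFree v) = CFree v"
| "cf_body (CBound i) = CBound i"
| "cf_body (CSym S es) = CSym S es"
| "cf_body (CMeta M ts) = CMeta M ts"
| "cf_body (CConv t \<alpha>) = CConv t \<alpha>"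
| "cf_body (CAsm \<alpha>) = CAsm \<alpha>"
| "cf_body (CAbs e) = cf_body e"

text \<open>Instantiations act on syntax all of whose metavariables they cover; the \<open>None\<close> cases are
  irrelevant.\<close>

primrec
  cf_inst :: "(('s, 'a, 'm) cf_mvar \<rightharpoonup> ('s, 'a, 'm) cf_exp)
    \<Rightarrow> ('s, 'a, 'm) cf_exp \<Rightarrow> ('s, 'a, 'm) cf_exp" and
  cf_inst_fvar :: "(('s, 'a, 'm) cf_mvar \<rightharpoonup> ('s, 'a, 'm) cf_exp)
    \<Rightarrow> ('s, 'a, 'm) cf_fvar \<Rightarrow> ('s, 'a, 'm) cf_fvar" and
  cf_inst_asm :: "(('s, 'a, 'm) cf_mvar \<rightharpoonup> ('s, 'a, 'm) cf_exp)
    \<Rightarrow> ('s, 'a, 'm) cf_asm \<Rightarrow> ('s, 'a, 'm) cf_asms"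
where
  "cf_inst I (CFree v) = CFree (cf_inst_fvar I v)"
| "cf_inst I (CBound i) = CBound i"
| "cf_inst I (CSym S es) = CSym S (map (cf_inst I) es)"
| "cf_inst I (CMeta M ts) = (case I M of
      None \<Rightarrow> CMeta M (map (cf_inst I) ts)
    | Some e \<Rightarrow> cf_subst (cf_vec (map (cf_inst I) ts)) (cf_body e))"
| "cf_inst I (CConv t \<alpha>) = CConv (cf_inst I t) (ffUnion (cf_inst_asm I |`| \<alpha>))"
| "cf_inst I (CAsm \<alpha>) = CAsm (ffUnion (cf_inst_asm I |`| \<alpha>))"
| "cf_inst I (CAbs e) = CAbs (cf_inst I e)"
| "cf_inst_fvar I (FV a A) = FV a (cf_inst I A)"
| "cf_inst_asm I (AFree v) = {|AFree (cf_inst_fvar I v)|}"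
| "cf_inst_asm I (ABound i) = {|ABound i|}"
| "cf_inst_asm I (AMeta M) = (case I M of None \<Rightarrow> {||} | Some e \<Rightarrow> asm e)"

definition cf_inst_asms :: "(('s, 'a, 'm) cf_mvar \<rightharpoonup> ('s, 'a, 'm) cf_exp)
    \<Rightarrow> ('s, 'a, 'm) cf_asms \<Rightarrow> ('s, 'a, 'm) cf_asms"
where
  "cf_inst_asms I \<alpha> = ffUnion (cf_inst_asm I |`| \<alpha>)"

primrec cf_inst_bdry :: "(('s, 'a, 'm) cf_mvar \<rightharpoonup> ('s, 'a, 'm) cf_exp)
    \<Rightarrow> ('s, 'a, 'm) cf_bdry \<Rightarrow> ('s, 'a, 'm) cf_bdry"
where
  "cf_inst_bdry I CBTy = CBTy"
| "cf_inst_bdry I (CBTm A) = CBTm (cf_inst I A)"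
| "cf_inst_bdry I (CBEqTy A B) = CBEqTy (cf_inst I A) (cf_inst I B)"
| "cf_inst_bdry I (CBEqTm s t A) = CBEqTm (cf_inst I s) (cf_inst I t) (cf_inst I A)"
| "cf_inst_bdry I (CBAbs A B) = CBAbs (cf_inst I A) (cf_inst_bdry I B)"

primrec cf_inst_jdg :: "(('s, 'a, 'm) cf_mvar \<rightharpoonup> ('s, 'a, 'm) cf_exp)
    \<Rightarrow> ('s, 'a, 'm) cf_jdg \<Rightarrow> ('s, 'a, 'm) cf_jdg"
where
  "cf_inst_jdg I (CJTy A) = CJTy (cf_inst I A)"
| "cf_inst_jdg I (CJTm t A) = CJTm (cf_inst I t) (cf_inst I A)"
| "cf_inst_jdg I (CJEqTy A B \<alpha>) = CJEqTy (cf_inst I A) (cf_inst I B) (cf_inst_asms I \<alpha>)"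
| "cf_inst_jdg I (CJEqTm s t A \<alpha>) =
    CJEqTm (cf_inst I s) (cf_inst I t) (cf_inst I A) (cf_inst_asms I \<alpha>)"
| "cf_inst_jdg I (CJAbs A J) = CJAbs (cf_inst I A) (cf_inst_jdg I J)"

fun cf_fill :: "('s, 'a, 'm) cf_bdry \<Rightarrow> ('s, 'a, 'm) cf_exp \<Rightarrow> ('s, 'a, 'm) cf_jdg" where
  "cf_fill CBTy e = CJTy e"
| "cf_fill (CBTm A) e = CJTm e A"
| "cf_fill (CBEqTy A B) e = CJEqTy A B (asm e)"
| "cf_fill (CBEqTm s t A) e = CJEqTm s t A (asm e)"
| "cf_fill (CBAbs A B) (CAbs e) = CJAbs A (cf_fill B e)"

fun cf_fill_eq :: "('s, 'a, 'm) cf_bdry \<Rightarrow> ('s, 'a, 'm) cf_exp \<Rightarrow> ('s, 'a, 'm) cf_exp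
    \<Rightarrow> ('s, 'a, 'm) cf_asms \<Rightarrow> ('s, 'a, 'm) cf_jdg"
where
  "cf_fill_eq CBTy e f \<alpha> = CJEqTy e f \<alpha>"
| "cf_fill_eq (CBTm A) e f \<alpha> = CJEqTm e f A \<alpha>"
| "cf_fill_eq (CBAbs A B) (CAbs e) (CAbs f) \<alpha> = CJAbs A (cf_fill_eq B e f \<alpha>)"

primrec cf_bdry_of :: "('s, 'a, 'm) cf_jdg \<Rightarrow> ('s, 'a, 'm) cf_bdry" where
  "cf_bdry_of (CJTy A) = CBTy"
| "cf_bdry_of (CJTm t A) = CBTm A"
| "cf_bdry_of (CJEqTy A B \<alpha>) = CBEqTy A B"
| "cf_bdry_of (CJEqTm s t A \<alpha>) = CBEqTm s t A"
| "cf_bdry_of (CJAbs A J) = CBAbs A (cf_bdry_of J)"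

section \<open>Erasure\<close>

text \<open>The names of tt-variables and tt-metavariables are the annotated cf-variables and
  cf-metavariables.\<close>

type_synonym ('s, 'a, 'm) er_exp = "('s, ('s, 'a, 'm) cf_fvar, ('s, 'a, 'm) cf_mvar) tt_exp"
type_synonym ('s, 'a, 'm) er_bdry = "('s, ('s, 'a, 'm) cf_fvar, ('s, 'a, 'm) cf_mvar) tt_bdry"
type_synonym ('s, 'a, 'm) er_jdg = "('s, ('s, 'a, 'm) cf_fvar, ('s, 'a, 'm) cf_mvar) tt_jdg"
type_synonym ('s, 'a, 'm) er_mctx = "('s, ('s, 'a, 'm) cf_fvar, ('s, 'a, 'm) cf_mvar) tt_mctx"
type_synonym ('s, 'a, 'm) er_vctx = "('s, ('s, 'a, 'm) cf_fvar, ('s, 'a, 'm) cf_mvar) tt_vctx"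
type_synonym ('s, 'a, 'm) er_rule = "('s, ('s, 'a, 'm) cf_fvar, ('s, 'a, 'm) cf_mvar) tt_rule"

primrec erase :: "('s, 'a, 'm) cf_exp \<Rightarrow> ('s, 'a, 'm) er_exp" where
  "erase (CFree v) = TFree v"
| "erase (CBound i) = TBound i"
| "erase (CSym S es) = TSym S (map erase es)"
| "erase (CMeta M ts) = TMeta M (map erase ts)"
| "erase (CConv t \<alpha>) = erase t"
| "erase (CAsm \<alpha>) = TStar"
| "erase (CAbs e) = TAbs (erase e)"

primrec erase_bdry :: "('s, 'a, 'm) cf_bdry \<Rightarrow> ('s, 'a, 'm) er_bdry" where
  "erase_bdry CBTy = TBTy"
| "erase_bdry (CBTm A) = TBTm (erase A)"
| "erase_bdry (CBEqTy A B) = TBEqTy (erase A) (erase B)"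
| "erase_bdry (CBEqTm s t A) = TBEqTm (erase s) (erase t) (erase A)"
| "erase_bdry (CBAbs A B) = TBAbs (erase A) (erase_bdry B)"

primrec erase_jdg :: "('s, 'a, 'm) cf_jdg \<Rightarrow> ('s, 'a, 'm) er_jdg" where
  "erase_jdg (CJTy A) = TJTy (erase A)"
| "erase_jdg (CJTm t A) = TJTm (erase t) (erase A)"
| "erase_jdg (CJEqTy A B \<alpha>) = TJEqTy (erase A) (erase B)"
| "erase_jdg (CJEqTm s t A \<alpha>) = TJEqTm (erase s) (erase t) (erase A)"
| "erase_jdg (CJAbs A J) = TJAbs (erase A) (erase_jdg J)"

definition erase_rule :: "('s, 'a, 'm) cf_rule \<Rightarrow> ('s, 'a, 'm) er_rule" where
  "erase_rule R = (map (\<lambda>M. (M, erase_bdry (mvar_bdry M))) (fst R), erase_jdg (snd R))"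

section \<open>Context-free rules and derivability\<close>

definition cf_raw_rule :: "'s signature \<Rightarrow> ('s, 'a, 'm) cf_rule \<Rightarrow> bool" where
  "cf_raw_rule \<Sigma> R \<longleftrightarrow> (case R of (Ms, J) \<Rightarrow>
      distinct Ms
    \<and> (\<forall>i < length Ms. cf_wf_mvar \<Sigma> (Ms ! i)
        \<and> mv_part (asm_bdry (mvar_bdry (Ms ! i))) \<subseteq> set (take i Ms))
    \<and> \<not> cf_is_abs_jdg J \<and> cf_wf_jdg \<Sigma> 0 J
    \<and> fv_part (asm_jdg J) = {} \<and> mv_part (asm_jdg J) = set Ms)"

definition cf_mk_inst :: "('s, 'a, 'm) cf_mvar list \<Rightarrow> ('s, 'a, 'm) cf_exp list
    \<Rightarrow> ('s, 'a, 'm) cf_mvar \<rightharpoonup> ('s, 'a, 'm) cf_exp"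
where
  "cf_mk_inst Ms es = map_of (zip Ms es)"

definition cf_inst_wf ::
  "'s signature \<Rightarrow> ('s, 'a, 'm) cf_mvar list \<Rightarrow> ('s, 'a, 'm) cf_exp list \<Rightarrow> bool"
where
  "cf_inst_wf \<Sigma> Ms es \<longleftrightarrow> list_all2 (\<lambda>M e. cf_wf \<Sigma> 0 (cf_arity (mvar_bdry M)) e) Ms es"

definition cf_prem_bdry ::
  "('s, 'a, 'm) cf_mvar list \<Rightarrow> ('s, 'a, 'm) cf_exp list \<Rightarrow> nat \<Rightarrow> ('s, 'a, 'm) cf_bdry"
where
  "cf_prem_bdry Ms es i =
    cf_inst_bdry (cf_mk_inst (take i Ms) (take i es)) (mvar_bdry (Ms ! i))"

definition cf_arg_bdry ::
  "('s, 'a, 'm) cf_exp list \<Rightarrow> ('s, 'a, 'm) cf_exp list \<Rightarrow> nat \<Rightarrow> ('s, 'a, 'm) cf_exp"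
where
  "cf_arg_bdry As ts j = cf_subst (cf_vec (take j ts)) (As ! j)"

text \<open>Lists of premises of the metavariable rules and of the instantiated specific rules. They are
  kept as lists because the suitability condition refers to all premises of a rule.\<close>

definition arg_prems ::
  "('s, 'a, 'm) cf_exp list \<Rightarrow> ('s, 'a, 'm) cf_exp list \<Rightarrow> ('s, 'a, 'm) cf_jdg list"
where
  "arg_prems As ts = map (\<lambda>j. CJTm (ts ! j) (cf_arg_bdry As ts j)) [0..<length As]"

definition arg_eq_prems :: "('s, 'a, 'm) cf_exp list \<Rightarrow> ('s, 'a, 'm) cf_exp list
    \<Rightarrow> ('s, 'a, 'm) cf_exp list \<Rightarrow> ('s, 'a, 'm) cf_asms list \<Rightarrow> ('s, 'a, 'm) cf_jdg list"
where
  "arg_eq_prems As ss ts \<alpha>s =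
    map (\<lambda>j. CJEqTm (ss ! j) (ts ! j) (cf_arg_bdry As ss j) (\<alpha>s ! j)) [0..<length As]"

definition inst_prems ::
  "('s, 'a, 'm) cf_mvar list \<Rightarrow> ('s, 'a, 'm) cf_exp list \<Rightarrow> ('s, 'a, 'm) cf_jdg list"
where
  "inst_prems Ms es = map (\<lambda>i. cf_fill (cf_prem_bdry Ms es i) (es ! i)) [0..<length Ms]"

definition inst_eq_prems :: "('s, 'a, 'm) cf_mvar list \<Rightarrow> ('s, 'a, 'm) cf_exp list
    \<Rightarrow> ('s, 'a, 'm) cf_exp list \<Rightarrow> ('s, 'a, 'm) cf_asms list \<Rightarrow> ('s, 'a, 'm) cf_jdg list"
where
  "inst_eq_prems Ms fs gs \<alpha>s =
    map (\<lambda>i. cf_fill_eq (cf_prem_bdry Ms fs i) (fs ! i) (gs ! i) (\<alpha>s ! i))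
      (filter (\<lambda>i. is_obj (cf_arity (mvar_bdry (Ms ! i)))) [0..<length Ms])"

definition asm_jdgs :: "('s, 'a, 'm) cf_jdg list \<Rightarrow> ('s, 'a, 'm) cf_asms" where
  "asm_jdgs ps = ffUnion (fset_of_list (map asm_jdg ps))"

text \<open>In the congruence rules, \<open>ts'\<close> and \<open>gs'\<close> are the right-hand sides that agree with \<open>ts\<close> and
  \<open>gs\<close> up to erasure; only the entries at object premises of \<open>gs'\<close> and \<open>\<alpha>s\<close> are used.\<close>

inductive
  cf_der :: "'s signature \<Rightarrow> ('s, 'a, 'm) cf_rule set \<Rightarrow> ('s, 'a, 'm) cf_jdg \<Rightarrow> bool" and
  cf_derb :: "'s signature \<Rightarrow> ('s, 'a, 'm) cf_rule set \<Rightarrow> ('s, 'a, 'm) cf_bdry \<Rightarrow> bool"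
  for \<Sigma> :: "'s signature" and T :: "('s, 'a, 'm) cf_rule set"
where
  cf_var:
    "cf_wf_fvar \<Sigma> (FV a A) \<Longrightarrow> cf_der \<Sigma> T (CJTm (CFree (FV a A)) A)"
| cf_meta:
    "M = MV m (foldr CBAbs As \<beta>) \<Longrightarrow> \<not> cf_is_abs_bdry \<beta> \<Longrightarrow> cf_wf_mvar \<Sigma> M
    \<Longrightarrow> length ts = length As
    \<Longrightarrow> (\<forall>p\<in>set (arg_prems As ts). cf_der \<Sigma> T p)
    \<Longrightarrow> cf_derb \<Sigma> T (cf_subst_bdry (cf_vec ts) \<beta>)
    \<Longrightarrow> cf_der \<Sigma> T (cf_fill (cf_subst_bdry (cf_vec ts) \<beta>) (CMeta M ts))"
| cf_meta_congr_ty: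
    "M = MV m (foldr CBAbs As CBTy) \<Longrightarrow> cf_wf_mvar \<Sigma> M
    \<Longrightarrow> length ss = length As \<Longrightarrow> length ts = length As
    \<Longrightarrow> length \<alpha>s = length As \<Longrightarrow> map erase ts' = map erase ts
    \<Longrightarrow> ps = arg_prems As ss @ arg_prems As ts @ arg_eq_prems As ss ts' \<alpha>s
    \<Longrightarrow> (\<forall>p\<in>set ps. cf_der \<Sigma> T p)
    \<Longrightarrow> J = CJEqTy (CMeta M ss) (CMeta M ts) \<gamma> \<Longrightarrow> asm_jdgs ps = asm_jdg J
    \<Longrightarrow> cf_der \<Sigma> T J"
| cf_meta_congr_tm:
    "M = MV m (foldr CBAbs As (CBTm B)) \<Longrightarrow> cf_wf_mvar \<Sigma> M
    \<Longrightarrow> length ss = length As \<Longrightarrow> length ts = length As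
    \<Longrightarrow> length \<alpha>s = length As \<Longrightarrow> map erase ts' = map erase ts
    \<Longrightarrow> ps = arg_prems As ss @ arg_prems As ts @ arg_eq_prems As ss ts' \<alpha>s
              @ [CJTm v (cf_subst (cf_vec ss) B)]
    \<Longrightarrow> (\<forall>p\<in>set ps. cf_der \<Sigma> T p) \<Longrightarrow> erase v = erase (CMeta M ts)
    \<Longrightarrow> J = CJEqTm (CMeta M ss) v (cf_subst (cf_vec ss) B) \<gamma> \<Longrightarrow> asm_jdgs ps = asm_jdg J
    \<Longrightarrow> cf_der \<Sigma> T J"
| cf_abs:
    "cf_der \<Sigma> T (CJTy A) \<Longrightarrow> FV a A \<notin> fv_part (asm_jdg J)
    \<Longrightarrow> cf_der \<Sigma> T (cf_subst_jdg (cf_vec [CFree (FV a A)]) J)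
    \<Longrightarrow> cf_der \<Sigma> T (CJAbs A J)"
| cf_eqty_refl:
    "cf_der \<Sigma> T (CJTy A) \<Longrightarrow> cf_der \<Sigma> T (CJTy B) \<Longrightarrow> erase A = erase B
    \<Longrightarrow> cf_der \<Sigma> T (CJEqTy A B {||})"
| cf_eqty_sym:
    "cf_der \<Sigma> T (CJEqTy A B \<alpha>) \<Longrightarrow> cf_der \<Sigma> T (CJEqTy B A \<alpha>)"
| cf_eqty_trans:
    "cf_der \<Sigma> T (CJEqTy A B \<alpha>) \<Longrightarrow> cf_der \<Sigma> T (CJEqTy B' C \<beta>) \<Longrightarrow> erase B = erase B'
    \<Longrightarrow> asm_jdgs [CJEqTy A B \<alpha>, CJEqTy B' C \<beta>] = asm_jdg (CJEqTy A C \<gamma>)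
    \<Longrightarrow> cf_der \<Sigma> T (CJEqTy A C \<gamma>)"
| cf_eqtm_refl:
    "cf_der \<Sigma> T (CJTm s A) \<Longrightarrow> cf_der \<Sigma> T (CJTm t A) \<Longrightarrow> erase s = erase t
    \<Longrightarrow> cf_der \<Sigma> T (CJEqTm s t A {||})"
| cf_eqtm_sym:
    "cf_der \<Sigma> T (CJEqTm s t A \<alpha>) \<Longrightarrow> cf_der \<Sigma> T (CJEqTm t s A \<alpha>)"
| cf_eqtm_trans:
    "cf_der \<Sigma> T (CJEqTm s t A \<alpha>) \<Longrightarrow> cf_der \<Sigma> T (CJEqTm t' u A \<beta>) \<Longrightarrow> erase t = erase t'
    \<Longrightarrow> asm_jdgs [CJEqTm s t A \<alpha>, CJEqTm t' u A \<beta>] = asm_jdg (CJEqTm s u A \<gamma>)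
    \<Longrightarrow> cf_der \<Sigma> T (CJEqTm s u A \<gamma>)"
| cf_conv:
    "cf_der \<Sigma> T (CJTm t A) \<Longrightarrow> cf_der \<Sigma> T (CJEqTy A B \<alpha>)
    \<Longrightarrow> asm t |\<union>| asm A |\<union>| asm B |\<union>| asm_set \<alpha> = asm t |\<union>| asm B |\<union>| asm_set \<beta>
    \<Longrightarrow> cf_der \<Sigma> T (CJTm (CConv t \<beta>) B)"
| cf_conv_eq:
    "cf_der \<Sigma> T (CJEqTm s t A \<alpha>) \<Longrightarrow> cf_der \<Sigma> T (CJEqTy A B \<beta>)
    \<Longrightarrow> asm s |\<union>| asm A |\<union>| asm B |\<union>| asm_set \<beta> = asm s |\<union>| asm B |\<union>| asm_set \<gamma>
    \<Longrightarrow> asm t |\<union>| asm A |\<union>| asm B |\<union>| asm_set \<beta> = asm t |\<union>| asm B |\<union>| asm_set \<delta>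
    \<Longrightarrow> cf_der \<Sigma> T (CJEqTm (CConv s \<gamma>) (CConv t \<delta>) B \<alpha>)"
| cf_specific:
    "(Ms, J) \<in> T \<Longrightarrow> cf_inst_wf \<Sigma> Ms es
    \<Longrightarrow> (\<forall>p\<in>set (inst_prems Ms es). cf_der \<Sigma> T p)
    \<Longrightarrow> cf_derb \<Sigma> T (cf_inst_bdry (cf_mk_inst Ms es) (cf_bdry_of J))
    \<Longrightarrow> cf_der \<Sigma> T (cf_inst_jdg (cf_mk_inst Ms es) J)"
| cf_congr_ty:
    "(Ms, CJTy A) \<in> T
    \<Longrightarrow> cf_inst_wf \<Sigma> Ms fs \<Longrightarrow> cf_inst_wf \<Sigma> Ms gs \<Longrightarrow> cf_inst_wf \<Sigma> Ms gs'
    \<Longrightarrow> length \<alpha>s = length Ms \<Longrightarrow> map erase gs' = map erase gs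
    \<Longrightarrow> ps = inst_prems Ms fs @ inst_prems Ms gs @ inst_eq_prems Ms fs gs' \<alpha>s
    \<Longrightarrow> (\<forall>p\<in>set ps. cf_der \<Sigma> T p)
    \<Longrightarrow> J = CJEqTy (cf_inst (cf_mk_inst Ms fs) A) (cf_inst (cf_mk_inst Ms gs) A) \<gamma>
    \<Longrightarrow> asm_jdgs ps = asm_jdg J
    \<Longrightarrow> cf_der \<Sigma> T J"
| cf_congr_tm:
    "(Ms, CJTm t A) \<in> T
    \<Longrightarrow> cf_inst_wf \<Sigma> Ms fs \<Longrightarrow> cf_inst_wf \<Sigma> Ms gs \<Longrightarrow> cf_inst_wf \<Sigma> Ms gs'
    \<Longrightarrow> length \<alpha>s = length Ms \<Longrightarrow> map erase gs' = map erase gs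
    \<Longrightarrow> ps = inst_prems Ms fs @ inst_prems Ms gs @ inst_eq_prems Ms fs gs' \<alpha>s
              @ [CJTm t' (cf_inst (cf_mk_inst Ms fs) A)]
    \<Longrightarrow> (\<forall>p\<in>set ps. cf_der \<Sigma> T p) \<Longrightarrow> erase t' = erase (cf_inst (cf_mk_inst Ms gs) t)
    \<Longrightarrow> J = CJEqTm (cf_inst (cf_mk_inst Ms fs) t) t' (cf_inst (cf_mk_inst Ms fs) A) \<gamma>
    \<Longrightarrow> asm_jdgs ps = asm_jdg J
    \<Longrightarrow> cf_der \<Sigma> T J"
| cf_bdry_ty:
    "cf_derb \<Sigma> T CBTy"
| cf_bdry_tm:
    "cf_der \<Sigma> T (CJTy A) \<Longrightarrow> cf_derb \<Sigma> T (CBTm A)"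
| cf_bdry_eqty:
    "cf_der \<Sigma> T (CJTy A) \<Longrightarrow> cf_der \<Sigma> T (CJTy B) \<Longrightarrow> cf_derb \<Sigma> T (CBEqTy A B)"
| cf_bdry_eqtm:
    "cf_der \<Sigma> T (CJTy A) \<Longrightarrow> cf_der \<Sigma> T (CJTm s A) \<Longrightarrow> cf_der \<Sigma> T (CJTm t A)
    \<Longrightarrow> cf_derb \<Sigma> T (CBEqTm s t A)"
| cf_bdry_abs:
    "cf_der \<Sigma> T (CJTy A) \<Longrightarrow> FV a A \<notin> fv_part (asm_bdry B)
    \<Longrightarrow> cf_derb \<Sigma> T (cf_subst_bdry (cf_vec [CFree (FV a A)]) B)
    \<Longrightarrow> cf_derb \<Sigma> T (CBAbs A B)"

definition cf_finitary_rule ::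
  "'s signature \<Rightarrow> ('s, 'a, 'm) cf_rule set \<Rightarrow> ('s, 'a, 'm) cf_rule \<Rightarrow> bool"
where
  "cf_finitary_rule \<Sigma> T R \<longleftrightarrow>
    (\<forall>M\<in>set (fst R). cf_derb \<Sigma> T (mvar_bdry M)) \<and> cf_derb \<Sigma> T (cf_bdry_of (snd R))"

definition cf_finitary ::
  "'s signature \<Rightarrow> 'i set \<Rightarrow> ('i \<Rightarrow> ('s, 'a, 'm) cf_rule) \<Rightarrow> bool"
where
  "cf_finitary \<Sigma> I R \<longleftrightarrow> (\<forall>i\<in>I. cf_raw_rule \<Sigma> (R i)) \<and>
    (\<exists>r. r \<subseteq> I \<times> I \<and> wf r \<and> trans r \<and>
      (\<forall>i\<in>I. cf_finitary_rule \<Sigma> (R ` {j \<in> I. (j, i) \<in> r}) (R i)))"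

text \<open>The metavariables that occur outside annotations and outside the arguments of metavariables.
  A rule records its premises when all of its metavariables do so in its conclusion. This is not
  implied by \<open>mv_part (asm_jdg J) = set Ms\<close>: instantiation by a constant abstraction drops the
  arguments of a metavariable, and it discards the annotation of a metavariable. For
  example, given $E\;\mathsf{type}$, the raw rule with premises
  $M_1^{\Box : E}$ and $M_2^{\{x : E\}\Box\,\mathsf{type}}$ and conclusion
  $D(M_2(M_1))\;\mathsf{type}$ has the instance $D(E)\;\mathsf{type}$ by $M_1 \mapsto a^E$ and
  $M_2 \mapsto \{x\}E$, which does not mention $a^E$, and $D(E)\;\mathsf{type}$ is not derivable in
  the empty tt-context because $E$ has no closed term.\<close>

primrec rigid_mv :: "('s, 'a, 'm) cf_exp \<Rightarrow> ('s, 'a, 'm) cf_mvar set" where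
  "rigid_mv (CFree v) = {}"
| "rigid_mv (CBound i) = {}"
| "rigid_mv (CSym S es) = \<Union> (set (map rigid_mv es))"
| "rigid_mv (CMeta M ts) = {M}"
| "rigid_mv (CConv t \<alpha>) = rigid_mv t \<union> mv_part \<alpha>"
| "rigid_mv (CAsm \<alpha>) = mv_part \<alpha>"
| "rigid_mv (CAbs e) = rigid_mv e"

primrec rigid_mv_jdg :: "('s, 'a, 'm) cf_jdg \<Rightarrow> ('s, 'a, 'm) cf_mvar set" where
  "rigid_mv_jdg (CJTy A) = rigid_mv A"
| "rigid_mv_jdg (CJTm t A) = rigid_mv t \<union> rigid_mv A"
| "rigid_mv_jdg (CJEqTy A B \<alpha>) = rigid_mv A \<union> rigid_mv B \<union> mv_part \<alpha>"
| "rigid_mv_jdg (CJEqTm s t A \<alpha>) = rigid_mv s \<union> rigid_mv t \<union> rigid_mv A \<union> mv_part \<alpha>"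
| "rigid_mv_jdg (CJAbs A J) = rigid_mv A \<union> rigid_mv_jdg J"

definition records_premises :: "('s, 'a, 'm) cf_rule \<Rightarrow> bool" where
  "records_premises R \<longleftrightarrow> set (fst R) \<subseteq> rigid_mv_jdg (snd R)"

text \<open>Suitability of a tt-context for a cf-entity \<open>X\<close>, with \<open>asm X\<close> in place of \<open>X\<close>.\<close>

definition suitable ::
  "('s, 'a, 'm) er_mctx \<Rightarrow> ('s, 'a, 'm) er_vctx \<Rightarrow> ('s, 'a, 'm) cf_asms \<Rightarrow> bool"
where
  "suitable \<Theta> \<Gamma> X \<longleftrightarrow>
    (\<forall>m B. MV m B \<in> mv_part X \<longrightarrow> map_of \<Theta> (MV m B) = Some (erase_bdry B)) \<and>
    (\<forall>a A. FV a A \<in> fv_part X \<longrightarrow> map_of \<Gamma> (FV a A) = Some (erase A))"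

end

theory Submission
  imports Defs
begin

text \<open>The translation is an induction on context-free derivations: in each rule the conclusion records
  the assumptions of the premises (for specific rules this is the hypothesis on \<open>T\<close>), so a suitable
  context is suitable throughout, and under binders the annotated variable is renamed to a fresh one.
  The premises missing on the cf side are the equations between the types of the two sides in the
  congruence rules. They follow from one induction on tt-derivations, which shows that a pair of
  equal replacements of metavariables and variables turns a derivable object judgement into a
  derivable equation; finitarity and the well-formedness of \<open>\<Theta>\<close> supply the derivations of the
  types to which it is applied. Part (1) uses the translation over the smaller theories, along the
  well-founded order.\<close>

section \<open>Substitution in tt-syntax\<close>

text \<open>The missing type equations are the obstacle. In a cf congruence for terms the right-hand
  side is a converted term, already placed at the type of the left-hand side; in the tt rule the two
  sides have different types, and the equation between them is a premise. It states that a derivable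
  type respects replacement of equals by equals, which has to be proved for all derivations, and
  under binders and at metavariables such a proof calls for weakening, substitution and
  instantiation. Therefore \<open>tt_act\<close> replaces metavariables and variables at once, and a
  pair of replacements is related in the manner of a logical relation: equal arguments give equal
  values, over every extension of the target context. The induction then relies on no earlier
  structural result, and each structural rule is recovered by exhibiting an interpretation: the
  identity for weakening, fresh variables sent to arguments for substitution, the premises of a rule
  for instantiation. The last one needs the boundary of each metavariable to be derivable over its
  predecessors, which finitarity provides.\<close>

lemma tt_lift_lift: "i \<le> k \<Longrightarrow> tt_lift (Suc k) (tt_lift i e) = tt_lift i (tt_lift k e)"
  by (induction e arbitrary: i k) auto

lemma tt_lift_up: "tt_lift (Suc k) \<circ> tt_up \<sigma> = tt_up (tt_lift k \<circ> \<sigma>)"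
  by (rule ext) (auto simp: tt_up_def tt_lift_lift split: nat.split)

lemma tt_lift_subst: "tt_lift k (tt_subst \<sigma> e) = tt_subst (tt_lift k \<circ> \<sigma>) e"
  by (induction e arbitrary: k \<sigma>) (auto simp: tt_lift_up)

lemma tt_up_skip:
  "(\<lambda>i. tt_up \<sigma> (if i < Suc k then i else Suc i)) = tt_up (\<lambda>i. \<sigma> (if i < k then i else Suc i))"
  by (rule ext) (auto simp: tt_up_def split: nat.split)

lemma tt_subst_lift: "tt_subst \<sigma> (tt_lift k e) = tt_subst (\<lambda>i. \<sigma> (if i < k then i else Suc i)) e"
proof (induction e arbitrary: k \<sigma>)
  case (TAbs e)
  show ?case by (simp only: tt_lift.simps tt_subst.simps TAbs tt_up_skip)
qed auto

lemma tt_up_comp: "tt_subst (tt_up \<sigma>) \<circ> tt_up \<theta> = tt_up (tt_subst \<sigma> \<circ> \<theta>)"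
  by (rule ext) (auto simp: tt_up_def tt_lift_subst tt_subst_lift comp_def split: nat.split)

lemma tt_subst_subst: "tt_subst \<sigma> (tt_subst \<theta> e) = tt_subst (tt_subst \<sigma> \<circ> \<theta>) e"
  by (induction e arbitrary: \<sigma> \<theta>) (auto simp: tt_up_comp)

lemma tt_vec_Nil [simp]: "tt_vec [] = TBound"
  by (rule ext) (simp add: tt_vec_def)

lemma tt_up_TBound [simp]: "tt_up TBound = TBound"
  by (rule ext) (simp add: tt_up_def split: nat.split)

lemma tt_subst_TBound [simp]: "tt_subst TBound e = e"
  by (induction e) (auto simp: map_idI)

lemma tt_subst_jdg_TBound [simp]: "tt_subst_jdg TBound J = J"
  by (induction J) auto

lemma tt_subst_jdg_subst:
  "tt_subst_jdg \<sigma> (tt_subst_jdg \<theta> J) = tt_subst_jdg (tt_subst \<sigma> \<circ> \<theta>) J"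
  by (induction J arbitrary: \<sigma> \<theta>) (auto simp: tt_up_comp tt_subst_subst)

text \<open>Opening one more binder after \<open>ts\<close> has been substituted outside it. The new
  term goes to the end of the list because the innermost variable has index 0 and
  \<open>tt_vec\<close> reads the list backwards. Telescopes are opened one binder at a time in this
  way.\<close>

lemma tt_vec_snoc: "tt_subst (tt_vec [t]) \<circ> tt_up (tt_vec ts) = tt_vec (ts @ [t])"
proof
  fix i
  show "(tt_subst (tt_vec [t]) \<circ> tt_up (tt_vec ts)) i = tt_vec (ts @ [t]) i"
  proof (cases i)
    case 0
    then show ?thesis by (simp add: tt_up_def tt_vec_def)
  next
    case (Suc j)
    \<comment> \<open>Lifting skips index 0 and \<open>tt_vec [t]\<close> lowers every other index
      by one, so the two cancel.\<close>
    have "(\<lambda>i. tt_vec [t] (if i < 0 then i else Suc i)) = TBound"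
      by (rule ext) (simp add: tt_vec_def)
    then show ?thesis
      using Suc by (simp add: tt_up_def tt_subst_lift) (simp add: tt_vec_def nth_append)
  qed
qed

lemma map_tt_vec: "i < length ts \<Longrightarrow> f (tt_vec ts i) = tt_vec (map f ts) i"
  by (simp add: tt_vec_def rev_nth)

section \<open>Well-formedness of tt-syntax\<close>

lemma tt_wf_subst_cong:
  "tt_wf \<Sigma> \<mu> V k ar e \<Longrightarrow> \<forall>i<k. \<sigma> i = \<tau> i \<Longrightarrow> tt_subst \<sigma> e = tt_subst \<tau> e"
proof (induction k ar e arbitrary: \<sigma> \<tau> rule: tt_wf.induct)
  case (tt_wf_sym S c as k es)
  then show ?case by (auto simp: list_all2_conv_all_nth in_set_conv_nth)
next
  case (tt_wf_abs k c n e)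
  have "\<forall>i<Suc k. tt_up \<sigma> i = tt_up \<tau> i"
    using tt_wf_abs.prems by (auto simp: tt_up_def split: nat.split)
  then show ?case using tt_wf_abs.IH by simp
qed auto

lemma tt_wf_subst_id: "tt_wf \<Sigma> \<mu> V 0 ar e \<Longrightarrow> tt_subst \<sigma> e = e"
  using tt_wf_subst_cong[of \<Sigma> \<mu> V 0 ar e \<sigma> TBound] by simp

lemma tt_wf_lift_id: "tt_wf \<Sigma> \<mu> V j ar e \<Longrightarrow> j \<le> k \<Longrightarrow> tt_lift k e = e"
proof (induction j ar e arbitrary: k rule: tt_wf.induct)
  case (tt_wf_sym S c as k es)
  then show ?case by (auto simp: list_all2_conv_all_nth in_set_conv_nth intro!: map_idI)
qed (auto intro!: map_idI)

lemma tt_wf_mono: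
  "tt_wf \<Sigma> \<mu> V k ar e \<Longrightarrow> k \<le> k' \<Longrightarrow> V \<subseteq> V' \<Longrightarrow> \<mu> \<subseteq>\<^sub>m \<mu>' \<Longrightarrow> tt_wf \<Sigma> \<mu>' V' k' ar e"
proof (induction k ar e arbitrary: k' rule: tt_wf.induct)
  case (tt_wf_sym S c as k es)
  then show ?case by (auto intro!: tt_wf.tt_wf_sym elim: list_all2_mono)
next
  case (tt_wf_meta M c ts k)
  then have "\<mu>' M = Some (Obj c, length ts)"
    by (auto simp: map_le_def dom_def)
  then show ?case using tt_wf_meta by (auto intro: tt_wf.intros)
qed (auto intro: tt_wf.intros)

lemma tt_wf_lift: "tt_wf \<Sigma> \<mu> V k ar e \<Longrightarrow> tt_wf \<Sigma> \<mu> V (Suc k) ar (tt_lift j e)"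
proof (induction k ar e arbitrary: j rule: tt_wf.induct)
  case (tt_wf_sym S c as k es)
  then show ?case
    by (auto intro!: tt_wf.tt_wf_sym simp: list_all2_conv_all_nth)
qed (auto intro!: tt_wf.intros)

lemma tt_wf_up:
  "\<forall>i<k. tt_wf \<Sigma> \<mu> V k' (Obj Tm, 0) (\<theta> i) \<Longrightarrow>
   \<forall>i<Suc k. tt_wf \<Sigma> \<mu> V (Suc k') (Obj Tm, 0) (tt_up \<theta> i)"
  by (auto simp: tt_up_def less_Suc_eq_0_disj intro!: tt_wf_lift tt_wf.tt_wf_bound)

lemma tt_wf_subst:
  "tt_wf \<Sigma> \<mu> V k ar e \<Longrightarrow> \<forall>i<k. tt_wf \<Sigma> \<mu> V k' (Obj Tm, 0) (\<theta> i) \<Longrightarrow>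
   tt_wf \<Sigma> \<mu> V k' ar (tt_subst \<theta> e)"
proof (induction k ar e arbitrary: k' \<theta> rule: tt_wf.induct)
  case (tt_wf_sym S c as k es)
  then show ?case
    by (auto intro!: tt_wf.tt_wf_sym simp: list_all2_conv_all_nth)
next
  case (tt_wf_abs k c n e)
  show ?case
    using tt_wf_abs.IH[OF tt_wf_up[OF tt_wf_abs.prems]] by (auto intro: tt_wf.intros)
qed (auto intro!: tt_wf.intros)

lemma tt_wf_subst_bdry:
  "tt_wf_bdry \<Sigma> \<mu> V k B \<Longrightarrow> \<forall>i<k. tt_wf \<Sigma> \<mu> V k' (Obj Tm, 0) (\<theta> i) \<Longrightarrow>
   tt_wf_bdry \<Sigma> \<mu> V k' (tt_subst_bdry \<theta> B)"
proof (induction B arbitrary: k k' \<theta>)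
  case (TBAbs A B)
  show ?case
    using TBAbs.IH[OF _ tt_wf_up[OF TBAbs.prems(2)]] TBAbs.prems by (auto intro: tt_wf_subst)
qed (auto intro: tt_wf_subst)

lemma tt_wf_vec:
  "\<forall>t\<in>set ts. tt_wf \<Sigma> \<mu> V k (Obj Tm, 0) t \<Longrightarrow> i < length ts \<Longrightarrow>
   tt_wf \<Sigma> \<mu> V k (Obj Tm, 0) (tt_vec ts i)"
  by (simp add: tt_vec_def rev_nth)

lemma tt_wf_body_id: "tt_wf \<Sigma> \<mu> V k (c, 0) e \<Longrightarrow> tt_body e = e"
  by (auto elim: tt_wf.cases)

lemma tt_wf_Suc_cases:
  assumes "tt_wf \<Sigma> \<mu> V k (c, Suc n) e"
  obtains f where "e = TAbs f" "tt_wf \<Sigma> \<mu> V (Suc k) (c, n) f"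
  using assms by (auto elim: tt_wf.cases)

lemma tt_wf_body: "tt_wf \<Sigma> \<mu> V k (c, n) e \<Longrightarrow> tt_wf \<Sigma> \<mu> V (k + n) (c, 0) (tt_body e)"
proof (induction n arbitrary: k e)
  case 0
  then show ?case by (simp add: tt_wf_body_id)
next
  case (Suc n)
  from Suc.prems obtain f where "e = TAbs f" "tt_wf \<Sigma> \<mu> V (Suc k) (c, n) f"
    by (rule tt_wf_Suc_cases)
  then show ?case using Suc.IH[of "Suc k" f] by simp
qed

lemma tt_wf_fv: "tt_wf \<Sigma> \<mu> V k ar e \<Longrightarrow> tt_fv e \<subseteq> V"
proof (induction k ar e rule: tt_wf.induct)
  case (tt_wf_sym S c as k es)
  then show ?case by (fastforce simp: list_all2_conv_all_nth in_set_conv_nth)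
qed auto

lemma tt_wf_fv_jdg: "tt_wf_jdg \<Sigma> \<mu> V k J \<Longrightarrow> tt_fv_jdg J \<subseteq> V"
  by (induction J arbitrary: k) (auto dest: tt_wf_fv)

lemma tt_wf_fv_bdry: "tt_wf_bdry \<Sigma> \<mu> V k B \<Longrightarrow> tt_fv_bdry B \<subseteq> V"
  by (induction B arbitrary: k) (auto dest: tt_wf_fv)

lemma tt_wf_bdry_mono:
  "tt_wf_bdry \<Sigma> \<mu> V k B \<Longrightarrow> k \<le> k' \<Longrightarrow> V \<subseteq> V' \<Longrightarrow> \<mu> \<subseteq>\<^sub>m \<mu>' \<Longrightarrow> tt_wf_bdry \<Sigma> \<mu>' V' k' B"
  by (induction B arbitrary: k k') (auto elim!: tt_wf_mono)

lemma tt_wf_jdg_mono: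
  "tt_wf_jdg \<Sigma> \<mu> V k J \<Longrightarrow> k \<le> k' \<Longrightarrow> V \<subseteq> V' \<Longrightarrow> \<mu> \<subseteq>\<^sub>m \<mu>' \<Longrightarrow> tt_wf_jdg \<Sigma> \<mu>' V' k' J"
  by (induction J arbitrary: k k') (auto elim!: tt_wf_mono)

text \<open>\<open>tt_vec [TFree a]\<close> is the case \<open>k = 0\<close>. The depth
  \<open>k\<close> makes the family closed under \<open>tt_up\<close>, as inductions under binders
  require.\<close>

definition tt_open :: "'v \<Rightarrow> nat \<Rightarrow> nat \<Rightarrow> ('s, 'v, 'm) tt_exp" where
  "tt_open a k i = (if i < k then TBound i else if i = k then TFree a else TBound (i - 1))"

lemma tt_vec_open: "tt_vec [TFree a] = tt_open a 0"
  by (rule ext) (simp add: tt_vec_def tt_open_def)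

lemma tt_up_open: "tt_up (tt_open a k) = tt_open a (Suc k)"
  by (rule ext) (auto simp: tt_up_def tt_open_def split: nat.split)

lemma tt_wf_open_inv:
  "tt_wf \<Sigma> \<mu> (insert a V) k ar (tt_subst (tt_open a k) e) \<Longrightarrow> a \<notin> tt_fv e \<Longrightarrow>
   tt_wf \<Sigma> \<mu> V (Suc k) ar e"
proof (induction e arbitrary: k ar)
  case (TFree x)
  then show ?case by (auto elim!: tt_wf.cases intro: tt_wf.intros)
next
  case (TBound i)
  then show ?case
    by (auto simp: tt_open_def split: if_splits elim!: tt_wf.cases intro!: tt_wf.intros)
next
  case (TSym S es)
  from TSym.prems(1) obtain c as where *: "ar = (Obj c, 0)" "\<Sigma> S = Some (c, as)"
    "list_all2 (tt_wf \<Sigma> \<mu> (insert a V) k) as (map (tt_subst (tt_open a k)) es)"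
    by (auto elim: tt_wf.cases)
  have "list_all2 (tt_wf \<Sigma> \<mu> V (Suc k)) as es"
    unfolding list_all2_conv_all_nth
  proof (intro conjI allI impI)
    show "length as = length es" using *(3) by (simp add: list_all2_conv_all_nth)
    fix i assume i: "i < length as"
    then have "es ! i \<in> set es" using *(3) by (auto simp: list_all2_conv_all_nth)
    moreover have "tt_wf \<Sigma> \<mu> (insert a V) k (as ! i) (tt_subst (tt_open a k) (es ! i))"
      using *(3) i by (auto simp: list_all2_conv_all_nth)
    ultimately show "tt_wf \<Sigma> \<mu> V (Suc k) (as ! i) (es ! i)"
      using TSym.IH TSym.prems(2) by auto
  qed
  then show ?case using * by (auto intro: tt_wf.intros)
next
  case (TMeta M ts)
  from TMeta.prems(1) obtain c where *: "ar = (Obj c, 0)" "\<mu> M = Some (Obj c, length ts)"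
    "\<forall>t\<in>set ts. tt_wf \<Sigma> \<mu> (insert a V) k (Obj Tm, 0) (tt_subst (tt_open a k) t)"
    by (auto elim: tt_wf.cases)
  then show ?case using TMeta.IH TMeta.prems(2) by (auto intro!: tt_wf.intros)
next
  case TStar
  then show ?case by (auto elim!: tt_wf.cases intro: tt_wf.intros)
next
  case (TAbs e)
  from TAbs.prems(1) obtain c n where *: "ar = (c, Suc n)"
    "tt_wf \<Sigma> \<mu> (insert a V) (Suc k) (c, n) (tt_subst (tt_open a (Suc k)) e)"
    by (auto simp: tt_up_open elim: tt_wf.cases)
  then show ?case using TAbs by (auto intro: tt_wf.intros)
qed

lemma tt_wf_jdg_open_inv:
  "tt_wf_jdg \<Sigma> \<mu> (insert a V) k (tt_subst_jdg (tt_open a k) J) \<Longrightarrow> a \<notin> tt_fv_jdg J \<Longrightarrow>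
   tt_wf_jdg \<Sigma> \<mu> V (Suc k) J"
  by (induction J arbitrary: k) (auto simp: tt_up_open dest: tt_wf_open_inv)

lemma tt_wf_bdry_open_inv:
  "tt_wf_bdry \<Sigma> \<mu> (insert a V) k (tt_subst_bdry (tt_open a k) B) \<Longrightarrow> a \<notin> tt_fv_bdry B \<Longrightarrow>
   tt_wf_bdry \<Sigma> \<mu> V (Suc k) B"
  by (induction B arbitrary: k) (auto simp: tt_up_open dest: tt_wf_open_inv)

section \<open>Simultaneous replacement of metavariables and free variables\<close>

text \<open>Separated from \<open>tt_act\<close> because interpretations are tested at arbitrary
  lists of arguments, not only at images of arguments.\<close>

definition tt_act_meta :: "('m \<rightharpoonup> ('s, 'v, 'm) tt_exp) \<Rightarrow> 'm \<Rightarrow> ('s, 'v, 'm) tt_exp list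
    \<Rightarrow> ('s, 'v, 'm) tt_exp" where
  "tt_act_meta I M us = (case I M of None \<Rightarrow> TMeta M us | Some f \<Rightarrow> tt_subst (tt_vec us) (tt_body f))"

text \<open>With \<open>\<sigma> = TFree\<close> this is \<open>tt_inst\<close>, with
  \<open>I = Map.empty\<close> it is substitution for free variables; renaming is the special case
  where the values of \<open>\<sigma>\<close> are variables.\<close>

primrec tt_act :: "('m \<rightharpoonup> ('s, 'v, 'm) tt_exp) \<Rightarrow> ('v \<Rightarrow> ('s, 'v, 'm) tt_exp)
    \<Rightarrow> ('s, 'v, 'm) tt_exp \<Rightarrow> ('s, 'v, 'm) tt_exp" where
  "tt_act I \<sigma> (TFree a) = \<sigma> a"
| "tt_act I \<sigma> (TBound i) = TBound i"
| "tt_act I \<sigma> (TSym S es) = TSym S (map (tt_act I \<sigma>) es)"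
| "tt_act I \<sigma> (TMeta M ts) = tt_act_meta I M (map (tt_act I \<sigma>) ts)"
| "tt_act I \<sigma> TStar = TStar"
| "tt_act I \<sigma> (TAbs e) = TAbs (tt_act I \<sigma> e)"

primrec tt_map_bdry :: "(('s, 'v, 'm) tt_exp \<Rightarrow> ('s, 'v, 'm) tt_exp) \<Rightarrow> ('s, 'v, 'm) tt_bdry
    \<Rightarrow> ('s, 'v, 'm) tt_bdry" where
  "tt_map_bdry f TBTy = TBTy"
| "tt_map_bdry f (TBTm A) = TBTm (f A)"
| "tt_map_bdry f (TBEqTy A B) = TBEqTy (f A) (f B)"
| "tt_map_bdry f (TBEqTm s t A) = TBEqTm (f s) (f t) (f A)"
| "tt_map_bdry f (TBAbs A B) = TBAbs (f A) (tt_map_bdry f B)"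

primrec tt_map_jdg :: "(('s, 'v, 'm) tt_exp \<Rightarrow> ('s, 'v, 'm) tt_exp) \<Rightarrow> ('s, 'v, 'm) tt_jdg
    \<Rightarrow> ('s, 'v, 'm) tt_jdg" where
  "tt_map_jdg f (TJTy A) = TJTy (f A)"
| "tt_map_jdg f (TJTm t A) = TJTm (f t) (f A)"
| "tt_map_jdg f (TJEqTy A B) = TJEqTy (f A) (f B)"
| "tt_map_jdg f (TJEqTm s t A) = TJEqTm (f s) (f t) (f A)"
| "tt_map_jdg f (TJAbs A J) = TJAbs (f A) (tt_map_jdg f J)"

text \<open>Meant for object judgements only; the values on equations are junk.\<close>

primrec tt_pair_jdg :: "(('s, 'v, 'm) tt_exp \<Rightarrow> ('s, 'v, 'm) tt_exp)
    \<Rightarrow> (('s, 'v, 'm) tt_exp \<Rightarrow> ('s, 'v, 'm) tt_exp) \<Rightarrow> ('s, 'v, 'm) tt_jdg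
    \<Rightarrow> ('s, 'v, 'm) tt_jdg" where
  "tt_pair_jdg f g (TJTy A) = TJEqTy (f A) (g A)"
| "tt_pair_jdg f g (TJTm t A) = TJEqTm (f t) (g t) (f A)"
| "tt_pair_jdg f g (TJEqTy A B) = TJEqTy A B"
| "tt_pair_jdg f g (TJEqTm s t A) = TJEqTm s t A"
| "tt_pair_jdg f g (TJAbs A J) = TJAbs (f A) (tt_pair_jdg f g J)"

primrec tt_obj_jdg :: "('s, 'v, 'm) tt_jdg \<Rightarrow> bool" where
  "tt_obj_jdg (TJTy A) = True"
| "tt_obj_jdg (TJTm t A) = True"
| "tt_obj_jdg (TJEqTy A B) = False"
| "tt_obj_jdg (TJEqTm s t A) = False"
| "tt_obj_jdg (TJAbs A J) = tt_obj_jdg J"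

lemma tt_inst_act: "tt_inst I e = tt_act I TFree e"
  by (induction e) (auto simp: tt_act_meta_def cong: map_cong option.case_cong)

lemma tt_inst_bdry_map: "tt_inst_bdry I B = tt_map_bdry (tt_act I TFree) B"
  by (induction B) (auto simp: tt_inst_act)

lemma tt_inst_jdg_map: "tt_inst_jdg I J = tt_map_jdg (tt_act I TFree) J"
  by (induction J) (auto simp: tt_inst_act)

lemma tt_act_id [simp]: "tt_act Map.empty TFree e = e"
  by (induction e) (auto simp: tt_act_meta_def intro!: map_idI)

lemma tt_map_bdry_ident: "(\<And>e. f e = e) \<Longrightarrow> tt_map_bdry f B = B"
  by (induction B) auto

lemma tt_map_jdg_ident: "(\<And>e. f e = e) \<Longrightarrow> tt_map_jdg f J = J"
  by (induction J) auto

lemma tt_arity_map [simp]: "tt_arity (tt_map_bdry f B) = tt_arity B"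
  by (induction B) auto

lemma tt_is_abs_map [simp]: "tt_is_abs_bdry (tt_map_bdry f B) = tt_is_abs_bdry B"
  by (induction B) auto

lemma tt_is_abs_subst [simp]: "tt_is_abs_bdry (tt_subst_bdry \<theta> B) = tt_is_abs_bdry B"
  by (induction B arbitrary: \<theta>) auto

lemma tt_arity_subst [simp]: "tt_arity (tt_subst_bdry \<theta> B) = tt_arity B"
  by (induction B arbitrary: \<theta>) auto

lemma tt_bdry_of_map: "tt_bdry_of (tt_map_jdg f J) = tt_map_bdry f (tt_bdry_of J)"
  by (induction J) auto

text \<open>All values have no dangling indices (bound 0), so they pass under binders without
  lifting. Where \<open>I\<close> is undefined the metavariable stays and must keep its arity in the
  target.\<close>

definition tt_act_ok :: "'s signature \<Rightarrow> ('m \<rightharpoonup> arity) \<Rightarrow> 'v set \<Rightarrow> ('m \<rightharpoonup> arity) \<Rightarrow> 'v set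
    \<Rightarrow> ('m \<rightharpoonup> ('s, 'v, 'm) tt_exp) \<Rightarrow> ('v \<Rightarrow> ('s, 'v, 'm) tt_exp) \<Rightarrow> bool" where
  "tt_act_ok \<Sigma> \<mu> V \<mu>' V' I \<sigma> \<longleftrightarrow> (\<forall>a\<in>V. tt_wf \<Sigma> \<mu>' V' 0 (Obj Tm, 0) (\<sigma> a)) \<and>
    (\<forall>M ar. \<mu> M = Some ar \<longrightarrow>
      (case I M of None \<Rightarrow> \<mu>' M = Some ar | Some f \<Rightarrow> tt_wf \<Sigma> \<mu>' V' 0 ar f))"

lemma tt_act_ok_body:
  "tt_act_ok \<Sigma> \<mu> V \<mu>' V' I \<sigma> \<Longrightarrow> \<mu> M = Some (c, n) \<Longrightarrow> I M = Some f \<Longrightarrow>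
   tt_wf \<Sigma> \<mu>' V' n (c, 0) (tt_body f)"
  using tt_wf_body[of \<Sigma> \<mu>' V' 0 c n f] by (force simp: tt_act_ok_def)

lemma tt_act_meta_wf:
  assumes "tt_act_ok \<Sigma> \<mu> V \<mu>' V' I \<sigma>" "\<mu> M = Some (Obj c, length us)"
    "\<forall>u\<in>set us. tt_wf \<Sigma> \<mu>' V' k (Obj Tm, 0) u"
  shows "tt_wf \<Sigma> \<mu>' V' k (Obj c, 0) (tt_act_meta I M us)"
proof (cases "I M")
  case None
  then have "\<mu>' M = Some (Obj c, length us)" using assms by (force simp: tt_act_ok_def)
  then show ?thesis using None assms by (auto simp: tt_act_meta_def intro: tt_wf.intros)
next
  case (Some f)
  show ?thesis
    using tt_wf_subst[OF tt_act_ok_body[OF assms(1,2) Some]] tt_wf_vec[OF assms(3)]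
    by (auto simp: tt_act_meta_def Some)
qed

lemma tt_wf_act:
  "tt_wf \<Sigma> \<mu> V k ar e \<Longrightarrow> tt_act_ok \<Sigma> \<mu> V \<mu>' V' I \<sigma> \<Longrightarrow> tt_wf \<Sigma> \<mu>' V' k ar (tt_act I \<sigma> e)"
proof (induction k ar e rule: tt_wf.induct)
  case (tt_wf_free a k)
  then show ?case by (auto simp: tt_act_ok_def intro: tt_wf_mono)
next
  case (tt_wf_sym S c as k es)
  then show ?case
    by (auto intro!: tt_wf.tt_wf_sym simp: list_all2_conv_all_nth)
next
  case (tt_wf_meta M c ts k)
  then show ?case by (auto intro!: tt_act_meta_wf)
qed (auto intro!: tt_wf.intros)

lemma tt_wf_act_bdry:
  "tt_wf_bdry \<Sigma> \<mu> V k B \<Longrightarrow> tt_act_ok \<Sigma> \<mu> V \<mu>' V' I \<sigma> \<Longrightarrow>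
   tt_wf_bdry \<Sigma> \<mu>' V' k (tt_map_bdry (tt_act I \<sigma>) B)"
  by (induction B arbitrary: k) (auto intro: tt_wf_act)

lemma tt_wf_act_jdg:
  "tt_wf_jdg \<Sigma> \<mu> V k J \<Longrightarrow> tt_act_ok \<Sigma> \<mu> V \<mu>' V' I \<sigma> \<Longrightarrow>
   tt_wf_jdg \<Sigma> \<mu>' V' k (tt_map_jdg (tt_act I \<sigma>) J)"
  by (induction J arbitrary: k) (auto intro: tt_wf_act)

section \<open>Congruence of replacement, and its commutation with lifting and substitution\<close>

lemma tt_act_cong:
  "tt_wf \<Sigma> \<mu> V k ar e \<Longrightarrow> \<forall>a\<in>V. \<sigma> a = \<tau> a \<Longrightarrow> \<forall>M\<in>dom \<mu>. I M = J M \<Longrightarrow>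
   tt_act I \<sigma> e = tt_act J \<tau> e"
proof (induction k ar e rule: tt_wf.induct)
  case (tt_wf_sym S c as k es)
  then show ?case by (auto simp: list_all2_conv_all_nth in_set_conv_nth)
next
  case (tt_wf_meta M c ts k)
  then have "I M = J M" by blast
  moreover have "map (tt_act I \<sigma>) ts = map (tt_act J \<tau>) ts" using tt_wf_meta by auto
  ultimately show ?case by (simp add: tt_act_meta_def del: map_eq_conv)
qed auto

lemma tt_act_cong_bdry:
  "tt_wf_bdry \<Sigma> \<mu> V k B \<Longrightarrow> \<forall>a\<in>V. \<sigma> a = \<tau> a \<Longrightarrow> \<forall>M\<in>dom \<mu>. I M = J M \<Longrightarrow>
   tt_map_bdry (tt_act I \<sigma>) B = tt_map_bdry (tt_act J \<tau>) B"
  by (induction B arbitrary: k) (auto intro: tt_act_cong)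

lemma tt_act_fun_upd:
  "a \<notin> tt_fv e \<Longrightarrow> tt_act I (\<sigma>(a := t)) e = tt_act I \<sigma> e"
  by (induction e) (auto cong: map_cong)

lemma tt_act_fun_upd_jdg:
  "a \<notin> tt_fv_jdg J \<Longrightarrow> tt_map_jdg (tt_act I (\<sigma>(a := t))) J = tt_map_jdg (tt_act I \<sigma>) J"
  by (induction J) (auto simp: tt_act_fun_upd)

lemma tt_act_fun_upd_bdry:
  "a \<notin> tt_fv_bdry B \<Longrightarrow> tt_map_bdry (tt_act I (\<sigma>(a := t))) B = tt_map_bdry (tt_act I \<sigma>) B"
  by (induction B) (auto simp: tt_act_fun_upd)

lemma tt_act_fun_upd_pair:
  "a \<notin> tt_fv_jdg J \<Longrightarrow> tt_obj_jdg J \<Longrightarrow> tt_pair_jdg (tt_act I (\<sigma>(a := t))) (tt_act K (\<tau>(a := s))) J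
    = tt_pair_jdg (tt_act I \<sigma>) (tt_act K \<tau>) J"
  by (induction J) (auto simp: tt_act_fun_upd)

text \<open>The body of the value of \<open>M\<close> has only indices below the number of
  arguments, so a substitution from outside reaches it through the arguments alone.\<close>

lemma tt_act_meta_subst:
  assumes "tt_act_ok \<Sigma> \<mu> V \<mu>' V' I \<sigma>" "\<mu> M = Some (Obj c, length us)"
  shows "tt_act_meta I M (map (tt_subst \<theta>) us) = tt_subst \<theta> (tt_act_meta I M us)"
proof (cases "I M")
  case None
  then show ?thesis by (auto simp: tt_act_meta_def)
next
  case (Some f)
  show ?thesis
    using tt_wf_subst_cong[OF tt_act_ok_body[OF assms Some],
        of "tt_vec (map (tt_subst \<theta>) us)" "tt_subst \<theta> \<circ> tt_vec us"]
    by (auto simp: tt_act_meta_def Some tt_subst_subst map_tt_vec)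
qed

lemma tt_lift_as_subst: "tt_lift k e = tt_subst (\<lambda>i. TBound (if i < k then i else Suc i)) e"
  by (metis tt_subst_TBound tt_subst_lift)

lemma tt_act_meta_lift:
  assumes "tt_act_ok \<Sigma> \<mu> V \<mu>' V' I \<sigma>" "\<mu> M = Some (Obj c, length us)"
  shows "tt_act_meta I M (map (tt_lift k) us) = tt_lift k (tt_act_meta I M us)"
proof -
  have "tt_lift k = tt_subst (\<lambda>i. TBound (if i < k then i else Suc i))"
    by (rule ext) (rule tt_lift_as_subst)
  then show ?thesis using tt_act_meta_subst[OF assms] by metis
qed

lemma tt_act_lift:
  "tt_wf \<Sigma> \<mu> V k ar e \<Longrightarrow> tt_act_ok \<Sigma> \<mu> V \<mu>' V' I \<sigma> \<Longrightarrow>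
   tt_act I \<sigma> (tt_lift j e) = tt_lift j (tt_act I \<sigma> e)"
proof (induction k ar e arbitrary: j rule: tt_wf.induct)
  case (tt_wf_free a k)
  then have "tt_wf \<Sigma> \<mu>' V' 0 (Obj Tm, 0) (\<sigma> a)" by (auto simp: tt_act_ok_def)
  then show ?case by (simp add: tt_wf_lift_id)
next
  case (tt_wf_sym S c as k es)
  then show ?case by (auto simp: list_all2_conv_all_nth in_set_conv_nth)
next
  case (tt_wf_meta M c ts k)
  then have "map (tt_act I \<sigma>) (map (tt_lift j) ts) = map (tt_lift j) (map (tt_act I \<sigma>) ts)"
    by auto
  then show ?case
    using tt_act_meta_lift[OF tt_wf_meta.prems, of M c "map (tt_act I \<sigma>) ts" j] tt_wf_meta.hyps
    by (simp del: map_map)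
qed auto

lemma tt_act_up:
  assumes "\<forall>i<k. tt_wf \<Sigma> \<mu> V k' (Obj Tm, 0) (\<theta> i)" "tt_act_ok \<Sigma> \<mu> V \<mu>' V' I \<sigma>"
  shows "\<forall>i<Suc k. (tt_act I \<sigma> \<circ> tt_up \<theta>) i = tt_up (tt_act I \<sigma> \<circ> \<theta>) i"
  using tt_act_lift[OF _ assms(2)] assms(1) by (auto simp: tt_up_def less_Suc_eq_0_disj)

lemma tt_act_subst:
  "tt_wf \<Sigma> \<mu> V k ar e \<Longrightarrow> tt_act_ok \<Sigma> \<mu> V \<mu>' V' I \<sigma> \<Longrightarrow>
   \<forall>i<k. tt_wf \<Sigma> \<mu> V k' (Obj Tm, 0) (\<theta> i) \<Longrightarrow>
   tt_act I \<sigma> (tt_subst \<theta> e) = tt_subst (tt_act I \<sigma> \<circ> \<theta>) (tt_act I \<sigma> e)"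
proof (induction k ar e arbitrary: k' \<theta> rule: tt_wf.induct)
  case (tt_wf_free a k)
  then have "tt_wf \<Sigma> \<mu>' V' 0 (Obj Tm, 0) (\<sigma> a)" by (auto simp: tt_act_ok_def)
  then show ?case by (simp add: tt_wf_subst_id)
next
  case (tt_wf_sym S c as k es)
  then show ?case by (auto simp: list_all2_conv_all_nth in_set_conv_nth)
next
  case (tt_wf_meta M c ts k)
  then have "map (tt_act I \<sigma>) (map (tt_subst \<theta>) ts)
      = map (tt_subst (tt_act I \<sigma> \<circ> \<theta>)) (map (tt_act I \<sigma>) ts)"
    by (auto simp: comp_def)
  then show ?case
    using tt_act_meta_subst[OF tt_wf_meta.prems(1), of M c "map (tt_act I \<sigma>) ts"
        "tt_act I \<sigma> \<circ> \<theta>"] tt_wf_meta.hyps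
    by (simp del: map_map comp_apply)
next
  case (tt_wf_abs k c n e)
  \<comment> \<open>\<open>tt_act_up\<close> gives agreement on the indices below
    \<open>Suc k\<close> only; this well-formedness makes that enough.\<close>
  have "tt_wf \<Sigma> \<mu>' V' (Suc k) (c, n) (tt_act I \<sigma> e)"
    by (rule tt_wf_act[OF tt_wf_abs.hyps tt_wf_abs.prems(1)])
  from tt_wf_subst_cong[OF this tt_act_up[OF tt_wf_abs.prems(2,1)]]
  show ?case
    using tt_wf_abs.IH[OF tt_wf_abs.prems(1) tt_wf_up[OF tt_wf_abs.prems(2)]]
    by (simp add: comp_def)
qed auto

lemma tt_act_subst_up:
  assumes "\<forall>i<k. tt_wf \<Sigma> \<mu> V k' (Obj Tm, 0) (\<theta> i)" "tt_act_ok \<Sigma> \<mu> V \<mu>' V' I \<sigma>"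
    "\<forall>i<k. tt_act I \<sigma> (\<theta> i) = \<theta>' i"
  shows "\<forall>i<Suc k. tt_act I \<sigma> (tt_up \<theta> i) = tt_up \<theta>' i"
  using tt_act_up[OF assms(1,2)] assms(3) by (auto simp: tt_up_def less_Suc_eq_0_disj)

lemma tt_act_subst':
  assumes "tt_wf \<Sigma> \<mu> V k ar e" "tt_act_ok \<Sigma> \<mu> V \<mu>' V' I \<sigma>"
    "\<forall>i<k. tt_wf \<Sigma> \<mu> V k' (Obj Tm, 0) (\<theta> i)" "\<forall>i<k. tt_act I \<sigma> (\<theta> i) = \<theta>' i"
  shows "tt_act I \<sigma> (tt_subst \<theta> e) = tt_subst \<theta>' (tt_act I \<sigma> e)"
  unfolding tt_act_subst[OF assms(1-3)]
  by (rule tt_wf_subst_cong[OF tt_wf_act[OF assms(1,2)]]) (simp add: assms(4))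

lemma tt_act_subst_bdry:
  assumes "tt_act_ok \<Sigma> \<mu> V \<mu>' V' I \<sigma>"
  shows "tt_wf_bdry \<Sigma> \<mu> V k B \<Longrightarrow> \<forall>i<k. tt_wf \<Sigma> \<mu> V k' (Obj Tm, 0) (\<theta> i) \<Longrightarrow>
   \<forall>i<k. tt_act I \<sigma> (\<theta> i) = \<theta>' i \<Longrightarrow>
   tt_map_bdry (tt_act I \<sigma>) (tt_subst_bdry \<theta> B) = tt_subst_bdry \<theta>' (tt_map_bdry (tt_act I \<sigma>) B)"
proof (induction B arbitrary: k k' \<theta> \<theta>')
  case (TBAbs A B)
  show ?case
    using TBAbs.IH[OF _ tt_wf_up[OF TBAbs.prems(2)] tt_act_subst_up[OF TBAbs.prems(2) assms TBAbs.prems(3)]]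
      tt_act_subst'[OF _ assms TBAbs.prems(2,3)] TBAbs.prems(1) by (simp, blast)
qed (auto intro: tt_act_subst'[OF _ assms])

lemma tt_act_subst_jdg:
  assumes "tt_act_ok \<Sigma> \<mu> V \<mu>' V' I \<sigma>"
  shows "tt_wf_jdg \<Sigma> \<mu> V k B \<Longrightarrow> \<forall>i<k. tt_wf \<Sigma> \<mu> V k' (Obj Tm, 0) (\<theta> i) \<Longrightarrow>
   \<forall>i<k. tt_act I \<sigma> (\<theta> i) = \<theta>' i \<Longrightarrow>
   tt_map_jdg (tt_act I \<sigma>) (tt_subst_jdg \<theta> B) = tt_subst_jdg \<theta>' (tt_map_jdg (tt_act I \<sigma>) B)"
proof (induction B arbitrary: k k' \<theta> \<theta>')
  case (TJAbs A B)
  show ?case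
    using TJAbs.IH[OF _ tt_wf_up[OF TJAbs.prems(2)] tt_act_subst_up[OF TJAbs.prems(2) assms TJAbs.prems(3)]]
      tt_act_subst'[OF _ assms TJAbs.prems(2,3)] TJAbs.prems(1) by (simp, blast)
qed (auto intro: tt_act_subst'[OF _ assms])

text \<open>Both replacements must send \<open>\<theta>\<close> to the same
  \<open>\<theta>'\<close>. In the abstraction case this is arranged by sending the opened variable
  to one fresh variable on both sides.\<close>

lemma tt_pair_subst_jdg:
  assumes "tt_act_ok \<Sigma> \<mu> V \<mu>' V' I \<sigma>" "tt_act_ok \<Sigma> \<mu> V \<mu>' V' J \<tau>"
  shows "tt_wf_jdg \<Sigma> \<mu> V k B \<Longrightarrow> tt_obj_jdg B \<Longrightarrow> \<forall>i<k. tt_wf \<Sigma> \<mu> V k' (Obj Tm, 0) (\<theta> i) \<Longrightarrow>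
   \<forall>i<k. tt_act I \<sigma> (\<theta> i) = \<theta>' i \<Longrightarrow> \<forall>i<k. tt_act J \<tau> (\<theta> i) = \<theta>' i \<Longrightarrow>
   tt_pair_jdg (tt_act I \<sigma>) (tt_act J \<tau>) (tt_subst_jdg \<theta> B)
     = tt_subst_jdg \<theta>' (tt_pair_jdg (tt_act I \<sigma>) (tt_act J \<tau>) B)"
proof (induction B arbitrary: k k' \<theta> \<theta>')
  case (TJAbs A B)
  show ?case
    using TJAbs.IH[OF _ _ tt_wf_up[OF TJAbs.prems(3)]
        tt_act_subst_up[OF TJAbs.prems(3) assms(1) TJAbs.prems(4)]
        tt_act_subst_up[OF TJAbs.prems(3) assms(2) TJAbs.prems(5)]]
      tt_act_subst'[OF _ assms(1) TJAbs.prems(3,4)] TJAbs.prems(1,2) by (simp, blast)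
qed (auto intro: tt_act_subst'[OF _ assms(1)] tt_act_subst'[OF _ assms(2)])

text \<open>The arity matters: if a body were a free variable whose value is an abstraction,
  \<open>tt_body\<close> would strip that abstraction too. Well-formedness excludes abstractions at
  class arity 0.\<close>

lemma tt_body_act:
  "tt_wf \<Sigma> \<mu> V k (c, n) e \<Longrightarrow> tt_act_ok \<Sigma> \<mu> V \<mu>' V' I \<sigma> \<Longrightarrow>
   tt_body (tt_act I \<sigma> e) = tt_act I \<sigma> (tt_body e)"
proof (induction n arbitrary: k e)
  case 0
  then show ?case using tt_wf_body_id tt_wf_act by metis
next
  case (Suc n)
  from Suc.prems(1) obtain f where "e = TAbs f" "tt_wf \<Sigma> \<mu> V (Suc k) (c, n) f"
    by (rule tt_wf_Suc_cases)
  then show ?case using Suc.IH[of "Suc k" f] Suc.prems by simp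
qed

text \<open>A replacement applied to an instance of a rule is again an instance of that rule. Since
  \<open>e\<close> has no free variables and \<open>K\<close> covers its metavariables, the outer
  replacement can act only on the values of \<open>K\<close>.\<close>

lemma tt_act_inst:
  assumes K: "tt_act_ok \<Sigma> \<mu> {} \<mu>' V' K TFree" and I: "tt_act_ok \<Sigma> \<mu>' V' \<mu>'' V'' I \<sigma>"
    and dom: "dom \<mu> \<subseteq> dom K"
  shows "tt_wf \<Sigma> \<mu> {} k ar e \<Longrightarrow>
    tt_act I \<sigma> (tt_act K TFree e) = tt_act (\<lambda>M. map_option (tt_act I \<sigma>) (K M)) TFree e"
proof (induction k ar e rule: tt_wf.induct)
  case (tt_wf_sym S c as k es)
  then show ?case by (auto simp: list_all2_conv_all_nth in_set_conv_nth)
next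
  case (tt_wf_meta M c ts k)
  have "M \<in> dom K" using tt_wf_meta.hyps(1) dom by (simp add: domI subsetD)
  then obtain f where f: "K M = Some f" by blast
  have wf: "tt_wf \<Sigma> \<mu>' V' 0 (Obj c, length ts) f"
    using K f tt_wf_meta.hyps(1) by (force simp: tt_act_ok_def)
  note b = tt_act_ok_body[OF K tt_wf_meta.hyps(1) f]
  have us: "\<forall>i<length ts. tt_wf \<Sigma> \<mu>' V' k (Obj Tm, 0) (tt_vec (map (tt_act K TFree) ts) i)"
  proof (intro allI impI tt_wf_vec ballI)
    fix u assume "u \<in> set (map (tt_act K TFree) ts)"
    then show "tt_wf \<Sigma> \<mu>' V' k (Obj Tm, 0) u"
      using tt_wf_meta.IH by (auto intro: tt_wf_act[OF _ K])
  qed simp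
  have eq: "\<forall>i<length ts. tt_act I \<sigma> (tt_vec (map (tt_act K TFree) ts) i)
      = tt_vec (map (tt_act (\<lambda>M. map_option (tt_act I \<sigma>) (K M)) TFree) ts) i"
    using tt_wf_meta.IH by (simp add: tt_vec_def rev_nth)
  show ?case
    using tt_act_subst'[OF b I us eq] tt_body_act[OF wf I]
    by (simp only: tt_act.simps tt_act_meta_def f option.case option.map length_map)
qed simp_all

lemma tt_act_inst_bdry:
  assumes "tt_act_ok \<Sigma> \<mu> {} \<mu>' V' K TFree" "tt_act_ok \<Sigma> \<mu>' V' \<mu>'' V'' I \<sigma>" "dom \<mu> \<subseteq> dom K"
    "tt_wf_bdry \<Sigma> \<mu> {} k B"
  shows "tt_map_bdry (tt_act I \<sigma>) (tt_map_bdry (tt_act K TFree) B)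
    = tt_map_bdry (tt_act (\<lambda>M. map_option (tt_act I \<sigma>) (K M)) TFree) B"
proof -
  note * = tt_act_inst[OF assms(1-3)]
  show ?thesis using assms(4) by (induction B arbitrary: k) (simp_all, (blast dest: *)+)
qed

lemma tt_act_inst_jdg:
  assumes "tt_act_ok \<Sigma> \<mu> {} \<mu>' V' K TFree" "tt_act_ok \<Sigma> \<mu>' V' \<mu>'' V'' I \<sigma>" "dom \<mu> \<subseteq> dom K"
    "tt_wf_jdg \<Sigma> \<mu> {} k B"
  shows "tt_map_jdg (tt_act I \<sigma>) (tt_map_jdg (tt_act K TFree) B)
    = tt_map_jdg (tt_act (\<lambda>M. map_option (tt_act I \<sigma>) (K M)) TFree) B"
proof -
  note * = tt_act_inst[OF assms(1-3)]
  show ?thesis using assms(4) by (induction B arbitrary: k) (simp_all, (blast dest: *)+)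
qed

lemma tt_act_closed: "tt_wf \<Sigma> \<mu> {} k ar e \<Longrightarrow> tt_act I \<sigma> e = tt_act I TFree e"
  by (rule tt_act_cong) auto

lemma tt_act_closed_bdry:
  "tt_wf_bdry \<Sigma> \<mu> {} k B \<Longrightarrow> tt_map_bdry (tt_act I \<sigma>) B = tt_map_bdry (tt_act I TFree) B"
  by (rule tt_act_cong_bdry) auto

section \<open>Derivable tt-judgements are well-formed\<close>

text \<open>A type may mention any variable of the context, in whatever order. The condition is
  about raw syntax only and so is easily kept when contexts are extended as maps.\<close>

definition tt_raw_vctx ::
  "'s signature \<Rightarrow> ('s, 'v, 'm) tt_mctx \<Rightarrow> ('s, 'v, 'm) tt_vctx \<Rightarrow> bool" where
  "tt_raw_vctx \<Sigma> \<Theta> \<Gamma> \<longleftrightarrow>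
    (\<forall>A\<in>ran (map_of \<Gamma>). tt_wf \<Sigma> (tt_marity \<Theta>) (fst ` set \<Gamma>) 0 (Obj Ty, 0) A)"

definition tt_raw_mctx :: "'s signature \<Rightarrow> ('s, 'v, 'm) tt_mctx \<Rightarrow> bool" where
  "tt_raw_mctx \<Sigma> \<Theta> \<longleftrightarrow> (\<forall>B\<in>ran (map_of \<Theta>). tt_wf_bdry \<Sigma> (tt_marity \<Theta>) {} 0 B)"

lemma tt_raw_vctxD:
  "tt_raw_vctx \<Sigma> \<Theta> \<Gamma> \<Longrightarrow> map_of \<Gamma> a = Some A \<Longrightarrow>
   tt_wf \<Sigma> (tt_marity \<Theta>) (fst ` set \<Gamma>) 0 (Obj Ty, 0) A"
  by (auto simp: tt_raw_vctx_def ran_def)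

lemma tt_raw_mctxD:
  "tt_raw_mctx \<Sigma> \<Theta> \<Longrightarrow> map_of \<Theta> M = Some B \<Longrightarrow> tt_wf_bdry \<Sigma> (tt_marity \<Theta>) {} 0 B"
  by (auto simp: tt_raw_mctx_def ran_def)

lemma tt_raw_vctx_Nil [simp]: "tt_raw_vctx \<Sigma> \<Theta> []"
  by (simp add: tt_raw_vctx_def)

lemma map_of_snoc:
  "a \<notin> fst ` set \<Gamma> \<Longrightarrow> map_of (\<Gamma> @ [(a, A)]) = (map_of \<Gamma>)(a \<mapsto> A)"
  by (rule ext) (auto simp: map_add_def dom_map_of_conv_image_fst[symmetric] split: option.splits)

lemma tt_raw_vctx_snoc:
  assumes "tt_raw_vctx \<Sigma> \<Theta> \<Gamma>" "tt_wf \<Sigma> (tt_marity \<Theta>) (fst ` set \<Gamma>) 0 (Obj Ty, 0) A"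
    "a \<notin> fst ` set \<Gamma>"
  shows "tt_raw_vctx \<Sigma> \<Theta> (\<Gamma> @ [(a, A)])"
proof -
  have "tt_wf \<Sigma> (tt_marity \<Theta>) (fst ` set (\<Gamma> @ [(a, A)])) 0 (Obj Ty, 0) B"
    if "B \<in> ran (map_of (\<Gamma> @ [(a, A)]))" for B
  proof -
    have "tt_wf \<Sigma> (tt_marity \<Theta>) (fst ` set \<Gamma>) 0 (Obj Ty, 0) B"
      using that assms unfolding map_of_snoc[OF assms(3)] tt_raw_vctx_def
      by (auto simp: ran_def split: if_splits)
    then show ?thesis by (rule tt_wf_mono) auto
  qed
  then show ?thesis by (simp add: tt_raw_vctx_def)
qed

lemma tt_wf_bdry_foldr:
  "tt_wf_bdry \<Sigma> \<mu> V k (foldr TBAbs As \<beta>) \<longleftrightarrow>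
   (\<forall>j<length As. tt_wf \<Sigma> \<mu> V (k + j) (Obj Ty, 0) (As ! j)) \<and> tt_wf_bdry \<Sigma> \<mu> V (k + length As) \<beta>"
  by (induction As arbitrary: k) (auto simp: All_less_Suc2)

lemma tt_arity_foldr:
  "tt_arity (foldr TBAbs As \<beta>) = (fst (tt_arity \<beta>), length As + snd (tt_arity \<beta>))"
  by (induction As) auto

lemma tt_arity_not_abs: "\<not> tt_is_abs_bdry \<beta> \<Longrightarrow> snd (tt_arity \<beta>) = 0"
  by (cases \<beta>) auto

lemma tt_marity_foldr:
  "map_of \<Theta> M = Some (foldr TBAbs As \<beta>) \<Longrightarrow> \<not> tt_is_abs_bdry \<beta> \<Longrightarrow>
   tt_marity \<Theta> M = Some (fst (tt_arity \<beta>), length As)"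
  by (simp add: tt_marity_def tt_arity_foldr tt_arity_not_abs)

lemma tt_mk_inst_Some:
  "list_all2 P \<Xi> es \<Longrightarrow> map_of \<Xi> M = Some B \<Longrightarrow> \<exists>e. tt_mk_inst \<Xi> es M = Some e \<and> P (M, B) e"
  by (induction rule: list_all2_induct) (auto simp: tt_mk_inst_def split: if_splits)

lemma tt_mk_inst_act_ok:
  assumes "tt_inst_wf \<Sigma> \<Theta> \<Gamma> \<Xi> es"
  shows "tt_act_ok \<Sigma> (tt_marity \<Xi>) {} (tt_marity \<Theta>) (fst ` set \<Gamma>) (tt_mk_inst \<Xi> es) TFree"
  using tt_mk_inst_Some[OF assms[unfolded tt_inst_wf_def]]
  by (fastforce simp: tt_act_ok_def tt_marity_def)

lemma tt_mk_inst_dom: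
  assumes "tt_inst_wf \<Sigma> \<Theta> \<Gamma> \<Xi> es"
  shows "dom (tt_marity \<Xi>) \<subseteq> dom (tt_mk_inst \<Xi> es)"
  using tt_mk_inst_Some[OF assms[unfolded tt_inst_wf_def]]
  by (fastforce simp: tt_marity_def)

lemma tt_bdry_args_wf:
  assumes "tt_wf_bdry \<Sigma> \<mu> {} (length ts) B" "\<forall>t\<in>set ts. tt_wf \<Sigma> \<mu> V k (Obj Tm, 0) t"
  shows "tt_wf_bdry \<Sigma> \<mu> V k (tt_subst_bdry (tt_vec ts) B)"
proof (rule tt_wf_subst_bdry)
  show "tt_wf_bdry \<Sigma> \<mu> V (length ts) B" using assms(1) by (rule tt_wf_bdry_mono) auto
  show "\<forall>i<length ts. tt_wf \<Sigma> \<mu> V k (Obj Tm, 0) (tt_vec ts i)"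
    using assms(2) by (auto intro!: tt_wf_vec)
qed

lemma tt_wf_fill:
  "\<not> tt_is_abs_bdry B \<Longrightarrow> tt_wf_bdry \<Sigma> \<mu> V k B \<Longrightarrow> tt_wf \<Sigma> \<mu> V k (tt_arity B) e \<or> \<not> is_obj (tt_arity B)
   \<Longrightarrow> tt_wf_jdg \<Sigma> \<mu> V k (tt_fill B e)"
  by (cases B) (auto simp: is_obj_def)

lemma tt_wf_fill_eq:
  "\<not> tt_is_abs_bdry B \<Longrightarrow> is_obj (tt_arity B) \<Longrightarrow> tt_wf_bdry \<Sigma> \<mu> V k B \<Longrightarrow>
   tt_wf \<Sigma> \<mu> V k (tt_arity B) e \<Longrightarrow> tt_wf \<Sigma> \<mu> V k (tt_arity B) f \<Longrightarrow>
   tt_wf_jdg \<Sigma> \<mu> V k (tt_fill_eq B e f)"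
  by (cases B) (auto simp: is_obj_def)

lemma tt_wf_meta_app:
  assumes "map_of \<Theta> M = Some (foldr TBAbs As \<beta>)" "\<not> tt_is_abs_bdry \<beta>" "is_obj (tt_arity \<beta>)"
    "length ts = length As" "\<forall>t\<in>set ts. tt_wf \<Sigma> (tt_marity \<Theta>) V k (Obj Tm, 0) t"
  shows "tt_wf \<Sigma> (tt_marity \<Theta>) V k (tt_arity (tt_subst_bdry \<theta> \<beta>)) (TMeta M ts)"
proof -
  obtain c where c: "tt_arity \<beta> = (Obj c, 0)"
    using assms(2,3) by (cases \<beta>) (auto simp: is_obj_def)
  then show ?thesis
    using tt_marity_foldr[OF assms(1,2)] assms(4,5) by (auto intro: tt_wf.intros)
qed

lemma tt_raw_mctx_body:
  assumes "tt_raw_mctx \<Sigma> \<Theta>" "map_of \<Theta> M = Some (foldr TBAbs As \<beta>)"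
  shows "j < length As \<Longrightarrow> tt_wf \<Sigma> (tt_marity \<Theta>) {} j (Obj Ty, 0) (As ! j)"
    and "tt_wf_bdry \<Sigma> (tt_marity \<Theta>) {} (length As) \<beta>"
  using tt_raw_mctxD[OF assms] by (simp_all add: tt_wf_bdry_foldr)

lemma tt_raw_ruleD:
  assumes "tt_raw_rule \<Sigma> (\<Xi>, J)"
  shows "distinct (map fst \<Xi>)" "\<not> tt_is_abs_jdg J" "tt_wf_jdg \<Sigma> (tt_marity \<Xi>) {} 0 J"
    "i < length \<Xi> \<Longrightarrow> tt_wf_bdry \<Sigma> (tt_marity (take i \<Xi>)) {} 0 (snd (\<Xi> ! i))"
  using assms by (auto simp: tt_raw_rule_def)

text \<open>Apart from \<open>tt_inst_wf\<close> the rules do not check raw syntax. It is recovered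
  here because the commutation lemmas for \<open>tt_act\<close> hold for well-formed syntax
  only.\<close>

lemma tt_der_wf:
  assumes rules: "\<forall>R\<in>T. tt_raw_rule \<Sigma> R" and \<Theta>: "tt_raw_mctx \<Sigma> \<Theta>"
  shows "tt_der \<Sigma> T \<Theta> \<Gamma> J \<Longrightarrow> tt_raw_vctx \<Sigma> \<Theta> \<Gamma> \<Longrightarrow>
      tt_wf_jdg \<Sigma> (tt_marity \<Theta>) (fst ` set \<Gamma>) 0 J"
    and "tt_derb \<Sigma> T \<Theta> \<Gamma> B \<Longrightarrow> tt_raw_vctx \<Sigma> \<Theta> \<Gamma> \<Longrightarrow>
      tt_wf_bdry \<Sigma> (tt_marity \<Theta>) (fst ` set \<Gamma>) 0 B"
proof (induct rule: tt_der_tt_derb.inducts)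
  case (tt_var \<Gamma> a A)
  then have "a \<in> fst ` set \<Gamma>" by (simp add: dom_map_of_conv_image_fst[symmetric] domI)
  then show ?case using tt_raw_vctxD[OF tt_var(2,1)] by (auto intro: tt_wf.intros)
next
  case (tt_meta M As \<beta> ts \<Gamma>)
  have ts: "\<forall>t\<in>set ts. tt_wf \<Sigma> (tt_marity \<Theta>) (fst ` set \<Gamma>) 0 (Obj Tm, 0) t"
    using tt_meta.hyps(3,4) tt_meta.prems by (auto simp: in_set_conv_nth)
  show ?case
    using tt_meta.hyps(6)[OF tt_meta.prems] tt_meta.hyps(2) tt_wf_meta_app[OF tt_meta.hyps(1,2) _ tt_meta.hyps(3) ts]
    by (intro tt_wf_fill) auto
next
  case (tt_meta_congr M As \<beta> ss ts \<Gamma>)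
  have ss: "\<forall>t\<in>set ss. tt_wf \<Sigma> (tt_marity \<Theta>) (fst ` set \<Gamma>) 0 (Obj Tm, 0) t"
    and ts: "\<forall>t\<in>set ts. tt_wf \<Sigma> (tt_marity \<Theta>) (fst ` set \<Gamma>) 0 (Obj Tm, 0) t"
    using tt_meta_congr.hyps(4-7) tt_meta_congr.prems
    by (auto simp: in_set_conv_nth)
  \<comment> \<open>The congruence rule has no boundary premise, so the boundary is checked through
    its entry in \<open>\<Theta>\<close>.\<close>
  have "tt_wf_bdry \<Sigma> (tt_marity \<Theta>) (fst ` set \<Gamma>) 0 (tt_subst_bdry (tt_vec ss) \<beta>)"
    using tt_raw_mctx_body(2)[OF \<Theta> tt_meta_congr.hyps(1)] tt_meta_congr.hyps(4) ss
    by (intro tt_bdry_args_wf) auto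
  then show ?case
    using tt_meta_congr.hyps(2,3) tt_wf_meta_app[OF tt_meta_congr.hyps(1,2,3,4) ss]
      tt_wf_meta_app[OF tt_meta_congr.hyps(1,2,3,5) ts]
    by (intro tt_wf_fill_eq) auto
next
  case (tt_abs \<Gamma> A a J)
  then have A: "tt_wf \<Sigma> (tt_marity \<Theta>) (fst ` set \<Gamma>) 0 (Obj Ty, 0) A" by simp
  have "tt_wf_jdg \<Sigma> (tt_marity \<Theta>) (insert a (fst ` set \<Gamma>)) 0 (tt_subst_jdg (tt_open a 0) J)"
    using tt_abs.hyps(6)[OF tt_raw_vctx_snoc[OF tt_abs.prems A tt_abs.hyps(3)]]
    by (simp add: tt_vec_open)
  then show ?case using tt_wf_jdg_open_inv tt_abs.hyps A by auto
next
  case (tt_specific \<Xi> J \<Gamma> es)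
  then have "tt_wf_jdg \<Sigma> (tt_marity \<Xi>) {} 0 J" using rules by (auto simp: tt_raw_rule_def)
  then show ?case
    unfolding tt_inst_jdg_map by (rule tt_wf_act_jdg[OF _ tt_mk_inst_act_ok[OF tt_specific.hyps(2)]])
next
  case (tt_congr_ty \<Xi> A \<Gamma> fs gs)
  then have "tt_wf \<Sigma> (tt_marity \<Xi>) {} 0 (Obj Ty, 0) A" using rules by (auto simp: tt_raw_rule_def)
  then show ?case
    using tt_wf_act[OF _ tt_mk_inst_act_ok[OF tt_congr_ty.hyps(2)]]
      tt_wf_act[OF _ tt_mk_inst_act_ok[OF tt_congr_ty.hyps(3)]]
    by (simp add: tt_inst_act)
next
  case (tt_congr_tm \<Xi> t B \<Gamma> fs gs)
  then have "tt_wf \<Sigma> (tt_marity \<Xi>) {} 0 (Obj Tm, 0) t" "tt_wf \<Sigma> (tt_marity \<Xi>) {} 0 (Obj Ty, 0) B"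
    using rules by (auto simp: tt_raw_rule_def)
  then show ?case
    using tt_wf_act[OF _ tt_mk_inst_act_ok[OF tt_congr_tm.hyps(2)]]
      tt_wf_act[OF _ tt_mk_inst_act_ok[OF tt_congr_tm.hyps(3)]]
    by (simp add: tt_inst_act)
next
  case (tt_bdry_abs \<Gamma> A a B)
  then have A: "tt_wf \<Sigma> (tt_marity \<Theta>) (fst ` set \<Gamma>) 0 (Obj Ty, 0) A" by simp
  have "tt_wf_bdry \<Sigma> (tt_marity \<Theta>) (insert a (fst ` set \<Gamma>)) 0 (tt_subst_bdry (tt_open a 0) B)"
    using tt_bdry_abs.hyps(6)[OF tt_raw_vctx_snoc[OF tt_bdry_abs.prems A tt_bdry_abs.hyps(3)]]
    by (simp add: tt_vec_open)
  then show ?case using tt_wf_bdry_open_inv tt_bdry_abs.hyps A by auto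
qed auto

section \<open>Interpretations of tt-judgements and their equality\<close>

text \<open>Inclusion of lookup maps rather than a list prefix, so that weakening may insert entries
  at any place.\<close>

definition tt_ext where
  "tt_ext \<Sigma> \<Theta> \<Gamma> \<Gamma>' \<longleftrightarrow> map_of \<Gamma> \<subseteq>\<^sub>m map_of \<Gamma>' \<and> tt_raw_vctx \<Sigma> \<Theta> \<Gamma>'"

text \<open>The map \<open>f\<close> is applied to the telescope inside the predicate; thus
  arguments over two interpretations of one telescope \<open>As\<close> can be compared without
  renaming \<open>As\<close>.\<close>

definition tt_args where
  "tt_args \<Sigma> T \<Theta> \<Gamma> f As us \<longleftrightarrow> length us = length As \<and>
    (\<forall>j<length As. tt_der \<Sigma> T \<Theta> \<Gamma> (TJTm (us ! j) (tt_subst (tt_vec (take j us)) (f (As ! j)))))"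

definition tt_args_eq where
  "tt_args_eq \<Sigma> T \<Theta> \<Gamma> f As us vs \<longleftrightarrow>
    (\<forall>j<length As. tt_der \<Sigma> T \<Theta> \<Gamma>
      (TJEqTm (us ! j) (vs ! j) (tt_subst (tt_vec (take j us)) (f (As ! j)))))"

text \<open>The images of metavariables and variables are required to be derivable over all extensions of
  the target context, so that interpretations pass under binders without prior weakening.\<close>

definition tt_meta_typed where
  "tt_meta_typed \<Sigma> T \<Theta>\<^sub>0 \<Theta> \<Gamma> I \<longleftrightarrow> (\<forall>M As \<beta> \<Gamma>' us.
    map_of \<Theta>\<^sub>0 M = Some (foldr TBAbs As \<beta>) \<longrightarrow> \<not> tt_is_abs_bdry \<beta> \<longrightarrow> tt_ext \<Sigma> \<Theta> \<Gamma> \<Gamma>' \<longrightarrow>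
    tt_args \<Sigma> T \<Theta> \<Gamma>' (tt_act I TFree) As us \<longrightarrow>
    tt_derb \<Sigma> T \<Theta> \<Gamma>' (tt_subst_bdry (tt_vec us) (tt_map_bdry (tt_act I TFree) \<beta>)) \<longrightarrow>
    tt_der \<Sigma> T \<Theta> \<Gamma>' (tt_fill (tt_subst_bdry (tt_vec us) (tt_map_bdry (tt_act I TFree) \<beta>))
      (tt_act_meta I M us)))"

text \<open>Here \<open>us\<close> is typed along \<open>I\<close> and \<open>vs\<close> along
  \<open>J\<close>, while all equations live at the types given by \<open>I\<close> and
  \<open>us\<close>. The asymmetry and the clause for \<open>C\<close> copy
  \<open>tt_meta_congr\<close>, which must be the special case where both replacements are the
  identity.\<close>

definition tt_meta_equal where
  "tt_meta_equal \<Sigma> T \<Theta>\<^sub>0 \<Theta> \<Gamma> I J \<longleftrightarrow> (\<forall>M As \<beta> \<Gamma>' us vs.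
    map_of \<Theta>\<^sub>0 M = Some (foldr TBAbs As \<beta>) \<longrightarrow> \<not> tt_is_abs_bdry \<beta> \<longrightarrow> is_obj (tt_arity \<beta>) \<longrightarrow>
    tt_ext \<Sigma> \<Theta> \<Gamma> \<Gamma>' \<longrightarrow>
    tt_args \<Sigma> T \<Theta> \<Gamma>' (tt_act I TFree) As us \<longrightarrow>
    tt_args \<Sigma> T \<Theta> \<Gamma>' (tt_act J TFree) As vs \<longrightarrow>
    tt_args_eq \<Sigma> T \<Theta> \<Gamma>' (tt_act I TFree) As us vs \<longrightarrow>
    (\<forall>C. \<beta> = TBTm C \<longrightarrow> tt_der \<Sigma> T \<Theta> \<Gamma>' (TJEqTy (tt_subst (tt_vec us) (tt_act I TFree C))
      (tt_subst (tt_vec vs) (tt_act J TFree C)))) \<longrightarrow>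
    tt_der \<Sigma> T \<Theta> \<Gamma>' (tt_fill_eq (tt_subst_bdry (tt_vec us) (tt_map_bdry (tt_act I TFree) \<beta>))
      (tt_act_meta I M us) (tt_act_meta J M vs)))"

definition tt_var_typed where
  "tt_var_typed \<Sigma> T \<Gamma>\<^sub>0 \<Theta> \<Gamma> I \<sigma> \<longleftrightarrow> (\<forall>a A \<Gamma>'. map_of \<Gamma>\<^sub>0 a = Some A \<longrightarrow> tt_ext \<Sigma> \<Theta> \<Gamma> \<Gamma>' \<longrightarrow>
    tt_der \<Sigma> T \<Theta> \<Gamma>' (TJTm (\<sigma> a) (tt_act I \<sigma> A)))"

definition tt_var_equal where
  "tt_var_equal \<Sigma> T \<Gamma>\<^sub>0 \<Theta> \<Gamma> I \<sigma> \<tau> \<longleftrightarrow> (\<forall>a A \<Gamma>'. map_of \<Gamma>\<^sub>0 a = Some A \<longrightarrow> tt_ext \<Sigma> \<Theta> \<Gamma> \<Gamma>' \<longrightarrow>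
    tt_der \<Sigma> T \<Theta> \<Gamma>' (TJEqTm (\<sigma> a) (\<tau> a) (tt_act I \<sigma> A)))"

text \<open>Equality of \<open>I\<close> with itself is included: it says that the values of
  \<open>I\<close> respect equal arguments, and it makes the relation on pairs reflexive
  (\<open>tt_interp_refl\<close>).\<close>

definition tt_interp where
  "tt_interp \<Sigma> T \<Theta>\<^sub>0 \<Gamma>\<^sub>0 \<Theta> \<Gamma> I \<sigma> \<longleftrightarrow> tt_raw_vctx \<Sigma> \<Theta> \<Gamma> \<and>
    tt_act_ok \<Sigma> (tt_marity \<Theta>\<^sub>0) (fst ` set \<Gamma>\<^sub>0) (tt_marity \<Theta>) (fst ` set \<Gamma>) I \<sigma> \<and>
    tt_meta_typed \<Sigma> T \<Theta>\<^sub>0 \<Theta> \<Gamma> I \<and> tt_meta_equal \<Sigma> T \<Theta>\<^sub>0 \<Theta> \<Gamma> I I \<and>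
    tt_var_typed \<Sigma> T \<Gamma>\<^sub>0 \<Theta> \<Gamma> I \<sigma>"

definition tt_interp2 where
  "tt_interp2 \<Sigma> T \<Theta>\<^sub>0 \<Gamma>\<^sub>0 \<Theta> \<Gamma> I \<sigma> J \<tau> \<longleftrightarrow>
    tt_interp \<Sigma> T \<Theta>\<^sub>0 \<Gamma>\<^sub>0 \<Theta> \<Gamma> I \<sigma> \<and> tt_interp \<Sigma> T \<Theta>\<^sub>0 \<Gamma>\<^sub>0 \<Theta> \<Gamma> J \<tau> \<and>
    tt_meta_equal \<Sigma> T \<Theta>\<^sub>0 \<Theta> \<Gamma> I J \<and> tt_var_equal \<Sigma> T \<Gamma>\<^sub>0 \<Theta> \<Gamma> I \<sigma> \<tau>"

section \<open>Closure properties of interpretations\<close>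

lemma tt_ext_refl: "tt_raw_vctx \<Sigma> \<Theta> \<Gamma> \<Longrightarrow> tt_ext \<Sigma> \<Theta> \<Gamma> \<Gamma>"
  by (simp add: tt_ext_def)

lemma tt_ext_trans: "tt_ext \<Sigma> \<Theta> \<Gamma> \<Gamma>' \<Longrightarrow> tt_ext \<Sigma> \<Theta> \<Gamma>' \<Gamma>'' \<Longrightarrow> tt_ext \<Sigma> \<Theta> \<Gamma> \<Gamma>''"
  by (auto simp: tt_ext_def intro: map_le_trans)

lemma tt_ext_dom: "tt_ext \<Sigma> \<Theta> \<Gamma> \<Gamma>' \<Longrightarrow> fst ` set \<Gamma> \<subseteq> fst ` set \<Gamma>'"
  by (metis tt_ext_def dom_map_of_conv_image_fst map_le_implies_dom_le)

lemma tt_ext_lookup: "tt_ext \<Sigma> \<Theta> \<Gamma> \<Gamma>' \<Longrightarrow> map_of \<Gamma> a = Some A \<Longrightarrow> map_of \<Gamma>' a = Some A"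
  by (auto simp: tt_ext_def map_le_def dom_def)

lemma tt_interp_refl: "tt_interp \<Sigma> T \<Theta>\<^sub>0 \<Gamma>\<^sub>0 \<Theta> \<Gamma> I \<sigma> \<Longrightarrow> tt_interp2 \<Sigma> T \<Theta>\<^sub>0 \<Gamma>\<^sub>0 \<Theta> \<Gamma> I \<sigma> I \<sigma>"
  by (auto simp: tt_interp2_def tt_interp_def tt_var_equal_def tt_var_typed_def intro: tt_eqtm_refl)

lemma tt_act_ok_mono:
  "tt_act_ok \<Sigma> \<mu> V \<mu>' V' I \<sigma> \<Longrightarrow> V' \<subseteq> V'' \<Longrightarrow> tt_act_ok \<Sigma> \<mu> V \<mu>' V'' I \<sigma>"
  unfolding tt_act_ok_def by (fastforce elim: tt_wf_mono split: option.splits)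

lemma tt_interp_ext:
  assumes "tt_interp \<Sigma> T \<Theta>\<^sub>0 \<Gamma>\<^sub>0 \<Theta> \<Gamma> I \<sigma>" and e: "tt_ext \<Sigma> \<Theta> \<Gamma> \<Gamma>'"
  shows "tt_interp \<Sigma> T \<Theta>\<^sub>0 \<Gamma>\<^sub>0 \<Theta> \<Gamma>' I \<sigma>"
  using assms(1) tt_ext_trans[OF e] tt_act_ok_mono[OF _ tt_ext_dom[OF e]] e
  unfolding tt_interp_def tt_meta_typed_def tt_meta_equal_def tt_var_typed_def
  by (auto simp: tt_ext_def)

lemma tt_interp2_ext:
  assumes "tt_interp2 \<Sigma> T \<Theta>\<^sub>0 \<Gamma>\<^sub>0 \<Theta> \<Gamma> I \<sigma> J \<tau>" and e: "tt_ext \<Sigma> \<Theta> \<Gamma> \<Gamma>'"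
  shows "tt_interp2 \<Sigma> T \<Theta>\<^sub>0 \<Gamma>\<^sub>0 \<Theta> \<Gamma>' I \<sigma> J \<tau>"
  using assms(1) tt_ext_trans[OF e] tt_interp_ext[OF _ e]
  unfolding tt_interp2_def tt_meta_equal_def tt_var_equal_def by blast

lemma tt_interp2_left: "tt_interp2 \<Sigma> T \<Theta>\<^sub>0 \<Gamma>\<^sub>0 \<Theta> \<Gamma> I \<sigma> J \<tau> \<Longrightarrow> tt_interp2 \<Sigma> T \<Theta>\<^sub>0 \<Gamma>\<^sub>0 \<Theta> \<Gamma> I \<sigma> I \<sigma>"
  by (rule tt_interp_refl) (simp add: tt_interp2_def)

lemma tt_interp2_right: "tt_interp2 \<Sigma> T \<Theta>\<^sub>0 \<Gamma>\<^sub>0 \<Theta> \<Gamma> I \<sigma> J \<tau> \<Longrightarrow> tt_interp2 \<Sigma> T \<Theta>\<^sub>0 \<Gamma>\<^sub>0 \<Theta> \<Gamma> J \<tau> J \<tau>"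
  by (rule tt_interp_refl) (simp add: tt_interp2_def)

lemma tt_interp2D:
  assumes "tt_interp2 \<Sigma> T \<Theta>\<^sub>0 \<Gamma>\<^sub>0 \<Theta> \<Gamma> I \<sigma> J \<tau>"
  shows "tt_raw_vctx \<Sigma> \<Theta> \<Gamma>"
    "tt_act_ok \<Sigma> (tt_marity \<Theta>\<^sub>0) (fst ` set \<Gamma>\<^sub>0) (tt_marity \<Theta>) (fst ` set \<Gamma>) I \<sigma>"
    "tt_act_ok \<Sigma> (tt_marity \<Theta>\<^sub>0) (fst ` set \<Gamma>\<^sub>0) (tt_marity \<Theta>) (fst ` set \<Gamma>) J \<tau>"
    "tt_meta_typed \<Sigma> T \<Theta>\<^sub>0 \<Theta> \<Gamma> I" "tt_meta_equal \<Sigma> T \<Theta>\<^sub>0 \<Theta> \<Gamma> I J"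
    "tt_var_typed \<Sigma> T \<Gamma>\<^sub>0 \<Theta> \<Gamma> I \<sigma>" "tt_var_equal \<Sigma> T \<Gamma>\<^sub>0 \<Theta> \<Gamma> I \<sigma> \<tau>"
  using assms by (auto simp: tt_interp2_def tt_interp_def)

text \<open>The typing of \<open>u\<close> is assumed over all extensions of
  \<open>\<Gamma>'\<close>, because weakening is itself a consequence of \<open>tt_der_act\<close>,
  where interpretations are extended under binders. Types already in \<open>\<Gamma>\<^sub>0\<close>
  keep their images, as they cannot mention \<open>a\<close>.\<close>

lemma tt_interp_snoc:
  assumes i: "tt_interp \<Sigma> T \<Theta>\<^sub>0 \<Gamma>\<^sub>0 \<Theta> \<Gamma> I \<sigma>" and \<Gamma>0: "tt_raw_vctx \<Sigma> \<Theta>\<^sub>0 \<Gamma>\<^sub>0"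
    and a: "a \<notin> fst ` set \<Gamma>\<^sub>0" and e: "tt_ext \<Sigma> \<Theta> \<Gamma> \<Gamma>'"
    and A: "tt_wf \<Sigma> (tt_marity \<Theta>\<^sub>0) (fst ` set \<Gamma>\<^sub>0) 0 (Obj Ty, 0) A"
    and wf: "tt_wf \<Sigma> (tt_marity \<Theta>) (fst ` set \<Gamma>') 0 (Obj Tm, 0) u"
    and u: "\<And>\<Gamma>''. tt_ext \<Sigma> \<Theta> \<Gamma>' \<Gamma>'' \<Longrightarrow> tt_der \<Sigma> T \<Theta> \<Gamma>'' (TJTm u (tt_act I \<sigma> A))"
  shows "tt_interp \<Sigma> T \<Theta>\<^sub>0 (\<Gamma>\<^sub>0 @ [(a, A)]) \<Theta> \<Gamma>' I (\<sigma>(a := u))"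
proof -
  have i': "tt_interp \<Sigma> T \<Theta>\<^sub>0 \<Gamma>\<^sub>0 \<Theta> \<Gamma>' I \<sigma>" by (rule tt_interp_ext[OF i e])
  have fresh: "tt_act I (\<sigma>(a := u)) B = tt_act I \<sigma> B"
    if "tt_wf \<Sigma> (tt_marity \<Theta>\<^sub>0) (fst ` set \<Gamma>\<^sub>0) 0 (Obj Ty, 0) B" for B
    using tt_wf_fv[OF that] a by (intro tt_act_fun_upd) auto
  have "tt_act_ok \<Sigma> (tt_marity \<Theta>\<^sub>0) (fst ` set (\<Gamma>\<^sub>0 @ [(a, A)])) (tt_marity \<Theta>) (fst ` set \<Gamma>') I (\<sigma>(a := u))"
    using i' wf by (auto simp: tt_interp_def tt_act_ok_def)
  moreover have "tt_var_typed \<Sigma> T (\<Gamma>\<^sub>0 @ [(a, A)]) \<Theta> \<Gamma>' I (\<sigma>(a := u))"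
    unfolding tt_var_typed_def map_of_snoc[OF a]
  proof (intro allI impI)
    fix b B \<Gamma>'' assume b: "((map_of \<Gamma>\<^sub>0)(a \<mapsto> A)) b = Some B" and e': "tt_ext \<Sigma> \<Theta> \<Gamma>' \<Gamma>''"
    show "tt_der \<Sigma> T \<Theta> \<Gamma>'' (TJTm ((\<sigma>(a := u)) b) (tt_act I (\<sigma>(a := u)) B))"
    proof (cases "b = a")
      case True
      then show ?thesis using b u[OF e'] fresh[OF A] by simp
    next
      case False
      then have "map_of \<Gamma>\<^sub>0 b = Some B" using b by simp
      then show ?thesis
        using False fresh[OF tt_raw_vctxD[OF \<Gamma>0]] i' e' by (simp add: tt_interp_def tt_var_typed_def)
    qed
  qed
  ultimately show ?thesis using i' by (simp add: tt_interp_def)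
qed

lemma tt_interp2_snoc:
  assumes i: "tt_interp2 \<Sigma> T \<Theta>\<^sub>0 \<Gamma>\<^sub>0 \<Theta> \<Gamma> I \<sigma> J \<tau>" and \<Gamma>0: "tt_raw_vctx \<Sigma> \<Theta>\<^sub>0 \<Gamma>\<^sub>0"
    and a: "a \<notin> fst ` set \<Gamma>\<^sub>0" and e: "tt_ext \<Sigma> \<Theta> \<Gamma> \<Gamma>'"
    and A: "tt_wf \<Sigma> (tt_marity \<Theta>\<^sub>0) (fst ` set \<Gamma>\<^sub>0) 0 (Obj Ty, 0) A"
    and wf: "tt_wf \<Sigma> (tt_marity \<Theta>) (fst ` set \<Gamma>') 0 (Obj Tm, 0) u"
      "tt_wf \<Sigma> (tt_marity \<Theta>) (fst ` set \<Gamma>') 0 (Obj Tm, 0) v"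
    and u: "\<And>\<Gamma>''. tt_ext \<Sigma> \<Theta> \<Gamma>' \<Gamma>'' \<Longrightarrow> tt_der \<Sigma> T \<Theta> \<Gamma>'' (TJTm u (tt_act I \<sigma> A))"
    and v: "\<And>\<Gamma>''. tt_ext \<Sigma> \<Theta> \<Gamma>' \<Gamma>'' \<Longrightarrow> tt_der \<Sigma> T \<Theta> \<Gamma>'' (TJTm v (tt_act J \<tau> A))"
    and uv: "\<And>\<Gamma>''. tt_ext \<Sigma> \<Theta> \<Gamma>' \<Gamma>'' \<Longrightarrow> tt_der \<Sigma> T \<Theta> \<Gamma>'' (TJEqTm u v (tt_act I \<sigma> A))"
  shows "tt_interp2 \<Sigma> T \<Theta>\<^sub>0 (\<Gamma>\<^sub>0 @ [(a, A)]) \<Theta> \<Gamma>' I (\<sigma>(a := u)) J (\<tau>(a := v))"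
proof -
  have i': "tt_interp2 \<Sigma> T \<Theta>\<^sub>0 \<Gamma>\<^sub>0 \<Theta> \<Gamma>' I \<sigma> J \<tau>" by (rule tt_interp2_ext[OF i e])
  have fresh: "tt_act I (\<sigma>(a := u)) B = tt_act I \<sigma> B"
    if "tt_wf \<Sigma> (tt_marity \<Theta>\<^sub>0) (fst ` set \<Gamma>\<^sub>0) 0 (Obj Ty, 0) B" for B
    using tt_wf_fv[OF that] a by (intro tt_act_fun_upd) auto
  have "tt_var_equal \<Sigma> T (\<Gamma>\<^sub>0 @ [(a, A)]) \<Theta> \<Gamma>' I (\<sigma>(a := u)) (\<tau>(a := v))"
    unfolding tt_var_equal_def map_of_snoc[OF a]
  proof (intro allI impI)
    fix b B \<Gamma>'' assume b: "((map_of \<Gamma>\<^sub>0)(a \<mapsto> A)) b = Some B" and e': "tt_ext \<Sigma> \<Theta> \<Gamma>' \<Gamma>''"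
    show "tt_der \<Sigma> T \<Theta> \<Gamma>'' (TJEqTm ((\<sigma>(a := u)) b) ((\<tau>(a := v)) b) (tt_act I (\<sigma>(a := u)) B))"
    proof (cases "b = a")
      case True
      then show ?thesis using b uv[OF e'] fresh[OF A] by simp
    next
      case False
      then have "map_of \<Gamma>\<^sub>0 b = Some B" using b by simp
      then show ?thesis
        using False fresh[OF tt_raw_vctxD[OF \<Gamma>0]] i' e' by (simp add: tt_interp2_def tt_var_equal_def)
    qed
  qed
  moreover have "tt_interp \<Sigma> T \<Theta>\<^sub>0 (\<Gamma>\<^sub>0 @ [(a, A)]) \<Theta> \<Gamma>' I (\<sigma>(a := u))"
    using i by (intro tt_interp_snoc[OF _ \<Gamma>0 a e A wf(1) u]) (simp_all add: tt_interp2_def)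
  moreover have "tt_interp \<Sigma> T \<Theta>\<^sub>0 (\<Gamma>\<^sub>0 @ [(a, A)]) \<Theta> \<Gamma>' J (\<tau>(a := v))"
    using i by (intro tt_interp_snoc[OF _ \<Gamma>0 a e A wf(2) v]) (simp_all add: tt_interp2_def)
  ultimately show ?thesis using i' by (simp add: tt_interp2_def)
qed

text \<open>The types in the boundary of a metavariable have no free variables, so
  \<open>\<sigma>\<close> acts on an instantiated argument type through the arguments alone.\<close>

lemma tt_act_arg:
  assumes "tt_act_ok \<Sigma> \<mu> V \<mu>' V' I \<sigma>" "tt_wf \<Sigma> \<mu> {} j ar A" "j \<le> length ts"
    "\<forall>t\<in>set ts. tt_wf \<Sigma> \<mu> V k (Obj Tm, 0) t"
  shows "tt_act I \<sigma> (tt_subst (tt_vec (take j ts)) A)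
    = tt_subst (tt_vec (take j (map (tt_act I \<sigma>) ts))) (tt_act I TFree A)"
proof -
  have "tt_wf \<Sigma> \<mu> V j ar A" using assms(2) by (rule tt_wf_mono) auto
  moreover have "\<forall>i<j. tt_wf \<Sigma> \<mu> V k (Obj Tm, 0) (tt_vec (take j ts) i)"
    using assms(3,4) by (auto intro!: tt_wf_vec dest: in_set_takeD)
  moreover have "\<forall>i<j. tt_act I \<sigma> (tt_vec (take j ts) i) = tt_vec (take j (map (tt_act I \<sigma>) ts)) i"
    using assms(3) by (simp add: map_tt_vec take_map)
  ultimately show ?thesis
    using tt_act_subst'[OF _ assms(1)] tt_act_closed[OF assms(2), of I \<sigma>] by metis
qed

lemma tt_act_args_bdry:
  assumes "tt_act_ok \<Sigma> \<mu> V \<mu>' V' I \<sigma>" "tt_wf_bdry \<Sigma> \<mu> {} (length ts) B"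
    "\<forall>t\<in>set ts. tt_wf \<Sigma> \<mu> V k (Obj Tm, 0) t"
  shows "tt_map_bdry (tt_act I \<sigma>) (tt_subst_bdry (tt_vec ts) B)
    = tt_subst_bdry (tt_vec (map (tt_act I \<sigma>) ts)) (tt_map_bdry (tt_act I TFree) B)"
proof -
  have "tt_wf_bdry \<Sigma> \<mu> V (length ts) B" using assms(2) by (rule tt_wf_bdry_mono) auto
  moreover have "\<forall>i<length ts. tt_wf \<Sigma> \<mu> V k (Obj Tm, 0) (tt_vec ts i)"
    using assms(3) by (auto intro!: tt_wf_vec)
  moreover have "\<forall>i<length ts. tt_act I \<sigma> (tt_vec ts i) = tt_vec (map (tt_act I \<sigma>) ts) i"
    by (simp add: map_tt_vec)
  ultimately show ?thesis
    using tt_act_subst_bdry[OF assms(1)] tt_act_closed_bdry[OF assms(2), of I \<sigma>] by metis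
qed

section \<open>Replacement and filling\<close>

lemma tt_map_fill:
  "\<not> tt_is_abs_bdry B \<Longrightarrow> tt_map_jdg f (tt_fill B e) = tt_fill (tt_map_bdry f B) (f e)"
  by (cases B) auto

lemma tt_pair_fill:
  "\<not> tt_is_abs_bdry B \<Longrightarrow> is_obj (tt_arity B) \<Longrightarrow>
   tt_pair_jdg f g (tt_fill B e) = tt_fill_eq (tt_map_bdry f B) (f e) (g e)"
  by (cases B) (auto simp: is_obj_def)

lemma tt_map_fill_eq:
  "\<not> tt_is_abs_bdry B \<Longrightarrow> is_obj (tt_arity B) \<Longrightarrow>
   tt_map_jdg f (tt_fill_eq B e e') = tt_fill_eq (tt_map_bdry f B) (f e) (f e')"
  by (cases B) (auto simp: is_obj_def)

lemma tt_obj_fill: "\<not> tt_is_abs_bdry B \<Longrightarrow> tt_obj_jdg (tt_fill B e) \<longleftrightarrow> is_obj (tt_arity B)"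
  by (cases B) (auto simp: is_obj_def)

lemma tt_not_obj_fill_eq:
  "\<not> tt_is_abs_bdry B \<Longrightarrow> is_obj (tt_arity B) \<Longrightarrow> \<not> tt_obj_jdg (tt_fill_eq B e e')"
  by (cases B) (auto simp: is_obj_def)

text \<open>The arity hypothesis makes the abstractions of head and boundary match;
  \<open>tt_fill\<close> is unspecified when they do not. It takes the place of the restriction to
  non-abstracted boundaries in \<open>tt_map_fill\<close>.\<close>

lemma tt_act_fill:
  "tt_wf \<Sigma> \<mu> V k (tt_arity B) e \<Longrightarrow>
   tt_map_jdg (tt_act I \<sigma>) (tt_fill B e) = tt_fill (tt_map_bdry (tt_act I \<sigma>) B) (tt_act I \<sigma> e)"
proof (induction B arbitrary: e k)
  case (TBAbs A B)
  obtain c n where cn: "tt_arity B = (c, n)" by fastforce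
  with TBAbs.prems obtain f where "e = TAbs f" "tt_wf \<Sigma> \<mu> V (Suc k) (c, n) f"
    by (auto elim: tt_wf_Suc_cases)
  then show ?case using TBAbs.IH[of "Suc k" f] cn by (simp add: is_obj_def)
qed auto

lemma tt_act_fill_obj:
  "tt_wf \<Sigma> \<mu> V k (tt_arity B) e \<Longrightarrow> tt_obj_jdg (tt_fill B e) \<longleftrightarrow> is_obj (tt_arity B)"
proof (induction B arbitrary: e k)
  case (TBAbs A B)
  obtain c n where cn: "tt_arity B = (c, n)" by fastforce
  with TBAbs.prems obtain f where "e = TAbs f" "tt_wf \<Sigma> \<mu> V (Suc k) (c, n) f"
    by (auto elim: tt_wf_Suc_cases)
  then show ?case using TBAbs.IH[of "Suc k" f] cn by (simp add: is_obj_def)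
qed (auto simp: is_obj_def)

lemma tt_act_fill_pair:
  "tt_wf \<Sigma> \<mu> V k (tt_arity B) e \<Longrightarrow> is_obj (tt_arity B) \<Longrightarrow>
   tt_pair_jdg (tt_act I \<sigma>) (tt_act J \<tau>) (tt_fill B e)
     = tt_fill_eq (tt_map_bdry (tt_act I \<sigma>) B) (tt_act I \<sigma> e) (tt_act J \<tau> e)"
proof (induction B arbitrary: e k)
  case (TBAbs A B)
  obtain c n where cn: "tt_arity B = (c, n)" by fastforce
  with TBAbs.prems obtain f where "e = TAbs f" "tt_wf \<Sigma> \<mu> V (Suc k) (c, n) f"
    by (auto elim: tt_wf_Suc_cases)
  then show ?case using TBAbs.IH[of "Suc k" f] TBAbs.prems(2) cn by (simp add: is_obj_def)
qed (auto simp: is_obj_def)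

lemma tt_act_fill_eq:
  "tt_wf \<Sigma> \<mu> V k (tt_arity B) e \<Longrightarrow> tt_wf \<Sigma> \<mu> V k (tt_arity B) e' \<Longrightarrow> is_obj (tt_arity B) \<Longrightarrow>
   tt_map_jdg (tt_act I \<sigma>) (tt_fill_eq B e e')
     = tt_fill_eq (tt_map_bdry (tt_act I \<sigma>) B) (tt_act I \<sigma> e) (tt_act I \<sigma> e')"
proof (induction B arbitrary: e e' k)
  case (TBAbs A B)
  obtain c n where cn: "tt_arity B = (c, n)" by fastforce
  with TBAbs.prems obtain f where "e = TAbs f" "tt_wf \<Sigma> \<mu> V (Suc k) (c, n) f"
    by (auto elim: tt_wf_Suc_cases)
  moreover from cn TBAbs.prems obtain f' where "e' = TAbs f'" "tt_wf \<Sigma> \<mu> V (Suc k) (c, n) f'"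
    by (auto elim: tt_wf_Suc_cases)
  ultimately show ?case using TBAbs.IH[of "Suc k" f f'] TBAbs.prems(3) cn by (simp add: is_obj_def)
qed (auto simp: is_obj_def)

section \<open>Instances of rules under a further replacement\<close>

lemma tt_mk_inst_map: "(\<lambda>M. map_option f (tt_mk_inst \<Xi> es M)) = tt_mk_inst \<Xi> (map f es)"
  by (rule ext) (simp add: tt_mk_inst_def zip_map2 map_of_map)

lemma tt_inst_wf_take: "tt_inst_wf \<Sigma> \<Theta> \<Gamma> \<Xi> es \<Longrightarrow> tt_inst_wf \<Sigma> \<Theta> \<Gamma> (take i \<Xi>) (take i es)"
  by (auto simp: tt_inst_wf_def list_all2_takeI)

lemma tt_inst_wf_length: "tt_inst_wf \<Sigma> \<Theta> \<Gamma> \<Xi> es \<Longrightarrow> length es = length \<Xi>"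
  by (auto simp: tt_inst_wf_def dest: list_all2_lengthD)

lemma tt_inst_wf_nth:
  "tt_inst_wf \<Sigma> \<Theta> \<Gamma> \<Xi> es \<Longrightarrow> i < length \<Xi> \<Longrightarrow>
   tt_wf \<Sigma> (tt_marity \<Theta>) (fst ` set \<Gamma>) 0 (tt_arity (snd (\<Xi> ! i))) (es ! i)"
  by (auto simp: tt_inst_wf_def list_all2_conv_all_nth)

lemma tt_inst_wf_act:
  "tt_inst_wf \<Sigma> \<Theta>\<^sub>0 \<Gamma>\<^sub>0 \<Xi> es \<Longrightarrow>
   tt_act_ok \<Sigma> (tt_marity \<Theta>\<^sub>0) (fst ` set \<Gamma>\<^sub>0) (tt_marity \<Theta>) (fst ` set \<Gamma>) I \<sigma> \<Longrightarrow>
   tt_inst_wf \<Sigma> \<Theta> \<Gamma> \<Xi> (map (tt_act I \<sigma>) es)"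
  by (auto simp: tt_inst_wf_def list_all2_conv_all_nth intro: tt_wf_act)

lemma tt_prem_bdry_arity [simp]: "tt_arity (tt_prem_bdry \<Xi> es i) = tt_arity (snd (\<Xi> ! i))"
  by (simp add: tt_prem_bdry_def tt_inst_bdry_map)

lemma tt_act_prem_bdry:
  assumes "tt_raw_rule \<Sigma> (\<Xi>, J)" "tt_inst_wf \<Sigma> \<Theta>\<^sub>0 \<Gamma>\<^sub>0 \<Xi> es" "i < length \<Xi>"
    "tt_act_ok \<Sigma> (tt_marity \<Theta>\<^sub>0) (fst ` set \<Gamma>\<^sub>0) \<mu>' V' I \<sigma>"
  shows "tt_map_bdry (tt_act I \<sigma>) (tt_prem_bdry \<Xi> es i) = tt_prem_bdry \<Xi> (map (tt_act I \<sigma>) es) i"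
  using tt_act_inst_bdry[OF tt_mk_inst_act_ok[OF tt_inst_wf_take[OF assms(2)]] assms(4)
      tt_mk_inst_dom[OF tt_inst_wf_take[OF assms(2)]] tt_raw_ruleD(4)[OF assms(1,3)]]
  by (simp add: tt_prem_bdry_def tt_inst_bdry_map tt_mk_inst_map take_map)

lemma tt_act_inst_concl:
  assumes "tt_raw_rule \<Sigma> (\<Xi>, J)" "tt_inst_wf \<Sigma> \<Theta>\<^sub>0 \<Gamma>\<^sub>0 \<Xi> es"
    "tt_act_ok \<Sigma> (tt_marity \<Theta>\<^sub>0) (fst ` set \<Gamma>\<^sub>0) \<mu>' V' I \<sigma>"
  shows "tt_map_jdg (tt_act I \<sigma>) (tt_inst_jdg (tt_mk_inst \<Xi> es) J)
    = tt_inst_jdg (tt_mk_inst \<Xi> (map (tt_act I \<sigma>) es)) J"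
  using tt_act_inst_jdg[OF tt_mk_inst_act_ok[OF assms(2)] assms(3) tt_mk_inst_dom[OF assms(2)]
      tt_raw_ruleD(3)[OF assms(1)]]
  by (simp add: tt_inst_jdg_map tt_mk_inst_map)

lemma tt_wf_bdry_of: "tt_wf_jdg \<Sigma> \<mu> V k J \<Longrightarrow> tt_wf_bdry \<Sigma> \<mu> V k (tt_bdry_of J)"
  by (induction J arbitrary: k) auto

lemma tt_act_inst_concl_bdry:
  assumes "tt_raw_rule \<Sigma> (\<Xi>, J)" "tt_inst_wf \<Sigma> \<Theta>\<^sub>0 \<Gamma>\<^sub>0 \<Xi> es"
    "tt_act_ok \<Sigma> (tt_marity \<Theta>\<^sub>0) (fst ` set \<Gamma>\<^sub>0) \<mu>' V' I \<sigma>"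
  shows "tt_map_bdry (tt_act I \<sigma>) (tt_inst_bdry (tt_mk_inst \<Xi> es) (tt_bdry_of J))
    = tt_inst_bdry (tt_mk_inst \<Xi> (map (tt_act I \<sigma>) es)) (tt_bdry_of J)"
  using tt_act_inst_bdry[OF tt_mk_inst_act_ok[OF assms(2)] assms(3) tt_mk_inst_dom[OF assms(2)]
      tt_wf_bdry_of[OF tt_raw_ruleD(3)[OF assms(1)]]]
  by (simp add: tt_inst_bdry_map tt_mk_inst_map)

lemma tt_ext_snoc:
  assumes "tt_raw_vctx \<Sigma> \<Theta> (\<Gamma> @ [(a, A)])" "a \<notin> fst ` set \<Gamma>"
  shows "tt_ext \<Sigma> \<Theta> \<Gamma> (\<Gamma> @ [(a, A)])"
  unfolding tt_ext_def map_of_snoc[OF assms(2)]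
  using assms by (auto simp: map_le_def dom_map_of_conv_image_fst)

lemma tt_args_act:
  assumes ok: "tt_act_ok \<Sigma> (tt_marity \<Theta>\<^sub>0) V \<mu>' V' I \<sigma>" and raw: "tt_raw_mctx \<Sigma> \<Theta>\<^sub>0"
    and M: "map_of \<Theta>\<^sub>0 M = Some (foldr TBAbs As \<beta>)" and len: "length ts = length As"
    and ts: "\<forall>t\<in>set ts. tt_wf \<Sigma> (tt_marity \<Theta>\<^sub>0) V 0 (Obj Tm, 0) t"
  shows "j < length As \<Longrightarrow> tt_act I \<sigma> (tt_arg_bdry As ts j)
      = tt_subst (tt_vec (take j (map (tt_act I \<sigma>) ts))) (tt_act I TFree (As ! j))"
    and "tt_map_bdry (tt_act I \<sigma>) (tt_subst_bdry (tt_vec ts) \<beta>)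
      = tt_subst_bdry (tt_vec (map (tt_act I \<sigma>) ts)) (tt_map_bdry (tt_act I TFree) \<beta>)"
  using tt_act_arg[OF ok tt_raw_mctx_body(1)[OF raw M] _ ts]
    tt_act_args_bdry[OF ok tt_raw_mctx_body(2)[OF raw M, folded len] ts] len
  by (simp_all add: tt_arg_bdry_def)

lemma tt_congr_prems_act:
  assumes raw: "tt_raw_rule \<Sigma> (\<Xi>, G)" and wf: "tt_inst_wf \<Sigma> \<Theta>\<^sub>0 \<Gamma>\<^sub>0 \<Xi> fs" "tt_inst_wf \<Sigma> \<Theta>\<^sub>0 \<Gamma>\<^sub>0 \<Xi> gs"
    and ok: "tt_act_ok \<Sigma> (tt_marity \<Theta>\<^sub>0) (fst ` set \<Gamma>\<^sub>0) \<mu>' V' I \<sigma>" and k: "k < length \<Xi>"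
  defines "h \<equiv> map (tt_act I \<sigma>)"
  shows "tt_map_jdg (tt_act I \<sigma>) (tt_fill (tt_prem_bdry \<Xi> fs k) (fs ! k))
      = tt_fill (tt_prem_bdry \<Xi> (h fs) k) (h fs ! k)"
    and "is_obj (tt_arity (snd (\<Xi> ! k))) \<Longrightarrow>
      tt_map_jdg (tt_act I \<sigma>) (tt_fill_eq (tt_prem_bdry \<Xi> fs k) (fs ! k) (gs ! k))
      = tt_fill_eq (tt_prem_bdry \<Xi> (h fs) k) (h fs ! k) (h gs ! k)"
proof -
  have "tt_wf \<Sigma> (tt_marity \<Theta>\<^sub>0) (fst ` set \<Gamma>\<^sub>0) 0 (tt_arity (tt_prem_bdry \<Xi> fs k)) (fs ! k)"
    "tt_wf \<Sigma> (tt_marity \<Theta>\<^sub>0) (fst ` set \<Gamma>\<^sub>0) 0 (tt_arity (tt_prem_bdry \<Xi> fs k)) (gs ! k)"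
    using tt_inst_wf_nth[OF wf(1) k] tt_inst_wf_nth[OF wf(2) k] by simp_all
  then show "tt_map_jdg (tt_act I \<sigma>) (tt_fill (tt_prem_bdry \<Xi> fs k) (fs ! k))
      = tt_fill (tt_prem_bdry \<Xi> (h fs) k) (h fs ! k)"
    "is_obj (tt_arity (snd (\<Xi> ! k))) \<Longrightarrow>
      tt_map_jdg (tt_act I \<sigma>) (tt_fill_eq (tt_prem_bdry \<Xi> fs k) (fs ! k) (gs ! k))
      = tt_fill_eq (tt_prem_bdry \<Xi> (h fs) k) (h fs ! k) (h gs ! k)"
    using k tt_inst_wf_length[OF wf(1)] tt_inst_wf_length[OF wf(2)]
    by (simp_all add: tt_act_fill tt_act_fill_eq tt_act_prem_bdry[OF raw wf(1) k ok] h_def)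
qed

text \<open>One fresh variable \<open>b\<close> serves both sides. The context can give it only one
  type, the image of \<open>A\<close> under \<open>I\<close>; on the side of \<open>J\<close> it
  gets its type by conversion, which is what \<open>eq\<close> is for.\<close>

lemma tt_interp2_bind:
  assumes i: "tt_interp2 \<Sigma> T \<Theta>\<^sub>0 \<Gamma>\<^sub>0 \<Theta> \<Gamma> I \<sigma> J \<tau>" and \<Gamma>0: "tt_raw_vctx \<Sigma> \<Theta>\<^sub>0 \<Gamma>\<^sub>0"
    and a: "a \<notin> fst ` set \<Gamma>\<^sub>0" and b: "b \<notin> fst ` set \<Gamma>"
    and A: "tt_wf \<Sigma> (tt_marity \<Theta>\<^sub>0) (fst ` set \<Gamma>\<^sub>0) 0 (Obj Ty, 0) A"
    and eq: "\<And>\<Gamma>'. tt_ext \<Sigma> \<Theta> \<Gamma> \<Gamma>' \<Longrightarrow> tt_der \<Sigma> T \<Theta> \<Gamma>' (TJEqTy (tt_act I \<sigma> A) (tt_act J \<tau> A))"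
  shows "tt_interp2 \<Sigma> T \<Theta>\<^sub>0 (\<Gamma>\<^sub>0 @ [(a, A)]) \<Theta> (\<Gamma> @ [(b, tt_act I \<sigma> A)]) I (\<sigma>(a := TFree b)) J (\<tau>(a := TFree b))"
proof -
  let ?\<Gamma> = "\<Gamma> @ [(b, tt_act I \<sigma> A)]"
  have ext: "tt_ext \<Sigma> \<Theta> \<Gamma> ?\<Gamma>"
    by (rule tt_ext_snoc[OF tt_raw_vctx_snoc[OF _ _ b] b])
      (rule tt_interp2D(1)[OF i] tt_wf_act[OF A tt_interp2D(2)[OF i]])+
  have wf: "tt_wf \<Sigma> (tt_marity \<Theta>) (fst ` set ?\<Gamma>) 0 (Obj Tm, 0) (TFree b)"
    by (auto intro: tt_wf.intros)
  have bI: "tt_der \<Sigma> T \<Theta> \<Gamma>' (TJTm (TFree b) (tt_act I \<sigma> A))" if "tt_ext \<Sigma> \<Theta> ?\<Gamma> \<Gamma>'" for \<Gamma>'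
    by (rule tt_var, rule tt_ext_lookup[OF that]) (simp add: map_of_snoc[OF b] del: map_of_append)
  show ?thesis
    by (rule tt_interp2_snoc[OF i \<Gamma>0 a ext A wf wf])
      (auto intro: bI tt_eqtm_refl tt_conv[OF bI eq[OF tt_ext_trans[OF ext]]])
qed

text \<open>Substitution, instantiation and their congruence are all instances of the next lemma.\<close>

lemma tt_der_act:
  fixes T :: "('s, 'v, 'm) tt_rule set"
  assumes inf: "infinite (UNIV :: 'v set)" and sub: "T\<^sub>0 \<subseteq> T"
    and rules: "\<forall>R\<in>T\<^sub>0. tt_raw_rule \<Sigma> R" and \<Theta>0: "tt_raw_mctx \<Sigma> \<Theta>\<^sub>0"
  shows "tt_der \<Sigma> T\<^sub>0 \<Theta>\<^sub>0 \<Gamma>\<^sub>0 G \<Longrightarrow> tt_raw_vctx \<Sigma> \<Theta>\<^sub>0 \<Gamma>\<^sub>0 \<Longrightarrow>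
      tt_interp2 \<Sigma> T \<Theta>\<^sub>0 \<Gamma>\<^sub>0 \<Theta> \<Gamma> I \<sigma> J \<tau> \<Longrightarrow>
      tt_der \<Sigma> T \<Theta> \<Gamma> (tt_map_jdg (tt_act I \<sigma>) G) \<and>
      (tt_obj_jdg G \<longrightarrow> tt_der \<Sigma> T \<Theta> \<Gamma> (tt_pair_jdg (tt_act I \<sigma>) (tt_act J \<tau>) G))"
    and "tt_derb \<Sigma> T\<^sub>0 \<Theta>\<^sub>0 \<Gamma>\<^sub>0 B \<Longrightarrow> tt_raw_vctx \<Sigma> \<Theta>\<^sub>0 \<Gamma>\<^sub>0 \<Longrightarrow>
      tt_interp2 \<Sigma> T \<Theta>\<^sub>0 \<Gamma>\<^sub>0 \<Theta> \<Gamma> I \<sigma> J \<tau> \<Longrightarrow>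
      tt_derb \<Sigma> T \<Theta> \<Gamma> (tt_map_bdry (tt_act I \<sigma>) B) \<and>
      (\<forall>C. B = TBTm C \<longrightarrow> tt_der \<Sigma> T \<Theta> \<Gamma> (TJEqTy (tt_act I \<sigma> C) (tt_act J \<tau> C)))"
\<comment> \<open>The clause for \<open>TBTm C\<close> in the boundary part produces the type
  equation that the congruence rules demand, at the point where the rule being replaced offers only
  a boundary premise.\<close>
proof (induct arbitrary: \<Gamma> I \<sigma> J \<tau> and \<Gamma> I \<sigma> J \<tau> rule: tt_der_tt_derb.inducts)
  case (tt_var \<Gamma>\<^sub>0 a A)
  note i = tt_interp2D[OF tt_var.prems(2)]
  show ?case
    using i(6,7) tt_var.hyps tt_ext_refl[OF i(1)]
    by (auto simp: tt_var_typed_def tt_var_equal_def)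
next
  case (tt_meta M As \<beta> ts \<Gamma>\<^sub>0)
  note i = tt_interp2D[OF tt_meta.prems(2)]
  note wf = tt_der_wf[OF rules \<Theta>0]
  let ?us = "map (tt_act I \<sigma>) ts" and ?vs = "map (tt_act J \<tau>) ts"
  have ts: "\<forall>t\<in>set ts. tt_wf \<Sigma> (tt_marity \<Theta>\<^sub>0) (fst ` set \<Gamma>\<^sub>0) 0 (Obj Tm, 0) t"
    using tt_meta.hyps(3,4) wf(1)[OF _ tt_meta.prems(1)] by (fastforce simp: in_set_conv_nth)
  note aI = tt_args_act[OF i(2) \<Theta>0 tt_meta.hyps(1,3) ts]
    and aJ = tt_args_act[OF i(3) \<Theta>0 tt_meta.hyps(1,3) ts]
  \<comment> \<open>The hypothesis for the given pair yields the image under \<open>I\<close> and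
    the equation; the image under \<open>J\<close> comes from the pair of \<open>J\<close> with
    itself.\<close>
  have IH: "tt_der \<Sigma> T \<Theta> \<Gamma> (tt_map_jdg (tt_act I \<sigma>) (TJTm (ts ! j) (tt_arg_bdry As ts j)))"
    "tt_der \<Sigma> T \<Theta> \<Gamma> (tt_map_jdg (tt_act J \<tau>) (TJTm (ts ! j) (tt_arg_bdry As ts j)))"
    "tt_der \<Sigma> T \<Theta> \<Gamma> (tt_pair_jdg (tt_act I \<sigma>) (tt_act J \<tau>) (TJTm (ts ! j) (tt_arg_bdry As ts j)))"
    if "j < length As" for j
    using tt_meta.hyps(4) that tt_meta.prems tt_interp2_right[OF tt_meta.prems(2)]
    by (metis tt_obj_jdg.simps(2))+
  have us: "tt_args \<Sigma> T \<Theta> \<Gamma> (tt_act I TFree) As ?us" and vs: "tt_args \<Sigma> T \<Theta> \<Gamma> (tt_act J TFree) As ?vs"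
    and uv: "tt_args_eq \<Sigma> T \<Theta> \<Gamma> (tt_act I TFree) As ?us ?vs"
    using IH tt_meta.hyps(3) by (simp_all add: tt_args_def tt_args_eq_def aI(1) aJ(1))
  have IHb: "tt_derb \<Sigma> T \<Theta> \<Gamma> (tt_map_bdry (tt_act I \<sigma>) (tt_subst_bdry (tt_vec ts) \<beta>))"
    "\<And>C. tt_subst_bdry (tt_vec ts) \<beta> = TBTm C \<Longrightarrow>
      tt_der \<Sigma> T \<Theta> \<Gamma> (TJEqTy (tt_act I \<sigma> C) (tt_act J \<tau> C))"
    using tt_meta.hyps(6)[OF tt_meta.prems] by blast+
  have C: "tt_der \<Sigma> T \<Theta> \<Gamma> (TJEqTy (tt_subst (tt_vec ?us) (tt_act I TFree C))
      (tt_subst (tt_vec ?vs) (tt_act J TFree C)))" if "\<beta> = TBTm C" for C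
    using IHb(2)[of "tt_subst (tt_vec ts) C"] aI(2) aJ(2) that by simp
  have "tt_der \<Sigma> T \<Theta> \<Gamma> (tt_fill (tt_subst_bdry (tt_vec ?us) (tt_map_bdry (tt_act I TFree) \<beta>))
      (tt_act_meta I M ?us))"
    using i(4) tt_meta.hyps(1,2) tt_ext_refl[OF i(1)] us IHb(1)
    unfolding tt_meta_typed_def aI(2) by blast
  moreover have "tt_der \<Sigma> T \<Theta> \<Gamma> (tt_fill_eq (tt_subst_bdry (tt_vec ?us) (tt_map_bdry (tt_act I TFree) \<beta>))
      (tt_act_meta I M ?us) (tt_act_meta J M ?vs))" if "is_obj (tt_arity \<beta>)"
    using i(5) tt_meta.hyps(1,2) that tt_ext_refl[OF i(1)] us vs uv C
    unfolding tt_meta_equal_def by blast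
  ultimately show ?case
    using tt_meta.hyps(2) by (simp add: tt_map_fill tt_pair_fill tt_obj_fill aI(2))
next
  case (tt_meta_congr M As \<beta> ss ts \<Gamma>\<^sub>0)
  \<comment> \<open>The conclusion is an equation, so only its image under \<open>I\<close> is
    claimed, and \<open>I\<close> may be paired with itself.\<close>
  note p = tt_interp2_left[OF tt_meta_congr.prems(2)]
  note i = tt_interp2D[OF p]
  note wf = tt_der_wf[OF rules \<Theta>0]
  let ?us = "map (tt_act I \<sigma>) ss" and ?vs = "map (tt_act I \<sigma>) ts"
  have ss: "\<forall>t\<in>set ss. tt_wf \<Sigma> (tt_marity \<Theta>\<^sub>0) (fst ` set \<Gamma>\<^sub>0) 0 (Obj Tm, 0) t"
    using tt_meta_congr.hyps(4,6) wf(1)[OF _ tt_meta_congr.prems(1)] by (fastforce simp: in_set_conv_nth)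
  have ts: "\<forall>t\<in>set ts. tt_wf \<Sigma> (tt_marity \<Theta>\<^sub>0) (fst ` set \<Gamma>\<^sub>0) 0 (Obj Tm, 0) t"
    using tt_meta_congr.hyps(5,7) wf(1)[OF _ tt_meta_congr.prems(1)] by (fastforce simp: in_set_conv_nth)
  note as = tt_args_act[OF i(2) \<Theta>0 tt_meta_congr.hyps(1,4) ss]
    and at = tt_args_act[OF i(2) \<Theta>0 tt_meta_congr.hyps(1,5) ts]
  have IH: "tt_der \<Sigma> T \<Theta> \<Gamma> (tt_map_jdg (tt_act I \<sigma>) (TJTm (ss ! j) (tt_arg_bdry As ss j)))"
    "tt_der \<Sigma> T \<Theta> \<Gamma> (tt_map_jdg (tt_act I \<sigma>) (TJTm (ts ! j) (tt_arg_bdry As ts j)))"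
    "tt_der \<Sigma> T \<Theta> \<Gamma> (tt_map_jdg (tt_act I \<sigma>) (TJEqTm (ss ! j) (ts ! j) (tt_arg_bdry As ss j)))"
    if "j < length As" for j
    using tt_meta_congr.hyps(6-8) that tt_meta_congr.prems by metis+
  have us: "tt_args \<Sigma> T \<Theta> \<Gamma> (tt_act I TFree) As ?us" and vs: "tt_args \<Sigma> T \<Theta> \<Gamma> (tt_act I TFree) As ?vs"
    and uv: "tt_args_eq \<Sigma> T \<Theta> \<Gamma> (tt_act I TFree) As ?us ?vs"
    using IH tt_meta_congr.hyps(4,5) by (simp_all add: tt_args_def tt_args_eq_def as(1) at(1))
  have C: "tt_der \<Sigma> T \<Theta> \<Gamma> (TJEqTy (tt_subst (tt_vec ?us) (tt_act I TFree C))
      (tt_subst (tt_vec ?vs) (tt_act I TFree C)))" if "\<beta> = TBTm C" for C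
  proof -
    have "tt_der \<Sigma> T \<Theta> \<Gamma> (tt_map_jdg (tt_act I \<sigma>) (TJEqTy (tt_subst (tt_vec ss) C) (tt_subst (tt_vec ts) C)))"
      using tt_meta_congr.hyps(9) that tt_meta_congr.prems by metis
    then show ?thesis using as(2) at(2) that by simp
  qed
  have "tt_der \<Sigma> T \<Theta> \<Gamma> (tt_fill_eq (tt_subst_bdry (tt_vec ?us) (tt_map_bdry (tt_act I TFree) \<beta>))
      (tt_act_meta I M ?us) (tt_act_meta I M ?vs))"
    using i(5) tt_meta_congr.hyps(1-3) tt_ext_refl[OF i(1)] us vs uv C
    unfolding tt_meta_equal_def by blast
  then show ?case
    using tt_meta_congr.hyps(2,3) by (simp add: tt_map_fill_eq tt_not_obj_fill_eq as(2))
next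
  case (tt_abs \<Gamma>\<^sub>0 A a G)
  note i = tt_interp2D[OF tt_abs.prems(2)]
  note wf = tt_der_wf[OF rules \<Theta>0]
  have A: "tt_wf \<Sigma> (tt_marity \<Theta>\<^sub>0) (fst ` set \<Gamma>\<^sub>0) 0 (Obj Ty, 0) A"
    using wf(1)[OF tt_abs.hyps(1) tt_abs.prems(1)] by simp
  have \<Gamma>0a: "tt_raw_vctx \<Sigma> \<Theta>\<^sub>0 (\<Gamma>\<^sub>0 @ [(a, A)])"
    by (rule tt_raw_vctx_snoc[OF tt_abs.prems(1) A tt_abs.hyps(3)])
  have G: "tt_wf_jdg \<Sigma> (tt_marity \<Theta>\<^sub>0) (fst ` set \<Gamma>\<^sub>0) (Suc 0) G"
    using wf(1)[OF tt_abs.hyps(5) \<Gamma>0a] tt_abs.hyps(4)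
    by (auto simp: tt_vec_open intro: tt_wf_jdg_open_inv)
  have GI: "tt_fv_jdg (tt_map_jdg (tt_act I \<sigma>) G) \<subseteq> fst ` set \<Gamma>"
    by (rule tt_wf_fv_jdg[OF tt_wf_act_jdg[OF G i(2)]])
  have "finite (fst ` set \<Gamma> \<union> tt_fv_jdg (tt_pair_jdg (tt_act I \<sigma>) (tt_act J \<tau>) G))"
  proof -
    have e: "finite (tt_fv e)" for e :: "('s, 'v, 'm) tt_exp" by (induction e) auto
    have "finite (tt_fv_jdg H)" for H :: "('s, 'v, 'm) tt_jdg" by (induction H) (auto simp: e)
    then show ?thesis by simp
  qed
  then obtain b where b: "b \<notin> fst ` set \<Gamma>" "b \<notin> tt_fv_jdg (tt_pair_jdg (tt_act I \<sigma>) (tt_act J \<tau>) G)"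
    using ex_new_if_finite[OF inf] by blast
  let ?\<Gamma> = "\<Gamma> @ [(b, tt_act I \<sigma> A)]"
  \<comment> \<open>The induction hypothesis for \<open>A\<close> holds over every extension of
    \<open>\<Gamma>\<close> and is the type equation required by
    \<open>tt_interp2_bind\<close>.\<close>
  have i2: "tt_interp2 \<Sigma> T \<Theta>\<^sub>0 (\<Gamma>\<^sub>0 @ [(a, A)]) \<Theta> ?\<Gamma> I (\<sigma>(a := TFree b)) J (\<tau>(a := TFree b))"
    using tt_abs.hyps(2)[OF tt_abs.prems(1) tt_interp2_ext[OF tt_abs.prems(2)]]
    by (intro tt_interp2_bind[OF tt_abs.prems(2,1) tt_abs.hyps(3) b(1) A]) simp
  note i' = tt_interp2D[OF i2]
  have Ga: "tt_wf_jdg \<Sigma> (tt_marity \<Theta>\<^sub>0) (fst ` set (\<Gamma>\<^sub>0 @ [(a, A)])) (Suc 0) G"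
    using G by (rule tt_wf_jdg_mono) auto
  have av: "\<forall>k<Suc 0. tt_wf \<Sigma> (tt_marity \<Theta>\<^sub>0) (fst ` set (\<Gamma>\<^sub>0 @ [(a, A)])) 0 (Obj Tm, 0) (tt_vec [TFree a] k)"
    by (auto simp: tt_vec_def intro: tt_wf.intros)
  have ab: "\<forall>k<Suc 0. tt_act K (\<upsilon>(a := TFree b)) (tt_vec [TFree a] k) = tt_vec [TFree b] k" for K \<upsilon>
    by (simp add: tt_vec_def)
  have m: "tt_map_jdg (tt_act I (\<sigma>(a := TFree b))) (tt_subst_jdg (tt_vec [TFree a]) G)
      = tt_subst_jdg (tt_vec [TFree b]) (tt_map_jdg (tt_act I \<sigma>) G)"
    unfolding tt_act_subst_jdg[OF i'(2) Ga av ab] tt_act_fun_upd_jdg[OF tt_abs.hyps(4)] ..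
  have pm: "tt_pair_jdg (tt_act I (\<sigma>(a := TFree b))) (tt_act J (\<tau>(a := TFree b))) (tt_subst_jdg (tt_vec [TFree a]) G)
      = tt_subst_jdg (tt_vec [TFree b]) (tt_pair_jdg (tt_act I \<sigma>) (tt_act J \<tau>) G)" if "tt_obj_jdg G"
    unfolding tt_pair_subst_jdg[OF i'(2,3) Ga that av ab ab] tt_act_fun_upd_pair[OF tt_abs.hyps(4) that] ..
  have ob: "tt_obj_jdg (tt_subst_jdg \<theta> G) = tt_obj_jdg G" for \<theta>
    by (induction G arbitrary: \<theta>) auto
  note IH1 = tt_abs.hyps(2)[OF tt_abs.prems] and IH2 = tt_abs.hyps(6)[OF \<Gamma>0a i2]
  have "tt_der \<Sigma> T \<Theta> \<Gamma> (TJAbs (tt_act I \<sigma> A) (tt_map_jdg (tt_act I \<sigma>) G))"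
    using IH1 b(1) GI
    by (intro tt_der_tt_derb.tt_abs[of _ _ _ _ _ b, OF _ _ _ IH2[THEN conjunct1, unfolded m]]) auto
  moreover have "tt_der \<Sigma> T \<Theta> \<Gamma> (TJAbs (tt_act I \<sigma> A) (tt_pair_jdg (tt_act I \<sigma>) (tt_act J \<tau>) G))"
    if "tt_obj_jdg G"
    using IH1 b that IH2[THEN conjunct2, unfolded pm[OF that] ob]
    by (intro tt_der_tt_derb.tt_abs[of _ _ _ _ _ b]) auto
  ultimately show ?case by simp
next
  case (tt_eqty_refl \<Gamma>\<^sub>0 A)
  show ?case using tt_eqty_refl.hyps(2)[OF tt_eqty_refl.prems] by (auto intro: tt_der_tt_derb.tt_eqty_refl)
next
  case (tt_eqty_sym \<Gamma>\<^sub>0 A B)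
  show ?case using tt_eqty_sym.hyps(2)[OF tt_eqty_sym.prems] by (auto intro: tt_der_tt_derb.tt_eqty_sym)
next
  case (tt_eqty_trans \<Gamma>\<^sub>0 A B C)
  show ?case
    using tt_eqty_trans.hyps(2)[OF tt_eqty_trans.prems] tt_eqty_trans.hyps(4)[OF tt_eqty_trans.prems]
    by (auto intro: tt_der_tt_derb.tt_eqty_trans)
next
  case (tt_eqtm_refl \<Gamma>\<^sub>0 t A)
  show ?case using tt_eqtm_refl.hyps(2)[OF tt_eqtm_refl.prems] by (auto intro: tt_der_tt_derb.tt_eqtm_refl)
next
  case (tt_eqtm_sym \<Gamma>\<^sub>0 s t A)
  show ?case using tt_eqtm_sym.hyps(2)[OF tt_eqtm_sym.prems] by (auto intro: tt_der_tt_derb.tt_eqtm_sym)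
next
  case (tt_eqtm_trans \<Gamma>\<^sub>0 s t A u)
  show ?case
    using tt_eqtm_trans.hyps(2)[OF tt_eqtm_trans.prems] tt_eqtm_trans.hyps(4)[OF tt_eqtm_trans.prems]
    by (auto intro: tt_der_tt_derb.tt_eqtm_trans)
next
  case (tt_conv \<Gamma>\<^sub>0 t A B)
  show ?case
    using tt_conv.hyps(2)[OF tt_conv.prems] tt_conv.hyps(4)[OF tt_conv.prems]
    by (auto intro: tt_der_tt_derb.tt_conv tt_der_tt_derb.tt_conv_eq)
next
  case (tt_conv_eq \<Gamma>\<^sub>0 s t A B)
  show ?case
    using tt_conv_eq.hyps(2)[OF tt_conv_eq.prems] tt_conv_eq.hyps(4)[OF tt_conv_eq.prems]
    by (auto intro: tt_der_tt_derb.tt_conv_eq)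
next
  case (tt_specific \<Xi> G \<Gamma>\<^sub>0 es)
  note i = tt_interp2D[OF tt_specific.prems(2)]
  note raw = rules[rule_format, OF tt_specific.hyps(1)]
  note w = tt_specific.hyps(2)
  let ?fs = "map (tt_act I \<sigma>) es" and ?gs = "map (tt_act J \<tau>) es"
  have R: "(\<Xi>, G) \<in> T" using tt_specific.hyps(1) sub by auto
  have wI: "tt_inst_wf \<Sigma> \<Theta> \<Gamma> \<Xi> ?fs" and wJ: "tt_inst_wf \<Sigma> \<Theta> \<Gamma> \<Xi> ?gs"
    by (rule tt_inst_wf_act[OF w i(2)] tt_inst_wf_act[OF w i(3)])+
  have nthwf: "tt_wf \<Sigma> (tt_marity \<Theta>\<^sub>0) (fst ` set \<Gamma>\<^sub>0) 0 (tt_arity (tt_prem_bdry \<Xi> es k)) (es ! k)"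
    if "k < length \<Xi>" for k
    using tt_inst_wf_nth[OF w that] by simp
  have IH: "tt_der \<Sigma> T \<Theta> \<Gamma> (tt_map_jdg (tt_act I \<sigma>) (tt_fill (tt_prem_bdry \<Xi> es k) (es ! k)))"
    "tt_der \<Sigma> T \<Theta> \<Gamma> (tt_map_jdg (tt_act J \<tau>) (tt_fill (tt_prem_bdry \<Xi> es k) (es ! k)))"
    "is_obj (tt_arity (snd (\<Xi> ! k))) \<Longrightarrow> tt_der \<Sigma> T \<Theta> \<Gamma>
      (tt_pair_jdg (tt_act I \<sigma>) (tt_act J \<tau>) (tt_fill (tt_prem_bdry \<Xi> es k) (es ! k)))"
    if "k < length \<Xi>" for k
    using tt_specific.hyps(3) that tt_specific.prems tt_interp2_right[OF tt_specific.prems(2)]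
      tt_act_fill_obj[OF nthwf[OF that]] tt_prem_bdry_arity by metis+
  have prems: "\<forall>k<length \<Xi>. tt_der \<Sigma> T \<Theta> \<Gamma> (tt_fill (tt_prem_bdry \<Xi> ?fs k) (?fs ! k))"
    "\<forall>k<length \<Xi>. tt_der \<Sigma> T \<Theta> \<Gamma> (tt_fill (tt_prem_bdry \<Xi> ?gs k) (?gs ! k))"
    "\<forall>k<length \<Xi>. is_obj (tt_arity (snd (\<Xi> ! k))) \<longrightarrow>
      tt_der \<Sigma> T \<Theta> \<Gamma> (tt_fill_eq (tt_prem_bdry \<Xi> ?fs k) (?fs ! k) (?gs ! k))"
    using IH tt_inst_wf_length[OF w]
    by (simp_all add: tt_act_fill[OF nthwf] tt_act_fill_pair[OF nthwf]
        tt_act_prem_bdry[OF raw w _ i(2)] tt_act_prem_bdry[OF raw w _ i(3)])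
  note IHb = tt_specific.hyps(5)[OF tt_specific.prems, unfolded tt_act_inst_concl_bdry[OF raw w i(2)]]
  have "tt_der \<Sigma> T \<Theta> \<Gamma> (tt_map_jdg (tt_act I \<sigma>) (tt_inst_jdg (tt_mk_inst \<Xi> es) G))"
    unfolding tt_act_inst_concl[OF raw w i(2)]
    using IHb by (intro tt_der_tt_derb.tt_specific[OF R wI prems(1)]) blast
  moreover have "tt_der \<Sigma> T \<Theta> \<Gamma> (tt_pair_jdg (tt_act I \<sigma>) (tt_act J \<tau>) (tt_inst_jdg (tt_mk_inst \<Xi> es) G))"
    if ob: "tt_obj_jdg (tt_inst_jdg (tt_mk_inst \<Xi> es) G)"
  proof (cases G)
    case (TJTy A)
    show ?thesis
      using tt_congr_ty[OF R[unfolded TJTy] wI wJ prems] tt_act_inst_concl[OF raw w i(2)]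
        tt_act_inst_concl[OF raw w i(3)] TJTy by simp
  next
    case (TJTm t A)
    \<comment> \<open>The boundary of the conclusion is \<open>TBTm A\<close>; the extra clause of
      its induction hypothesis is the type premise of \<open>tt_congr_tm\<close>.\<close>
    have "tt_der \<Sigma> T \<Theta> \<Gamma> (TJEqTy (tt_inst (tt_mk_inst \<Xi> ?fs) A) (tt_inst (tt_mk_inst \<Xi> ?gs) A))"
      using IHb tt_act_inst_concl[OF raw w i(2)] tt_act_inst_concl[OF raw w i(3)] TJTm by simp
    then show ?thesis
      using tt_congr_tm[OF R[unfolded TJTm] wI wJ prems] tt_act_inst_concl[OF raw w i(2)]
        tt_act_inst_concl[OF raw w i(3)] TJTm by simp
  qed (use ob tt_raw_ruleD(2)[OF raw] in auto)
  ultimately show ?case by blast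
next
  case (tt_congr_ty \<Xi> A \<Gamma>\<^sub>0 fs gs)
  note i = tt_interp2D[OF tt_congr_ty.prems(2)]
  note raw = rules[rule_format, OF tt_congr_ty.hyps(1)]
  note wf = tt_congr_ty.hyps(2) and wg = tt_congr_ty.hyps(3)
  let ?fs = "map (tt_act I \<sigma>) fs" and ?gs = "map (tt_act I \<sigma>) gs"
  have R: "(\<Xi>, TJTy A) \<in> T" using tt_congr_ty.hyps(1) sub by auto
  have prems: "\<forall>k<length \<Xi>. tt_der \<Sigma> T \<Theta> \<Gamma> (tt_fill (tt_prem_bdry \<Xi> ?fs k) (?fs ! k))"
    "\<forall>k<length \<Xi>. tt_der \<Sigma> T \<Theta> \<Gamma> (tt_fill (tt_prem_bdry \<Xi> ?gs k) (?gs ! k))"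
    "\<forall>k<length \<Xi>. is_obj (tt_arity (snd (\<Xi> ! k))) \<longrightarrow>
      tt_der \<Sigma> T \<Theta> \<Gamma> (tt_fill_eq (tt_prem_bdry \<Xi> ?fs k) (?fs ! k) (?gs ! k))"
    using tt_congr_ty.hyps(4-6) tt_congr_ty.prems tt_congr_prems_act(1)[OF raw wf wf i(2)]
      tt_congr_prems_act(1)[OF raw wg wg i(2)] tt_congr_prems_act(2)[OF raw wf wg i(2)] by metis+
  show ?case
    using tt_der_tt_derb.tt_congr_ty[OF R tt_inst_wf_act[OF wf i(2)] tt_inst_wf_act[OF wg i(2)] prems]
      tt_act_inst_concl[OF raw wf i(2)] tt_act_inst_concl[OF raw wg i(2)] by simp
next
  case (tt_congr_tm \<Xi> t A \<Gamma>\<^sub>0 fs gs)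
  note i = tt_interp2D[OF tt_congr_tm.prems(2)]
  note raw = rules[rule_format, OF tt_congr_tm.hyps(1)]
  note wf = tt_congr_tm.hyps(2) and wg = tt_congr_tm.hyps(3)
  let ?fs = "map (tt_act I \<sigma>) fs" and ?gs = "map (tt_act I \<sigma>) gs"
  have R: "(\<Xi>, TJTm t A) \<in> T" using tt_congr_tm.hyps(1) sub by auto
  have prems: "\<forall>k<length \<Xi>. tt_der \<Sigma> T \<Theta> \<Gamma> (tt_fill (tt_prem_bdry \<Xi> ?fs k) (?fs ! k))"
    "\<forall>k<length \<Xi>. tt_der \<Sigma> T \<Theta> \<Gamma> (tt_fill (tt_prem_bdry \<Xi> ?gs k) (?gs ! k))"
    "\<forall>k<length \<Xi>. is_obj (tt_arity (snd (\<Xi> ! k))) \<longrightarrow>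
      tt_der \<Sigma> T \<Theta> \<Gamma> (tt_fill_eq (tt_prem_bdry \<Xi> ?fs k) (?fs ! k) (?gs ! k))"
    using tt_congr_tm.hyps(4-6) tt_congr_tm.prems tt_congr_prems_act(1)[OF raw wf wf i(2)]
      tt_congr_prems_act(1)[OF raw wg wg i(2)] tt_congr_prems_act(2)[OF raw wf wg i(2)] by metis+
  have "tt_der \<Sigma> T \<Theta> \<Gamma> (TJEqTy (tt_inst (tt_mk_inst \<Xi> ?fs) A) (tt_inst (tt_mk_inst \<Xi> ?gs) A))"
    using tt_congr_tm.hyps(8)[OF tt_congr_tm.prems]
      tt_act_inst_concl[OF raw wf i(2)] tt_act_inst_concl[OF raw wg i(2)] by simp
  then show ?case
    using tt_der_tt_derb.tt_congr_tm[OF R tt_inst_wf_act[OF wf i(2)] tt_inst_wf_act[OF wg i(2)] prems]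
      tt_act_inst_concl[OF raw wf i(2)] tt_act_inst_concl[OF raw wg i(2)] by simp
next
  case (tt_bdry_ty \<Gamma>\<^sub>0)
  show ?case by (auto intro: tt_der_tt_derb.intros)
next
  case (tt_bdry_tm \<Gamma>\<^sub>0 A)
  show ?case
    using tt_bdry_tm.hyps(2)[OF tt_bdry_tm.prems] by (auto intro: tt_der_tt_derb.tt_bdry_tm)
next
  case (tt_bdry_eqty \<Gamma>\<^sub>0 A B)
  show ?case
    using tt_bdry_eqty.hyps(2)[OF tt_bdry_eqty.prems] tt_bdry_eqty.hyps(4)[OF tt_bdry_eqty.prems]
    by (auto intro: tt_der_tt_derb.tt_bdry_eqty)
next
  case (tt_bdry_eqtm \<Gamma>\<^sub>0 A s t)
  show ?case
    using tt_bdry_eqtm.hyps(2)[OF tt_bdry_eqtm.prems] tt_bdry_eqtm.hyps(4)[OF tt_bdry_eqtm.prems]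
      tt_bdry_eqtm.hyps(6)[OF tt_bdry_eqtm.prems]
    by (auto intro: tt_der_tt_derb.tt_bdry_eqtm)
next
  case (tt_bdry_abs \<Gamma>\<^sub>0 A a G)
  note i = tt_interp2D[OF tt_bdry_abs.prems(2)]
  note wf = tt_der_wf[OF rules \<Theta>0]
  have A: "tt_wf \<Sigma> (tt_marity \<Theta>\<^sub>0) (fst ` set \<Gamma>\<^sub>0) 0 (Obj Ty, 0) A"
    using wf(1)[OF tt_bdry_abs.hyps(1) tt_bdry_abs.prems(1)] by simp
  have \<Gamma>0a: "tt_raw_vctx \<Sigma> \<Theta>\<^sub>0 (\<Gamma>\<^sub>0 @ [(a, A)])"
    by (rule tt_raw_vctx_snoc[OF tt_bdry_abs.prems(1) A tt_bdry_abs.hyps(3)])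
  have G: "tt_wf_bdry \<Sigma> (tt_marity \<Theta>\<^sub>0) (fst ` set \<Gamma>\<^sub>0) (Suc 0) G"
    using wf(2)[OF tt_bdry_abs.hyps(5) \<Gamma>0a] tt_bdry_abs.hyps(4)
    by (auto simp: tt_vec_open intro: tt_wf_bdry_open_inv)
  have GI: "tt_fv_bdry (tt_map_bdry (tt_act I \<sigma>) G) \<subseteq> fst ` set \<Gamma>"
    by (rule tt_wf_fv_bdry[OF tt_wf_act_bdry[OF G i(2)]])
  obtain b where b: "b \<notin> fst ` set \<Gamma>"
    using ex_new_if_finite[OF inf, of "fst ` set \<Gamma>"] by auto
  let ?\<Gamma> = "\<Gamma> @ [(b, tt_act I \<sigma> A)]"
  \<comment> \<open>For an abstracted boundary only the image under \<open>I\<close> is claimed, so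
    \<open>I\<close> is paired with itself and the equation for \<open>A\<close> is
    reflexivity.\<close>
  have i2: "tt_interp2 \<Sigma> T \<Theta>\<^sub>0 (\<Gamma>\<^sub>0 @ [(a, A)]) \<Theta> ?\<Gamma> I (\<sigma>(a := TFree b)) I (\<sigma>(a := TFree b))"
    using tt_bdry_abs.hyps(2)[OF tt_bdry_abs.prems(1) tt_interp2_ext[OF tt_bdry_abs.prems(2)]]
    by (intro tt_interp2_bind[OF tt_interp2_left[OF tt_bdry_abs.prems(2)] tt_bdry_abs.prems(1)
          tt_bdry_abs.hyps(3) b A] tt_eqty_refl) simp
  note i' = tt_interp2D[OF i2]
  have Ga: "tt_wf_bdry \<Sigma> (tt_marity \<Theta>\<^sub>0) (fst ` set (\<Gamma>\<^sub>0 @ [(a, A)])) (Suc 0) G"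
    using G by (rule tt_wf_bdry_mono) auto
  have av: "\<forall>k<Suc 0. tt_wf \<Sigma> (tt_marity \<Theta>\<^sub>0) (fst ` set (\<Gamma>\<^sub>0 @ [(a, A)])) 0 (Obj Tm, 0) (tt_vec [TFree a] k)"
    by (auto simp: tt_vec_def intro: tt_wf.intros)
  have ab: "\<forall>k<Suc 0. tt_act K (\<upsilon>(a := TFree b)) (tt_vec [TFree a] k) = tt_vec [TFree b] k" for K \<upsilon>
    by (simp add: tt_vec_def)
  have m: "tt_map_bdry (tt_act I (\<sigma>(a := TFree b))) (tt_subst_bdry (tt_vec [TFree a]) G)
      = tt_subst_bdry (tt_vec [TFree b]) (tt_map_bdry (tt_act I \<sigma>) G)"
    unfolding tt_act_subst_bdry[OF i'(2) Ga av ab] tt_act_fun_upd_bdry[OF tt_bdry_abs.hyps(4)] ..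
  show ?case
    using tt_bdry_abs.hyps(2)[OF tt_bdry_abs.prems] b GI
    by (auto intro!: tt_der_tt_derb.tt_bdry_abs[of _ _ _ _ _ b,
          OF _ _ _ tt_bdry_abs.hyps(6)[OF \<Gamma>0a i2, THEN conjunct1, unfolded m]])
qed

section \<open>Weakening, iterated substitution and equal instantiations\<close>

lemma tt_marity_mono: "map_of \<Theta>\<^sub>0 \<subseteq>\<^sub>m map_of \<Theta> \<Longrightarrow> tt_marity \<Theta>\<^sub>0 \<subseteq>\<^sub>m tt_marity \<Theta>"
  by (auto simp: map_le_def tt_marity_def dom_def)

text \<open>For the identity the requirement is the rule \<open>tt_meta\<close> itself. The boundary
  premise inside \<open>tt_meta_typed\<close> is there for this case.\<close>

lemma tt_meta_typed_empty:
  assumes "map_of \<Theta>\<^sub>0 \<subseteq>\<^sub>m map_of \<Theta>"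
  shows "tt_meta_typed \<Sigma> T \<Theta>\<^sub>0 \<Theta> \<Gamma> Map.empty"
  unfolding tt_meta_typed_def tt_args_def tt_act_meta_def
proof (simp add: tt_map_bdry_ident, intro allI impI)
  fix M As \<beta> \<Gamma>' us
  assume *: "map_of \<Theta>\<^sub>0 M = Some (foldr TBAbs As \<beta>)" "\<not> tt_is_abs_bdry \<beta>"
    "length us = length As \<and>
      (\<forall>j<length As. tt_der \<Sigma> T \<Theta> \<Gamma>' (TJTm (us ! j) (tt_subst (tt_vec (take j us)) (As ! j))))"
    "tt_derb \<Sigma> T \<Theta> \<Gamma>' (tt_subst_bdry (tt_vec us) \<beta>)"
  have "map_of \<Theta> M = Some (foldr TBAbs As \<beta>)" using assms *(1) by (auto simp: map_le_def dom_def)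
  then show "tt_der \<Sigma> T \<Theta> \<Gamma>' (tt_fill (tt_subst_bdry (tt_vec us) \<beta>) (TMeta M us))"
    using * by - (rule tt_meta[of \<Theta> M As], simp_all add: tt_arg_bdry_def)
qed

lemma tt_meta_equal_empty:
  assumes "map_of \<Theta>\<^sub>0 \<subseteq>\<^sub>m map_of \<Theta>"
  shows "tt_meta_equal \<Sigma> T \<Theta>\<^sub>0 \<Theta> \<Gamma> Map.empty Map.empty"
  unfolding tt_meta_equal_def tt_args_def tt_args_eq_def tt_act_meta_def
proof (simp add: tt_map_bdry_ident, intro allI impI)
  fix M As \<beta> \<Gamma>' us vs
  assume *: "map_of \<Theta>\<^sub>0 M = Some (foldr TBAbs As \<beta>)" "\<not> tt_is_abs_bdry \<beta>" "is_obj (tt_arity \<beta>)"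
    "length us = length As \<and>
      (\<forall>j<length As. tt_der \<Sigma> T \<Theta> \<Gamma>' (TJTm (us ! j) (tt_subst (tt_vec (take j us)) (As ! j))))"
    "length vs = length As \<and>
      (\<forall>j<length As. tt_der \<Sigma> T \<Theta> \<Gamma>' (TJTm (vs ! j) (tt_subst (tt_vec (take j vs)) (As ! j))))"
    "\<forall>j<length As. tt_der \<Sigma> T \<Theta> \<Gamma>' (TJEqTm (us ! j) (vs ! j) (tt_subst (tt_vec (take j us)) (As ! j)))"
    "\<forall>C. \<beta> = TBTm C \<longrightarrow> tt_der \<Sigma> T \<Theta> \<Gamma>' (TJEqTy (tt_subst (tt_vec us) C) (tt_subst (tt_vec vs) C))"
  have "map_of \<Theta> M = Some (foldr TBAbs As \<beta>)" using assms *(1) by (auto simp: map_le_def dom_def)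
  then show "tt_der \<Sigma> T \<Theta> \<Gamma>'
      (tt_fill_eq (tt_subst_bdry (tt_vec us) \<beta>) (TMeta M us) (TMeta M vs))"
    using * by - (rule tt_meta_congr[of \<Theta> M As], simp_all add: tt_arg_bdry_def)
qed

lemma tt_interp_id:
  assumes "tt_ext \<Sigma> \<Theta> \<Gamma> \<Gamma>'" "map_of \<Theta>\<^sub>0 \<subseteq>\<^sub>m map_of \<Theta>"
  shows "tt_interp \<Sigma> T \<Theta>\<^sub>0 \<Gamma> \<Theta> \<Gamma>' Map.empty TFree"
proof -
  have "tt_raw_vctx \<Sigma> \<Theta> \<Gamma>'" using assms(1) by (simp add: tt_ext_def)
  moreover have "tt_act_ok \<Sigma> (tt_marity \<Theta>\<^sub>0) (fst ` set \<Gamma>) (tt_marity \<Theta>) (fst ` set \<Gamma>') Map.empty TFree"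
    unfolding tt_act_ok_def
  proof (intro conjI ballI allI impI)
    show "tt_wf \<Sigma> (tt_marity \<Theta>) (fst ` set \<Gamma>') 0 (Obj Tm, 0) (TFree a)" if "a \<in> fst ` set \<Gamma>" for a
      using tt_ext_dom[OF assms(1)] that by (intro tt_wf_free) auto
    show "case Map.empty M of None \<Rightarrow> tt_marity \<Theta> M = Some ar
        | Some f \<Rightarrow> tt_wf \<Sigma> (tt_marity \<Theta>) (fst ` set \<Gamma>') 0 ar f"
      if "tt_marity \<Theta>\<^sub>0 M = Some ar" for M ar
      using tt_marity_mono[OF assms(2)] that by (auto simp: map_le_def dom_def)
  qed
  moreover have "tt_var_typed \<Sigma> T \<Gamma> \<Theta> \<Gamma>' Map.empty TFree"
    unfolding tt_var_typed_def tt_act_id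
    by (intro allI impI, rule tt_var, erule (1) tt_ext_lookup[OF tt_ext_trans[OF assms(1)]])
  ultimately show ?thesis
    using tt_meta_typed_empty[OF assms(2)] tt_meta_equal_empty[OF assms(2)]
    by (simp add: tt_interp_def)
qed

text \<open>Theory, metavariable context and variable context grow together, since the identity is
  an interpretation into any larger target.\<close>

lemma tt_der_weaken:
  fixes T :: "('s, 'v, 'm) tt_rule set"
  assumes "infinite (UNIV :: 'v set)" "T\<^sub>0 \<subseteq> T" "\<forall>R\<in>T\<^sub>0. tt_raw_rule \<Sigma> R"
    "tt_raw_mctx \<Sigma> \<Theta>\<^sub>0" "map_of \<Theta>\<^sub>0 \<subseteq>\<^sub>m map_of \<Theta>" "tt_raw_vctx \<Sigma> \<Theta>\<^sub>0 \<Gamma>" "tt_ext \<Sigma> \<Theta> \<Gamma> \<Gamma>'"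
    "tt_der \<Sigma> T\<^sub>0 \<Theta>\<^sub>0 \<Gamma> G"
  shows "tt_der \<Sigma> T \<Theta> \<Gamma>' G"
  using tt_der_act(1)[OF assms(1-4,8,6) tt_interp_refl[OF tt_interp_id[OF assms(7,5)]]]
  by (simp add: tt_map_jdg_ident)

lemma tt_derb_weaken:
  fixes T :: "('s, 'v, 'm) tt_rule set"
  assumes "infinite (UNIV :: 'v set)" "T\<^sub>0 \<subseteq> T" "\<forall>R\<in>T\<^sub>0. tt_raw_rule \<Sigma> R"
    "tt_raw_mctx \<Sigma> \<Theta>\<^sub>0" "map_of \<Theta>\<^sub>0 \<subseteq>\<^sub>m map_of \<Theta>" "tt_raw_vctx \<Sigma> \<Theta>\<^sub>0 \<Gamma>" "tt_ext \<Sigma> \<Theta> \<Gamma> \<Gamma>'"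
    "tt_derb \<Sigma> T\<^sub>0 \<Theta>\<^sub>0 \<Gamma> B"
  shows "tt_derb \<Sigma> T \<Theta> \<Gamma>' B"
  using tt_der_act(2)[OF assms(1-4,8,6) tt_interp_refl[OF tt_interp_id[OF assms(7,5)]]]
  by (simp add: tt_map_bdry_ident)

section \<open>Opening abstractions and substituting equal arguments\<close>

lemma tt_fill_not_abs: "\<not> tt_is_abs_bdry B \<Longrightarrow> tt_fill B e \<noteq> TJAbs A G"
  by (cases B) auto

lemma tt_fill_eq_not_abs: "\<not> tt_is_abs_bdry B \<Longrightarrow> is_obj (tt_arity B) \<Longrightarrow> tt_fill_eq B e f \<noteq> TJAbs A G"
  by (cases B) (auto simp: is_obj_def)

text \<open>Only \<open>tt_abs\<close> can conclude an abstracted judgement: the metavariable rules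
  fill non-abstracted boundaries, and raw rules have non-abstracted conclusions.\<close>

lemma tt_der_abs_inv:
  assumes "tt_der \<Sigma> T \<Theta> \<Gamma> (TJAbs A G)" "\<forall>R\<in>T. tt_raw_rule \<Sigma> R"
  obtains a where "tt_der \<Sigma> T \<Theta> \<Gamma> (TJTy A)" "a \<notin> fst ` set \<Gamma>"
    "tt_der \<Sigma> T \<Theta> (\<Gamma> @ [(a, A)]) (tt_subst_jdg (tt_vec [TFree a]) G)"
  using assms(1)
proof (cases rule: tt_der.cases)
  case (tt_meta M As \<beta> ts)
  then have False using tt_fill_not_abs[of "tt_subst_bdry (tt_vec ts) \<beta>"] by (metis tt_is_abs_subst)
  then show ?thesis ..
next
  case (tt_meta_congr M As \<beta> ss ts)
  then have False
    using tt_fill_eq_not_abs[of "tt_subst_bdry (tt_vec ss) \<beta>"] by (metis tt_is_abs_subst tt_arity_subst)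
  then show ?thesis ..
next
  case (tt_specific \<Xi> J es)
  then have "\<not> tt_is_abs_jdg J" using assms(2) tt_raw_ruleD(2) by blast
  then have False using tt_specific(1) by (cases J) auto
  then show ?thesis ..
qed (auto intro: that)

lemma tt_act_subst_vars:
  assumes "tt_act_ok \<Sigma> \<mu> V \<mu>' V' I \<sigma>" "tt_wf \<Sigma> \<mu> V\<^sub>0 (length xs) ar e" "V\<^sub>0 \<subseteq> V" "set xs \<subseteq> V"
    "\<forall>c\<in>V\<^sub>0. \<sigma> c = \<sigma>\<^sub>0 c" "map \<sigma> xs = pu"
  shows "tt_act I \<sigma> (tt_subst (tt_vec (map TFree xs)) e) = tt_subst (tt_vec pu) (tt_act I \<sigma>\<^sub>0 e)"
proof -
  have e: "tt_wf \<Sigma> \<mu> V (length xs) ar e" using assms(2,3) by (auto elim: tt_wf_mono)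
  have xs: "\<forall>i<length xs. tt_wf \<Sigma> \<mu> V 0 (Obj Tm, 0) (tt_vec (map TFree xs) i)"
    using assms(4) by (auto intro!: tt_wf_vec tt_wf.intros)
  have "\<forall>i<length xs. tt_act I \<sigma> (tt_vec (map TFree xs) i) = tt_vec pu i"
    using assms(6) by (auto simp: tt_vec_def rev_nth)
  from tt_act_subst'[OF e assms(1) xs this] show ?thesis
    using tt_act_cong[OF assms(2,5), of I I] by simp
qed

text \<open>Inverting the abstractions one by one gives names \<open>ys\<close> to the bound
  variables; the interpretations are extended by sending these to \<open>us\<close> and
  \<open>vs\<close>. In the induction, \<open>xs\<close> with values \<open>pu\<close> and
  \<open>pv\<close> is the part of the telescope already opened. \<open>V\<^sub>0\<close>,
  \<open>\<sigma>\<^sub>0\<close> and \<open>\<tau>\<^sub>0\<close> record the original variables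
  and their values, which the extensions must not change.\<close>

lemma tt_interp_args:
  fixes T :: "('s, 'v, 'm) tt_rule set"
  assumes inf: "infinite (UNIV :: 'v set)" and sub: "T\<^sub>0 \<subseteq> T"
    and rules: "\<forall>R\<in>T. tt_raw_rule \<Sigma> R" and \<Theta>0: "tt_raw_mctx \<Sigma> \<Theta>\<^sub>0" and \<Theta>: "tt_raw_mctx \<Sigma> \<Theta>"
  shows "tt_der \<Sigma> T\<^sub>0 \<Theta>\<^sub>0 \<Gamma>\<^sub>0 (tt_subst_jdg (tt_vec (map TFree xs)) (foldr TJAbs As G)) \<Longrightarrow>
    tt_raw_vctx \<Sigma> \<Theta>\<^sub>0 \<Gamma>\<^sub>0 \<Longrightarrow> tt_interp2 \<Sigma> T \<Theta>\<^sub>0 \<Gamma>\<^sub>0 \<Theta> \<Gamma> I \<sigma> J \<tau> \<Longrightarrow>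
    V\<^sub>0 \<subseteq> fst ` set \<Gamma>\<^sub>0 \<Longrightarrow> set xs \<subseteq> fst ` set \<Gamma>\<^sub>0 \<Longrightarrow>
    \<forall>j<length As. tt_wf \<Sigma> (tt_marity \<Theta>\<^sub>0) V\<^sub>0 (length xs + j) (Obj Ty, 0) (As ! j) \<Longrightarrow>
    \<forall>c\<in>V\<^sub>0. \<sigma> c = \<sigma>\<^sub>0 c \<Longrightarrow> \<forall>c\<in>V\<^sub>0. \<tau> c = \<tau>\<^sub>0 c \<Longrightarrow> map \<sigma> xs = pu \<Longrightarrow> map \<tau> xs = pv \<Longrightarrow>
    length us = length As \<Longrightarrow> length vs = length As \<Longrightarrow>
    \<forall>j<length As. tt_der \<Sigma> T \<Theta> \<Gamma> (TJTm (us ! j) (tt_subst (tt_vec (pu @ take j us)) (tt_act I \<sigma>\<^sub>0 (As ! j)))) \<Longrightarrow>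
    \<forall>j<length As. tt_der \<Sigma> T \<Theta> \<Gamma> (TJTm (vs ! j) (tt_subst (tt_vec (pv @ take j vs)) (tt_act J \<tau>\<^sub>0 (As ! j)))) \<Longrightarrow>
    \<forall>j<length As. tt_der \<Sigma> T \<Theta> \<Gamma>
      (TJEqTm (us ! j) (vs ! j) (tt_subst (tt_vec (pu @ take j us)) (tt_act I \<sigma>\<^sub>0 (As ! j)))) \<Longrightarrow>
    \<exists>\<Gamma>\<^sub>1 \<sigma>\<^sub>1 \<tau>\<^sub>1 ys. tt_der \<Sigma> T\<^sub>0 \<Theta>\<^sub>0 \<Gamma>\<^sub>1 (tt_subst_jdg (tt_vec (map TFree ys)) G) \<and>
      tt_raw_vctx \<Sigma> \<Theta>\<^sub>0 \<Gamma>\<^sub>1 \<and> tt_interp2 \<Sigma> T \<Theta>\<^sub>0 \<Gamma>\<^sub>1 \<Theta> \<Gamma> I \<sigma>\<^sub>1 J \<tau>\<^sub>1 \<and>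
      V\<^sub>0 \<subseteq> fst ` set \<Gamma>\<^sub>1 \<and> set ys \<subseteq> fst ` set \<Gamma>\<^sub>1 \<and>
      (\<forall>c\<in>V\<^sub>0. \<sigma>\<^sub>1 c = \<sigma>\<^sub>0 c) \<and> (\<forall>c\<in>V\<^sub>0. \<tau>\<^sub>1 c = \<tau>\<^sub>0 c) \<and>
      map \<sigma>\<^sub>1 ys = pu @ us \<and> map \<tau>\<^sub>1 ys = pv @ vs"
proof (induction As arbitrary: \<Gamma>\<^sub>0 xs \<sigma> \<tau> pu pv us vs)
  case Nil
  then show ?case
    by (intro exI[of _ \<Gamma>\<^sub>0] exI[of _ \<sigma>] exI[of _ \<tau>] exI[of _ xs]) simp
next
  case (Cons A As)
  note prems = Cons.prems
  have rules0: "\<forall>R\<in>T\<^sub>0. tt_raw_rule \<Sigma> R" using rules sub by auto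
  note i = tt_interp2D[OF prems(3)]
  let ?A = "tt_subst (tt_vec (map TFree xs)) A"
  obtain a where a: "tt_der \<Sigma> T\<^sub>0 \<Theta>\<^sub>0 \<Gamma>\<^sub>0 (TJTy ?A)" "a \<notin> fst ` set \<Gamma>\<^sub>0"
    "tt_der \<Sigma> T\<^sub>0 \<Theta>\<^sub>0 (\<Gamma>\<^sub>0 @ [(a, ?A)]) (tt_subst_jdg (tt_vec [TFree a])
      (tt_subst_jdg (tt_up (tt_vec (map TFree xs))) (foldr TJAbs As G)))"
    by (rule tt_der_abs_inv[OF prems(1)[simplified] rules0])
  have Awf: "tt_wf \<Sigma> (tt_marity \<Theta>\<^sub>0) (fst ` set \<Gamma>\<^sub>0) 0 (Obj Ty, 0) ?A"
    using tt_der_wf(1)[OF rules0 \<Theta>0 a(1) prems(2)] by simp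
  have A: "tt_wf \<Sigma> (tt_marity \<Theta>\<^sub>0) V\<^sub>0 (length xs) (Obj Ty, 0) A" using prems(6)[rule_format, of 0] by simp
  obtain u us' where us: "us = u # us'" "length us' = length As" using prems(11) by (cases us) auto
  obtain v vs' where vs: "vs = v # vs'" "length vs' = length As" using prems(12) by (cases vs) auto
  have AI: "tt_act I \<sigma> ?A = tt_subst (tt_vec pu) (tt_act I \<sigma>\<^sub>0 A)"
    by (rule tt_act_subst_vars[OF i(2) A prems(4,5,7,9)])
  have AJ: "tt_act J \<tau> ?A = tt_subst (tt_vec pv) (tt_act J \<tau>\<^sub>0 A)"
    by (rule tt_act_subst_vars[OF i(3) A prems(4,5,8,10)])
  have u: "tt_der \<Sigma> T \<Theta> \<Gamma> (TJTm u (tt_act I \<sigma> ?A))" and v: "tt_der \<Sigma> T \<Theta> \<Gamma> (TJTm v (tt_act J \<tau> ?A))"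
    and uv: "tt_der \<Sigma> T \<Theta> \<Gamma> (TJEqTm u v (tt_act I \<sigma> ?A))"
    using prems(13-15)[rule_format, of 0] by (simp_all add: us vs AI AJ)
  have uwf: "tt_wf \<Sigma> (tt_marity \<Theta>) (fst ` set \<Gamma>) 0 (Obj Tm, 0) u"
    and vwf: "tt_wf \<Sigma> (tt_marity \<Theta>) (fst ` set \<Gamma>) 0 (Obj Tm, 0) v"
    using tt_der_wf(1)[OF rules \<Theta> u i(1)] tt_der_wf(1)[OF rules \<Theta> v i(1)] by simp_all
  \<comment> \<open>The given typings of the arguments hold over \<open>\<Gamma>\<close> only; by
    weakening they hold over all its extensions, as \<open>tt_interp2_snoc\<close> demands.\<close>
  note weaken = tt_der_weaken[OF inf order.refl rules \<Theta> map_le_refl i(1)]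
  have i2: "tt_interp2 \<Sigma> T \<Theta>\<^sub>0 (\<Gamma>\<^sub>0 @ [(a, ?A)]) \<Theta> \<Gamma> I (\<sigma>(a := u)) J (\<tau>(a := v))"
    by (rule tt_interp2_snoc[OF prems(3,2) a(2) tt_ext_refl[OF i(1)] Awf uwf vwf])
      (erule weaken, rule u v uv)+
  have der: "tt_der \<Sigma> T\<^sub>0 \<Theta>\<^sub>0 (\<Gamma>\<^sub>0 @ [(a, ?A)])
      (tt_subst_jdg (tt_vec (map TFree (xs @ [a]))) (foldr TJAbs As G))"
    using a(3) by (simp add: tt_subst_jdg_subst tt_vec_snoc)
  have fresh: "a \<notin> V\<^sub>0" "a \<notin> set xs" using a(2) prems(4,5) by auto
  have map_upd: "map (\<sigma>(a := u)) (xs @ [a]) = pu @ [u]" "map (\<tau>(a := v)) (xs @ [a]) = pv @ [v]"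
    using prems(9,10) fresh by auto
  have "\<exists>\<Gamma>\<^sub>1 \<sigma>\<^sub>1 \<tau>\<^sub>1 ys. tt_der \<Sigma> T\<^sub>0 \<Theta>\<^sub>0 \<Gamma>\<^sub>1 (tt_subst_jdg (tt_vec (map TFree ys)) G) \<and>
      tt_raw_vctx \<Sigma> \<Theta>\<^sub>0 \<Gamma>\<^sub>1 \<and> tt_interp2 \<Sigma> T \<Theta>\<^sub>0 \<Gamma>\<^sub>1 \<Theta> \<Gamma> I \<sigma>\<^sub>1 J \<tau>\<^sub>1 \<and>
      V\<^sub>0 \<subseteq> fst ` set \<Gamma>\<^sub>1 \<and> set ys \<subseteq> fst ` set \<Gamma>\<^sub>1 \<and>
      (\<forall>c\<in>V\<^sub>0. \<sigma>\<^sub>1 c = \<sigma>\<^sub>0 c) \<and> (\<forall>c\<in>V\<^sub>0. \<tau>\<^sub>1 c = \<tau>\<^sub>0 c) \<and>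
      map \<sigma>\<^sub>1 ys = (pu @ [u]) @ us' \<and> map \<tau>\<^sub>1 ys = (pv @ [v]) @ vs'"
  proof (rule Cons.IH[OF der tt_raw_vctx_snoc[OF prems(2) Awf a(2)] i2 _ _ _ _ _ map_upd us(2) vs(2)])
    show "V\<^sub>0 \<subseteq> fst ` set (\<Gamma>\<^sub>0 @ [(a, ?A)])" "set (xs @ [a]) \<subseteq> fst ` set (\<Gamma>\<^sub>0 @ [(a, ?A)])"
      using prems(4,5) by auto
    show "\<forall>j<length As. tt_wf \<Sigma> (tt_marity \<Theta>\<^sub>0) V\<^sub>0 (length (xs @ [a]) + j) (Obj Ty, 0) (As ! j)"
      using prems(6)[rule_format, of "Suc _"] by simp
    show "\<forall>c\<in>V\<^sub>0. (\<sigma>(a := u)) c = \<sigma>\<^sub>0 c" "\<forall>c\<in>V\<^sub>0. (\<tau>(a := v)) c = \<tau>\<^sub>0 c"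
      using prems(7,8) fresh by auto
    show "\<forall>j<length As. tt_der \<Sigma> T \<Theta> \<Gamma>
        (TJTm (us' ! j) (tt_subst (tt_vec ((pu @ [u]) @ take j us')) (tt_act I \<sigma>\<^sub>0 (As ! j))))"
      "\<forall>j<length As. tt_der \<Sigma> T \<Theta> \<Gamma>
        (TJTm (vs' ! j) (tt_subst (tt_vec ((pv @ [v]) @ take j vs')) (tt_act J \<tau>\<^sub>0 (As ! j))))"
      "\<forall>j<length As. tt_der \<Sigma> T \<Theta> \<Gamma>
        (TJEqTm (us' ! j) (vs' ! j) (tt_subst (tt_vec ((pu @ [u]) @ take j us')) (tt_act I \<sigma>\<^sub>0 (As ! j))))"
      using prems(13-15)[rule_format, of "Suc _"] by (simp_all add: us vs)
  qed
  then show ?case by (simp add: us vs)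
qed

lemma tt_wf_jdg_foldr:
  "tt_wf_jdg \<Sigma> \<mu> V k (foldr TJAbs As G) \<longleftrightarrow>
   (\<forall>j<length As. tt_wf \<Sigma> \<mu> V (k + j) (Obj Ty, 0) (As ! j)) \<and> tt_wf_jdg \<Sigma> \<mu> V (k + length As) G"
  by (induction As arbitrary: k) (auto simp: All_less_Suc2)

text \<open>After all abstractions are opened, \<open>tt_der_act\<close> applies to the body over
  the enlarged source context. Since the opening variables have the values \<open>us\<close> and
  \<open>vs\<close>, its two conclusions are the substituted judgement and the equation between the
  two substituted versions.\<close>

lemma tt_der_args:
  fixes T :: "('s, 'v, 'm) tt_rule set"
  assumes inf: "infinite (UNIV :: 'v set)" and sub: "T\<^sub>0 \<subseteq> T"
    and rules: "\<forall>R\<in>T. tt_raw_rule \<Sigma> R" and \<Theta>0: "tt_raw_mctx \<Sigma> \<Theta>\<^sub>0" and \<Theta>: "tt_raw_mctx \<Sigma> \<Theta>"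
    and der: "tt_der \<Sigma> T\<^sub>0 \<Theta>\<^sub>0 \<Gamma>\<^sub>0 (foldr TJAbs As G)" and \<Gamma>0: "tt_raw_vctx \<Sigma> \<Theta>\<^sub>0 \<Gamma>\<^sub>0"
    and i2: "tt_interp2 \<Sigma> T \<Theta>\<^sub>0 \<Gamma>\<^sub>0 \<Theta> \<Gamma> I \<sigma> J \<tau>"
    and us: "tt_args \<Sigma> T \<Theta> \<Gamma> (tt_act I \<sigma>) As us" and vs: "tt_args \<Sigma> T \<Theta> \<Gamma> (tt_act J \<tau>) As vs"
    and uv: "tt_args_eq \<Sigma> T \<Theta> \<Gamma> (tt_act I \<sigma>) As us vs"
    and nabs: "\<not> tt_is_abs_jdg G"
  shows "tt_der \<Sigma> T \<Theta> \<Gamma> (tt_subst_jdg (tt_vec us) (tt_map_jdg (tt_act I \<sigma>) G))"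
    and "tt_obj_jdg G \<Longrightarrow> tt_der \<Sigma> T \<Theta> \<Gamma> (tt_pair_jdg (\<lambda>e. tt_subst (tt_vec us) (tt_act I \<sigma> e))
      (\<lambda>e. tt_subst (tt_vec vs) (tt_act J \<tau> e)) G)"
proof -
  have rules0: "\<forall>R\<in>T\<^sub>0. tt_raw_rule \<Sigma> R" using rules sub by auto
  have wf: "\<forall>j<length As. tt_wf \<Sigma> (tt_marity \<Theta>\<^sub>0) (fst ` set \<Gamma>\<^sub>0) j (Obj Ty, 0) (As ! j)"
    "tt_wf_jdg \<Sigma> (tt_marity \<Theta>\<^sub>0) (fst ` set \<Gamma>\<^sub>0) (length As) G"
    using tt_der_wf(1)[OF rules0 \<Theta>0 der \<Gamma>0] by (simp_all add: tt_wf_jdg_foldr)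
  have "\<exists>\<Gamma>1 \<sigma>1 \<tau>1 ys. tt_der \<Sigma> T\<^sub>0 \<Theta>\<^sub>0 \<Gamma>1 (tt_subst_jdg (tt_vec (map TFree ys)) G) \<and>
      tt_raw_vctx \<Sigma> \<Theta>\<^sub>0 \<Gamma>1 \<and> tt_interp2 \<Sigma> T \<Theta>\<^sub>0 \<Gamma>1 \<Theta> \<Gamma> I \<sigma>1 J \<tau>1 \<and>
      fst ` set \<Gamma>\<^sub>0 \<subseteq> fst ` set \<Gamma>1 \<and> set ys \<subseteq> fst ` set \<Gamma>1 \<and>
      (\<forall>c\<in>fst ` set \<Gamma>\<^sub>0. \<sigma>1 c = \<sigma> c) \<and> (\<forall>c\<in>fst ` set \<Gamma>\<^sub>0. \<tau>1 c = \<tau> c) \<and>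
      map \<sigma>1 ys = [] @ us \<and> map \<tau>1 ys = [] @ vs"
    by (rule tt_interp_args[OF inf sub rules \<Theta>0 \<Theta> _ \<Gamma>0 i2, of "[]" As])
      (use der us vs uv wf in \<open>simp_all add: tt_args_def tt_args_eq_def\<close>)
  then obtain \<Gamma>1 \<sigma>1 \<tau>1 ys where 1: "tt_der \<Sigma> T\<^sub>0 \<Theta>\<^sub>0 \<Gamma>1 (tt_subst_jdg (tt_vec (map TFree ys)) G)"
    "tt_raw_vctx \<Sigma> \<Theta>\<^sub>0 \<Gamma>1" "tt_interp2 \<Sigma> T \<Theta>\<^sub>0 \<Gamma>1 \<Theta> \<Gamma> I \<sigma>1 J \<tau>1"
    "fst ` set \<Gamma>\<^sub>0 \<subseteq> fst ` set \<Gamma>1" "set ys \<subseteq> fst ` set \<Gamma>1"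
    "\<forall>c\<in>fst ` set \<Gamma>\<^sub>0. \<sigma>1 c = \<sigma> c" "\<forall>c\<in>fst ` set \<Gamma>\<^sub>0. \<tau>1 c = \<tau> c" "map \<sigma>1 ys = us" "map \<tau>1 ys = vs"
    unfolding append_Nil by blast
  note i = tt_interp2D[OF 1(3)]
  have len: "length ys = length As" using 1(8) us by (auto simp: tt_args_def)
  have eqI: "tt_act I \<sigma>1 (tt_subst (tt_vec (map TFree ys)) e) = tt_subst (tt_vec us) (tt_act I \<sigma> e)"
    and eqJ: "tt_act J \<tau>1 (tt_subst (tt_vec (map TFree ys)) e) = tt_subst (tt_vec vs) (tt_act J \<tau> e)"
    if "tt_wf \<Sigma> (tt_marity \<Theta>\<^sub>0) (fst ` set \<Gamma>\<^sub>0) (length As) ar e" for ar e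
    using tt_act_subst_vars[OF i(2) that[folded len] 1(4,5,6,8)]
      tt_act_subst_vars[OF i(3) that[folded len] 1(4,5,7,9)] by blast+
  note E = tt_der_act(1)[OF inf sub rules0 \<Theta>0 1(1,2,3)]
  note eq = eqI[of "(Obj Ty, 0)"] eqI[of "(Obj Tm, 0)"] eqJ[of "(Obj Ty, 0)"] eqJ[of "(Obj Tm, 0)"]
  show "tt_der \<Sigma> T \<Theta> \<Gamma> (tt_subst_jdg (tt_vec us) (tt_map_jdg (tt_act I \<sigma>) G))"
    using E[THEN conjunct1] wf(2) nabs by (cases G) (simp_all add: eq)
  show "tt_der \<Sigma> T \<Theta> \<Gamma> (tt_pair_jdg (\<lambda>e. tt_subst (tt_vec us) (tt_act I \<sigma> e))
      (\<lambda>e. tt_subst (tt_vec vs) (tt_act J \<tau> e)) G)" if "tt_obj_jdg G"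
    using E[THEN conjunct2] wf(2) nabs that by (cases G) (simp_all add: eq)
qed

text \<open>The type of the \<open>j\<close>-th argument of a boundary, or of its result when \<open>j\<close> is its arity,
  abstracted over the preceding arguments.\<close>

primrec tt_bdry_arg :: "('s, 'v, 'm) tt_bdry \<Rightarrow> nat \<Rightarrow> ('s, 'v, 'm) tt_jdg option" where
  "tt_bdry_arg TBTy j = None"
| "tt_bdry_arg (TBTm A) j = (if j = 0 then Some (TJTy A) else None)"
| "tt_bdry_arg (TBEqTy A B) j = None"
| "tt_bdry_arg (TBEqTm s t A) j = None"
| "tt_bdry_arg (TBAbs A B) j =
    (case j of 0 \<Rightarrow> Some (TJTy A) | Suc i \<Rightarrow> map_option (TJAbs A) (tt_bdry_arg B i))"

lemma tt_bdry_arg_subst: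
  "tt_bdry_arg B j = Some G \<Longrightarrow> tt_bdry_arg (tt_subst_bdry \<theta> B) j = Some (tt_subst_jdg \<theta> G)"
  by (induction B arbitrary: j G \<theta>) (auto split: if_splits nat.splits)

lemma tt_bdry_arg_fv: "tt_bdry_arg B j = Some G \<Longrightarrow> tt_fv_jdg G \<subseteq> tt_fv_bdry B"
proof (induction B arbitrary: j G)
  case (TBAbs A B)
  then show ?case by (cases j) (auto dest!: TBAbs.IH)
qed (auto split: if_splits)

text \<open>A derivation of a boundary already contains derivations of all the types in its
  telescope; reabstracting them gives judgements over the outer context.\<close>

lemma tt_der_bdry_arg:
  "tt_derb \<Sigma> T \<Theta> \<Gamma> B \<Longrightarrow> tt_bdry_arg B j = Some G \<Longrightarrow> tt_der \<Sigma> T \<Theta> \<Gamma> G"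
proof (induct arbitrary: j G rule: tt_der_tt_derb.inducts(2)[where ?P1.0 = "\<lambda>_ _. True"])
  case (tt_bdry_abs \<Gamma> A a B)
  show ?case
  proof (cases j)
    case 0
    then show ?thesis using tt_bdry_abs by simp
  next
    case (Suc i)
    then obtain H where H: "tt_bdry_arg B i = Some H" "G = TJAbs A H"
      using tt_bdry_abs.prems by auto
    have "tt_der \<Sigma> T \<Theta> (\<Gamma> @ [(a, A)]) (tt_subst_jdg (tt_vec [TFree a]) H)"
      by (rule tt_bdry_abs.hyps(6)[OF tt_bdry_arg_subst[OF H(1)]])
    then show ?thesis
      unfolding H(2) using tt_bdry_abs.hyps(1,3,4) tt_bdry_arg_fv[OF H(1)] by (auto intro: tt_abs)
  qed
qed (auto split: if_splits)

lemma tt_bdry_arg_foldr: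
  "j < length As \<Longrightarrow> tt_bdry_arg (foldr TBAbs As \<beta>) j = Some (foldr TJAbs (take j As) (TJTy (As ! j)))"
  "tt_bdry_arg (foldr TBAbs As (TBTm C)) (length As) = Some (foldr TJAbs As (TJTy C))"
  by (induction As arbitrary: j) (auto simp: less_Suc_eq_0_disj)

lemma tt_subst_fill:
  "\<not> tt_is_abs_bdry B \<Longrightarrow> tt_subst_jdg \<theta> (tt_fill B e) = tt_fill (tt_subst_bdry \<theta> B) (tt_subst \<theta> e)"
  by (cases B) auto

lemma tt_map_bdry_foldr: "tt_map_bdry f (foldr TBAbs As \<beta>) = foldr TBAbs (map f As) (tt_map_bdry f \<beta>)"
  by (induction As) auto

lemma tt_fill_foldr:
  "tt_wf \<Sigma> \<mu> V k (c, length As) e \<Longrightarrow>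
   tt_fill (foldr TBAbs As \<beta>) e = foldr TJAbs As (tt_fill \<beta> (tt_body e))"
proof (induction As arbitrary: k e)
  case Nil
  then show ?case by (simp add: tt_wf_body_id)
next
  case (Cons A As)
  from Cons.prems have "tt_wf \<Sigma> \<mu> V k (c, Suc (length As)) e" by simp
  then obtain f where "e = TAbs f" "tt_wf \<Sigma> \<mu> V (Suc k) (c, length As) f" by (rule tt_wf_Suc_cases)
  then show ?case using Cons.IH by simp
qed

lemma tt_fill_eq_foldr:
  "tt_wf \<Sigma> \<mu> V k (c, length As) e \<Longrightarrow> tt_wf \<Sigma> \<mu> V k (c, length As) e' \<Longrightarrow>
   tt_fill_eq (foldr TBAbs As \<beta>) e e' = foldr TJAbs As (tt_fill_eq \<beta> (tt_body e) (tt_body e'))"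
proof (induction As arbitrary: k e e')
  case Nil
  then show ?case by (simp add: tt_wf_body_id)
next
  case (Cons A As)
  from Cons.prems have "tt_wf \<Sigma> \<mu> V k (c, Suc (length As)) e" by simp
  then obtain f where "e = TAbs f" "tt_wf \<Sigma> \<mu> V (Suc k) (c, length As) f" by (rule tt_wf_Suc_cases)
  moreover from Cons.prems have "tt_wf \<Sigma> \<mu> V k (c, Suc (length As)) e'" by simp
  then obtain f' where "e' = TAbs f'" "tt_wf \<Sigma> \<mu> V (Suc k) (c, length As) f'" by (rule tt_wf_Suc_cases)
  ultimately show ?case using Cons.IH by simp
qed

lemma tt_args_take:
  "tt_args \<Sigma> T \<Theta> \<Gamma> f As us \<Longrightarrow> j \<le> length As \<Longrightarrow> tt_args \<Sigma> T \<Theta> \<Gamma> f (take j As) (take j us)"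
  by (auto simp: tt_args_def min_def)

lemma tt_args_eq_take:
  "tt_args_eq \<Sigma> T \<Theta> \<Gamma> f As us vs \<Longrightarrow> j \<le> length As \<Longrightarrow>
   tt_args_eq \<Sigma> T \<Theta> \<Gamma> f (take j As) (take j us) (take j vs)"
  by (auto simp: tt_args_eq_def min_def)

text \<open>\<open>tt_der_args\<close> applied to the abstracted judgement "this entry of the
  telescope is a type", which \<open>tt_der_bdry_arg\<close> extracts from the derivable
  boundary.\<close>

lemma tt_bdry_types_equal:
  fixes T :: "('s, 'v, 'm) tt_rule set"
  assumes inf: "infinite (UNIV :: 'v set)" and sub: "T\<^sub>0 \<subseteq> T"
    and rules: "\<forall>R\<in>T. tt_raw_rule \<Sigma> R" and \<Theta>0: "tt_raw_mctx \<Sigma> \<Theta>\<^sub>0" and \<Theta>: "tt_raw_mctx \<Sigma> \<Theta>"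
    and der: "tt_derb \<Sigma> T\<^sub>0 \<Theta>\<^sub>0 [] (foldr TBAbs As \<beta>)"
    and i2: "tt_interp2 \<Sigma> T \<Theta>\<^sub>0 [] \<Theta> \<Gamma> I TFree J TFree"
  shows "j < length As \<Longrightarrow> tt_args \<Sigma> T \<Theta> \<Gamma> (tt_act I TFree) (take j As) us \<Longrightarrow>
      tt_args \<Sigma> T \<Theta> \<Gamma> (tt_act J TFree) (take j As) vs \<Longrightarrow>
      tt_args_eq \<Sigma> T \<Theta> \<Gamma> (tt_act I TFree) (take j As) us vs \<Longrightarrow>
      tt_der \<Sigma> T \<Theta> \<Gamma> (TJEqTy (tt_subst (tt_vec us) (tt_act I TFree (As ! j)))
        (tt_subst (tt_vec vs) (tt_act J TFree (As ! j))))"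
    and "\<beta> = TBTm C \<Longrightarrow> tt_args \<Sigma> T \<Theta> \<Gamma> (tt_act I TFree) As us \<Longrightarrow>
      tt_args \<Sigma> T \<Theta> \<Gamma> (tt_act J TFree) As vs \<Longrightarrow>
      tt_args_eq \<Sigma> T \<Theta> \<Gamma> (tt_act I TFree) As us vs \<Longrightarrow>
      tt_der \<Sigma> T \<Theta> \<Gamma> (TJEqTy (tt_subst (tt_vec us) (tt_act I TFree C))
        (tt_subst (tt_vec vs) (tt_act J TFree C)))"
proof -
  note D = tt_der_args(2)[OF inf sub rules \<Theta>0 \<Theta> _ tt_raw_vctx_Nil i2]
  show "tt_der \<Sigma> T \<Theta> \<Gamma> (TJEqTy (tt_subst (tt_vec us) (tt_act I TFree (As ! j)))
      (tt_subst (tt_vec vs) (tt_act J TFree (As ! j))))"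
    if "j < length As" "tt_args \<Sigma> T \<Theta> \<Gamma> (tt_act I TFree) (take j As) us"
      "tt_args \<Sigma> T \<Theta> \<Gamma> (tt_act J TFree) (take j As) vs"
      "tt_args_eq \<Sigma> T \<Theta> \<Gamma> (tt_act I TFree) (take j As) us vs"
    using D[OF tt_der_bdry_arg[OF der tt_bdry_arg_foldr(1)[OF that(1)]] that(2-4)] by simp
  show "tt_der \<Sigma> T \<Theta> \<Gamma> (TJEqTy (tt_subst (tt_vec us) (tt_act I TFree C))
      (tt_subst (tt_vec vs) (tt_act J TFree C)))"
    if "\<beta> = TBTm C" "tt_args \<Sigma> T \<Theta> \<Gamma> (tt_act I TFree) As us"
      "tt_args \<Sigma> T \<Theta> \<Gamma> (tt_act J TFree) As vs"
      "tt_args_eq \<Sigma> T \<Theta> \<Gamma> (tt_act I TFree) As us vs"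
    using D[OF tt_der_bdry_arg[OF der[unfolded that(1)] tt_bdry_arg_foldr(2)] that(2-4)] by simp
qed

text \<open>Retypes \<open>vs\<close> along \<open>I\<close>. An entry of \<open>vs\<close> has its
  \<open>J\<close>-type at \<open>vs\<close>; this equals the \<open>I\<close>-type at
  \<open>us\<close> by comparing \<open>I\<close> with \<open>J\<close>, and then the
  \<open>I\<close>-type at \<open>vs\<close> by comparing \<open>I\<close> with itself. The second
  comparison needs the earlier entries of \<open>vs\<close> to be typed along \<open>I\<close>,
  hence the induction on prefixes.\<close>

lemma tt_args_transfer:
  fixes T :: "('s, 'v, 'm) tt_rule set"
  assumes inf: "infinite (UNIV :: 'v set)" and sub: "T\<^sub>0 \<subseteq> T"
    and rules: "\<forall>R\<in>T. tt_raw_rule \<Sigma> R" and \<Theta>0: "tt_raw_mctx \<Sigma> \<Theta>\<^sub>0" and \<Theta>: "tt_raw_mctx \<Sigma> \<Theta>"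
    and der: "tt_derb \<Sigma> T\<^sub>0 \<Theta>\<^sub>0 [] (foldr TBAbs As \<beta>)"
    and i2: "tt_interp2 \<Sigma> T \<Theta>\<^sub>0 [] \<Theta> \<Gamma> I TFree J TFree"
    and us: "tt_args \<Sigma> T \<Theta> \<Gamma> (tt_act I TFree) As us"
    and vs: "tt_args \<Sigma> T \<Theta> \<Gamma> (tt_act J TFree) As vs"
    and uv: "tt_args_eq \<Sigma> T \<Theta> \<Gamma> (tt_act I TFree) As us vs"
  shows "j \<le> length As \<Longrightarrow> tt_args \<Sigma> T \<Theta> \<Gamma> (tt_act I TFree) (take j As) (take j vs)"
proof (induction j)
  case 0
  then show ?case by (simp add: tt_args_def)
next
  case (Suc j)
  then have j: "j < length As" "j \<le> length As" by simp_all
  note IH = Suc.IH[OF j(2)]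
  note us' = tt_args_take[OF us j(2)] and vs' = tt_args_take[OF vs j(2)]
    and uv' = tt_args_eq_take[OF uv j(2)]
  note eq = tt_bdry_types_equal(1)[OF inf sub rules \<Theta>0 \<Theta> der]
  have "tt_der \<Sigma> T \<Theta> \<Gamma> (TJTm (vs ! j) (tt_subst (tt_vec (take j us)) (tt_act I TFree (As ! j))))"
    using vs j(1) by (intro tt_conv[OF _ tt_eqty_sym[OF eq[OF i2 j(1) us' vs' uv']]]) (simp add: tt_args_def)
  then have v: "tt_der \<Sigma> T \<Theta> \<Gamma> (TJTm (vs ! j) (tt_subst (tt_vec (take j vs)) (tt_act I TFree (As ! j))))"
    using eq[OF tt_interp2_left[OF i2] j(1) us' IH uv'] by (rule tt_conv)
  have len: "length vs = length As" using vs by (simp add: tt_args_def)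
  show ?case unfolding tt_args_def
  proof (intro conjI allI impI)
    show "length (take (Suc j) vs) = length (take (Suc j) As)" using len by simp
    fix i assume "i < length (take (Suc j) As)"
    then consider "i < j" | "i = j" by fastforce
    then show "tt_der \<Sigma> T \<Theta> \<Gamma> (TJTm (take (Suc j) vs ! i)
        (tt_subst (tt_vec (take i (take (Suc j) vs))) (tt_act I TFree (take (Suc j) As ! i))))"
      using v IH j by cases (auto simp: tt_args_def min_def)
  qed
qed

lemma tt_args_self:
  "tt_args \<Sigma> T \<Theta> \<Gamma> f As us \<Longrightarrow> tt_args_eq \<Sigma> T \<Theta> \<Gamma> f As us us"
  by (simp add: tt_args_def tt_args_eq_def tt_eqtm_refl)

lemma tt_args_map: "tt_args \<Sigma> T \<Theta> \<Gamma> f (map g As) us = tt_args \<Sigma> T \<Theta> \<Gamma> (\<lambda>e. f (g e)) As us"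
  by (auto simp: tt_args_def)

lemma tt_args_eq_map: "tt_args_eq \<Sigma> T \<Theta> \<Gamma> f (map g As) us vs = tt_args_eq \<Sigma> T \<Theta> \<Gamma> (\<lambda>e. f (g e)) As us vs"
  by (auto simp: tt_args_eq_def)

lemma tt_fill_not_abs_jdg: "\<not> tt_is_abs_bdry B \<Longrightarrow> \<not> tt_is_abs_jdg (tt_fill B e)"
  by (cases B) auto

lemma tt_fill_eq_not_abs_jdg:
  "\<not> tt_is_abs_bdry B \<Longrightarrow> is_obj (tt_arity B) \<Longrightarrow> \<not> tt_is_abs_jdg (tt_fill_eq B e f)"
  by (cases B) (auto simp: is_obj_def)

text \<open>Provides the clauses of \<open>tt_meta_typed\<close> and \<open>tt_meta_equal\<close>
  for a metavariable with values \<open>f\<close> and \<open>g\<close>. These are derivable as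
  abstractions over the target, so their bodies are filled with arguments by
  \<open>tt_der_args\<close> for the identity interpretation of the target in itself.\<close>

lemma tt_meta_inst:
  fixes T :: "('s, 'v, 'm) tt_rule set"
  assumes inf: "infinite (UNIV :: 'v set)" and sub: "T\<^sub>0 \<subseteq> T"
    and rules: "\<forall>R\<in>T. tt_raw_rule \<Sigma> R" and \<Theta>0: "tt_raw_mctx \<Sigma> \<Theta>\<^sub>0" and \<Theta>: "tt_raw_mctx \<Sigma> \<Theta>"
    and \<Gamma>: "tt_raw_vctx \<Sigma> \<Theta> \<Gamma>"
    and der: "tt_derb \<Sigma> T\<^sub>0 \<Theta>\<^sub>0 [] (foldr TBAbs As \<beta>)" and nabs: "\<not> tt_is_abs_bdry \<beta>"
    and i2: "tt_interp2 \<Sigma> T \<Theta>\<^sub>0 [] \<Theta> \<Gamma> I TFree J TFree"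
    and wff: "tt_wf \<Sigma> (tt_marity \<Theta>) (fst ` set \<Gamma>) 0 (tt_arity (foldr TBAbs As \<beta>)) f"
    and wfg: "tt_wf \<Sigma> (tt_marity \<Theta>) (fst ` set \<Gamma>) 0 (tt_arity (foldr TBAbs As \<beta>)) g"
    and f: "tt_der \<Sigma> T \<Theta> \<Gamma> (tt_fill (tt_map_bdry (tt_act I TFree) (foldr TBAbs As \<beta>)) f)"
    and fg: "is_obj (tt_arity \<beta>) \<Longrightarrow>
      tt_der \<Sigma> T \<Theta> \<Gamma> (tt_fill_eq (tt_map_bdry (tt_act I TFree) (foldr TBAbs As \<beta>)) f g)"
    and ext: "tt_ext \<Sigma> \<Theta> \<Gamma> \<Gamma>'" and us: "tt_args \<Sigma> T \<Theta> \<Gamma>' (tt_act I TFree) As us"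
  shows "tt_der \<Sigma> T \<Theta> \<Gamma>' (tt_fill (tt_subst_bdry (tt_vec us) (tt_map_bdry (tt_act I TFree) \<beta>))
      (tt_subst (tt_vec us) (tt_body f)))"
    and "is_obj (tt_arity \<beta>) \<Longrightarrow> tt_args \<Sigma> T \<Theta> \<Gamma>' (tt_act J TFree) As vs \<Longrightarrow>
      tt_args_eq \<Sigma> T \<Theta> \<Gamma>' (tt_act I TFree) As us vs \<Longrightarrow>
      tt_der \<Sigma> T \<Theta> \<Gamma>' (tt_fill_eq (tt_subst_bdry (tt_vec us) (tt_map_bdry (tt_act I TFree) \<beta>))
      (tt_subst (tt_vec us) (tt_body f)) (tt_subst (tt_vec vs) (tt_body g)))"
proof -
  let ?As = "map (tt_act I TFree) As" and ?\<beta> = "tt_map_bdry (tt_act I TFree) \<beta>"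
  obtain c where ar: "tt_arity (foldr TBAbs As \<beta>) = (c, length As)"
    using tt_arity_not_abs[OF nabs] by (simp add: tt_arity_foldr)
  note wff' = wff[unfolded ar, folded length_map[of "tt_act I TFree" As]]
  note wfg' = wfg[unfolded ar, folded length_map[of "tt_act I TFree" As]]
  have raw': "tt_raw_vctx \<Sigma> \<Theta> \<Gamma>'" using ext by (simp add: tt_ext_def)
  note weaken = tt_der_weaken[OF inf order.refl rules \<Theta> map_le_refl \<Gamma> ext]
  have f': "tt_der \<Sigma> T \<Theta> \<Gamma>' (foldr TJAbs ?As (tt_fill ?\<beta> (tt_body f)))"
    using weaken[OF f] by (simp only: tt_map_bdry_foldr tt_fill_foldr[OF wff'])
  note id = tt_interp_refl[OF tt_interp_id[OF tt_ext_refl[OF raw'] map_le_refl]]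
  have usid: "tt_args \<Sigma> T \<Theta> \<Gamma>' (tt_act Map.empty TFree) ?As us" using us by (simp add: tt_args_map)
  note D = tt_der_args[OF inf order.refl rules \<Theta> \<Theta> _ raw' id]
  show "tt_der \<Sigma> T \<Theta> \<Gamma>' (tt_fill (tt_subst_bdry (tt_vec us) ?\<beta>) (tt_subst (tt_vec us) (tt_body f)))"
    using D(1)[OF f' usid usid tt_args_self[OF usid]] nabs
    by (simp add: tt_map_jdg_ident tt_fill_not_abs_jdg tt_subst_fill)
  assume ob: "is_obj (tt_arity \<beta>)" and vs: "tt_args \<Sigma> T \<Theta> \<Gamma>' (tt_act J TFree) As vs"
    and uv: "tt_args_eq \<Sigma> T \<Theta> \<Gamma>' (tt_act I TFree) As us vs"
  note i2' = tt_interp2_ext[OF i2 ext]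
  \<comment> \<open>\<open>f\<close> has its boundary along \<open>I\<close>, so \<open>vs\<close>,
    given along \<open>J\<close>, must be retyped before being put into \<open>f\<close>.\<close>
  have vs': "tt_args \<Sigma> T \<Theta> \<Gamma>' (tt_act I TFree) As vs"
    using tt_args_transfer[OF inf sub rules \<Theta>0 \<Theta> der i2' us vs uv order.refl] vs
    by (simp add: tt_args_def)
  have vsid: "tt_args \<Sigma> T \<Theta> \<Gamma>' (tt_act Map.empty TFree) ?As vs" using vs' by (simp add: tt_args_map)
  have uvid: "tt_args_eq \<Sigma> T \<Theta> \<Gamma>' (tt_act Map.empty TFree) ?As us vs"
    using uv by (simp add: tt_args_eq_map)
  have fg': "tt_der \<Sigma> T \<Theta> \<Gamma>' (foldr TJAbs ?As (tt_fill_eq ?\<beta> (tt_body f) (tt_body g)))"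
    using weaken[OF fg[OF ob]] by (simp only: tt_map_bdry_foldr tt_fill_eq_foldr[OF wff' wfg'])
  have 1: "tt_der \<Sigma> T \<Theta> \<Gamma>' (tt_pair_jdg (\<lambda>e. tt_subst (tt_vec us) e) (\<lambda>e. tt_subst (tt_vec vs) e)
      (tt_fill ?\<beta> (tt_body f)))"
    using D(2)[OF f' usid vsid uvid] nabs ob
    by (simp add: tt_fill_not_abs_jdg tt_obj_fill)
  have 2: "tt_der \<Sigma> T \<Theta> \<Gamma>' (tt_subst_jdg (tt_vec vs) (tt_fill_eq ?\<beta> (tt_body f) (tt_body g)))"
    using D(1)[OF fg' vsid vsid tt_args_self[OF vsid]] nabs ob
    by (simp add: tt_map_jdg_ident tt_fill_eq_not_abs_jdg)
  \<comment> \<open>\<open>f us \<equiv> f vs\<close> by 1 and \<open>f vs \<equiv> g vs\<close> by 2\<close>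
  show "tt_der \<Sigma> T \<Theta> \<Gamma>' (tt_fill_eq (tt_subst_bdry (tt_vec us) ?\<beta>)
      (tt_subst (tt_vec us) (tt_body f)) (tt_subst (tt_vec vs) (tt_body g)))"
  proof (cases \<beta>)
    case TBTy
    then show ?thesis using 1 2 by (auto intro: tt_eqty_trans)
  next
    case (TBTm C)
    \<comment> \<open>The second equation lives at the type for \<open>vs\<close> and is converted
      back to the type for \<open>us\<close> before the two are composed.\<close>
    have "tt_der \<Sigma> T \<Theta> \<Gamma>' (TJEqTy (tt_subst (tt_vec us) (tt_act I TFree C))
        (tt_subst (tt_vec vs) (tt_act I TFree C)))"
      by (rule tt_bdry_types_equal(2)[OF inf sub rules \<Theta>0 \<Theta> der tt_interp2_left[OF i2'] TBTm us vs' uv])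
    from tt_conv_eq[OF _ tt_eqty_sym[OF this]] show ?thesis
      using 1 2 TBTm by (auto intro: tt_eqtm_trans)
  qed (use nabs ob in \<open>auto simp: is_obj_def\<close>)
qed

section \<open>Instantiations of rule premises as interpretations\<close>

lemma tt_meta_typed_snoc:
  assumes "M \<notin> fst ` set \<Theta>\<^sub>0" "tt_meta_typed \<Sigma> T \<Theta>\<^sub>0 \<Theta> \<Gamma> I"
    "\<And>As \<beta> \<Gamma>' us. B = foldr TBAbs As \<beta> \<Longrightarrow> \<not> tt_is_abs_bdry \<beta> \<Longrightarrow> tt_ext \<Sigma> \<Theta> \<Gamma> \<Gamma>' \<Longrightarrow>
      tt_args \<Sigma> T \<Theta> \<Gamma>' (tt_act I TFree) As us \<Longrightarrow>
      tt_der \<Sigma> T \<Theta> \<Gamma>' (tt_fill (tt_subst_bdry (tt_vec us) (tt_map_bdry (tt_act I TFree) \<beta>))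
        (tt_act_meta I M us))"
  shows "tt_meta_typed \<Sigma> T (\<Theta>\<^sub>0 @ [(M, B)]) \<Theta> \<Gamma> I"
  unfolding tt_meta_typed_def map_of_snoc[OF assms(1)]
proof (intro allI impI)
  fix N As \<beta> \<Gamma>' us
  assume *: "((map_of \<Theta>\<^sub>0)(M \<mapsto> B)) N = Some (foldr TBAbs As \<beta>)" "\<not> tt_is_abs_bdry \<beta>" "tt_ext \<Sigma> \<Theta> \<Gamma> \<Gamma>'"
    "tt_args \<Sigma> T \<Theta> \<Gamma>' (tt_act I TFree) As us"
    "tt_derb \<Sigma> T \<Theta> \<Gamma>' (tt_subst_bdry (tt_vec us) (tt_map_bdry (tt_act I TFree) \<beta>))"
  show "tt_der \<Sigma> T \<Theta> \<Gamma>' (tt_fill (tt_subst_bdry (tt_vec us) (tt_map_bdry (tt_act I TFree) \<beta>))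
      (tt_act_meta I N us))"
  proof (cases "N = M")
    case True
    then show ?thesis using * assms(3) by simp
  next
    case False
    then have "map_of \<Theta>\<^sub>0 N = Some (foldr TBAbs As \<beta>)" using *(1) by simp
    then show ?thesis using assms(2) *(2-5) unfolding tt_meta_typed_def by blast
  qed
qed

lemma tt_meta_equal_snoc:
  assumes "M \<notin> fst ` set \<Theta>\<^sub>0" "tt_meta_equal \<Sigma> T \<Theta>\<^sub>0 \<Theta> \<Gamma> I J"
    "\<And>As \<beta> \<Gamma>' us vs. B = foldr TBAbs As \<beta> \<Longrightarrow> \<not> tt_is_abs_bdry \<beta> \<Longrightarrow> is_obj (tt_arity \<beta>) \<Longrightarrow>
      tt_ext \<Sigma> \<Theta> \<Gamma> \<Gamma>' \<Longrightarrow> tt_args \<Sigma> T \<Theta> \<Gamma>' (tt_act I TFree) As us \<Longrightarrow>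
      tt_args \<Sigma> T \<Theta> \<Gamma>' (tt_act J TFree) As vs \<Longrightarrow> tt_args_eq \<Sigma> T \<Theta> \<Gamma>' (tt_act I TFree) As us vs \<Longrightarrow>
      tt_der \<Sigma> T \<Theta> \<Gamma>' (tt_fill_eq (tt_subst_bdry (tt_vec us) (tt_map_bdry (tt_act I TFree) \<beta>))
        (tt_act_meta I M us) (tt_act_meta J M vs))"
  shows "tt_meta_equal \<Sigma> T (\<Theta>\<^sub>0 @ [(M, B)]) \<Theta> \<Gamma> I J"
  unfolding tt_meta_equal_def map_of_snoc[OF assms(1)]
proof (intro allI impI)
  fix N As \<beta> \<Gamma>' us vs
  assume *: "((map_of \<Theta>\<^sub>0)(M \<mapsto> B)) N = Some (foldr TBAbs As \<beta>)" "\<not> tt_is_abs_bdry \<beta>"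
    "is_obj (tt_arity \<beta>)" "tt_ext \<Sigma> \<Theta> \<Gamma> \<Gamma>'" "tt_args \<Sigma> T \<Theta> \<Gamma>' (tt_act I TFree) As us"
    "tt_args \<Sigma> T \<Theta> \<Gamma>' (tt_act J TFree) As vs" "tt_args_eq \<Sigma> T \<Theta> \<Gamma>' (tt_act I TFree) As us vs"
    "\<forall>C. \<beta> = TBTm C \<longrightarrow> tt_der \<Sigma> T \<Theta> \<Gamma>' (TJEqTy (tt_subst (tt_vec us) (tt_act I TFree C))
      (tt_subst (tt_vec vs) (tt_act J TFree C)))"
  show "tt_der \<Sigma> T \<Theta> \<Gamma>' (tt_fill_eq (tt_subst_bdry (tt_vec us) (tt_map_bdry (tt_act I TFree) \<beta>))
      (tt_act_meta I N us) (tt_act_meta J N vs))"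
  proof (cases "N = M")
    case True
    then show ?thesis using * assms(3) by simp
  next
    case False
    then have "map_of \<Theta>\<^sub>0 N = Some (foldr TBAbs As \<beta>)" using *(1) by simp
    then show ?thesis using assms(2) *(2-8) unfolding tt_meta_equal_def by blast
  qed
qed

text \<open>The reflexivity rules cover non-abstracted judgements only. For abstracted ones,
  reflexivity is the equation obtained by pairing the identity interpretation with itself.\<close>

lemma tt_fill_refl:
  fixes T :: "('s, 'v, 'm) tt_rule set"
  assumes "infinite (UNIV :: 'v set)" "\<forall>R\<in>T. tt_raw_rule \<Sigma> R" "tt_raw_mctx \<Sigma> \<Theta>" "tt_raw_vctx \<Sigma> \<Theta> \<Gamma>"
    "tt_der \<Sigma> T \<Theta> \<Gamma> (tt_fill B e)" "is_obj (tt_arity B)" "tt_wf \<Sigma> \<mu> V k (tt_arity B) e"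
  shows "tt_der \<Sigma> T \<Theta> \<Gamma> (tt_fill_eq B e e)"
  using tt_der_act(1)[OF assms(1) order.refl assms(2,3,5,4)
      tt_interp_refl[OF tt_interp_id[OF tt_ext_refl[OF assms(4)] map_le_refl]]]
    tt_act_fill_obj[OF assms(7)] tt_act_fill_pair[OF assms(7,6), of Map.empty TFree Map.empty TFree] assms(6)
  by (simp add: tt_map_bdry_ident)

lemma tt_raw_mctx_snoc:
  assumes "tt_raw_mctx \<Sigma> \<Theta>" "tt_wf_bdry \<Sigma> (tt_marity \<Theta>) {} 0 B" "M \<notin> fst ` set \<Theta>"
  shows "tt_raw_mctx \<Sigma> (\<Theta> @ [(M, B)])"
proof -
  have le: "tt_marity \<Theta> \<subseteq>\<^sub>m tt_marity (\<Theta> @ [(M, B)])"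
    using assms(3) unfolding map_of_snoc[OF assms(3)]
    by (intro tt_marity_mono)
      (auto simp: map_of_snoc map_le_def dom_map_of_conv_image_fst simp del: map_of_append)
  have "tt_wf_bdry \<Sigma> (tt_marity (\<Theta> @ [(M, B)])) {} 0 C"
    if "C \<in> ran (map_of (\<Theta> @ [(M, B)]))" for C
  proof -
    have "tt_wf_bdry \<Sigma> (tt_marity \<Theta>) {} 0 C"
      using that assms unfolding map_of_snoc[OF assms(3)] tt_raw_mctx_def
      by (auto simp: ran_def split: if_splits)
    then show ?thesis by (rule tt_wf_bdry_mono) (auto simp: le)
  qed
  then show ?thesis by (simp add: tt_raw_mctx_def)
qed

lemma tt_wf_mctxD:
  assumes "tt_wf_mctx \<Sigma> T \<Theta>" "\<forall>R\<in>T. tt_raw_rule \<Sigma> R"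
  shows "distinct (map fst \<Theta>)" "i \<le> length \<Theta> \<Longrightarrow> tt_raw_mctx \<Sigma> (take i \<Theta>)"
    "i < length \<Theta> \<Longrightarrow> tt_derb \<Sigma> T (take i \<Theta>) [] (snd (\<Theta> ! i))"
proof -
  have "distinct (map fst \<Theta>) \<and> (\<forall>i\<le>length \<Theta>. tt_raw_mctx \<Sigma> (take i \<Theta>)) \<and>
    (\<forall>i<length \<Theta>. tt_derb \<Sigma> T (take i \<Theta>) [] (snd (\<Theta> ! i)))"
    using assms(1)
  proof (induction rule: tt_wf_mctx.induct)
    case tt_mctx_empty
    then show ?case by (simp add: tt_raw_mctx_def)
  next
    case (tt_mctx_extend \<Theta> B M)
    then have raw: "tt_raw_mctx \<Sigma> \<Theta>" by force
    have "tt_raw_mctx \<Sigma> (\<Theta> @ [(M, B)])"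
      using tt_der_wf(2)[OF assms(2) raw tt_mctx_extend.hyps(2)] tt_mctx_extend.hyps(3)
      by (intro tt_raw_mctx_snoc[OF raw]) auto
    then show ?case
      using tt_mctx_extend by (auto simp: le_Suc_eq less_Suc_eq nth_append)
  qed
  then show "distinct (map fst \<Theta>)" "i \<le> length \<Theta> \<Longrightarrow> tt_raw_mctx \<Sigma> (take i \<Theta>)"
    "i < length \<Theta> \<Longrightarrow> tt_derb \<Sigma> T (take i \<Theta>) [] (snd (\<Theta> ! i))" by auto
qed

lemma tt_wf_mctx_raw: "tt_wf_mctx \<Sigma> T \<Theta> \<Longrightarrow> \<forall>R\<in>T. tt_raw_rule \<Sigma> R \<Longrightarrow> tt_raw_mctx \<Sigma> \<Theta>"
  using tt_wf_mctxD(2)[of \<Sigma> T \<Theta> "length \<Theta>"] by simp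

lemma tt_wf_vctx_raw:
  "tt_wf_vctx \<Sigma> T \<Theta> \<Gamma> \<Longrightarrow> \<forall>R\<in>T. tt_raw_rule \<Sigma> R \<Longrightarrow> tt_raw_mctx \<Sigma> \<Theta> \<Longrightarrow> tt_raw_vctx \<Sigma> \<Theta> \<Gamma>"
proof (induction rule: tt_wf_vctx.induct)
  case (tt_vctx_extend \<Gamma> A a)
  then show ?case using tt_der_wf(1)[OF tt_vctx_extend.prems tt_vctx_extend.hyps(2)]
    by (intro tt_raw_vctx_snoc) auto
qed simp

lemma map_of_take_le: "map_of (take k xs) \<subseteq>\<^sub>m map_of xs"
  by (metis append_take_drop_id map_le_map_add map_of_append)

lemma tt_mk_inst_take_le: "tt_mk_inst (take k \<Xi>) (take k es) \<subseteq>\<^sub>m tt_mk_inst \<Xi> es"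
  unfolding tt_mk_inst_def take_map[symmetric] take_zip[symmetric] by (rule map_of_take_le)

lemma tt_act_ok_sub:
  "tt_act_ok \<Sigma> \<mu> V \<mu>' V' I \<sigma> \<Longrightarrow> \<mu>\<^sub>0 \<subseteq>\<^sub>m \<mu> \<Longrightarrow> tt_act_ok \<Sigma> \<mu>\<^sub>0 V \<mu>' V' I \<sigma>"
  by (auto simp: tt_act_ok_def map_le_def dom_def)

text \<open>Replaces the restricted instantiation of the \<open>i\<close>-th premise by the full
  one; they agree because the boundary mentions earlier metavariables only. A single map can then be
  used at all stages of \<open>tt_interp_inst\<close>.\<close>

lemma tt_prem_bdry_act:
  assumes "tt_raw_mctx \<Sigma> (take i \<Xi>)" "tt_wf_bdry \<Sigma> (tt_marity (take i \<Xi>)) {} 0 (snd (\<Xi> ! i))"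
    "tt_inst_wf \<Sigma> \<Theta> \<Gamma> \<Xi> es"
  shows "tt_prem_bdry \<Xi> es i = tt_map_bdry (tt_act (tt_mk_inst \<Xi> es) TFree) (snd (\<Xi> ! i))"
  unfolding tt_prem_bdry_def tt_inst_bdry_map
proof (rule tt_act_cong_bdry[OF assms(2)])
  show "\<forall>M\<in>dom (tt_marity (take i \<Xi>)). tt_mk_inst (take i \<Xi>) (take i es) M = tt_mk_inst \<Xi> es M"
    using tt_mk_inst_dom[OF tt_inst_wf_take[OF assms(3)]] tt_mk_inst_take_le[of i \<Xi> es]
    by (auto simp: map_le_def)
qed simp

text \<open>The instantiations stay fixed and the source context grows by one premise at a time. The
  next boundary is derivable over the premises already treated, so its two images can be compared by
  the interpretation obtained so far.\<close>

lemma tt_interp_inst: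
  fixes T :: "('s, 'v, 'm) tt_rule set"
  assumes inf: "infinite (UNIV :: 'v set)" and sub: "T\<^sub>0 \<subseteq> T"
    and rules: "\<forall>R\<in>T. tt_raw_rule \<Sigma> R" and \<Theta>: "tt_raw_mctx \<Sigma> \<Theta>" and \<Gamma>: "tt_raw_vctx \<Sigma> \<Theta> \<Gamma>"
    and \<Xi>: "tt_wf_mctx \<Sigma> T\<^sub>0 \<Xi>"
    and wff: "tt_inst_wf \<Sigma> \<Theta> \<Gamma> \<Xi> fs" and wfg: "tt_inst_wf \<Sigma> \<Theta> \<Gamma> \<Xi> gs"
    and f: "\<forall>i<length \<Xi>. tt_der \<Sigma> T \<Theta> \<Gamma> (tt_fill (tt_prem_bdry \<Xi> fs i) (fs ! i))"
    and g: "\<forall>i<length \<Xi>. tt_der \<Sigma> T \<Theta> \<Gamma> (tt_fill (tt_prem_bdry \<Xi> gs i) (gs ! i))"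
    and fg: "\<forall>i<length \<Xi>. is_obj (tt_arity (snd (\<Xi> ! i))) \<longrightarrow>
      tt_der \<Sigma> T \<Theta> \<Gamma> (tt_fill_eq (tt_prem_bdry \<Xi> fs i) (fs ! i) (gs ! i))"
  shows "k \<le> length \<Xi> \<Longrightarrow>
    tt_interp2 \<Sigma> T (take k \<Xi>) [] \<Theta> \<Gamma> (tt_mk_inst \<Xi> fs) TFree (tt_mk_inst \<Xi> gs) TFree"
proof (induction k)
  let ?I = "tt_mk_inst \<Xi> fs" and ?J = "tt_mk_inst \<Xi> gs"
  have ok: "tt_act_ok \<Sigma> (tt_marity (take k \<Xi>)) {} (tt_marity \<Theta>) (fst ` set \<Gamma>) ?I TFree"
    "tt_act_ok \<Sigma> (tt_marity (take k \<Xi>)) {} (tt_marity \<Theta>) (fst ` set \<Gamma>) ?J TFree" for k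
    using tt_act_ok_sub[OF tt_mk_inst_act_ok[OF wff] tt_marity_mono[OF map_of_take_le]]
      tt_act_ok_sub[OF tt_mk_inst_act_ok[OF wfg] tt_marity_mono[OF map_of_take_le]] by auto
  have rules0: "\<forall>R\<in>T\<^sub>0. tt_raw_rule \<Sigma> R" using rules sub by auto
  note \<Xi>D = tt_wf_mctxD[OF \<Xi> rules0]
  {
    case 0
    show ?case
      using \<Gamma> ok[of 0]
      by (simp add: tt_interp2_def tt_interp_def tt_meta_typed_def tt_meta_equal_def
          tt_var_typed_def tt_var_equal_def)
  next
    case (Suc k)
    then have k: "k < length \<Xi>" and i2: "tt_interp2 \<Sigma> T (take k \<Xi>) [] \<Theta> \<Gamma> ?I TFree ?J TFree" by simp_all
    define M where "M = fst (\<Xi> ! k)"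
    define B where "B = snd (\<Xi> ! k)"
    have raw: "tt_raw_mctx \<Sigma> (take k \<Xi>)" using \<Xi>D(2) k by simp
    have B: "tt_derb \<Sigma> T\<^sub>0 (take k \<Xi>) [] B" using \<Xi>D(3)[OF k] by (simp add: B_def)
    have Bwf: "tt_wf_bdry \<Sigma> (tt_marity (take k \<Xi>)) {} 0 B"
      using tt_der_wf(2)[OF rules0 raw B] by simp
    have tk: "take (Suc k) \<Xi> = take k \<Xi> @ [(M, B)]" using k by (simp add: take_Suc_conv_app_nth M_def B_def)
    have "distinct (map fst (take (Suc k) \<Xi>))" using \<Xi>D(1) by (simp add: take_map[symmetric])
    then have M: "M \<notin> fst ` set (take k \<Xi>)" by (simp add: tk)
    have zip: "(M, fs ! k) \<in> set (zip (map fst \<Xi>) fs)" "(M, gs ! k) \<in> set (zip (map fst \<Xi>) gs)"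
      using k tt_inst_wf_length[OF wff] tt_inst_wf_length[OF wfg] by (auto simp: set_zip M_def intro!: exI[of _ k])
    then have IM: "?I M = Some (fs ! k)" "?J M = Some (gs ! k)"
      using \<Xi>D(1) tt_inst_wf_length[OF wff] tt_inst_wf_length[OF wfg]
      by (auto simp: tt_mk_inst_def intro!: map_of_is_SomeI)
    have wfk: "tt_wf \<Sigma> (tt_marity \<Theta>) (fst ` set \<Gamma>) 0 (tt_arity B) (fs ! k)"
      "tt_wf \<Sigma> (tt_marity \<Theta>) (fst ` set \<Gamma>) 0 (tt_arity B) (gs ! k)"
      using tt_inst_wf_nth[OF wff k] tt_inst_wf_nth[OF wfg k] by (simp_all add: B_def)
    have Bf: "tt_prem_bdry \<Xi> fs k = tt_map_bdry (tt_act ?I TFree) B"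
      and Bg: "tt_prem_bdry \<Xi> gs k = tt_map_bdry (tt_act ?J TFree) B"
      using tt_prem_bdry_act[OF raw _ wff] tt_prem_bdry_act[OF raw _ wfg] Bwf by (simp_all add: B_def)
    have f': "tt_der \<Sigma> T \<Theta> \<Gamma> (tt_fill (tt_map_bdry (tt_act ?I TFree) B) (fs ! k))"
      using f k Bf by metis
    have g': "tt_der \<Sigma> T \<Theta> \<Gamma> (tt_fill (tt_map_bdry (tt_act ?J TFree) B) (gs ! k))"
      using g k Bg by metis
    have fg': "tt_der \<Sigma> T \<Theta> \<Gamma> (tt_fill_eq (tt_map_bdry (tt_act ?I TFree) B) (fs ! k) (gs ! k))"
      if "is_obj (tt_arity B)" using fg k Bf that B_def by metis
    \<comment> \<open>Each side also has to be equal to itself at the new metavariable, as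
      \<open>tt_interp\<close> demands.\<close>
    have ff': "tt_der \<Sigma> T \<Theta> \<Gamma> (tt_fill_eq (tt_map_bdry (tt_act ?I TFree) B) (fs ! k) (fs ! k))"
      and gg': "tt_der \<Sigma> T \<Theta> \<Gamma> (tt_fill_eq (tt_map_bdry (tt_act ?J TFree) B) (gs ! k) (gs ! k))"
      if "is_obj (tt_arity B)"
      using that wfk by (auto intro!: tt_fill_refl[OF inf rules \<Theta> \<Gamma>] f' g')
    have ar: "is_obj (tt_arity (foldr TBAbs As \<beta>)) = is_obj (tt_arity \<beta>)" for As :: "('s, 'v, 'm) tt_exp list" and \<beta>
      by (simp add: tt_arity_foldr is_obj_def)
    \<comment> \<open>Stated for arbitrary \<open>K\<close> and \<open>L\<close>, since it is used
      for the pair of both instantiations and for each of them with itself.\<close>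
    have step: "tt_meta_typed \<Sigma> T (take (Suc k) \<Xi>) \<Theta> \<Gamma> K \<and> tt_meta_equal \<Sigma> T (take (Suc k) \<Xi>) \<Theta> \<Gamma> K L"
      if i: "tt_interp2 \<Sigma> T (take k \<Xi>) [] \<Theta> \<Gamma> K TFree L TFree" and KL: "K M = Some p" "L M = Some q"
        and p: "tt_wf \<Sigma> (tt_marity \<Theta>) (fst ` set \<Gamma>) 0 (tt_arity B) p"
        and q: "tt_wf \<Sigma> (tt_marity \<Theta>) (fst ` set \<Gamma>) 0 (tt_arity B) q"
        and dp: "tt_der \<Sigma> T \<Theta> \<Gamma> (tt_fill (tt_map_bdry (tt_act K TFree) B) p)"
        and dpq: "is_obj (tt_arity B) \<Longrightarrow> tt_der \<Sigma> T \<Theta> \<Gamma> (tt_fill_eq (tt_map_bdry (tt_act K TFree) B) p q)"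
      for K L p q
    proof -
      note MI = tt_meta_inst[OF inf sub rules raw \<Theta> \<Gamma> _ _ i]
      show ?thesis
        unfolding tk
      proof (intro conjI tt_meta_typed_snoc[OF M tt_interp2D(4)[OF i]] tt_meta_equal_snoc[OF M tt_interp2D(5)[OF i]])
        fix As \<beta> \<Gamma>' us
        assume e: "B = foldr TBAbs As \<beta>" "\<not> tt_is_abs_bdry \<beta>" "tt_ext \<Sigma> \<Theta> \<Gamma> \<Gamma>'"
          "tt_args \<Sigma> T \<Theta> \<Gamma>' (tt_act K TFree) As us"
        note MI' = MI[OF B[unfolded e(1)] e(2) p[unfolded e(1)] q[unfolded e(1)] dp[unfolded e(1)]
            dpq[unfolded e(1) ar] e(3,4)]
        show "tt_der \<Sigma> T \<Theta> \<Gamma>' (tt_fill (tt_subst_bdry (tt_vec us) (tt_map_bdry (tt_act K TFree) \<beta>))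
            (tt_act_meta K M us))"
          using MI'(1) by (simp add: tt_act_meta_def KL)
        show "tt_der \<Sigma> T \<Theta> \<Gamma>' (tt_fill_eq (tt_subst_bdry (tt_vec us) (tt_map_bdry (tt_act K TFree) \<beta>))
            (tt_act_meta K M us) (tt_act_meta L M vs))"
          if "is_obj (tt_arity \<beta>)" "tt_args \<Sigma> T \<Theta> \<Gamma>' (tt_act L TFree) As vs"
            "tt_args_eq \<Sigma> T \<Theta> \<Gamma>' (tt_act K TFree) As us vs" for vs
          using MI'(2)[OF _ that] by (simp add: tt_act_meta_def KL)
      qed
    qed
    note IJ = step[OF i2 IM wfk f' fg'] and II = step[OF tt_interp2_left[OF i2] IM(1,1) wfk(1,1) f' ff']
      and JJ = step[OF tt_interp2_right[OF i2] IM(2,2) wfk(2,2) g' gg']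
    show ?case
      using \<Gamma> ok[of "Suc k"] IJ II JJ
      by (simp add: tt_interp2_def tt_interp_def tt_var_typed_def tt_var_equal_def)
  }
qed

text \<open>The type premise of \<open>tt_congr_tm\<close>, which a cf congruence does not carry:
  the type of the conclusion is derivable over the premises of the rule, and two equal
  instantiations form a pair of interpretations.\<close>

lemma tt_inst_types_equal:
  fixes T :: "('s, 'v, 'm) tt_rule set"
  assumes inf: "infinite (UNIV :: 'v set)" and sub: "T\<^sub>0 \<subseteq> T"
    and rules: "\<forall>R\<in>T. tt_raw_rule \<Sigma> R" and \<Theta>: "tt_raw_mctx \<Sigma> \<Theta>" and \<Gamma>: "tt_raw_vctx \<Sigma> \<Theta> \<Gamma>"
    and \<Xi>: "tt_wf_mctx \<Sigma> T\<^sub>0 \<Xi>" and A: "tt_derb \<Sigma> T\<^sub>0 \<Xi> [] (TBTm A)"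
    and prems: "tt_inst_wf \<Sigma> \<Theta> \<Gamma> \<Xi> fs" "tt_inst_wf \<Sigma> \<Theta> \<Gamma> \<Xi> gs"
     "\<forall>i<length \<Xi>. tt_der \<Sigma> T \<Theta> \<Gamma> (tt_fill (tt_prem_bdry \<Xi> fs i) (fs ! i))"
     "\<forall>i<length \<Xi>. tt_der \<Sigma> T \<Theta> \<Gamma> (tt_fill (tt_prem_bdry \<Xi> gs i) (gs ! i))"
     "\<forall>i<length \<Xi>. is_obj (tt_arity (snd (\<Xi> ! i))) \<longrightarrow>
      tt_der \<Sigma> T \<Theta> \<Gamma> (tt_fill_eq (tt_prem_bdry \<Xi> fs i) (fs ! i) (gs ! i))"
  shows "tt_der \<Sigma> T \<Theta> \<Gamma> (TJEqTy (tt_inst (tt_mk_inst \<Xi> fs) A) (tt_inst (tt_mk_inst \<Xi> gs) A))"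
proof -
  have rules0: "\<forall>R\<in>T\<^sub>0. tt_raw_rule \<Sigma> R" using rules sub by auto
  have "tt_interp2 \<Sigma> T \<Xi> [] \<Theta> \<Gamma> (tt_mk_inst \<Xi> fs) TFree (tt_mk_inst \<Xi> gs) TFree"
    using tt_interp_inst[OF inf sub rules \<Theta> \<Gamma> \<Xi> prems order.refl] by simp
  from tt_der_act(2)[OF inf sub rules0 tt_wf_mctx_raw[OF \<Xi> rules0] A tt_raw_vctx_Nil this]
  show ?thesis by (simp add: tt_inst_act)
qed

text \<open>The same for \<open>tt_meta_congr\<close>. The boundary of \<open>M\<close> is derivable
  over the part of \<open>\<Theta>\<close> before \<open>M\<close>, and that part is interpreted in
  \<open>\<Theta>\<close> by the identity.\<close>

lemma tt_meta_types_equal: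
  fixes T :: "('s, 'v, 'm) tt_rule set"
  assumes inf: "infinite (UNIV :: 'v set)" and rules: "\<forall>R\<in>T. tt_raw_rule \<Sigma> R"
    and \<Theta>: "tt_wf_mctx \<Sigma> T \<Theta>" and \<Gamma>: "tt_raw_vctx \<Sigma> \<Theta> \<Gamma>"
    and M: "map_of \<Theta> M = Some (foldr TBAbs As (TBTm C))"
    and ss: "tt_args \<Sigma> T \<Theta> \<Gamma> id As ss" and ts: "tt_args \<Sigma> T \<Theta> \<Gamma> id As ts"
    and st: "tt_args_eq \<Sigma> T \<Theta> \<Gamma> id As ss ts"
  shows "tt_der \<Sigma> T \<Theta> \<Gamma> (TJEqTy (tt_subst (tt_vec ss) C) (tt_subst (tt_vec ts) C))"
proof -
  obtain i where i: "i < length \<Theta>" "\<Theta> ! i = (M, foldr TBAbs As (TBTm C))"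
    using map_of_SomeD[OF M] by (auto simp: in_set_conv_nth)
  note D = tt_wf_mctxD[OF \<Theta> rules]
  have i2: "tt_interp2 \<Sigma> T (take i \<Theta>) [] \<Theta> \<Gamma> Map.empty TFree Map.empty TFree"
    using \<Gamma> by (intro tt_interp_refl tt_interp_id map_of_take_le) (simp add: tt_ext_def)
  have id: "tt_act Map.empty TFree = id" by (rule ext) simp
  show ?thesis
    using tt_bdry_types_equal(2)[OF inf order.refl rules D(2) tt_wf_mctx_raw[OF \<Theta> rules] _ i2 refl, of As C ss ts]
      D(3)[OF i(1)] i ss ts st by (simp add: id)
qed

section \<open>Assumption sets of cf-expressions\<close>

text \<open>The part of an assumption set that suitability refers to.\<close>

definition nb :: "('s, 'a, 'm) cf_asms \<Rightarrow> ('s, 'a, 'm) cf_asm set" where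
  "nb X = {x. x |\<in>| X \<and> (\<forall>i. x \<noteq> ABound i)}"

lemma nb_simps [simp]:
  "nb {||} = {}" "nb (X |\<union>| Y) = nb X \<union> nb Y" "nb {|ABound i|} = {}"
  "nb (finsert (AFree v) X) = insert (AFree v) (nb X)"
  "nb (finsert (AMeta M) X) = insert (AMeta M) (nb X)"
  by (auto simp: nb_def)

lemma in_ffUnion: "x |\<in>| ffUnion F \<longleftrightarrow> (\<exists>X. X |\<in>| F \<and> x |\<in>| X)"
  by (auto simp: ffUnion.rep_eq)

lemma nb_ffUnion: "nb (ffUnion F) = (\<Union>X\<in>fset F. nb X)"
  by (auto simp: nb_def in_ffUnion)

lemma nb_ffUnion_list [simp]: "nb (ffUnion (f |`| fset_of_list xs)) = (\<Union>x\<in>set xs. nb (f x))"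
  by (simp add: nb_ffUnion fset_of_list.rep_eq)

lemma nb_asm_set: "nb (asm_set \<alpha>) = (\<Union>x\<in>fset \<alpha>. nb (asm_elem x))"
  by (simp add: asm_set_def nb_ffUnion)

lemma nb_asm_set_ffUnion: "nb (asm_set (ffUnion (h |`| \<alpha>))) = (\<Union>x\<in>fset \<alpha>. nb (asm_set (h x)))"
  by (simp add: nb_asm_set ffUnion.rep_eq)

lemma asm_simps_set: "ffUnion (asm_elem |`| \<alpha>) = asm_set \<alpha>"
  by (simp add: asm_set_def)

lemma nb_unbind [simp]: "nb (asm_unbind X) = nb X"
proof
  show "nb (asm_unbind X) \<subseteq> nb X"
    by (auto simp: nb_def asm_unbind_def split: cf_asm.splits)
  show "nb X \<subseteq> nb (asm_unbind X)"
  proof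
    fix x assume x: "x \<in> nb X"
    then have "(case x of ABound i \<Rightarrow> ABound (i - 1) | _ \<Rightarrow> x) = x" by (auto simp: nb_def split: cf_asm.splits)
    moreover have "x |\<in>| ffilter (\<lambda>x. x \<noteq> ABound 0) X" using x by (auto simp: nb_def)
    ultimately have "x |\<in>| asm_unbind X" unfolding asm_unbind_def by (metis (no_types, lifting) fimageI)
    then show "x \<in> nb (asm_unbind X)" using x by (simp add: nb_def)
  qed
qed

lemma fv_part_nb: "v \<in> fv_part X \<longleftrightarrow> AFree v \<in> nb X"
  by (simp add: fv_part_def nb_def)

lemma mv_part_nb: "M \<in> mv_part X \<longleftrightarrow> AMeta M \<in> nb X"
  by (simp add: mv_part_def nb_def)

lemma nb_elem_self: "x \<in> nb X \<Longrightarrow> x \<in> nb (asm_elem x)"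
proof (cases x)
  case (AFree v)
  then show ?thesis by (cases v) simp
next
  case (AMeta M)
  then show ?thesis by (cases M) simp
qed (simp add: nb_def)

text \<open>Assumption sets are hereditary: a variable or metavariable contributes the assumptions
  of its annotation along with itself, and members of assumption sets are expanded by
  \<open>asm_elem\<close>. Annotations contain all kinds of syntax, hence the mutual
  induction.\<close>

lemma nb_asm_trans':
  fixes e :: "('s, 'a, 'm) cf_exp" and B :: "('s, 'a, 'm) cf_bdry"
  assumes "y \<in> nb (asm_elem x)"
  shows "x \<in> nb (asm e) \<Longrightarrow> y \<in> nb (asm e)"
    and "x \<in> nb (asm_fvar v) \<Longrightarrow> y \<in> nb (asm_fvar v)"
    and "x \<in> nb (asm_mvar M) \<Longrightarrow> y \<in> nb (asm_mvar M)"
    and "x \<in> nb (asm_elem z) \<Longrightarrow> y \<in> nb (asm_elem z)"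
    and "x \<in> nb (asm_bdry B) \<Longrightarrow> y \<in> nb (asm_bdry B)"
proof (induct e and v and M and z and B
    rule: cf_exp.induct cf_fvar.induct cf_mvar.induct cf_asm.induct cf_bdry.induct)
  case (FV a A)
  then show ?case using assms by auto
next
  case (MV m B)
  then show ?case using assms by auto
next
  case (CConv t \<alpha>)
  then show ?case by (auto simp: nb_ffUnion)
next
  case (CAsm \<alpha>)
  then show ?case by (auto simp: nb_ffUnion)
qed auto

lemma nb_asm_trans: "x \<in> nb (asm e) \<Longrightarrow> nb (asm_elem x) \<subseteq> nb (asm e)"
  using nb_asm_trans'(1) by blast

text \<open>Filling an equality boundary with a head \<open>e\<close> stores \<open>asm e\<close> as
  an assumption set, which \<open>asm_jdg\<close> then expands again. By heredity the second
  expansion adds nothing.\<close>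

lemma nb_asm_set_asm [simp]: "nb (asm_set (asm e)) = nb (asm e)"
proof
  show "nb (asm_set (asm e)) \<subseteq> nb (asm e)"
  proof
    fix y assume "y \<in> nb (asm_set (asm e))"
    then obtain x where x: "x |\<in>| asm e" "y \<in> nb (asm_elem x)" by (auto simp: nb_asm_set)
    then have "x \<in> nb (asm e)" by (cases x) (auto simp: nb_def)
    then show "y \<in> nb (asm e)" using nb_asm_trans x(2) by blast
  qed
  show "nb (asm e) \<subseteq> nb (asm_set (asm e))"
  proof
    fix x assume "x \<in> nb (asm e)"
    then have "x |\<in>| asm e" "x \<in> nb (asm_elem x)" using nb_elem_self by (auto simp: nb_def)
    then show "x \<in> nb (asm_set (asm e))" by (auto simp: nb_asm_set)
  qed
qed

section \<open>Annotations are strictly smaller than the syntax that contains them\<close>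

lemma size_fset_member: "x |\<in>| \<alpha> \<Longrightarrow> f x < size_fset f \<alpha>"
proof -
  assume "x |\<in>| \<alpha>"
  then have "Suc (f x) \<le> (\<Sum>x\<in>fset \<alpha>. Suc (f x))" by (intro member_le_sum) auto
  then show ?thesis by (simp add: size_fset_simps)
qed

text \<open>The size of a datatype value counts annotations and the members of assumption sets, so
  every constructor around an annotated variable increases it.\<close>

lemma size_annotation:
  fixes e :: "('s, 'a, 'm) cf_exp" and B :: "('s, 'a, 'm) cf_bdry"
  shows "AFree (FV a A) \<in> nb (asm e) \<Longrightarrow> size A < size e"
    and "AFree (FV a A) \<in> nb (asm_fvar v) \<Longrightarrow> size A < size v"
    and "AFree (FV a A) \<in> nb (asm_mvar M) \<Longrightarrow> size A < size M"
    and "AFree (FV a A) \<in> nb (asm_elem y) \<Longrightarrow> size A < size y"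
    and "AFree (FV a A) \<in> nb (asm_bdry B) \<Longrightarrow> size A < size B"
proof (induct e and v and M and y and B
    rule: cf_exp.induct cf_fvar.induct cf_mvar.induct cf_asm.induct cf_bdry.induct)
  case (CSym S es)
  then obtain e where e: "e \<in> set es" "size A < size e" by auto
  have "size e \<le> size_list size es" using e(1) by (rule size_list_estimation') simp
  then show ?case using e(2) by simp
next
  case (CMeta M es)
  show ?case
  proof (cases "AFree (FV a A) \<in> nb (asm_mvar M)")
    case True
    then show ?thesis using CMeta by simp
  next
    case False
    then obtain e where e: "e \<in> set es" "size A < size e" using CMeta by auto
    have "size e \<le> size_list size es" using e(1) by (rule size_list_estimation') simp
    then show ?thesis using e(2) by simp
  qed
next
  case (CConv t \<alpha>)
  show ?case
  proof (cases "AFree (FV a A) \<in> nb (asm t)")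
    case True
    then show ?thesis using CConv by simp
  next
    case False
    then obtain x where "x |\<in>| \<alpha>" "size A < size x" using CConv by (auto simp: nb_ffUnion)
    then show ?thesis using size_fset_member[of x \<alpha> size] by simp
  qed
next
  case (CAsm \<alpha>)
  then obtain x where "x |\<in>| \<alpha>" "size A < size x" by (auto simp: nb_ffUnion)
  then show ?case using size_fset_member[of x \<alpha> size] by simp
qed auto

text \<open>The cf abstraction rules require the variable to be fresh for the body only; this
  supplies freshness for the type of the binder.\<close>

lemma fresh_annotation: "AFree (FV a A) \<notin> nb (asm A)"
  using size_annotation(1)[of a A A] by auto

text \<open>Lifting, substitution and erasure do not enter annotations, so induction on expressions
  without the mutual hypotheses is enough for them.\<close>

lemma cf_exp_induct [case_names CFree CBound CSym CMeta CConv CAsm CAbs]: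
  assumes "\<And>v. P (CFree v)" "\<And>i. P (CBound i)" "\<And>S es. (\<And>e. e \<in> set es \<Longrightarrow> P e) \<Longrightarrow> P (CSym S es)"
    "\<And>M ts. (\<And>t. t \<in> set ts \<Longrightarrow> P t) \<Longrightarrow> P (CMeta M ts)"
    "\<And>t \<alpha>. P t \<Longrightarrow> P (CConv t \<alpha>)" "\<And>\<alpha>. P (CAsm \<alpha>)" "\<And>e. P e \<Longrightarrow> P (CAbs e)"
  shows "P e"
  by (rule cf_exp.induct[where ?P1.0 = P and ?P2.0 = "\<lambda>_. True" and ?P3.0 = "\<lambda>_. True"
        and ?P4.0 = "\<lambda>_. True" and ?P5.0 = "\<lambda>_. True"]) (simp_all add: assms)

lemma cf_bdry_induct [case_names CBTy CBTm CBEqTy CBEqTm CBAbs]: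
  assumes "P CBTy" "\<And>A. P (CBTm A)" "\<And>A B. P (CBEqTy A B)" "\<And>s t A. P (CBEqTm s t A)"
    "\<And>A B. P B \<Longrightarrow> P (CBAbs A B)"
  shows "P B"
  by (rule cf_bdry.induct[where ?P1.0 = "\<lambda>_. True" and ?P2.0 = "\<lambda>_. True" and ?P3.0 = "\<lambda>_. True"
        and ?P4.0 = "\<lambda>_. True" and ?P5.0 = P]) (simp_all add: assms)

section \<open>Assumptions of lifted and substituted syntax\<close>

lemma nb_elem_lift [simp]: "nb (asm_elem (lift_asm k x)) = nb (asm_elem x)"
  by (cases x) auto

lemma nb_lift [simp]: "nb (asm (cf_lift k e)) = nb (asm e)"
proof (induction e arbitrary: k rule: cf_exp_induct)
  case (CConv t \<alpha>)
  then show ?case by (simp add: nb_ffUnion)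
next
  case (CAsm \<alpha>)
  then show ?case by (simp add: nb_ffUnion)
qed auto

lemma nb_up: "(\<Union>i. nb (asm (cf_up \<theta> i))) \<subseteq> (\<Union>i. nb (asm (\<theta> i)))"
  by (auto simp: cf_up_def split: nat.splits)

lemma nb_subst_asms: "nb (asm_set (subst_asms \<theta> \<alpha>)) \<subseteq> nb (asm_set \<alpha>) \<union> (\<Union>i. nb (asm (\<theta> i)))"
proof
  fix y assume "y \<in> nb (asm_set (subst_asms \<theta> \<alpha>))"
  then obtain x where x: "x |\<in>| \<alpha>"
    "y \<in> nb (asm_set (case x of ABound i \<Rightarrow> asm (\<theta> i) | _ \<Rightarrow> {|x|}))"
    unfolding subst_asms_def nb_asm_set_ffUnion by blast
  then show "y \<in> nb (asm_set \<alpha>) \<union> (\<Union>i. nb (asm (\<theta> i)))"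
    by (cases x) (force simp: nb_asm_set[of \<alpha>] nb_asm_set[of "{|_|}"])+
qed

lemma nb_subst_asms_mono: "nb (asm_set \<alpha>) \<subseteq> nb (asm_set (subst_asms \<theta> \<alpha>))"
proof
  fix y assume "y \<in> nb (asm_set \<alpha>)"
  then obtain x where x: "x |\<in>| \<alpha>" "y \<in> nb (asm_elem x)" by (auto simp: nb_asm_set)
  then have "x |\<in>| subst_asms \<theta> \<alpha>"
    by (cases x) (auto simp: subst_asms_def in_ffUnion intro!: bexI[of _ x])
  then show "y \<in> nb (asm_set (subst_asms \<theta> \<alpha>))" using x by (auto simp: nb_asm_set)
qed

lemma nb_subst: "nb (asm (cf_subst \<theta> e)) \<subseteq> nb (asm e) \<union> (\<Union>i. nb (asm (\<theta> i)))"
proof (induction e arbitrary: \<theta> rule: cf_exp_induct)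
  case (CConv t \<alpha>)
  then show ?case using nb_subst_asms[of \<theta> \<alpha>] by (auto simp: asm_simps_set)
next
  case (CAsm \<alpha>)
  then show ?case using nb_subst_asms[of \<theta> \<alpha>] by (auto simp: asm_simps_set)
next
  case (CAbs e)
  show ?case using CAbs[of "cf_up \<theta>"] nb_up[of \<theta>] by auto
qed (simp_all, blast+)

text \<open>Substitution removes bound variables only. Hence the value put in place of a
  metavariable keeps its own assumptions, whatever happens to the arguments.\<close>

lemma nb_subst_mono: "nb (asm e) \<subseteq> nb (asm (cf_subst \<theta> e))"
proof (induction e arbitrary: \<theta> rule: cf_exp_induct)
  case (CConv t \<alpha>)
  then show ?case using nb_subst_asms_mono[of \<alpha> \<theta>] by (auto simp: asm_simps_set)
next
  case (CAsm \<alpha>)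
  then show ?case using nb_subst_asms_mono[of \<alpha> \<theta>] by (auto simp: asm_simps_set)
qed (simp_all, blast+)

lemma nb_subst_bdry:
  "nb (asm_bdry (cf_subst_bdry \<theta> B)) \<subseteq> nb (asm_bdry B) \<union> (\<Union>i. nb (asm (\<theta> i)))"
proof (induction B arbitrary: \<theta> rule: cf_bdry_induct)
  case (CBAbs A B)
  show ?case using CBAbs[of "cf_up \<theta>"] nb_up[of \<theta>] nb_subst[of \<theta> A] by auto
next
  case (CBEqTy A B)
  show ?case using nb_subst[of \<theta> A] nb_subst[of \<theta> B] by auto
next
  case (CBEqTm s t A)
  show ?case using nb_subst[of \<theta> A] nb_subst[of \<theta> s] nb_subst[of \<theta> t] by auto
qed (simp_all add: nb_subst)

lemma nb_subst_jdg:
  "nb (asm_jdg (cf_subst_jdg \<theta> J)) \<subseteq> nb (asm_jdg J) \<union> (\<Union>i. nb (asm (\<theta> i)))"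
proof (induction J arbitrary: \<theta>)
  case (CJAbs A J)
  show ?case using CJAbs[of "cf_up \<theta>"] nb_up[of \<theta>] nb_subst[of \<theta> A] by auto
next
  case (CJEqTy A B \<alpha>)
  show ?case using nb_subst[of \<theta> A] nb_subst[of \<theta> B] nb_subst_asms[of \<theta> \<alpha>] by auto
next
  case (CJEqTm s t A \<alpha>)
  show ?case
    using nb_subst[of \<theta> A] nb_subst[of \<theta> s] nb_subst[of \<theta> t] nb_subst_asms[of \<theta> \<alpha>] by auto
next
  case (CJTm t A)
  show ?case using nb_subst[of \<theta> A] nb_subst[of \<theta> t] by auto
qed (simp add: nb_subst)

lemma nb_vec: "(\<Union>i. nb (asm (cf_vec ts i))) \<subseteq> (\<Union>t\<in>set ts. nb (asm t))"
proof
  fix x assume "x \<in> (\<Union>i. nb (asm (cf_vec ts i)))"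
  then obtain i where i: "i < length ts" "x \<in> nb (asm (rev ts ! i))"
    by (auto simp: cf_vec_def split: if_splits)
  then have "rev ts ! i \<in> set ts" by (metis length_rev nth_mem set_rev)
  then show "x \<in> (\<Union>t\<in>set ts. nb (asm t))" using i(2) by blast
qed

lemma nb_body [simp]: "nb (asm (cf_body e)) = nb (asm e)"
  by (induction e rule: cf_exp_induct) auto

section \<open>Assumptions of instances, bounded from above and from below\<close>

definition inst_nb :: "(('s, 'a, 'm) cf_mvar \<rightharpoonup> ('s, 'a, 'm) cf_exp) \<Rightarrow> ('s, 'a, 'm) cf_asm set
    \<Rightarrow> ('s, 'a, 'm) cf_asm set" where
  "inst_nb I X = {x. \<exists>M f. AMeta M \<in> X \<and> I M = Some f \<and> x \<in> nb (asm f)}"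

lemma inst_nb_mono: "X \<subseteq> Y \<Longrightarrow> inst_nb I X \<subseteq> inst_nb I Y"
  by (fastforce simp: inst_nb_def)

lemma inst_nb_Un [simp]: "inst_nb I (X \<union> Y) = inst_nb I X \<union> inst_nb I Y"
  by (auto simp: inst_nb_def)

text \<open>Free variables are excluded because instantiation acts on their annotations and thereby
  turns them into other variables.\<close>

definition inst_covers :: "(('s, 'a, 'm) cf_mvar \<rightharpoonup> ('s, 'a, 'm) cf_exp) \<Rightarrow> ('s, 'a, 'm) cf_asm set \<Rightarrow> bool" where
  "inst_covers I X \<longleftrightarrow> (\<forall>v. AFree v \<notin> X) \<and> (\<forall>M. AMeta M \<in> X \<longrightarrow> I M \<noteq> None)"

lemma inst_covers_Un [simp]: "inst_covers I (X \<union> Y) \<longleftrightarrow> inst_covers I X \<and> inst_covers I Y"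
  by (auto simp: inst_covers_def)

lemma inst_covers_mono: "inst_covers I Y \<Longrightarrow> X \<subseteq> Y \<Longrightarrow> inst_covers I X"
  by (auto simp: inst_covers_def)

lemma nb_inst_asms:
  assumes "inst_covers I (nb (asm_set \<alpha>))"
  shows "nb (asm_set (cf_inst_asms I \<alpha>)) \<subseteq> inst_nb I (nb (asm_set \<alpha>))"
proof
  fix y assume "y \<in> nb (asm_set (cf_inst_asms I \<alpha>))"
  then obtain x where x: "x |\<in>| \<alpha>" "y \<in> nb (asm_set (cf_inst_asm I x))"
    unfolding cf_inst_asms_def nb_asm_set_ffUnion by blast
  show "y \<in> inst_nb I (nb (asm_set \<alpha>))"
  proof (cases x)
    case (AFree v)
    then have "AFree v \<in> nb (asm_set \<alpha>)" using x(1) by (cases v) (force simp: nb_asm_set)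
    then show ?thesis using assms by (auto simp: inst_covers_def)
  next
    case (ABound i)
    then show ?thesis using x(2) by (simp add: nb_asm_set)
  next
    case (AMeta M)
    then have "AMeta M \<in> nb (asm_set \<alpha>)" using x(1) by (cases M) (force simp: nb_asm_set)
    then show ?thesis using x(2) AMeta
      by (auto simp: inst_nb_def nb_asm_set[of "{||}"] split: option.splits)
  qed
qed

text \<open>Each metavariable disappears together with its annotation, so all that can remain are
  assumptions of values. This is an inclusion only: arguments are lost when a value ignores
  them.\<close>

lemma nb_inst: "inst_covers I (nb (asm e)) \<Longrightarrow> nb (asm (cf_inst I e)) \<subseteq> inst_nb I (nb (asm e))"
proof (induction e rule: cf_exp_induct)
  case (CFree v)
  then show ?case by (cases v) (simp add: inst_covers_def)
next
  case (CSym S es)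
  have "nb (asm (cf_inst I e)) \<subseteq> inst_nb I (nb (asm (CSym S es)))" if "e \<in> set es" for e
  proof -
    have sub: "nb (asm e) \<subseteq> nb (asm (CSym S es))" using that by auto
    show ?thesis
      using CSym.IH[OF that inst_covers_mono[OF CSym.prems sub]] inst_nb_mono[OF sub] by (rule order.trans)
  qed
  then show ?case by auto
next
  case (CMeta M ts)
  have 1: "nb (asm (cf_inst I e)) \<subseteq> inst_nb I (nb (asm (CMeta M ts)))" if "e \<in> set ts" for e
  proof -
    have sub: "nb (asm e) \<subseteq> nb (asm (CMeta M ts))" using that by auto
    show ?thesis
      using CMeta.IH[OF that inst_covers_mono[OF CMeta.prems sub]] inst_nb_mono[OF sub] by (rule order.trans)
  qed
  have M: "AMeta M \<in> nb (asm (CMeta M ts))" by (cases M) simp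
  then obtain f where f: "I M = Some f" using CMeta.prems by (auto simp: inst_covers_def)
  have 2: "nb (asm f) \<subseteq> inst_nb I (nb (asm (CMeta M ts)))" using M f by (auto simp: inst_nb_def)
  have "nb (asm (cf_inst I (CMeta M ts))) \<subseteq> nb (asm f) \<union> (\<Union>t\<in>set ts. nb (asm (cf_inst I t)))"
    using nb_subst[of "cf_vec (map (cf_inst I) ts)" "cf_body f"] nb_vec[of "map (cf_inst I) ts"]
    by (fastforce simp: f)
  then show ?case using 1 2 by blast
next
  case (CConv t \<alpha>)
  then show ?case using nb_inst_asms[of I \<alpha>] by (auto simp: asm_simps_set cf_inst_asms_def[symmetric])
next
  case (CAsm \<alpha>)
  then show ?case using nb_inst_asms[of I \<alpha>] by (auto simp: asm_simps_set cf_inst_asms_def[symmetric])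
qed auto

lemma nb_inst_bdry:
  "inst_covers I (nb (asm_bdry B)) \<Longrightarrow> nb (asm_bdry (cf_inst_bdry I B)) \<subseteq> inst_nb I (nb (asm_bdry B))"
  by (induction B rule: cf_bdry_induct) (auto dest!: nb_inst)

lemma nb_inst_asms_rigid:
  "M \<in> mv_part \<alpha> \<Longrightarrow> I M = Some f \<Longrightarrow> nb (asm f) \<subseteq> nb (asm_set (cf_inst_asms I \<alpha>))"
proof -
  assume M: "M \<in> mv_part \<alpha>" "I M = Some f"
  have "nb (asm_set (asm f)) \<subseteq> nb (asm_set (cf_inst_asms I \<alpha>))"
  proof -
    have "fset (asm f) \<subseteq> fset (cf_inst_asms I \<alpha>)"
      using M by (force simp: cf_inst_asms_def mv_part_def in_ffUnion)
    then show ?thesis by (auto simp: nb_asm_set)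
  qed
  then show ?thesis by simp
qed

text \<open>The converse bound to \<open>nb_inst\<close>, for occurrences that instantiation cannot
  discard. It turns \<open>records_premises\<close> into a statement about instances.\<close>

lemma nb_inst_rigid: "M \<in> rigid_mv e \<Longrightarrow> I M = Some f \<Longrightarrow> nb (asm f) \<subseteq> nb (asm (cf_inst I e))"
proof (induction e rule: cf_exp_induct)
  case (CMeta N ts)
  then show ?case using nb_subst_mono[of "cf_body f"] by auto
next
  case (CConv t \<alpha>)
  then show ?case using nb_inst_asms_rigid[of M \<alpha> I f]
    by (auto simp: asm_simps_set cf_inst_asms_def[symmetric])
next
  case (CAsm \<alpha>)
  then show ?case using nb_inst_asms_rigid[of M \<alpha> I f]
    by (auto simp: asm_simps_set cf_inst_asms_def[symmetric])
qed auto

lemma nb_inst_rigid_jdg: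
  "M \<in> rigid_mv_jdg J \<Longrightarrow> I M = Some f \<Longrightarrow> nb (asm f) \<subseteq> nb (asm_jdg (cf_inst_jdg I J))"
  by (induction J) (auto dest!: nb_inst_rigid nb_inst_asms_rigid)

lemma cf_wf_Suc_cases:
  assumes "cf_wf \<Sigma> k (c, Suc n) e"
  obtains f where "e = CAbs f" "cf_wf \<Sigma> (Suc k) (c, n) f"
  using assms by (auto elim: cf_wf.cases)

lemma nb_fill:
  "cf_wf \<Sigma> k (cf_arity B) e \<Longrightarrow> nb (asm_jdg (cf_fill B e)) = nb (asm_bdry B) \<union> nb (asm e)"
proof (induction B arbitrary: k e rule: cf_bdry_induct)
  case (CBAbs A B)
  obtain c n where cn: "cf_arity B = (c, n)" by fastforce
  with CBAbs.prems obtain f where "e = CAbs f" "cf_wf \<Sigma> (Suc k) (c, n) f"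
    by (auto elim: cf_wf_Suc_cases)
  then show ?case using CBAbs.IH[of "Suc k" f] cn by (simp add: Un_assoc)
qed (simp_all add: Un_commute)

lemma nb_bdry_of: "nb (asm_bdry (cf_bdry_of J)) \<subseteq> nb (asm_jdg J)"
  by (induction J) auto

section \<open>Erasure\<close>

lemma erase_lift: "erase (cf_lift k e) = tt_lift k (erase e)"
  by (induction e arbitrary: k rule: cf_exp_induct) auto

lemma erase_up: "erase \<circ> cf_up \<theta> = tt_up (erase \<circ> \<theta>)"
  by (rule ext) (simp add: cf_up_def tt_up_def erase_lift split: nat.split)

lemma erase_subst: "erase (cf_subst \<theta> e) = tt_subst (erase \<circ> \<theta>) (erase e)"
  by (induction e arbitrary: \<theta> rule: cf_exp_induct) (auto simp: erase_up)

lemma erase_subst_bdry: "erase_bdry (cf_subst_bdry \<theta> B) = tt_subst_bdry (erase \<circ> \<theta>) (erase_bdry B)"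
  by (induction B arbitrary: \<theta> rule: cf_bdry_induct) (simp_all add: erase_up erase_subst)

lemma erase_subst_jdg: "erase_jdg (cf_subst_jdg \<theta> J) = tt_subst_jdg (erase \<circ> \<theta>) (erase_jdg J)"
  by (induction J arbitrary: \<theta>) (simp_all add: erase_up erase_subst)

lemma erase_vec: "erase \<circ> cf_vec ts = tt_vec (map erase ts)"
  by (rule ext) (simp add: cf_vec_def tt_vec_def rev_map)

lemma erase_arity [simp]: "tt_arity (erase_bdry B) = cf_arity B"
  by (induction B rule: cf_bdry_induct) simp_all

lemma erase_is_abs [simp]: "tt_is_abs_bdry (erase_bdry B) = cf_is_abs_bdry B"
  by (induction B rule: cf_bdry_induct) simp_all

lemma erase_is_abs_jdg [simp]: "tt_is_abs_jdg (erase_jdg J) = cf_is_abs_jdg J"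
  by (induction J) simp_all

lemma erase_foldr: "erase_bdry (foldr CBAbs As \<beta>) = foldr TBAbs (map erase As) (erase_bdry \<beta>)"
  by (induction As) simp_all

lemma erase_bdry_of: "erase_bdry (cf_bdry_of J) = tt_bdry_of (erase_jdg J)"
  by (induction J) simp_all

text \<open>An inclusion only, since variables inside annotations and assumption sets do not survive
  erasure.\<close>

lemma erase_fv: "tt_fv (erase e) \<subseteq> {v. AFree v \<in> nb (asm e)}"
proof (induction e rule: cf_exp_induct)
  case (CFree v)
  then show ?case by (cases v) simp
qed (auto simp: asm_simps_set)

lemma erase_fv_bdry: "tt_fv_bdry (erase_bdry B) \<subseteq> {v. AFree v \<in> nb (asm_bdry B)}"
  by (induction B rule: cf_bdry_induct) (auto dest: subsetD[OF erase_fv])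

lemma erase_fv_jdg: "tt_fv_jdg (erase_jdg J) \<subseteq> {v. AFree v \<in> nb (asm_jdg J)}"
  by (induction J) (auto dest: subsetD[OF erase_fv])

lemma cf_wf_erase:
  "cf_wf \<Sigma> k ar e \<Longrightarrow> \<forall>v. AFree v \<in> nb (asm e) \<longrightarrow> v \<in> V \<Longrightarrow>
   \<forall>M. AMeta M \<in> nb (asm e) \<longrightarrow> \<mu> M = Some (cf_arity (mvar_bdry M)) \<Longrightarrow>
   tt_wf \<Sigma> \<mu> V k ar (erase e)"
proof (induct k ar e rule: cf_wf_cf_wf_fvar_cf_wf_mvar_cf_wf_asm_cf_wf_bdry.inducts(1)[where
      ?P2.0 = "\<lambda>_. True" and ?P3.0 = "\<lambda>_. True" and ?P4.0 = "\<lambda>_ _. True" and ?P5.0 = "\<lambda>_ _. True"])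
  case (cf_wf_free v k)
  then show ?case by (cases v) (auto intro: tt_wf.intros)
next
  case (cf_wf_sym S c as k es)
  have "list_all2 (tt_wf \<Sigma> \<mu> V k) as (map erase es)"
    unfolding list_all2_conv_all_nth
  proof (intro conjI allI impI)
    show "length as = length (map erase es)" using cf_wf_sym(2) by (simp add: list_all2_conv_all_nth)
    fix i assume i: "i < length as"
    then have "i < length es" using cf_wf_sym(2) by (simp add: list_all2_conv_all_nth)
    then have "nb (asm (es ! i)) \<subseteq> nb (asm (CSym S es))" using nth_mem by auto
    moreover note \<open>i < length es\<close>
    ultimately show "tt_wf \<Sigma> \<mu> V k (as ! i) (map erase es ! i)"
      using cf_wf_sym(2) i cf_wf_sym.prems by (auto simp: list_all2_conv_all_nth subset_iff)
  qed
  then show ?case using cf_wf_sym(1) by (auto intro: tt_wf.intros)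
next
  case (cf_wf_meta M c ts k)
  have "\<mu> M = Some (Obj c, length (map erase ts))"
    using cf_wf_meta.hyps(3) cf_wf_meta.prems(2) by (cases M) auto
  moreover have "\<forall>t\<in>set ts. tt_wf \<Sigma> \<mu> V k (Obj Tm, 0) (erase t)"
  proof
    fix t assume t: "t \<in> set ts"
    then have "nb (asm t) \<subseteq> nb (asm (CMeta M ts))" by auto
    then show "tt_wf \<Sigma> \<mu> V k (Obj Tm, 0) (erase t)"
      using cf_wf_meta.hyps(4) cf_wf_meta.prems t by blast
  qed
  ultimately show ?case by (auto intro!: tt_wf.intros)
qed (auto intro: tt_wf.intros)

lemma cf_wf_erase_bdry:
  "cf_wf_bdry \<Sigma> k B \<Longrightarrow> \<forall>v. AFree v \<in> nb (asm_bdry B) \<longrightarrow> v \<in> V \<Longrightarrow>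
   \<forall>M. AMeta M \<in> nb (asm_bdry B) \<longrightarrow> \<mu> M = Some (cf_arity (mvar_bdry M)) \<Longrightarrow>
   tt_wf_bdry \<Sigma> \<mu> V k (erase_bdry B)"
  by (induction B arbitrary: k rule: cf_bdry_induct)
    (auto elim!: cf_wf_bdry.cases[of _ _ "CBAbs _ _"] cf_wf_bdry.cases[of _ _ "CBTm _"]
      cf_wf_bdry.cases[of _ _ "CBEqTy _ _"] cf_wf_bdry.cases[of _ _ "CBEqTm _ _ _"] intro!: cf_wf_erase)

lemma cf_wf_erase_jdg:
  "cf_wf_jdg \<Sigma> k J \<Longrightarrow> \<forall>v. AFree v \<in> nb (asm_jdg J) \<longrightarrow> v \<in> V \<Longrightarrow>
   \<forall>M. AMeta M \<in> nb (asm_jdg J) \<longrightarrow> \<mu> M = Some (cf_arity (mvar_bdry M)) \<Longrightarrow>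
   tt_wf_jdg \<Sigma> \<mu> V k (erase_jdg J)"
  by (induction J arbitrary: k) (auto intro!: cf_wf_erase)

text \<open>For uses where only the shape of an expression matters: every variable is available and
  every metavariable has the arity of its own annotation.\<close>

lemma cf_wf_erase_UNIV:
  "cf_wf \<Sigma> k ar e \<Longrightarrow> tt_wf \<Sigma> (\<lambda>M. Some (cf_arity (mvar_bdry M))) UNIV k ar (erase e)"
  by (rule cf_wf_erase) simp_all

text \<open>Fails for ill-formed syntax: a conversion around an abstraction erases to an
  abstraction, while \<open>cf_body\<close> stops at the conversion.\<close>

lemma erase_body: "cf_wf \<Sigma> k (c, n) e \<Longrightarrow> erase (cf_body e) = tt_body (erase e)"
proof (induction n arbitrary: k e)
  case 0
  then have "cf_body e = e" by (auto elim: cf_wf.cases)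
  then show ?case using tt_wf_body_id[OF cf_wf_erase_UNIV[OF 0]] by simp
next
  case (Suc n)
  from Suc.prems obtain f where "e = CAbs f" "cf_wf \<Sigma> (Suc k) (c, n) f" by (rule cf_wf_Suc_cases)
  then show ?case using Suc.IH by simp
qed

text \<open>Closedness is essential. On the cf side instantiation changes the annotation of a free
  variable; on the tt side the annotated variable is an atomic name and stays as it is.\<close>

lemma erase_inst:
  assumes "\<And>M f. I M = Some f \<Longrightarrow> erase (cf_body f) = tt_body (erase f)"
  shows "\<forall>v. AFree v \<notin> nb (asm e) \<Longrightarrow> erase (cf_inst I e) = tt_inst (\<lambda>M. map_option erase (I M)) (erase e)"
proof (induction e rule: cf_exp_induct)
  case (CFree v)
  then show ?case by (cases v) auto
next
  case (CMeta M ts)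
  have eq: "map erase (map (cf_inst I) ts) = map (tt_inst (\<lambda>M. map_option erase (I M))) (map erase ts)"
    using CMeta by auto
  show ?case
  proof (cases "I M")
    case None
    then show ?thesis using eq by simp
  next
    case (Some f)
    then show ?thesis
      using eq assms[OF Some] by (simp add: erase_subst erase_vec del: map_map map_eq_conv)
  qed
qed (auto simp: asm_simps_set)

lemma erase_inst_bdry:
  assumes "\<And>M f. I M = Some f \<Longrightarrow> erase (cf_body f) = tt_body (erase f)"
  shows "\<forall>v. AFree v \<notin> nb (asm_bdry B) \<Longrightarrow>
    erase_bdry (cf_inst_bdry I B) = tt_inst_bdry (\<lambda>M. map_option erase (I M)) (erase_bdry B)"
  by (induction B rule: cf_bdry_induct) (simp_all add: erase_inst[OF assms])

lemma erase_inst_jdg: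
  assumes "\<And>M f. I M = Some f \<Longrightarrow> erase (cf_body f) = tt_body (erase f)"
  shows "\<forall>v. AFree v \<notin> nb (asm_jdg J) \<Longrightarrow>
    erase_jdg (cf_inst_jdg I J) = tt_inst_jdg (\<lambda>M. map_option erase (I M)) (erase_jdg J)"
  by (induction J) (simp_all add: erase_inst[OF assms])

lemma erase_fill:
  "cf_wf \<Sigma> k (cf_arity B) e \<Longrightarrow> erase_jdg (cf_fill B e) = tt_fill (erase_bdry B) (erase e)"
proof (induction B arbitrary: k e rule: cf_bdry_induct)
  case (CBAbs A B)
  obtain c n where cn: "cf_arity B = (c, n)" by fastforce
  with CBAbs.prems obtain f where "e = CAbs f" "cf_wf \<Sigma> (Suc k) (c, n) f"
    by (auto elim: cf_wf_Suc_cases)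
  then show ?case using CBAbs.IH[of "Suc k" f] cn by simp
qed simp_all

lemma erase_fill_eq:
  "cf_wf \<Sigma> k (cf_arity B) e \<Longrightarrow> cf_wf \<Sigma> k (cf_arity B) e' \<Longrightarrow> is_obj (cf_arity B) \<Longrightarrow>
   erase_jdg (cf_fill_eq B e e' \<alpha>) = tt_fill_eq (erase_bdry B) (erase e) (erase e')"
proof (induction B arbitrary: k e e' rule: cf_bdry_induct)
  case (CBAbs A B)
  obtain c n where cn: "cf_arity B = (c, n)" by fastforce
  with CBAbs.prems obtain f where "e = CAbs f" "cf_wf \<Sigma> (Suc k) (c, n) f"
    by (auto elim: cf_wf_Suc_cases)
  moreover from cn CBAbs.prems obtain f' where "e' = CAbs f'" "cf_wf \<Sigma> (Suc k) (c, n) f'"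
    by (auto elim: cf_wf_Suc_cases)
  ultimately show ?case using CBAbs.IH[of "Suc k" f f'] CBAbs.prems(3) cn by (simp add: is_obj_def)
qed (simp_all add: is_obj_def)

section \<open>Renaming of variables\<close>

text \<open>A special case of \<open>tt_act\<close> treated separately: as variables are replaced by
  variables, it commutes with lifting, substitution and \<open>tt_body\<close> without any
  well-formedness hypothesis.\<close>

definition tt_ren :: "('v \<Rightarrow> 'v) \<Rightarrow> ('s, 'v, 'm) tt_exp \<Rightarrow> ('s, 'v, 'm) tt_exp" where
  "tt_ren \<rho> = tt_act Map.empty (TFree \<circ> \<rho>)"

lemma tt_ren_simps [simp]:
  "tt_ren \<rho> (TFree a) = TFree (\<rho> a)" "tt_ren \<rho> (TBound i) = TBound i"
  "tt_ren \<rho> (TSym S es) = TSym S (map (tt_ren \<rho>) es)"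
  "tt_ren \<rho> (TMeta M ts) = TMeta M (map (tt_ren \<rho>) ts)"
  "tt_ren \<rho> TStar = TStar" "tt_ren \<rho> (TAbs e) = TAbs (tt_ren \<rho> e)"
  by (simp_all add: tt_ren_def tt_act_meta_def)

lemma tt_ren_lift: "tt_ren \<rho> (tt_lift k e) = tt_lift k (tt_ren \<rho> e)"
  by (induction e arbitrary: k) auto

lemma tt_ren_up: "tt_ren \<rho> \<circ> tt_up \<theta> = tt_up (tt_ren \<rho> \<circ> \<theta>)"
  by (rule ext) (simp add: tt_up_def tt_ren_lift split: nat.split)

lemma tt_ren_subst: "tt_ren \<rho> (tt_subst \<theta> e) = tt_subst (tt_ren \<rho> \<circ> \<theta>) (tt_ren \<rho> e)"
  by (induction e arbitrary: \<theta>) (auto simp: tt_ren_up)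

lemma tt_ren_subst_bdry:
  "tt_map_bdry (tt_ren \<rho>) (tt_subst_bdry \<theta> B) = tt_subst_bdry (tt_ren \<rho> \<circ> \<theta>) (tt_map_bdry (tt_ren \<rho>) B)"
  by (induction B arbitrary: \<theta>) (simp_all add: tt_ren_up tt_ren_subst)

lemma tt_ren_subst_jdg:
  "tt_map_jdg (tt_ren \<rho>) (tt_subst_jdg \<theta> J) = tt_subst_jdg (tt_ren \<rho> \<circ> \<theta>) (tt_map_jdg (tt_ren \<rho>) J)"
  by (induction J arbitrary: \<theta>) (simp_all add: tt_ren_up tt_ren_subst)

lemma tt_ren_vec: "tt_ren \<rho> \<circ> tt_vec ts = tt_vec (map (tt_ren \<rho>) ts)"
  by (rule ext) (simp add: tt_vec_def rev_map)

lemma tt_ren_cong: "\<forall>a\<in>tt_fv e. \<rho> a = \<rho>' a \<Longrightarrow> tt_ren \<rho> e = tt_ren \<rho>' e"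
  by (induction e) auto

lemma tt_ren_cong_jdg:
  "\<forall>a\<in>tt_fv_jdg J. \<rho> a = \<rho>' a \<Longrightarrow> tt_map_jdg (tt_ren \<rho>) J = tt_map_jdg (tt_ren \<rho>') J"
  by (induction J) (auto intro: tt_ren_cong)

lemma tt_ren_cong_bdry:
  "\<forall>a\<in>tt_fv_bdry B. \<rho> a = \<rho>' a \<Longrightarrow> tt_map_bdry (tt_ren \<rho>) B = tt_map_bdry (tt_ren \<rho>') B"
  by (induction B) (auto intro: tt_ren_cong)

lemma tt_ren_id [simp]: "tt_ren id e = e"
  by (simp add: tt_ren_def)

lemma tt_ren_closed: "tt_fv e = {} \<Longrightarrow> tt_ren \<rho> e = e"
  using tt_ren_cong[of e \<rho> id] by simp

lemma tt_ren_closed_bdry: "tt_fv_bdry B = {} \<Longrightarrow> tt_map_bdry (tt_ren \<rho>) B = B"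
  using tt_ren_cong_bdry[of B \<rho> id] by (simp add: tt_map_bdry_ident)

lemma tt_ren_body: "tt_ren \<rho> (tt_body e) = tt_body (tt_ren \<rho> e)"
  by (induction e) auto

lemma tt_ren_inst:
  "tt_fv e = {} \<Longrightarrow> tt_ren \<rho> (tt_inst K e) = tt_inst (\<lambda>M. map_option (tt_ren \<rho>) (K M)) e"
proof (induction e)
  case (TMeta M ts)
  have eq: "map (tt_ren \<rho>) (map (tt_inst K) ts) = map (tt_inst (\<lambda>M. map_option (tt_ren \<rho>) (K M))) ts"
    using TMeta by auto
  show ?case
    using eq by (cases "K M") (simp_all add: tt_ren_subst tt_ren_vec tt_ren_body del: map_map map_eq_conv)
qed auto

lemma tt_ren_inst_bdry:
  "tt_fv_bdry B = {} \<Longrightarrow> tt_map_bdry (tt_ren \<rho>) (tt_inst_bdry K B)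
    = tt_inst_bdry (\<lambda>M. map_option (tt_ren \<rho>) (K M)) B"
  by (induction B) (simp_all add: tt_ren_inst)

lemma tt_ren_inst_jdg:
  "tt_fv_jdg J = {} \<Longrightarrow> tt_map_jdg (tt_ren \<rho>) (tt_inst_jdg K J)
    = tt_inst_jdg (\<lambda>M. map_option (tt_ren \<rho>) (K M)) J"
  by (induction J) (simp_all add: tt_ren_inst)

section \<open>Suitability up to renaming\<close>

text \<open>The renaming lets the induction pass under a binder whose annotated variable already occurs in
  \<open>\<Gamma>\<close>, possibly with an unrelated type.\<close>

definition suit where
  "suit \<Theta> \<Gamma> \<rho> X \<longleftrightarrow> (\<forall>M. AMeta M \<in> X \<longrightarrow> map_of \<Theta> M = Some (erase_bdry (mvar_bdry M))) \<and>
    (\<forall>a A. AFree (FV a A) \<in> X \<longrightarrow> map_of \<Gamma> (\<rho> (FV a A)) = Some (tt_ren \<rho> (erase A)))"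

lemma suit_mono: "suit \<Theta> \<Gamma> \<rho> Y \<Longrightarrow> X \<subseteq> Y \<Longrightarrow> suit \<Theta> \<Gamma> \<rho> X"
  unfolding suit_def by blast

lemma suitable_suit:
  assumes "suitable \<Theta> \<Gamma> X"
  shows "suit \<Theta> \<Gamma> id (nb X)"
proof -
  have "map_of \<Theta> M = Some (erase_bdry (mvar_bdry M))" if "AMeta M \<in> nb X" for M
    using assms that by (cases M) (simp add: suitable_def mv_part_nb)
  then show ?thesis using assms by (simp add: suit_def suitable_def fv_part_nb)
qed

lemma suit_wf:
  assumes "cf_wf \<Sigma> k ar e" "suit \<Theta> \<Gamma> \<rho> (nb (asm e))"
  shows "tt_wf \<Sigma> (tt_marity \<Theta>) (fst ` set \<Gamma>) k ar (tt_ren \<rho> (erase e))"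
proof -
  have wf: "tt_wf \<Sigma> (tt_marity \<Theta>) {v. AFree v \<in> nb (asm e)} k ar (erase e)"
    using assms by (intro cf_wf_erase) (auto simp: suit_def tt_marity_def)
  have "\<rho> v \<in> fst ` set \<Gamma>" if "AFree v \<in> nb (asm e)" for v
  proof (cases v)
    case (FV a A)
    then have "map_of \<Gamma> (\<rho> v) = Some (tt_ren \<rho> (erase A))" using assms(2) that by (simp add: suit_def)
    then show ?thesis by (metis domI dom_map_of_conv_image_fst)
  qed
  then have "tt_act_ok \<Sigma> (tt_marity \<Theta>) {v. AFree v \<in> nb (asm e)} (tt_marity \<Theta>) (fst ` set \<Gamma>)
      Map.empty (TFree \<circ> \<rho>)"
    by (auto simp: tt_act_ok_def intro!: tt_wf.intros)
  from tt_wf_act[OF wf this] show ?thesis by (simp add: tt_ren_def)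
qed

text \<open>The entry of a variable is the renamed erasure of its annotation, so the renamings must
  agree on the variables in annotations too. Heredity of \<open>X\<close> puts these into
  \<open>X\<close>.\<close>

lemma suit_cong:
  assumes "suit \<Theta> \<Gamma> \<rho> X" "\<forall>v. AFree v \<in> X \<longrightarrow> \<rho> v = \<rho>' v"
    "\<forall>x\<in>X. nb (asm_elem x) \<subseteq> X" "map_of \<Gamma> \<subseteq>\<^sub>m map_of \<Gamma>'"
  shows "suit \<Theta> \<Gamma>' \<rho>' X"
  unfolding suit_def
proof (intro conjI allI impI)
  fix M assume "AMeta M \<in> X"
  then show "map_of \<Theta> M = Some (erase_bdry (mvar_bdry M))" using assms(1) by (simp add: suit_def)
next
  fix a A assume v: "AFree (FV a A) \<in> X"
  then have "nb (asm A) \<subseteq> X" using assms(3) by fastforce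
  then have "tt_ren \<rho> (erase A) = tt_ren \<rho>' (erase A)"
    using assms(2) erase_fv[of A] by (intro tt_ren_cong) blast
  moreover have "map_of \<Gamma> (\<rho> (FV a A)) = Some (tt_ren \<rho> (erase A))"
    using assms(1) v by (simp add: suit_def)
  ultimately show "map_of \<Gamma>' (\<rho>' (FV a A)) = Some (tt_ren \<rho>' (erase A))"
    using assms(2,4) v by (auto simp: map_le_def dom_def)
qed

lemma nb_asm_trans_bdry: "x \<in> nb (asm_bdry B) \<Longrightarrow> nb (asm_elem x) \<subseteq> nb (asm_bdry B)"
  using nb_asm_trans'(5) by blast

lemma nb_asm_trans_set: "x \<in> nb (asm_set \<alpha>) \<Longrightarrow> nb (asm_elem x) \<subseteq> nb (asm_set \<alpha>)"
  using nb_asm_trans'(4) unfolding nb_asm_set by blast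

lemma nb_asm_trans_jdg: "x \<in> nb (asm_jdg J) \<Longrightarrow> nb (asm_elem x) \<subseteq> nb (asm_jdg J)"
proof (induction J)
  case (CJAbs A J)
  then show ?case using nb_asm_trans[of x A] by auto
next
  case (CJTy A)
  then show ?case using nb_asm_trans[of x A] by auto
next
  case (CJTm t A)
  then show ?case using nb_asm_trans[of x A] nb_asm_trans[of x t] by auto
next
  case (CJEqTy A B \<alpha>)
  then show ?case using nb_asm_trans[of x A] nb_asm_trans[of x B] nb_asm_trans_set[of x \<alpha>] by auto
next
  case (CJEqTm s t A \<alpha>)
  then show ?case
    using nb_asm_trans[of x A] nb_asm_trans[of x s] nb_asm_trans[of x t] nb_asm_trans_set[of x \<alpha>] by auto
qed

text \<open>The renaming may already have a value at \<open>a^A\<close>. Overriding it is harmless,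
  because \<open>a^A\<close> does not occur in \<open>X\<close>, nor therefore in any type that
  \<open>X\<close> refers to.\<close>

lemma suit_abs:
  assumes "suit \<Theta> \<Gamma> \<rho> X" "nb (asm A) \<subseteq> X" "AFree (FV a A) \<notin> X" "\<forall>x\<in>X. nb (asm_elem x) \<subseteq> X"
    "b \<notin> fst ` set \<Gamma>"
  shows "suit \<Theta> (\<Gamma> @ [(b, tt_ren \<rho> (erase A))]) (\<rho>(FV a A := b)) (insert (AFree (FV a A)) X)"
proof -
  have "suit \<Theta> (\<Gamma> @ [(b, tt_ren \<rho> (erase A))]) (\<rho>(FV a A := b)) X"
    using assms by (intro suit_cong[OF assms(1)])
      (auto simp: map_of_snoc map_le_def dom_map_of_conv_image_fst simp del: map_of_append)
  moreover have "tt_ren (\<rho>(FV a A := b)) (erase A) = tt_ren \<rho> (erase A)"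
    using assms(2,3) erase_fv[of A] by (intro tt_ren_cong) auto
  ultimately show ?thesis
    using assms(5) by (auto simp: suit_def map_of_snoc simp del: map_of_append)
qed

section \<open>The translation of derivations\<close>

lemma nb_asm_jdgs: "nb (asm_jdgs ps) = (\<Union>p\<in>set ps. nb (asm_jdg p))"
  by (simp add: asm_jdgs_def)

lemma nb_foldr: "nb (asm_bdry (foldr CBAbs As \<beta>)) = (\<Union>A\<in>set As. nb (asm A)) \<union> nb (asm_bdry \<beta>)"
  by (induction As) auto

lemma nb_arg_bdry:
  "j < length As \<Longrightarrow> nb (asm (cf_arg_bdry As ts j)) \<subseteq> nb (asm (As ! j)) \<union> (\<Union>t\<in>set ts. nb (asm t))"
  using nb_subst[of "cf_vec (take j ts)" "As ! j"] nb_vec[of "take j ts"] set_take_subset[of j ts]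
  unfolding cf_arg_bdry_def by blast

lemma cf_wf_mvar_closed: "cf_wf_mvar \<Sigma> M \<Longrightarrow> AFree v \<notin> nb (asm_bdry (mvar_bdry M))"
  by (cases rule: cf_wf_mvar.cases) (auto simp: fv_part_nb[symmetric])

lemma cf_wf_mvar_bdry: "cf_wf_mvar \<Sigma> M \<Longrightarrow> cf_wf_bdry \<Sigma> 0 (mvar_bdry M)"
  by (cases rule: cf_wf_mvar.cases) auto

lemma erase_closed: "(\<And>v. AFree v \<notin> nb (asm e)) \<Longrightarrow> tt_fv (erase e) = {}"
  using erase_fv[of e] by auto

lemma erase_closed_bdry: "(\<And>v. AFree v \<notin> nb (asm_bdry e)) \<Longrightarrow> tt_fv_bdry (erase_bdry e) = {}"
  using erase_fv_bdry[of e] by auto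

lemma erase_closed_jdg: "(\<And>v. AFree v \<notin> nb (asm_jdg e)) \<Longrightarrow> tt_fv_jdg (erase_jdg e) = {}"
  using erase_fv_jdg[of e] by auto

abbreviation er :: "(('s, 'a, 'm) cf_fvar \<Rightarrow> ('s, 'a, 'm) cf_fvar) \<Rightarrow> ('s, 'a, 'm) cf_exp \<Rightarrow> ('s, 'a, 'm) er_exp" where
  "er \<rho> e \<equiv> tt_ren \<rho> (erase e)"

text \<open>The annotation of a metavariable is closed, so a renaming acts on an instance of it
  through the arguments alone.\<close>

lemma ren_subst_vec:
  "tt_fv (erase e) = {} \<Longrightarrow> tt_ren \<rho> (erase (cf_subst (cf_vec ts) e))
    = tt_subst (tt_vec (map (er \<rho>) ts)) (erase e)"
  by (simp add: erase_subst erase_vec tt_ren_subst tt_ren_vec tt_ren_closed) (simp add: comp_def)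

lemma ren_subst_vec_bdry:
  "tt_fv_bdry (erase_bdry B) = {} \<Longrightarrow> tt_map_bdry (tt_ren \<rho>) (erase_bdry (cf_subst_bdry (cf_vec ts) B))
    = tt_subst_bdry (tt_vec (map (er \<rho>) ts)) (erase_bdry B)"
  by (simp add: erase_subst_bdry erase_vec tt_ren_subst_bdry tt_ren_vec tt_ren_closed_bdry)
    (simp add: comp_def)

lemma ren_arg_bdry:
  "tt_fv (erase (As ! j)) = {} \<Longrightarrow> tt_ren \<rho> (erase (cf_arg_bdry As ts j))
    = tt_subst (tt_vec (take j (map (er \<rho>) ts))) (erase (As ! j))"
  by (simp add: cf_arg_bdry_def ren_subst_vec take_map)

lemma erase_fill_not_abs:
  "\<not> cf_is_abs_bdry B \<Longrightarrow> erase_jdg (cf_fill B e) = tt_fill (erase_bdry B) (erase e)"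
  by (cases B) auto

lemma cf_is_abs_subst [simp]: "cf_is_abs_bdry (cf_subst_bdry \<theta> B) = cf_is_abs_bdry B"
  by (cases B) auto

lemma nb_fill_not_abs: "\<not> cf_is_abs_bdry B \<Longrightarrow> nb (asm_jdg (cf_fill B e)) = nb (asm_bdry B) \<union> nb (asm e)"
  by (cases B) (auto simp: Un_ac)

section \<open>Erasure of rules and of their instances\<close>

abbreviation er_prems :: "('s, 'a, 'm) cf_mvar list \<Rightarrow> ('s, 'a, 'm) er_mctx" where
  "er_prems Ms \<equiv> map (\<lambda>M. (M, erase_bdry (mvar_bdry M))) Ms"

lemma er_prems_fst [simp]: "map fst (er_prems Ms) = Ms"
  by (simp add: comp_def)

lemma er_prems_marity: "M \<in> set Ms \<Longrightarrow> tt_marity (er_prems Ms) M = Some (cf_arity (mvar_bdry M))"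
  unfolding tt_marity_def by (induction Ms) auto

lemma er_mk_inst:
  "(\<lambda>M. map_option (tt_ren \<rho>) (map_option erase (cf_mk_inst Ms es M)))
    = tt_mk_inst (er_prems Ms) (map (er \<rho>) es)"
  by (rule ext) (simp add: cf_mk_inst_def tt_mk_inst_def zip_map2 map_of_map option.map_comp comp_def)

lemma cf_mk_inst_body:
  assumes "cf_inst_wf \<Sigma> Ms es" "cf_mk_inst Ms es M = Some f"
  shows "erase (cf_body f) = tt_body (erase f)"
proof -
  obtain i where "i < length Ms" "Ms ! i = M" "es ! i = f" "i < length es"
    using map_of_SomeD[OF assms(2)[unfolded cf_mk_inst_def]] by (auto simp: in_set_zip)
  then have "cf_wf \<Sigma> 0 (cf_arity (mvar_bdry M)) f"
    using assms(1) by (auto simp: cf_inst_wf_def list_all2_conv_all_nth)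
  then show ?thesis by (cases "cf_arity (mvar_bdry M)") (auto intro: erase_body)
qed

lemma cf_inst_wf_take: "cf_inst_wf \<Sigma> Ms es \<Longrightarrow> cf_inst_wf \<Sigma> (take i Ms) (take i es)"
  by (auto simp: cf_inst_wf_def list_all2_takeI)

lemma cf_inst_wf_nth:
  "cf_inst_wf \<Sigma> Ms es \<Longrightarrow> i < length Ms \<Longrightarrow> cf_wf \<Sigma> 0 (cf_arity (mvar_bdry (Ms ! i))) (es ! i)"
  by (auto simp: cf_inst_wf_def list_all2_conv_all_nth)

lemma cf_inst_wf_length: "cf_inst_wf \<Sigma> Ms es \<Longrightarrow> length es = length Ms"
  by (auto simp: cf_inst_wf_def dest: list_all2_lengthD)

lemma cf_arity_inst [simp]: "cf_arity (cf_inst_bdry I B) = cf_arity B"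
  by (induction B rule: cf_bdry_induct) auto

lemma cf_prem_bdry_arity [simp]: "cf_arity (cf_prem_bdry Ms es i) = cf_arity (mvar_bdry (Ms ! i))"
  by (simp add: cf_prem_bdry_def)

lemma cf_raw_ruleD:
  assumes "cf_raw_rule \<Sigma> (Ms, J)"
  shows "distinct Ms" "\<not> cf_is_abs_jdg J" "cf_wf_jdg \<Sigma> 0 J" "AFree v \<notin> nb (asm_jdg J)"
    "AMeta M \<in> nb (asm_jdg J) \<longleftrightarrow> M \<in> set Ms" "i < length Ms \<Longrightarrow> cf_wf_mvar \<Sigma> (Ms ! i)"
    "i < length Ms \<Longrightarrow> AMeta M \<in> nb (asm_bdry (mvar_bdry (Ms ! i))) \<Longrightarrow> M \<in> set (take i Ms)"
  using assms by (auto simp: cf_raw_rule_def fv_part_nb[symmetric] mv_part_nb[symmetric])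

lemma erase_rule_raw:
  assumes "cf_raw_rule \<Sigma> R"
  shows "tt_raw_rule \<Sigma> (erase_rule R)"
proof -
  obtain Ms J where R: "R = (Ms, J)" by fastforce
  note D = cf_raw_ruleD[OF assms[unfolded R]]
  have "tt_wf_bdry \<Sigma> (tt_marity (take i (er_prems Ms))) {} 0 (erase_bdry (mvar_bdry (Ms ! i)))"
    if i: "i < length Ms" for i
    unfolding take_map
  proof (rule cf_wf_erase_bdry[OF cf_wf_mvar_bdry[OF D(6)[OF i]]])
    show "\<forall>v. AFree v \<in> nb (asm_bdry (mvar_bdry (Ms ! i))) \<longrightarrow> v \<in> {}"
      using cf_wf_mvar_closed[OF D(6)[OF i]] by blast
    show "\<forall>M. AMeta M \<in> nb (asm_bdry (mvar_bdry (Ms ! i))) \<longrightarrow>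
        tt_marity (er_prems (take i Ms)) M = Some (cf_arity (mvar_bdry M))"
      using er_prems_marity D(7)[OF i] by blast
  qed
  moreover have "tt_wf_jdg \<Sigma> (tt_marity (er_prems Ms)) {} 0 (erase_jdg J)"
    using D(4,5) er_prems_marity by (intro cf_wf_erase_jdg[OF D(3)]) blast+
  ultimately show ?thesis
    using D(1,2) by (simp add: tt_raw_rule_def erase_rule_def R comp_def)
qed

lemma er_prem_bdry:
  assumes "cf_raw_rule \<Sigma> (Ms, J)" "cf_inst_wf \<Sigma> Ms es" "i < length Ms"
  shows "tt_map_bdry (tt_ren \<rho>) (erase_bdry (cf_prem_bdry Ms es i))
    = tt_prem_bdry (er_prems Ms) (map (er \<rho>) es) i"
proof -
  note c = cf_wf_mvar_closed[OF cf_raw_ruleD(6)[OF assms(1,3)]]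
  have "erase_bdry (cf_prem_bdry Ms es i)
      = tt_inst_bdry (\<lambda>M. map_option erase (cf_mk_inst (take i Ms) (take i es) M)) (erase_bdry (mvar_bdry (Ms ! i)))"
    unfolding cf_prem_bdry_def
    using c cf_mk_inst_body[OF cf_inst_wf_take[OF assms(2)]] by (intro erase_inst_bdry) auto
  then show ?thesis
    using assms(3) by (simp add: tt_ren_inst_bdry[OF erase_closed_bdry[OF c]] er_mk_inst tt_prem_bdry_def take_map)
qed

lemma er_inst_concl:
  assumes "cf_raw_rule \<Sigma> (Ms, J)" "cf_inst_wf \<Sigma> Ms es"
  shows "tt_map_jdg (tt_ren \<rho>) (erase_jdg (cf_inst_jdg (cf_mk_inst Ms es) J))
    = tt_inst_jdg (tt_mk_inst (er_prems Ms) (map (er \<rho>) es)) (erase_jdg J)"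
  using erase_inst_jdg[OF cf_mk_inst_body[OF assms(2)], where J = J] cf_raw_ruleD(4)[OF assms(1)]
  by (simp add: tt_ren_inst_jdg[OF erase_closed_jdg] er_mk_inst)

lemma tt_ren_fill:
  "tt_wf \<Sigma> \<mu> V k (tt_arity B) e \<Longrightarrow>
   tt_map_jdg (tt_ren \<rho>) (tt_fill B e) = tt_fill (tt_map_bdry (tt_ren \<rho>) B) (tt_ren \<rho> e)"
  unfolding tt_ren_def by (rule tt_act_fill)

lemma tt_ren_fill_eq:
  "tt_wf \<Sigma> \<mu> V k (tt_arity B) e \<Longrightarrow> tt_wf \<Sigma> \<mu> V k (tt_arity B) e' \<Longrightarrow> is_obj (tt_arity B) \<Longrightarrow>
   tt_map_jdg (tt_ren \<rho>) (tt_fill_eq B e e') = tt_fill_eq (tt_map_bdry (tt_ren \<rho>) B) (tt_ren \<rho> e) (tt_ren \<rho> e')"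
  unfolding tt_ren_def by (rule tt_act_fill_eq)

lemma er_inst_prem:
  assumes "cf_raw_rule \<Sigma> (Ms, J)" "cf_inst_wf \<Sigma> Ms es" "i < length Ms"
  shows "tt_map_jdg (tt_ren \<rho>) (erase_jdg (cf_fill (cf_prem_bdry Ms es i) (es ! i)))
    = tt_fill (tt_prem_bdry (er_prems Ms) (map (er \<rho>) es) i)
        (map (er \<rho>) es ! i)"
proof -
  have wf: "cf_wf \<Sigma> 0 (cf_arity (cf_prem_bdry Ms es i)) (es ! i)"
    using cf_inst_wf_nth[OF assms(2,3)] by simp
  have "tt_wf \<Sigma> (\<lambda>M. Some (cf_arity (mvar_bdry M))) UNIV 0
      (tt_arity (erase_bdry (cf_prem_bdry Ms es i))) (erase (es ! i))"
    using cf_wf_erase_UNIV[OF wf] by simp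
  from tt_ren_fill[OF this] show ?thesis
    using assms(3) cf_inst_wf_length[OF assms(2)] by (simp add: erase_fill[OF wf] er_prem_bdry[OF assms])
qed

lemma er_inst_eq_prem:
  assumes "cf_raw_rule \<Sigma> (Ms, J)" "cf_inst_wf \<Sigma> Ms fs" "cf_inst_wf \<Sigma> Ms gs" "i < length Ms"
    "is_obj (cf_arity (mvar_bdry (Ms ! i)))"
  shows "tt_map_jdg (tt_ren \<rho>) (erase_jdg (cf_fill_eq (cf_prem_bdry Ms fs i) (fs ! i) (gs ! i) \<alpha>))
    = tt_fill_eq (tt_prem_bdry (er_prems Ms) (map (er \<rho>) fs) i)
        (map (er \<rho>) fs ! i) (map (er \<rho>) gs ! i)"
proof -
  have wf: "cf_wf \<Sigma> 0 (cf_arity (cf_prem_bdry Ms fs i)) (fs ! i)"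
    "cf_wf \<Sigma> 0 (cf_arity (cf_prem_bdry Ms fs i)) (gs ! i)"
    using cf_inst_wf_nth[OF assms(2,4)] cf_inst_wf_nth[OF assms(3,4)] by simp_all
  have ob: "is_obj (cf_arity (cf_prem_bdry Ms fs i))" using assms(5) by simp
  have "tt_wf \<Sigma> (\<lambda>M. Some (cf_arity (mvar_bdry M))) UNIV 0
      (tt_arity (erase_bdry (cf_prem_bdry Ms fs i))) (erase (fs ! i))"
    "tt_wf \<Sigma> (\<lambda>M. Some (cf_arity (mvar_bdry M))) UNIV 0
      (tt_arity (erase_bdry (cf_prem_bdry Ms fs i))) (erase (gs ! i))"
    "is_obj (tt_arity (erase_bdry (cf_prem_bdry Ms fs i)))"
    using cf_wf_erase_UNIV[OF wf(1)] cf_wf_erase_UNIV[OF wf(2)] ob by simp_all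
  from tt_ren_fill_eq[OF this] show ?thesis
    using assms(4) cf_inst_wf_length[OF assms(2)] cf_inst_wf_length[OF assms(3)]
    by (simp add: erase_fill_eq[OF wf ob] er_prem_bdry[OF assms(1,2,4)])
qed

lemma er_inst_wf:
  assumes "cf_inst_wf \<Sigma> Ms es" "\<forall>i<length Ms. suit \<Theta> \<Gamma> \<rho> (nb (asm (es ! i)))"
  shows "tt_inst_wf \<Sigma> \<Theta> \<Gamma> (er_prems Ms) (map (er \<rho>) es)"
  using suit_wf[OF cf_inst_wf_nth[OF assms(1)]] assms(2) cf_inst_wf_length[OF assms(1)]
  by (auto simp: tt_inst_wf_def list_all2_conv_all_nth)

text \<open>The boundary of a premise is closed and mentions earlier metavariables only, all of
  which the restricted instantiation covers; so \<open>nb_inst\<close> bounds the premise by the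
  assumptions of the instantiating expressions.\<close>

lemma nb_inst_prem:
  assumes "cf_raw_rule \<Sigma> (Ms, J)" "cf_inst_wf \<Sigma> Ms es" "i < length Ms"
  shows "nb (asm_jdg (cf_fill (cf_prem_bdry Ms es i) (es ! i))) \<subseteq> (\<Union>e\<in>set es. nb (asm e))"
proof -
  let ?I = "cf_mk_inst (take i Ms) (take i es)"
  note len = cf_inst_wf_length[OF assms(2)]
  have "inst_covers ?I (nb (asm_bdry (mvar_bdry (Ms ! i))))"
    unfolding inst_covers_def
  proof (intro conjI allI impI)
    show "AFree v \<notin> nb (asm_bdry (mvar_bdry (Ms ! i)))" for v
      by (rule cf_wf_mvar_closed[OF cf_raw_ruleD(6)[OF assms(1,3)]])
    fix M assume "AMeta M \<in> nb (asm_bdry (mvar_bdry (Ms ! i)))"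
    then have "M \<in> set (take i Ms)" by (rule cf_raw_ruleD(7)[OF assms(1,3)])
    moreover have "dom ?I = set (take i Ms)" unfolding cf_mk_inst_def using len by (intro dom_map_of_zip) simp
    ultimately show "?I M \<noteq> None" by blast
  qed
  from nb_inst_bdry[OF this]
  have "nb (asm_bdry (cf_prem_bdry Ms es i)) \<subseteq> inst_nb ?I (nb (asm_bdry (mvar_bdry (Ms ! i))))"
    by (simp add: cf_prem_bdry_def)
  also have "\<dots> \<subseteq> (\<Union>e\<in>set es. nb (asm e))"
  proof -
    have "f \<in> set es" if "?I M = Some f" for M f
      using map_of_SomeD[OF that[unfolded cf_mk_inst_def]] by (auto dest: set_zip_rightD in_set_takeD)
    then show ?thesis by (auto simp: inst_nb_def)
  qed
  finally have "nb (asm_bdry (cf_prem_bdry Ms es i)) \<subseteq> (\<Union>e\<in>set es. nb (asm e))" .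
  moreover have "es ! i \<in> set es" using assms(3) len by simp
  then have "nb (asm (es ! i)) \<subseteq> (\<Union>e\<in>set es. nb (asm e))" by (rule UN_upper)
  ultimately show ?thesis
    using nb_fill[of \<Sigma> 0 "cf_prem_bdry Ms es i" "es ! i"] cf_inst_wf_nth[OF assms(2,3)] by simp
qed

text \<open>This is where \<open>records_premises\<close> enters. With \<open>nb_inst_prem\<close>
  it shows that the conclusion of an instance records the assumptions of all premises.\<close>

lemma nb_inst_args:
  assumes "cf_raw_rule \<Sigma> (Ms, J)" "records_premises (Ms, J)" "cf_inst_wf \<Sigma> Ms es" "e \<in> set es"
  shows "nb (asm e) \<subseteq> nb (asm_jdg (cf_inst_jdg (cf_mk_inst Ms es) J))"
proof -
  note len = cf_inst_wf_length[OF assms(3)]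
  obtain i where i: "i < length es" "es ! i = e" using assms(4) by (auto simp: in_set_conv_nth)
  then have "Ms ! i \<in> rigid_mv_jdg J" using assms(2) len by (auto simp: records_premises_def)
  moreover have "cf_mk_inst Ms es (Ms ! i) = Some e"
    unfolding cf_mk_inst_def using i len cf_raw_ruleD(1)[OF assms(1)] by (metis map_of_zip_nth)
  ultimately show ?thesis by (rule nb_inst_rigid_jdg)
qed

lemma nb_fill_arg:
  assumes "cf_inst_wf \<Sigma> Ms es" "i < length Ms"
  shows "nb (asm (es ! i)) \<subseteq> nb (asm_jdg (cf_fill (cf_prem_bdry Ms es i) (es ! i)))"
  using nb_fill[of \<Sigma> 0 "cf_prem_bdry Ms es i" "es ! i"] cf_inst_wf_nth[OF assms] by simp

lemma cf_inst_bdry_of: "cf_inst_bdry I (cf_bdry_of J) = cf_bdry_of (cf_inst_jdg I J)"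
  by (induction J) auto

lemma tt_inst_bdry_of: "tt_inst_bdry I (tt_bdry_of J) = tt_bdry_of (tt_inst_jdg I J)"
  by (induction J) auto

lemma suit_prems:
  "asm_jdgs ps = asm_jdg J \<Longrightarrow> suit \<Theta> \<Gamma> \<rho> (nb (asm_jdg J)) \<Longrightarrow> p \<in> set ps \<Longrightarrow> suit \<Theta> \<Gamma> \<rho> (nb (asm_jdg p))"
  using nb_asm_jdgs[of ps] by (auto elim!: suit_mono)

text \<open>Holds even for a finite type of names, since different annotations give different
  variables. Ill-formed annotations do no harm, as fresh variables serve as atomic tt-names.\<close>

lemma infinite_cf_fvar: "infinite (UNIV :: ('s, 'a, 'm) cf_fvar set)"
proof -
  have "inj (\<lambda>n. FV undefined (CBound n) :: ('s, 'a, 'm) cf_fvar)" by (auto simp: inj_def)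
  then show ?thesis using finite_imageD infinite_UNIV_nat by (metis finite_subset subset_UNIV)
qed

lemma finite_tt_fv: "finite (tt_fv e)"
  by (induction e) auto

lemma finite_tt_fv_jdg: "finite (tt_fv_jdg J)"
  by (induction J) (auto simp: finite_tt_fv)

lemma finite_tt_fv_bdry: "finite (tt_fv_bdry J)"
  by (induction J) (auto simp: finite_tt_fv)


text \<open>Finitarity is stated over the whole of \<open>T\<close>, without an order. The locale
  can thus be used both for the full theory and for the set of rules below a given one.\<close>

locale suitable_translation =
  fixes \<Sigma> :: "'s signature" and T :: "('s, 'a, 'm) cf_rule set" and \<Theta> :: "('s, 'a, 'm) er_mctx"
  assumes raw: "\<forall>R\<in>T. cf_raw_rule \<Sigma> R" and rec: "\<forall>R\<in>T. records_premises R"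
    and finitary: "\<forall>R\<in>T. tt_finitary_rule \<Sigma> (erase_rule ` T) (erase_rule R)"
    and mctx: "tt_wf_mctx \<Sigma> (erase_rule ` T) \<Theta>"
begin

abbreviation "T' \<equiv> erase_rule ` T"

lemma rules: "\<forall>R\<in>T'. tt_raw_rule \<Sigma> R"
  using raw erase_rule_raw by blast

lemma raw_mctx: "tt_raw_mctx \<Sigma> \<Theta>"
  by (rule tt_wf_mctx_raw[OF mctx rules])

lemma in_T': "(Ms, J) \<in> T \<Longrightarrow> (er_prems Ms, erase_jdg J) \<in> T'"
  by (force simp: erase_rule_def)

lemma meta_args:
  assumes M: "M = MV m (foldr CBAbs As \<beta>)" "cf_wf_mvar \<Sigma> M"
    and len: "length ts = length As"
    and prems: "\<And>j. j < length As \<Longrightarrow>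
      tt_der \<Sigma> T' \<Theta> \<Gamma> (tt_map_jdg (tt_ren \<rho>) (erase_jdg (CJTm (ts ! j) (cf_arg_bdry As ts j))))"
  shows "tt_args \<Sigma> T' \<Theta> \<Gamma> id (map erase As) (map (er \<rho>) ts)"
  unfolding tt_args_def
proof (intro conjI allI impI)
  fix j assume "j < length (map erase As)"
  then have j: "j < length As" by simp
  have "tt_fv (erase (As ! j)) = {}"
    using cf_wf_mvar_closed[OF M(2)] j by (intro erase_closed) (auto simp: M(1) nb_foldr)
  then show "tt_der \<Sigma> T' \<Theta> \<Gamma> (TJTm (map (er \<rho>) ts ! j)
      (tt_subst (tt_vec (take j (map (er \<rho>) ts))) (id (map erase As ! j))))"
    using prems[OF j] j len by (simp add: ren_arg_bdry)
qed (simp add: len)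

lemma meta_args_eq:
  assumes M: "M = MV m (foldr CBAbs As \<beta>)" "cf_wf_mvar \<Sigma> M"
    and len: "length ss = length As" "length ts = length As" and ts': "map erase ts' = map erase ts"
    and prems: "\<And>j. j < length As \<Longrightarrow> tt_der \<Sigma> T' \<Theta> \<Gamma>
      (tt_map_jdg (tt_ren \<rho>) (erase_jdg (CJEqTm (ss ! j) (ts' ! j) (cf_arg_bdry As ss j) (\<alpha>s ! j))))"
  shows "tt_args_eq \<Sigma> T' \<Theta> \<Gamma> id (map erase As) (map (er \<rho>) ss)
    (map (er \<rho>) ts)"
  unfolding tt_args_eq_def
proof (intro allI impI)
  fix j assume "j < length (map erase As)"
  then have j: "j < length As" by simp
  have "tt_fv (erase (As ! j)) = {}"
    using cf_wf_mvar_closed[OF M(2)] j by (intro erase_closed) (auto simp: M(1) nb_foldr)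
  moreover have "erase (ts' ! j) = erase (ts ! j)"
    using ts' j len(2) by (metis length_map nth_map)
  ultimately show "tt_der \<Sigma> T' \<Theta> \<Gamma> (TJEqTm (map (er \<rho>) ss ! j)
      (map (er \<rho>) ts ! j)
      (tt_subst (tt_vec (take j (map (er \<rho>) ss))) (id (map erase As ! j))))"
    using prems[OF j] j len by (simp add: ren_arg_bdry)
qed

lemma suit_meta:
  assumes "suit \<Theta> \<Gamma> \<rho> X" "M = MV m (foldr CBAbs As \<beta>)" "AMeta M \<in> X"
  shows "map_of \<Theta> M = Some (foldr TBAbs (map erase As) (erase_bdry \<beta>))"
  using assms by (auto simp: suit_def erase_foldr)

lemma set_arg_prems: "j < length As \<Longrightarrow> CJTm (ts ! j) (cf_arg_bdry As ts j) \<in> set (arg_prems As ts)"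
  by (simp add: arg_prems_def)

lemma set_arg_eq_prems:
  "j < length As \<Longrightarrow> CJEqTm (ss ! j) (ts ! j) (cf_arg_bdry As ss j) (\<alpha>s ! j) \<in> set (arg_eq_prems As ss ts \<alpha>s)"
  by (simp add: arg_eq_prems_def)

lemma set_inst_prems:
  "i < length Ms \<Longrightarrow> cf_fill (cf_prem_bdry Ms es i) (es ! i) \<in> set (inst_prems Ms es)"
  by (simp add: inst_prems_def)

lemma set_inst_eq_prems:
  "i < length Ms \<Longrightarrow> is_obj (cf_arity (mvar_bdry (Ms ! i))) \<Longrightarrow>
   cf_fill_eq (cf_prem_bdry Ms fs i) (fs ! i) (gs ! i) (\<alpha>s ! i) \<in> set (inst_eq_prems Ms fs gs \<alpha>s)"
  by (auto simp: inst_eq_prems_def)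

lemma congr_prems:
  assumes R: "(Ms, J) \<in> T" and wf: "cf_inst_wf \<Sigma> Ms fs" "cf_inst_wf \<Sigma> Ms gs" "cf_inst_wf \<Sigma> Ms gs'"
    and gs': "map erase gs' = map erase gs"
    and sub: "set (inst_prems Ms fs @ inst_prems Ms gs @ inst_eq_prems Ms fs gs' \<alpha>s) \<subseteq> set ps"
    and ps: "\<forall>p\<in>set ps. tt_der \<Sigma> T' \<Theta> \<Gamma> (tt_map_jdg (tt_ren \<rho>) (erase_jdg p))"
    and suit: "\<forall>p\<in>set ps. suit \<Theta> \<Gamma> \<rho> (nb (asm_jdg p))"
  defines "h \<equiv> map (er \<rho>)"
  shows "tt_inst_wf \<Sigma> \<Theta> \<Gamma> (er_prems Ms) (h fs)" "tt_inst_wf \<Sigma> \<Theta> \<Gamma> (er_prems Ms) (h gs)"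
    "\<forall>i<length (er_prems Ms). tt_der \<Sigma> T' \<Theta> \<Gamma> (tt_fill (tt_prem_bdry (er_prems Ms) (h fs) i) (h fs ! i))"
    "\<forall>i<length (er_prems Ms). tt_der \<Sigma> T' \<Theta> \<Gamma> (tt_fill (tt_prem_bdry (er_prems Ms) (h gs) i) (h gs ! i))"
    "\<forall>i<length (er_prems Ms). is_obj (tt_arity (snd (er_prems Ms ! i))) \<longrightarrow>
      tt_der \<Sigma> T' \<Theta> \<Gamma> (tt_fill_eq (tt_prem_bdry (er_prems Ms) (h fs) i) (h fs ! i) (h gs ! i))"
proof -
  have rR: "cf_raw_rule \<Sigma> (Ms, J)" using raw R by blast
  have f: "cf_fill (cf_prem_bdry Ms fs i) (fs ! i) \<in> set ps"
    and g: "cf_fill (cf_prem_bdry Ms gs i) (gs ! i) \<in> set ps" if "i < length Ms" for i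
    using sub set_inst_prems[OF that] by auto
  have fg: "cf_fill_eq (cf_prem_bdry Ms fs i) (fs ! i) (gs' ! i) (\<alpha>s ! i) \<in> set ps"
    if "i < length Ms" "is_obj (cf_arity (mvar_bdry (Ms ! i)))" for i
    using sub set_inst_eq_prems[OF that] by auto
  \<comment> \<open>The cf equations have \<open>gs'\<close> on the right and the other premises
    have \<open>gs\<close>; after erasure the two coincide, as one tt rule requires.\<close>
  have er': "h gs' = h gs"
    using arg_cong[OF gs', of "map (tt_ren \<rho>)"] by (simp add: h_def comp_def)
  show "tt_inst_wf \<Sigma> \<Theta> \<Gamma> (er_prems Ms) (h fs)" "tt_inst_wf \<Sigma> \<Theta> \<Gamma> (er_prems Ms) (h gs)"
    unfolding h_def
    using suit_mono[OF bspec[OF suit f] nb_fill_arg[OF wf(1)]] suit_mono[OF bspec[OF suit g] nb_fill_arg[OF wf(2)]]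
    by (auto intro!: er_inst_wf wf(1,2))
  show "\<forall>i<length (er_prems Ms). tt_der \<Sigma> T' \<Theta> \<Gamma> (tt_fill (tt_prem_bdry (er_prems Ms) (h fs) i) (h fs ! i))"
    using bspec[OF ps f] unfolding h_def by (simp add: er_inst_prem[OF rR wf(1)])
  show "\<forall>i<length (er_prems Ms). tt_der \<Sigma> T' \<Theta> \<Gamma> (tt_fill (tt_prem_bdry (er_prems Ms) (h gs) i) (h gs ! i))"
    using bspec[OF ps g] unfolding h_def by (simp add: er_inst_prem[OF rR wf(2)])
  show "\<forall>i<length (er_prems Ms). is_obj (tt_arity (snd (er_prems Ms ! i))) \<longrightarrow>
      tt_der \<Sigma> T' \<Theta> \<Gamma> (tt_fill_eq (tt_prem_bdry (er_prems Ms) (h fs) i) (h fs ! i) (h gs ! i))"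
    using bspec[OF ps fg] unfolding er'[symmetric] unfolding h_def
    by (simp add: er_inst_eq_prem[OF rR wf(1,3)])
qed

text \<open>\<open>\<Gamma>\<close> and \<open>\<rho>\<close> vary in the induction so that a binder
  may add a fresh name and redirect the annotated variable to it, while \<open>\<Theta>\<close> is
  fixed. Suitability is required of the conclusion only; each case derives it for the
  premises.\<close>

lemma translation:
  "cf_der \<Sigma> T J \<Longrightarrow> tt_raw_vctx \<Sigma> \<Theta> \<Gamma> \<Longrightarrow> suit \<Theta> \<Gamma> \<rho> (nb (asm_jdg J)) \<Longrightarrow>
    tt_der \<Sigma> T' \<Theta> \<Gamma> (tt_map_jdg (tt_ren \<rho>) (erase_jdg J))"
  "cf_derb \<Sigma> T B \<Longrightarrow> tt_raw_vctx \<Sigma> \<Theta> \<Gamma> \<Longrightarrow> suit \<Theta> \<Gamma> \<rho> (nb (asm_bdry B)) \<Longrightarrow>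
    tt_derb \<Sigma> T' \<Theta> \<Gamma> (tt_map_bdry (tt_ren \<rho>) (erase_bdry B))"
proof (induct arbitrary: \<Gamma> \<rho> and \<Gamma> \<rho> rule: cf_der_cf_derb.inducts)
  case (cf_var a A)
  then show ?case by (auto simp: suit_def intro!: tt_var)
next
  case (cf_meta M m As \<beta> ts)
  let ?X = "nb (asm_bdry (cf_subst_bdry (cf_vec ts) \<beta>)) \<union> nb (asm (CMeta M ts))"
  have suit: "suit \<Theta> \<Gamma> \<rho> ?X" using cf_meta.prems(2) cf_meta.hyps(2) by (simp add: nb_fill_not_abs)
  have M: "AMeta M \<in> nb (asm (CMeta M ts))" and sub: "nb (asm_bdry (foldr CBAbs As \<beta>)) \<subseteq> nb (asm (CMeta M ts))"
    by (auto simp: cf_meta.hyps(1))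
  have lookup: "map_of \<Theta> M = Some (foldr TBAbs (map erase As) (erase_bdry \<beta>))"
    by (rule suit_meta[OF suit cf_meta.hyps(1)]) (use M in simp)
  have args: "tt_args \<Sigma> T' \<Theta> \<Gamma> id (map erase As) (map (er \<rho>) ts)"
  proof (rule meta_args[OF cf_meta.hyps(1,3,4)])
    fix j assume j: "j < length As"
    \<comment> \<open>The types of the telescope belong to the annotation of \<open>M\<close>, so
      their assumptions are recorded wherever \<open>M\<close> occurs.\<close>
    have "nb (asm_jdg (CJTm (ts ! j) (cf_arg_bdry As ts j))) \<subseteq> ?X"
      using nb_arg_bdry[OF j, of ts] sub j cf_meta.hyps(4) by (fastforce simp: nb_foldr)
    then have "suit \<Theta> \<Gamma> \<rho> (nb (asm_jdg (CJTm (ts ! j) (cf_arg_bdry As ts j))))" by (rule suit_mono[OF suit])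
    then show "tt_der \<Sigma> T' \<Theta> \<Gamma> (tt_map_jdg (tt_ren \<rho>) (erase_jdg (CJTm (ts ! j) (cf_arg_bdry As ts j))))"
      using cf_meta.hyps(5) set_arg_prems[OF j] cf_meta.prems(1) by blast
  qed
  have cl: "tt_fv_bdry (erase_bdry \<beta>) = {}"
    using cf_wf_mvar_closed[OF cf_meta.hyps(3)] by (intro erase_closed_bdry) (auto simp: cf_meta.hyps(1) nb_foldr)
  have "tt_derb \<Sigma> T' \<Theta> \<Gamma> (tt_subst_bdry (tt_vec (map (er \<rho>) ts)) (erase_bdry \<beta>))"
    using cf_meta.hyps(7)[OF cf_meta.prems(1) suit_mono[OF suit]] by (simp add: ren_subst_vec_bdry[OF cl])
  then have "tt_der \<Sigma> T' \<Theta> \<Gamma> (tt_fill (tt_subst_bdry (tt_vec (map (er \<rho>) ts)) (erase_bdry \<beta>)) (TMeta M (map (er \<rho>) ts)))"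
    using args cf_meta.hyps(2,4) by (intro tt_meta[OF lookup]) (auto simp: tt_args_def tt_arg_bdry_def)
  then show ?case
    using cf_meta.hyps(2)
    by (simp add: erase_fill_not_abs tt_map_fill ren_subst_vec_bdry[OF cl] comp_def)
next
  case (cf_meta_congr_ty M m As ss ts \<alpha>s ts' ps J \<gamma>)
  \<comment> \<open>The choice of \<open>\<gamma>\<close> puts the assumptions of every premise into
    the conclusion, so \<open>\<Gamma>\<close> is suitable for all of them.\<close>
  have der: "tt_der \<Sigma> T' \<Theta> \<Gamma> (tt_map_jdg (tt_ren \<rho>) (erase_jdg p))" if "p \<in> set ps" for p
    using cf_meta_congr_ty.hyps(8) that cf_meta_congr_ty.prems(1) suit_prems[OF cf_meta_congr_ty.hyps(10) cf_meta_congr_ty.prems(2)] by blast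
  note ps = cf_meta_congr_ty.hyps(7)
  have lookup: "map_of \<Theta> M = Some (foldr TBAbs (map erase As) TBTy)"
    using suit_meta[OF cf_meta_congr_ty.prems(2) cf_meta_congr_ty.hyps(1)]
    by (simp add: cf_meta_congr_ty.hyps(1,9))
  have a: "tt_args \<Sigma> T' \<Theta> \<Gamma> id (map erase As) (map (er \<rho>) ss)"
    by (rule meta_args[OF cf_meta_congr_ty.hyps(1-3)]) (rule der, simp add: ps set_arg_prems del: erase_jdg.simps)
  have b: "tt_args \<Sigma> T' \<Theta> \<Gamma> id (map erase As) (map (er \<rho>) ts)"
    by (rule meta_args[OF cf_meta_congr_ty.hyps(1,2,4)]) (rule der, simp add: ps set_arg_prems)
  have c: "tt_args_eq \<Sigma> T' \<Theta> \<Gamma> id (map erase As) (map (er \<rho>) ss) (map (er \<rho>) ts)"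
    by (rule meta_args_eq[where \<alpha>s = \<alpha>s, OF cf_meta_congr_ty.hyps(1-4,6)]) (rule der, simp add: ps set_arg_eq_prems)
  have "tt_der \<Sigma> T' \<Theta> \<Gamma> (tt_fill_eq (tt_subst_bdry (tt_vec (map (er \<rho>) ss)) TBTy)
      (TMeta M (map (er \<rho>) ss)) (TMeta M (map (er \<rho>) ts)))"
    by (rule tt_meta_congr[OF lookup])
      (use a b c in \<open>auto simp: tt_args_def tt_args_eq_def tt_arg_bdry_def is_obj_def\<close>)
  then show ?case by (simp add: cf_meta_congr_ty.hyps(9) comp_def)
next
  case (cf_meta_congr_tm M m As B ss ts \<alpha>s ts' ps v J \<gamma>)
  have der: "tt_der \<Sigma> T' \<Theta> \<Gamma> (tt_map_jdg (tt_ren \<rho>) (erase_jdg p))" if "p \<in> set ps" for p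
    using cf_meta_congr_tm.hyps(8) that cf_meta_congr_tm.prems(1) suit_prems[OF cf_meta_congr_tm.hyps(11) cf_meta_congr_tm.prems(2)] by blast
  note ps = cf_meta_congr_tm.hyps(7)
  have lookup: "map_of \<Theta> M = Some (foldr TBAbs (map erase As) (TBTm (erase B)))"
    using suit_meta[OF cf_meta_congr_tm.prems(2) cf_meta_congr_tm.hyps(1)]
    by (simp add: cf_meta_congr_tm.hyps(1,10))
  have a: "tt_args \<Sigma> T' \<Theta> \<Gamma> id (map erase As) (map (er \<rho>) ss)"
    by (rule meta_args[OF cf_meta_congr_tm.hyps(1-3)]) (rule der, simp add: ps set_arg_prems)
  have b: "tt_args \<Sigma> T' \<Theta> \<Gamma> id (map erase As) (map (er \<rho>) ts)"
    by (rule meta_args[OF cf_meta_congr_tm.hyps(1,2,4)]) (rule der, simp add: ps set_arg_prems)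
  have c: "tt_args_eq \<Sigma> T' \<Theta> \<Gamma> id (map erase As) (map (er \<rho>) ss) (map (er \<rho>) ts)"
    by (rule meta_args_eq[where \<alpha>s = \<alpha>s, OF cf_meta_congr_tm.hyps(1-4,6)]) (rule der, simp add: ps set_arg_eq_prems)
  \<comment> \<open>In the cf rule \<open>v\<close> is already converted to the type of the
    left-hand side; erasure forgets the conversion, and the tt rule asks for the type equation
    behind it.\<close>
  have C: "tt_der \<Sigma> T' \<Theta> \<Gamma> (TJEqTy (tt_subst (tt_vec (map (er \<rho>) ss)) (erase B)) (tt_subst (tt_vec (map (er \<rho>) ts)) (erase B)))"
    by (rule tt_meta_types_equal[OF infinite_cf_fvar rules mctx cf_meta_congr_tm.prems(1) lookup a b c])
  have "tt_der \<Sigma> T' \<Theta> \<Gamma> (tt_fill_eq (tt_subst_bdry (tt_vec (map (er \<rho>) ss)) (TBTm (erase B)))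
      (TMeta M (map (er \<rho>) ss)) (TMeta M (map (er \<rho>) ts)))"
    by (rule tt_meta_congr[OF lookup])
      (use a b c C in \<open>auto simp: tt_args_def tt_args_eq_def tt_arg_bdry_def is_obj_def\<close>)
  moreover have "tt_fv (erase B) = {}"
    using cf_wf_mvar_closed[OF cf_meta_congr_tm.hyps(2)]
    by (intro erase_closed) (auto simp: cf_meta_congr_tm.hyps(1) nb_foldr)
  ultimately show ?case
    by (simp add: cf_meta_congr_tm.hyps(9,10) ren_subst_vec comp_def)
next
  case (cf_abs A a J)
  have A: "tt_der \<Sigma> T' \<Theta> \<Gamma> (TJTy (er \<rho> A))"
    using cf_abs.hyps(2)[OF cf_abs.prems(1) suit_mono[OF cf_abs.prems(2)]] by auto
  have "finite (fst ` set \<Gamma> \<union> tt_fv_jdg (tt_map_jdg (tt_ren \<rho>) (erase_jdg J)))" by (simp add: finite_tt_fv_jdg)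
  then obtain b where b: "b \<notin> fst ` set \<Gamma>" "b \<notin> tt_fv_jdg (tt_map_jdg (tt_ren \<rho>) (erase_jdg J))"
    using ex_new_if_finite[OF infinite_cf_fvar] by blast
  let ?\<rho> = "\<rho>(FV a A := b)" and ?X = "nb (asm_jdg (CJAbs A J))"
  have fresh: "AFree (FV a A) \<notin> nb (asm_jdg J)" using cf_abs.hyps(3) by (simp add: fv_part_nb)
  have notin: "AFree (FV a A) \<notin> ?X" using fresh fresh_annotation[of a A] by simp
  have cl: "\<forall>x\<in>?X. nb (asm_elem x) \<subseteq> ?X" using nb_asm_trans_jdg[of _ "CJAbs A J"] by blast
  have s: "suit \<Theta> (\<Gamma> @ [(b, er \<rho> A)]) ?\<rho> (insert (AFree (FV a A)) ?X)"
    by (rule suit_abs[OF cf_abs.prems(2) _ notin cl b(1)]) simp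
  have "nb (asm_jdg (cf_subst_jdg (cf_vec [CFree (FV a A)]) J)) \<subseteq> insert (AFree (FV a A)) ?X"
    using nb_subst_jdg[of "cf_vec [CFree (FV a A)]" J] nb_vec[of "[CFree (FV a A)]"] by auto
  note s' = suit_mono[OF s this]
  have raw': "tt_raw_vctx \<Sigma> \<Theta> (\<Gamma> @ [(b, er \<rho> A)])"
    using tt_der_wf(1)[OF rules raw_mctx A cf_abs.prems(1)] b(1) by (intro tt_raw_vctx_snoc[OF cf_abs.prems(1)]) auto
  \<comment> \<open>The update concerns \<open>a^A\<close> only, which is absent from
    \<open>J\<close>. Hence opening with \<open>a^A\<close> and renaming amounts to opening the
    renamed body with \<open>b\<close>.\<close>
  have "tt_map_jdg (tt_ren ?\<rho>) (erase_jdg J) = tt_map_jdg (tt_ren \<rho>) (erase_jdg J)"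
    using fresh erase_fv_jdg[of J] by (intro tt_ren_cong_jdg) auto
  then have "tt_map_jdg (tt_ren ?\<rho>) (erase_jdg (cf_subst_jdg (cf_vec [CFree (FV a A)]) J))
      = tt_subst_jdg (tt_vec [TFree b]) (tt_map_jdg (tt_ren \<rho>) (erase_jdg J))"
    by (simp only: erase_subst_jdg erase_vec tt_ren_subst_jdg tt_ren_vec) simp
  then have "tt_der \<Sigma> T' \<Theta> (\<Gamma> @ [(b, er \<rho> A)])
      (tt_subst_jdg (tt_vec [TFree b]) (tt_map_jdg (tt_ren \<rho>) (erase_jdg J)))"
    using cf_abs.hyps(5)[OF raw' s'] by metis
  then show ?case using tt_abs[OF A b] by simp
next
  case (cf_eqty_refl A B)
  have "tt_der \<Sigma> T' \<Theta> \<Gamma> (TJTy (er \<rho> A))"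
    using cf_eqty_refl.hyps(2)[OF cf_eqty_refl.prems(1) suit_mono[OF cf_eqty_refl.prems(2)]] by auto
  then show ?case using cf_eqty_refl.hyps(5) by (simp add: tt_eqty_refl)
next
  case (cf_eqty_sym A B \<alpha>)
  have "tt_der \<Sigma> T' \<Theta> \<Gamma> (TJEqTy (er \<rho> A) (er \<rho> B))"
    using cf_eqty_sym.hyps(2)[OF cf_eqty_sym.prems(1) suit_mono[OF cf_eqty_sym.prems(2)]] by auto
  then show ?case by (simp add: tt_eqty_sym)
next
  case (cf_eqty_trans A B \<alpha> B' C \<beta> \<gamma>)
  have "nb (asm_jdg (CJEqTy A C \<gamma>)) = nb (asm_jdg (CJEqTy A B \<alpha>)) \<union> nb (asm_jdg (CJEqTy B' C \<beta>))"
    unfolding cf_eqty_trans.hyps(6)[symmetric] nb_asm_jdgs by simp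
  then have s: "suit \<Theta> \<Gamma> \<rho> (nb (asm_jdg (CJEqTy A B \<alpha>)) \<union> nb (asm_jdg (CJEqTy B' C \<beta>)))"
    using cf_eqty_trans.prems(2) by metis
  show ?case
    using cf_eqty_trans.hyps(2)[OF cf_eqty_trans.prems(1) suit_mono[OF s Un_upper1]]
      cf_eqty_trans.hyps(4)[OF cf_eqty_trans.prems(1) suit_mono[OF s Un_upper2]] cf_eqty_trans.hyps(5)
    by (auto intro: tt_eqty_trans)
next
  case (cf_eqtm_refl s A t)
  have "tt_der \<Sigma> T' \<Theta> \<Gamma> (TJTm (er \<rho> s) (er \<rho> A))"
    using cf_eqtm_refl.hyps(2)[OF cf_eqtm_refl.prems(1) suit_mono[OF cf_eqtm_refl.prems(2)]] by auto
  then show ?case using cf_eqtm_refl.hyps(5) by (simp add: tt_eqtm_refl)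
next
  case (cf_eqtm_sym s t A \<alpha>)
  have "tt_der \<Sigma> T' \<Theta> \<Gamma> (TJEqTm (er \<rho> s) (er \<rho> t) (er \<rho> A))"
    using cf_eqtm_sym.hyps(2)[OF cf_eqtm_sym.prems(1) suit_mono[OF cf_eqtm_sym.prems(2)]] by auto
  then show ?case by (simp add: tt_eqtm_sym)
next
  case (cf_eqtm_trans s t A \<alpha> t' u \<beta> \<gamma>)
  have "nb (asm_jdg (CJEqTm s u A \<gamma>)) = nb (asm_jdg (CJEqTm s t A \<alpha>)) \<union> nb (asm_jdg (CJEqTm t' u A \<beta>))"
    unfolding cf_eqtm_trans.hyps(6)[symmetric] nb_asm_jdgs by simp
  then have s: "suit \<Theta> \<Gamma> \<rho> (nb (asm_jdg (CJEqTm s t A \<alpha>)) \<union> nb (asm_jdg (CJEqTm t' u A \<beta>)))"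
    using cf_eqtm_trans.prems(2) by metis
  show ?case
    using cf_eqtm_trans.hyps(2)[OF cf_eqtm_trans.prems(1) suit_mono[OF s Un_upper1]]
      cf_eqtm_trans.hyps(4)[OF cf_eqtm_trans.prems(1) suit_mono[OF s Un_upper2]] cf_eqtm_trans.hyps(5)
    by (auto intro: tt_eqtm_trans)
next
  case (cf_conv t A B \<alpha> \<beta>)
  \<comment> \<open>The side condition on \<open>\<beta>\<close> is what keeps the assumptions of
    \<open>A\<close> and \<open>\<alpha>\<close> visible in the conclusion, although both have
    disappeared from it.\<close>
  have "nb (asm t) \<union> nb (asm A) \<union> nb (asm B) \<union> nb (asm_set \<alpha>) = nb (asm t) \<union> nb (asm B) \<union> nb (asm_set \<beta>)"
    using arg_cong[OF cf_conv.hyps(5), of nb] by simp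
  then have s: "suit \<Theta> \<Gamma> \<rho> (nb (asm t) \<union> nb (asm A) \<union> nb (asm B) \<union> nb (asm_set \<alpha>))"
    using cf_conv.prems(2) by (auto simp: asm_simps_set elim!: suit_mono)
  show ?case
    using cf_conv.hyps(2)[OF cf_conv.prems(1) suit_mono[OF s]] cf_conv.hyps(4)[OF cf_conv.prems(1) suit_mono[OF s]]
    by (auto intro: tt_conv)
next
  case (cf_conv_eq s t A \<alpha> B \<beta> \<gamma> \<delta>)
  have "nb (asm s) \<union> nb (asm A) \<union> nb (asm B) \<union> nb (asm_set \<beta>) = nb (asm s) \<union> nb (asm B) \<union> nb (asm_set \<gamma>)"
    using arg_cong[OF cf_conv_eq.hyps(5), of nb] by simp
  then have s: "suit \<Theta> \<Gamma> \<rho> (nb (asm s) \<union> nb (asm t) \<union> nb (asm A) \<union> nb (asm B) \<union> nb (asm_set \<alpha>) \<union> nb (asm_set \<beta>))"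
    using cf_conv_eq.prems(2) by (auto simp: asm_simps_set elim!: suit_mono)
  show ?case
    using cf_conv_eq.hyps(2)[OF cf_conv_eq.prems(1) suit_mono[OF s]]
      cf_conv_eq.hyps(4)[OF cf_conv_eq.prems(1) suit_mono[OF s]]
    by (auto intro: tt_der_tt_derb.tt_conv_eq)
next
  case (cf_specific Ms J es)
  let ?er = "map (er \<rho>)"
  have rR: "cf_raw_rule \<Sigma> (Ms, J)" and rec': "records_premises (Ms, J)"
    using raw rec cf_specific.hyps(1) by blast+
  note wf = cf_specific.hyps(2)
  \<comment> \<open>A specific rule has no assumption set to be chosen; the assumptions of its
    arguments are visible because every premise has a rigid occurrence in the conclusion.\<close>
  have s: "suit \<Theta> \<Gamma> \<rho> (\<Union>e\<in>set es. nb (asm e))"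
    using nb_inst_args[OF rR rec' wf] by (intro suit_mono[OF cf_specific.prems(2)]) blast
  have iw: "tt_inst_wf \<Sigma> \<Theta> \<Gamma> (er_prems Ms) (?er es)"
    using cf_inst_wf_length[OF wf] nth_mem by (intro er_inst_wf[OF wf] allI impI suit_mono[OF s]) fastforce
  have prems: "\<forall>i<length (er_prems Ms). tt_der \<Sigma> T' \<Theta> \<Gamma> (tt_fill (tt_prem_bdry (er_prems Ms) (?er es) i) (?er es ! i))"
  proof (intro allI impI)
    fix i assume "i < length (er_prems Ms)"
    then have i: "i < length Ms" by simp
    show "tt_der \<Sigma> T' \<Theta> \<Gamma> (tt_fill (tt_prem_bdry (er_prems Ms) (?er es) i) (?er es ! i))"
      using cf_specific.hyps(3) set_inst_prems[OF i] cf_specific.prems(1) suit_mono[OF s nb_inst_prem[OF rR wf i]]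
      unfolding er_inst_prem[OF rR wf i, symmetric] by blast
  qed
  have "tt_derb \<Sigma> T' \<Theta> \<Gamma> (tt_map_bdry (tt_ren \<rho>) (erase_bdry (cf_inst_bdry (cf_mk_inst Ms es) (cf_bdry_of J))))"
    unfolding cf_inst_bdry_of using nb_bdry_of
    by (intro cf_specific.hyps(5)[unfolded cf_inst_bdry_of] cf_specific.prems(1) suit_mono[OF cf_specific.prems(2)])
  then have "tt_derb \<Sigma> T' \<Theta> \<Gamma> (tt_inst_bdry (tt_mk_inst (er_prems Ms) (?er es)) (tt_bdry_of (erase_jdg J)))"
    unfolding cf_inst_bdry_of erase_bdry_of tt_bdry_of_map[symmetric] er_inst_concl[OF rR wf] tt_inst_bdry_of .
  from tt_specific[OF in_T'[OF cf_specific.hyps(1)] iw prems this]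
  show ?case by (simp only: er_inst_concl[OF rR wf])
next
  case (cf_congr_ty Ms A fs gs gs' \<alpha>s ps J \<gamma>)
  have sp: "\<forall>p\<in>set ps. suit \<Theta> \<Gamma> \<rho> (nb (asm_jdg p))"
    using suit_prems[OF cf_congr_ty.hyps(10) cf_congr_ty.prems(2)] by blast
  have der: "\<forall>p\<in>set ps. tt_der \<Sigma> T' \<Theta> \<Gamma> (tt_map_jdg (tt_ren \<rho>) (erase_jdg p))"
    using cf_congr_ty.hyps(8) cf_congr_ty.prems(1) sp by blast
  have rR: "cf_raw_rule \<Sigma> (Ms, CJTy A)" using raw cf_congr_ty.hyps(1) by blast
  note P = congr_prems[OF cf_congr_ty.hyps(1-4,6) _ der sp, unfolded cf_congr_ty.hyps(7), OF order.refl]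
  note R = in_T'[OF cf_congr_ty.hyps(1), simplified]
  from tt_congr_ty[OF R P] show ?case
    using er_inst_concl[OF rR cf_congr_ty.hyps(2), of \<rho>] er_inst_concl[OF rR cf_congr_ty.hyps(3), of \<rho>]
    by (simp add: cf_congr_ty.hyps(9))
next
  case (cf_congr_tm Ms t A fs gs gs' \<alpha>s ps t' J \<gamma>)
  let ?er = "map (er \<rho>)"
  have sp: "\<forall>p\<in>set ps. suit \<Theta> \<Gamma> \<rho> (nb (asm_jdg p))"
    using suit_prems[OF cf_congr_tm.hyps(11) cf_congr_tm.prems(2)] by blast
  have der: "\<forall>p\<in>set ps. tt_der \<Sigma> T' \<Theta> \<Gamma> (tt_map_jdg (tt_ren \<rho>) (erase_jdg p))"
    using cf_congr_tm.hyps(8) cf_congr_tm.prems(1) sp by blast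
  have rR: "cf_raw_rule \<Sigma> (Ms, CJTm t A)" using raw cf_congr_tm.hyps(1) by blast
  have sub: "set (inst_prems Ms fs @ inst_prems Ms gs @ inst_eq_prems Ms fs gs' \<alpha>s) \<subseteq> set ps"
    by (auto simp: cf_congr_tm.hyps(7))
  note P = congr_prems[OF cf_congr_tm.hyps(1-4,6) sub der sp]
  note R = in_T'[OF cf_congr_tm.hyps(1), simplified]
  \<comment> \<open>Finitarity makes the premises a well-formed metavariable context over which
    \<open>A\<close> is a type, so that \<open>tt_inst_types_equal\<close> can compare its two
    instances.\<close>
  have fin: "tt_wf_mctx \<Sigma> T' (er_prems Ms)" "tt_derb \<Sigma> T' (er_prems Ms) [] (TBTm (erase A))"
    using finitary[rule_format, OF cf_congr_tm.hyps(1)] by (simp_all add: tt_finitary_rule_def erase_rule_def)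
  have "tt_der \<Sigma> T' \<Theta> \<Gamma> (TJEqTy (tt_inst (tt_mk_inst (er_prems Ms) (?er fs)) (erase A))
      (tt_inst (tt_mk_inst (er_prems Ms) (?er gs)) (erase A)))"
    by (rule tt_inst_types_equal[OF infinite_cf_fvar order.refl rules raw_mctx cf_congr_tm.prems(1) fin P])
  from tt_congr_tm[OF R P this] show ?case
    using er_inst_concl[OF rR cf_congr_tm.hyps(2), of \<rho>] er_inst_concl[OF rR cf_congr_tm.hyps(3), of \<rho>]
    by (simp add: cf_congr_tm.hyps(9,10))
next
  case cf_bdry_ty
  then show ?case by (simp add: tt_bdry_ty)
next
  case (cf_bdry_tm A)
  then show ?case by (simp add: tt_bdry_tm)
next
  case (cf_bdry_eqty A B)
  show ?case
    using cf_bdry_eqty.hyps(2)[OF cf_bdry_eqty.prems(1) suit_mono[OF cf_bdry_eqty.prems(2)]]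
      cf_bdry_eqty.hyps(4)[OF cf_bdry_eqty.prems(1) suit_mono[OF cf_bdry_eqty.prems(2)]]
    by (auto intro: tt_bdry_eqty)
next
  case (cf_bdry_eqtm A s t)
  show ?case
    using cf_bdry_eqtm.hyps(2)[OF cf_bdry_eqtm.prems(1) suit_mono[OF cf_bdry_eqtm.prems(2)]]
      cf_bdry_eqtm.hyps(4)[OF cf_bdry_eqtm.prems(1) suit_mono[OF cf_bdry_eqtm.prems(2)]]
      cf_bdry_eqtm.hyps(6)[OF cf_bdry_eqtm.prems(1) suit_mono[OF cf_bdry_eqtm.prems(2)]]
    by (auto intro: tt_bdry_eqtm)
next
  case (cf_bdry_abs A a B)
  have A: "tt_der \<Sigma> T' \<Theta> \<Gamma> (TJTy (er \<rho> A))"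
    using cf_bdry_abs.hyps(2)[OF cf_bdry_abs.prems(1) suit_mono[OF cf_bdry_abs.prems(2)]] by auto
  have "finite (fst ` set \<Gamma> \<union> tt_fv_bdry (tt_map_bdry (tt_ren \<rho>) (erase_bdry B)))" by (simp add: finite_tt_fv_bdry)
  then obtain b where b: "b \<notin> fst ` set \<Gamma>" "b \<notin> tt_fv_bdry (tt_map_bdry (tt_ren \<rho>) (erase_bdry B))"
    using ex_new_if_finite[OF infinite_cf_fvar] by blast
  let ?\<rho> = "\<rho>(FV a A := b)" and ?X = "nb (asm_bdry (CBAbs A B))"
  have fresh: "AFree (FV a A) \<notin> nb (asm_bdry B)" using cf_bdry_abs.hyps(3) by (simp add: fv_part_nb)
  have notin: "AFree (FV a A) \<notin> ?X" using fresh fresh_annotation[of a A] by simp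
  have cl: "\<forall>x\<in>?X. nb (asm_elem x) \<subseteq> ?X" using nb_asm_trans_bdry[of _ "CBAbs A B"] by blast
  have s: "suit \<Theta> (\<Gamma> @ [(b, er \<rho> A)]) ?\<rho> (insert (AFree (FV a A)) ?X)"
    by (rule suit_abs[OF cf_bdry_abs.prems(2) _ notin cl b(1)]) simp
  have "nb (asm_bdry (cf_subst_bdry (cf_vec [CFree (FV a A)]) B)) \<subseteq> insert (AFree (FV a A)) ?X"
    using nb_subst_bdry[of "cf_vec [CFree (FV a A)]" B] nb_vec[of "[CFree (FV a A)]"] by auto
  note s' = suit_mono[OF s this]
  have raw': "tt_raw_vctx \<Sigma> \<Theta> (\<Gamma> @ [(b, er \<rho> A)])"
    using tt_der_wf(1)[OF rules raw_mctx A cf_bdry_abs.prems(1)] b(1)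
    by (intro tt_raw_vctx_snoc[OF cf_bdry_abs.prems(1)]) auto
  have "tt_map_bdry (tt_ren ?\<rho>) (erase_bdry B) = tt_map_bdry (tt_ren \<rho>) (erase_bdry B)"
    using fresh erase_fv_bdry[of B] by (intro tt_ren_cong_bdry) auto
  then have "tt_map_bdry (tt_ren ?\<rho>) (erase_bdry (cf_subst_bdry (cf_vec [CFree (FV a A)]) B))
      = tt_subst_bdry (tt_vec [TFree b]) (tt_map_bdry (tt_ren \<rho>) (erase_bdry B))"
    by (simp only: erase_subst_bdry erase_vec tt_ren_subst_bdry tt_ren_vec) simp
  then have "tt_derb \<Sigma> T' \<Theta> (\<Gamma> @ [(b, er \<rho> A)])
      (tt_subst_bdry (tt_vec [TFree b]) (tt_map_bdry (tt_ren \<rho>) (erase_bdry B)))"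
    using cf_bdry_abs.hyps(5)[OF raw' s'] by metis
  then show ?case using tt_bdry_abs[OF A b] by simp
qed

end

section \<open>Monotonicity in the theory, and finitarity of the translated theory\<close>

lemma tt_wf_mctx_mono:
  fixes T :: "('s, 'v, 'm) tt_rule set"
  assumes "tt_wf_mctx \<Sigma> T\<^sub>0 \<Theta>" and inf: "infinite (UNIV :: 'v set)" and sub: "T\<^sub>0 \<subseteq> T"
    and rules: "\<forall>R\<in>T\<^sub>0. tt_raw_rule \<Sigma> R"
  shows "tt_wf_mctx \<Sigma> T \<Theta>"
  using assms(1)
proof (induction rule: tt_wf_mctx.induct)
  case (tt_mctx_extend \<Theta> B M)
  have "tt_derb \<Sigma> T \<Theta> [] B"
    by (rule tt_derb_weaken[OF inf sub rules tt_wf_mctx_raw[OF tt_mctx_extend.hyps(1) rules] map_le_refl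
          tt_raw_vctx_Nil tt_ext_refl[OF tt_raw_vctx_Nil] tt_mctx_extend.hyps(2)])
  then show ?case using tt_mctx_extend by (intro tt_wf_mctx.tt_mctx_extend)
qed (rule tt_mctx_empty)

lemma tt_finitary_rule_mono:
  fixes T :: "('s, 'v, 'm) tt_rule set"
  assumes "tt_finitary_rule \<Sigma> T\<^sub>0 R" and inf: "infinite (UNIV :: 'v set)" and sub: "T\<^sub>0 \<subseteq> T"
    and rules: "\<forall>R\<in>T\<^sub>0. tt_raw_rule \<Sigma> R"
  shows "tt_finitary_rule \<Sigma> T R"
proof -
  have \<Xi>: "tt_wf_mctx \<Sigma> T\<^sub>0 (fst R)" and B: "tt_derb \<Sigma> T\<^sub>0 (fst R) [] (tt_bdry_of (snd R))"
    using assms(1) by (simp_all add: tt_finitary_rule_def)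
  have "tt_derb \<Sigma> T (fst R) [] (tt_bdry_of (snd R))"
    by (rule tt_derb_weaken[OF inf sub rules tt_wf_mctx_raw[OF \<Xi> rules] map_le_refl
          tt_raw_vctx_Nil tt_ext_refl[OF tt_raw_vctx_Nil] B])
  then show ?thesis using tt_wf_mctx_mono[OF \<Xi> inf sub rules] by (simp add: tt_finitary_rule_def)
qed

lemma er_prems_lookup: "M \<in> set Ms \<Longrightarrow> map_of (er_prems Ms) M = Some (erase_bdry (mvar_bdry M))"
  by (induction Ms) auto

lemma suit_closed:
  "(\<And>v. AFree v \<notin> X) \<Longrightarrow> (\<And>M. AMeta M \<in> X \<Longrightarrow> M \<in> set Ms) \<Longrightarrow> suit (er_prems Ms) \<Gamma> \<rho> X"
  by (auto simp: suit_def er_prems_lookup)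

text \<open>\<open>T\<close> is to be thought of as the rules below \<open>R\<close>. The context of
  premises is built entry by entry: over the entries already present it is well-formed, so
  \<open>translation\<close> applies and derives the next boundary. The boundary of the conclusion
  comes last.\<close>

lemma erase_finitary_rule:
  assumes raw: "\<forall>R\<in>T. cf_raw_rule \<Sigma> R" and rec: "\<forall>R\<in>T. records_premises R"
    and fin: "\<forall>R\<in>T. tt_finitary_rule \<Sigma> (erase_rule ` T) (erase_rule R)"
    and R: "cf_raw_rule \<Sigma> R" "cf_finitary_rule \<Sigma> T R"
  shows "tt_finitary_rule \<Sigma> (erase_rule ` T) (erase_rule R)"
proof -
  obtain Ms J where Ms: "R = (Ms, J)" by fastforce
  note D = cf_raw_ruleD[OF R(1)[unfolded Ms]]
  have B: "cf_derb \<Sigma> T (mvar_bdry M)" if "M \<in> set Ms" for M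
    using R(2) that by (simp add: cf_finitary_rule_def Ms)
  have b: "cf_derb \<Sigma> T (cf_bdry_of J)" using R(2) by (simp add: cf_finitary_rule_def Ms)
  have ctx: "k \<le> length Ms \<Longrightarrow> tt_wf_mctx \<Sigma> (erase_rule ` T) (er_prems (take k Ms))" for k
  proof (induction k)
    case 0
    show ?case by (simp add: tt_mctx_empty)
  next
    case (Suc k)
    then have k: "k < length Ms" and IH: "tt_wf_mctx \<Sigma> (erase_rule ` T) (er_prems (take k Ms))" by simp_all
    \<comment> \<open>The prefix is suitable for the next boundary because that boundary is closed
      and mentions only earlier metavariables.\<close>
    interpret suitable_translation \<Sigma> T "er_prems (take k Ms)"
      by unfold_locales (rule raw rec fin IH)+
    have "tt_derb \<Sigma> (erase_rule ` T) (er_prems (take k Ms)) [] (tt_map_bdry (tt_ren id) (erase_bdry (mvar_bdry (Ms ! k))))"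
      using k cf_wf_mvar_closed[OF D(6)[OF k]] D(7)[OF k]
      by (intro translation(2) B suit_closed) auto
    moreover have "distinct (take (Suc k) Ms)" using D(1) by simp
    then have "Ms ! k \<notin> set (take k Ms)" using k by (simp add: take_Suc_conv_app_nth)
    ultimately show ?case
      using k IH by (simp add: take_Suc_conv_app_nth tt_map_bdry_ident tt_mctx_extend image_image)
  qed
  interpret suitable_translation \<Sigma> T "er_prems Ms"
    by unfold_locales (use raw rec fin ctx[of "length Ms"] in simp_all)
  have "tt_derb \<Sigma> (erase_rule ` T) (er_prems Ms) [] (tt_map_bdry (tt_ren id) (erase_bdry (cf_bdry_of J)))"
    using D(4,5) nb_bdry_of[of J] by (intro translation(2) b suit_closed) auto
  then show ?thesis
    using ctx[of "length Ms"]
    by (simp add: tt_finitary_rule_def erase_rule_def Ms tt_map_bdry_ident erase_bdry_of)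
qed

theorem mainTheorem15:
  fixes \<Sigma> :: "'s signature" and I :: "'i set" and T :: "'i \<Rightarrow> ('s, 'a, 'm) cf_rule"
  assumes "cf_finitary \<Sigma> I T"
    and "\<forall>i\<in>I. records_premises (T i)"
  shows "tt_finitary \<Sigma> I (\<lambda>i. erase_rule (T i)) \<and>
    (tt_finitary \<Sigma> I (\<lambda>i. erase_rule (T i)) \<longrightarrow>
      (\<forall>(\<Theta> :: ('s, 'a, 'm) er_mctx) (\<Gamma> :: ('s, 'a, 'm) er_vctx).
        tt_wf_mctx \<Sigma> ((\<lambda>i. erase_rule (T i)) ` I) \<Theta> \<longrightarrow>
        tt_wf_vctx \<Sigma> ((\<lambda>i. erase_rule (T i)) ` I) \<Theta> \<Gamma> \<longrightarrow>
          (\<forall>J. cf_der \<Sigma> (T ` I) J \<longrightarrow> suitable \<Theta> \<Gamma> (asm_jdg J) \<longrightarrow>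
            tt_der \<Sigma> ((\<lambda>i. erase_rule (T i)) ` I) \<Theta> \<Gamma> (erase_jdg J)) \<and>
          (\<forall>B. cf_derb \<Sigma> (T ` I) B \<longrightarrow> suitable \<Theta> \<Gamma> (asm_bdry B) \<longrightarrow>
            tt_derb \<Sigma> ((\<lambda>i. erase_rule (T i)) ` I) \<Theta> \<Gamma> (erase_bdry B))))"
proof -
  from assms(1) obtain r where raw: "\<forall>i\<in>I. cf_raw_rule \<Sigma> (T i)" and r: "r \<subseteq> I \<times> I" "wf r" "trans r"
    and fin: "\<forall>i\<in>I. cf_finitary_rule \<Sigma> (T ` {j \<in> I. (j, i) \<in> r}) (T i)"
    unfolding cf_finitary_def by blast
  have raw': "\<forall>i\<in>I. tt_raw_rule \<Sigma> (erase_rule (T i))" using raw erase_rule_raw by blast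
  note mono = tt_finitary_rule_mono[OF _ infinite_cf_fvar]
  have fin': "i \<in> I \<longrightarrow> tt_finitary_rule \<Sigma> (erase_rule ` T ` {j \<in> I. (j, i) \<in> r}) (erase_rule (T i))" for i
  proof (induction i rule: wf_induct_rule[OF r(2)])
    case (1 i)
    let ?S = "\<lambda>i. T ` {j \<in> I. (j, i) \<in> r}"
    show ?case
    proof
      assume i: "i \<in> I"
      show "tt_finitary_rule \<Sigma> (erase_rule ` ?S i) (erase_rule (T i))"
      proof (rule erase_finitary_rule)
        show "\<forall>R\<in>?S i. tt_finitary_rule \<Sigma> (erase_rule ` ?S i) (erase_rule R)"
        proof
          fix R assume "R \<in> ?S i"
          then obtain j where j: "j \<in> I" "(j, i) \<in> r" "R = T j" by blast
          have "tt_finitary_rule \<Sigma> (erase_rule ` ?S j) (erase_rule R)" using 1 j by blast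
          \<comment> \<open>By transitivity of the order every rule below \<open>j\<close> is also
            below \<open>i\<close>, so finitarity passes to the set below \<open>i\<close> by
            monotonicity.\<close>
          moreover have "erase_rule ` ?S j \<subseteq> erase_rule ` ?S i" using transD[OF r(3)] j(2) by blast
          moreover have "\<forall>R\<in>erase_rule ` ?S j. tt_raw_rule \<Sigma> R" using raw' by blast
          ultimately show "tt_finitary_rule \<Sigma> (erase_rule ` ?S i) (erase_rule R)" by (rule mono)
        qed
      qed (use i raw fin assms(2) in blast)+
    qed
  qed
  have all: "(\<lambda>i. erase_rule (T i)) ` K = erase_rule ` T ` K" for K by (simp add: image_image)
  have 1: "tt_finitary \<Sigma> I (\<lambda>i. erase_rule (T i))"
    unfolding tt_finitary_def all using raw' r fin' by blast
  \<comment> \<open>Monotonicity from the rules below each index to the whole theory gives the form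
    of finitarity that the locale asks for.\<close>
  have finI: "\<forall>R\<in>T ` I. tt_finitary_rule \<Sigma> (erase_rule ` T ` I) (erase_rule R)"
  proof
    fix R assume "R \<in> T ` I"
    then obtain i where i: "i \<in> I" "R = T i" by blast
    have "tt_finitary_rule \<Sigma> (erase_rule ` T ` {j \<in> I. (j, i) \<in> r}) (erase_rule R)" using fin' i by simp
    then show "tt_finitary_rule \<Sigma> (erase_rule ` T ` I) (erase_rule R)" by (rule mono) (use raw' in auto)
  qed
  have "tt_der \<Sigma> (erase_rule ` T ` I) \<Theta> \<Gamma> (erase_jdg J)"
    if \<Theta>: "tt_wf_mctx \<Sigma> (erase_rule ` T ` I) \<Theta>" and \<Gamma>: "tt_wf_vctx \<Sigma> (erase_rule ` T ` I) \<Theta> \<Gamma>"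
      and J: "cf_der \<Sigma> (T ` I) J" "suitable \<Theta> \<Gamma> (asm_jdg J)" for \<Theta> \<Gamma> J
  proof -
    interpret suitable_translation \<Sigma> "T ` I" \<Theta>
      by unfold_locales (use raw assms(2) finI \<Theta> in blast)+
    \<comment> \<open>Suitability is the case of the identity renaming, which leaves the erased
      judgement unchanged.\<close>
    show ?thesis
      using translation(1)[OF J(1) tt_wf_vctx_raw[OF \<Gamma> rules raw_mctx] suitable_suit[OF J(2)]]
      by (simp add: tt_map_jdg_ident)
  qed
  moreover have "tt_derb \<Sigma> (erase_rule ` T ` I) \<Theta> \<Gamma> (erase_bdry B)"
    if \<Theta>: "tt_wf_mctx \<Sigma> (erase_rule ` T ` I) \<Theta>" and \<Gamma>: "tt_wf_vctx \<Sigma> (erase_rule ` T ` I) \<Theta> \<Gamma>"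
      and B: "cf_derb \<Sigma> (T ` I) B" "suitable \<Theta> \<Gamma> (asm_bdry B)" for \<Theta> \<Gamma> B
  proof -
    interpret suitable_translation \<Sigma> "T ` I" \<Theta>
      by unfold_locales (use raw assms(2) finI \<Theta> in blast)+
    show ?thesis
      using translation(2)[OF B(1) tt_wf_vctx_raw[OF \<Gamma> rules raw_mctx] suitable_suit[OF B(2)]]
      by (simp add: tt_map_bdry_ident)
  qed
  ultimately show ?thesis using 1 unfolding all by blast
qed

end
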